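(* Let $\Lambda$ be a basic finite dimensional algebra over an algebraically closed field $K$ whose Jacobson radical $J$ satisfies $J^2=0$, let $\mathbf d$ be a dimension vector, and let $T$ be a semisimple left $\Lambda$-module. Then the closure of $\mathbf{Rep}^T_{\mathbf d}$ in $\mathbf{Rep}_{\mathbf d}(\Lambda)$ is an irreducible component of $\mathbf{Rep}_{\mathbf d}(\Lambda)$ if and only if there exists a module $M$ with top $T$ and dimension vector $\mathbf d$ such that the pair $(\underline{\dim}\operatorname{top}M,\underline{\dim}\operatorname{soc}M)$ is minimal in the set $\mathbf{Top\text{-}Soc}(\mathbf d)$. If $M_1,\dots,M_m$ are modules with dimension vector $\mathbf d$ such that the pairs $$(\underline{\dim}\operatorname{top}M_1,\underline{\dim}\operatorname{soc}M_1),\ \dots,\ (\underline{\dim}\operatorname{top}M_m,\underline{\dim}\operatorname{soc}M_m)$$ are the distinct minimal elements of $\mathbf{Top\text{-}Soc}(\mathbf d)$, then $\mathbf{Rep}_{\mathbf d}(\Lambda)$ has precisely $m$ distinct irreducible components, namely the closures of the subvarieties $\mathbf{Rep}^T_{\mathbf d}$, where $T$ traces $\operatorname{top}M_1,\dots,\operatorname{top}M_m$. In particular, $\operatorname{top}M_1,\dots,\operatorname{top}M_m$ are the generic tops of $\mathbf{Rep}_{\mathbf d}(\Lambda)$, and $\operatorname{soc}M_1,\dots,\operatorname{soc}M_m$ are the generic socles of $\mathbf{Rep}_{\mathbf d}(\Lambda)$.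
   Context: Write $\Lambda=KQ/I$ with $Q$ a finite quiver with vertices $e_1,\dots,e_n$ (identified with primitive idempotents of $\Lambda$) and arrow set $Q_1$, and $I$ an admissible ideal; since $J^2=0$, $I$ is generated by all paths of length $2$. Modules are finite dimensional left modules; $\underline{\dim}$ denotes the dimension vector in $(\mathbb N_0)^n$; $\operatorname{top}M=M/JM$; $\operatorname{soc}M$ is the socle. Isomorphic semisimple modules are identified. For $\mathbf d=(d_1,\dots,d_n)$, $\mathbf{Rep}_{\mathbf d}(\Lambda)$ is the affine variety of tuples $(x_\alpha)_{\alpha\in Q_1}\in\prod_\alpha \operatorname{Hom}_K(K^{d_{\mathrm{start}(\alpha)}},K^{d_{\mathrm{end}(\alpha)}})$ satisfying all relations in $I$, with the conjugation action of $\operatorname{GL}(\mathbf d)=\prod_i\operatorname{GL}_{d_i}(K)$, whose orbits correspond to isomorphism classes of modules with dimension vector $\mathbf d$. For a semisimple module $T$, $\mathbf{Rep}^T_{\mathbf d}$ is the locally closed subvariety of points whose modules have top $T$; when $J^2=0$ it is irreducible whenever nonempty. $T$ is a generic top of $\mathbf{Rep}_{\mathbf d}(\Lambda)$ if $\overline{\mathbf{Rep}^T_{\mathbf d}}$ is an irreducible component of $\mathbf{Rep}_{\mathbf d}(\Lambda)$; in that case the generic socle of the modules in $\overline{\mathbf{Rep}^T_{\mathbf d}}$ (the semisimple module that is the socle of all modules in some dense open subset) is called a generic socle of $\mathbf{Rep}_{\mathbf d}(\Lambda)$. $\mathbf{Top\text{-}Soc}(\mathbf d)=\{(\underline{\dim}\operatorname{top}M,\underline{\dim}\operatorname{soc}M)\mid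 M \text{ a } \Lambda\text{-module with } \underline{\dim}\,M=\mathbf d\}$, partially ordered as a subset of $(\mathbb N_0)^n\times(\mathbb N_0)^n$ by the componentwise order on pairs, where $(\mathbb N_0)^n$ has the componentwise order. *)

theory Defs
  imports
    "HOL-Analysis.Abstract_Topology"
    "HOL-Library.Product_Order"
    "HOL-Algebra.Ideal_Product"
    "HOL-Algebra.QuotRing"
    "HOL-Computational_Algebra.Polynomial"
    "Jordan_Normal_Form.VS_Connect"
    "Graph_Theory.Arc_Walk"
begin

hide_const (open) Multiset.mult Polynomial.smult Modules.module

section \<open>Left modules over a non-commutative ring\<close>

text \<open>
  The library locale \<open>module\<close> only covers commutative rings; the record type \<open>module\<close>, the
  locale \<open>Module.submodule\<close> and the set \<open>module_hom\<close> are independent of commutativity and are reused.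
  Only the fields \<open>carrier\<close>, \<open>zero\<close>, \<open>add\<close> and \<open>smult\<close> of the record are meaningful.
\<close>

locale left_module = R?: ring R + M?: abelian_group M
  for R :: "('a, 'r) ring_scheme" (structure)
    and M :: "('a, 'm) module" (structure) +
  assumes smult_closed:
      "\<lbrakk>a \<in> carrier R; x \<in> carrier M\<rbrakk> \<Longrightarrow> a \<odot>\<^bsub>M\<^esub> x \<in> carrier M"
    and smult_l_distr:
      "\<lbrakk>a \<in> carrier R; b \<in> carrier R; x \<in> carrier M\<rbrakk> \<Longrightarrow>
        (a \<oplus>\<^bsub>R\<^esub> b) \<odot>\<^bsub>M\<^esub> x = a \<odot>\<^bsub>M\<^esub> x \<oplus>\<^bsub>M\<^esub> b \<odot>\<^bsub>M\<^esub> x"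
    and smult_r_distr:
      "\<lbrakk>a \<in> carrier R; x \<in> carrier M; y \<in> carrier M\<rbrakk> \<Longrightarrow>
        a \<odot>\<^bsub>M\<^esub> (x \<oplus>\<^bsub>M\<^esub> y) = a \<odot>\<^bsub>M\<^esub> x \<oplus>\<^bsub>M\<^esub> a \<odot>\<^bsub>M\<^esub> y"
    and smult_assoc:
      "\<lbrakk>a \<in> carrier R; b \<in> carrier R; x \<in> carrier M\<rbrakk> \<Longrightarrow>
        (a \<otimes>\<^bsub>R\<^esub> b) \<odot>\<^bsub>M\<^esub> x = a \<odot>\<^bsub>M\<^esub> (b \<odot>\<^bsub>M\<^esub> x)"
    and smult_one: "x \<in> carrier M \<Longrightarrow> \<one>\<^bsub>R\<^esub> \<odot>\<^bsub>M\<^esub> x = x"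

definition mod_isomorphic ::
  "('a, 'r) ring_scheme \<Rightarrow> ('a, 'm) module \<Rightarrow> ('a, 'n) module \<Rightarrow> bool" where
  "mod_isomorphic R M N \<longleftrightarrow> (\<exists>\<phi> \<in> module_hom R M N. bij_betw \<phi> (carrier M) (carrier N))"

definition gen_submodule :: "('a, 'r) ring_scheme \<Rightarrow> ('a, 'm) module \<Rightarrow> 'm set \<Rightarrow> 'm set" where
  "gen_submodule R M A = \<Inter>{N. Module.submodule N R M \<and> A \<subseteq> N}"

definition quot_module :: "('a, 'm) module \<Rightarrow> 'm set \<Rightarrow> ('a, 'm set) module" where
  "quot_module M N = \<lparr>carrier = a_rcosets\<^bsub>M\<^esub> N, mult = undefined, one = undefined,
     zero = N, add = set_add M, smult = (\<lambda>a C. \<Union>x\<in>C. N +>\<^bsub>M\<^esub> (a \<odot>\<^bsub>M\<^esub> x))\<rparr>"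

definition simple_module :: "('a, 'r) ring_scheme \<Rightarrow> ('a, 'm) module \<Rightarrow> bool" where
  "simple_module R S \<longleftrightarrow> left_module R S \<and> carrier S \<noteq> {\<zero>\<^bsub>S\<^esub>} \<and>
     (\<forall>N. Module.submodule N R S \<longrightarrow> N = {\<zero>\<^bsub>S\<^esub>} \<or> N = carrier S)"

text \<open>The socle, i.e. the sum of all simple submodules, as a module.\<close>

definition soc :: "('a, 'r) ring_scheme \<Rightarrow> ('a, 'm) module \<Rightarrow> ('a, 'm) module" where
  "soc R M = M\<lparr>carrier := gen_submodule R M
     (\<Union>{S. Module.submodule S R M \<and> simple_module R (M\<lparr>carrier := S\<rparr>)})\<rparr>"

definition semisimple :: "('a, 'r) ring_scheme \<Rightarrow> ('a, 'm) module \<Rightarrow> bool" where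
  "semisimple R M \<longleftrightarrow> left_module R M \<and> carrier (soc R M) = carrier M"

definition regular_module :: "('a, 'r) ring_scheme \<Rightarrow> ('a, 'a) module" where
  "regular_module R = \<lparr>carrier = carrier R, mult = undefined, one = undefined,
     zero = \<zero>\<^bsub>R\<^esub>, add = add R, smult = mult R\<rparr>"

definition maximal_left_ideal :: "('a, 'r) ring_scheme \<Rightarrow> 'a set \<Rightarrow> bool" where
  "maximal_left_ideal R L \<longleftrightarrow>
     Module.submodule L R (regular_module R) \<and> L \<noteq> carrier R \<and>
     (\<forall>N. Module.submodule N R (regular_module R) \<and> L \<subseteq> N \<longrightarrow> N = L \<or> N = carrier R)"

definition jacobson_radical :: "('a, 'r) ring_scheme \<Rightarrow> 'a set" where
  "jacobson_radical R = carrier R \<inter> \<Inter>{L. maximal_left_ideal R L}"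

definition rad_submodule :: "('a, 'r) ring_scheme \<Rightarrow> ('a, 'm) module \<Rightarrow> 'm set" where
  "rad_submodule R M =
     gen_submodule R M {a \<odot>\<^bsub>M\<^esub> x | a x. a \<in> jacobson_radical R \<and> x \<in> carrier M}"

text \<open>The top \<open>M / J M\<close>.\<close>

definition top_mod :: "('a, 'r) ring_scheme \<Rightarrow> ('a, 'm) module \<Rightarrow> ('a, 'm set) module" where
  "top_mod R M = quot_module M (rad_submodule R M)"


section \<open>Path algebras and their admissible quotients\<close>

text \<open>
  A quiver is a \<open>fin_digraph\<close> (loops and multiple arrows are allowed). A path is a pair of its
  starting vertex and the list of its arrows in the order in which they are traversed;
  \<open>(i, [])\<close> is the path of length 0 at \<open>i\<close>.
\<close>

type_synonym ('v, 'e) path = "'v \<times> 'e list"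

definition paths :: "('v, 'e) pre_digraph \<Rightarrow> ('v, 'e) path set" where
  "paths Q = {(u, p). \<exists>v. pre_digraph.awalk Q u p v}"

text \<open>
  Elements of the path algebra are finitely supported coefficient functions. As modules are left
  modules, a product of paths is traversed from right to left: in \<open>f \<otimes> g\<close>, a path contributing to
  \<open>g\<close> is followed by one contributing to \<open>f\<close>.
\<close>

definition path_algebra ::
  "('v, 'e) pre_digraph \<Rightarrow> (('v, 'e) path \<Rightarrow> 'k::field) ring" where
  "path_algebra Q =
     \<lparr>carrier = {f. finite {w. f w \<noteq> 0} \<and> {w. f w \<noteq> 0} \<subseteq> paths Q},
      mult = (\<lambda>f g (u, p). \<Sum>k\<le>length p.
         f (pre_digraph.awlast Q u (take k p), drop k p) * g (u, take k p)),
      one = (\<lambda>(u, p). if u \<in> verts Q \<and> p = [] then 1 else 0),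
      zero = (\<lambda>_. 0),
      add = (\<lambda>f g w. f w + g w)\<rparr>"

text \<open>The \<open>k\<close>-th power of the arrow ideal is spanned by the paths of length at least \<open>k\<close>.\<close>

definition arrow_ideal_pow ::
  "('v, 'e) pre_digraph \<Rightarrow> nat \<Rightarrow> (('v, 'e) path \<Rightarrow> 'k::field) set" where
  "arrow_ideal_pow Q k = {f \<in> carrier (path_algebra Q). \<forall>u p. length p < k \<longrightarrow> f (u, p) = 0}"

definition admissible ::
  "('v, 'e) pre_digraph \<Rightarrow> (('v, 'e) path \<Rightarrow> 'k::field) set \<Rightarrow> bool" where
  "admissible Q I \<longleftrightarrow> ideal I (path_algebra Q) \<and>
     I \<subseteq> arrow_ideal_pow Q 2 \<and> (\<exists>k\<ge>2. arrow_ideal_pow Q k \<subseteq> I)"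

text \<open>
  The algebra \<open>K Q / I\<close>. Its elements are cosets, and \<open>bqa\<close> is their type; the image of the path
  of length 0 at \<open>i\<close> is the primitive idempotent identified with the vertex \<open>i\<close>.
\<close>

type_synonym ('v, 'e, 'k) bqa = "(('v, 'e) path \<Rightarrow> 'k) set"

definition bq_algebra ::
  "('v, 'e) pre_digraph \<Rightarrow> (('v, 'e) path \<Rightarrow> 'k::field) set \<Rightarrow> ('v, 'e, 'k) bqa ring" where
  "bq_algebra Q I = path_algebra Q Quot I"

definition vertex_idem ::
  "('v, 'e) pre_digraph \<Rightarrow> (('v, 'e) path \<Rightarrow> 'k::field) set \<Rightarrow> 'v \<Rightarrow> ('v, 'e, 'k) bqa" where
  "vertex_idem Q I i = I +>\<^bsub>path_algebra Q\<^esub> (\<lambda>w. if w = (i, []) then 1 else 0)"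

definition scalar ::
  "('v, 'e) pre_digraph \<Rightarrow> (('v, 'e) path \<Rightarrow> 'k::field) set \<Rightarrow> 'k \<Rightarrow> ('v, 'e, 'k) bqa" where
  "scalar Q I c = I +>\<^bsub>path_algebra Q\<^esub> (\<lambda>w. c * \<one>\<^bsub>path_algebra Q\<^esub> w)"


section \<open>Finite dimensional modules and dimension vectors\<close>

text \<open>The \<open>K\<close>-vector space carried by a \<open>K\<close>-subspace \<open>H\<close> of a module.\<close>

definition kspace ::
  "('v, 'e) pre_digraph \<Rightarrow> (('v, 'e) path \<Rightarrow> 'k::field) set \<Rightarrow>
   (('v, 'e, 'k) bqa, 'm) module \<Rightarrow> 'm set \<Rightarrow> ('k, 'm) module" where
  "kspace Q I M H = \<lparr>carrier = H, mult = undefined, one = undefined, zero = \<zero>\<^bsub>M\<^esub>,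
     add = add M, smult = (\<lambda>c x. scalar Q I c \<odot>\<^bsub>M\<^esub> x)\<rparr>"

definition fd_module ::
  "('v, 'e) pre_digraph \<Rightarrow> (('v, 'e) path \<Rightarrow> 'k::field) set \<Rightarrow>
   (('v, 'e, 'k) bqa, 'm) module \<Rightarrow> bool" where
  "fd_module Q I M \<longleftrightarrow> left_module (bq_algebra Q I) M \<and>
     vectorspace.fin_dim class_ring (kspace Q I M (carrier M))"

text \<open>
  Dimension vectors are functions on the type of vertices that vanish outside \<open>verts Q\<close>; their
  componentwise order is then the pointwise order of functions.
\<close>

definition dimvec ::
  "('v, 'e) pre_digraph \<Rightarrow> (('v, 'e) path \<Rightarrow> 'k::field) set \<Rightarrow>
   (('v, 'e, 'k) bqa, 'm) module \<Rightarrow> 'v \<Rightarrow> nat" where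
  "dimvec Q I M i = (if i \<in> verts Q
     then vectorspace.dim class_ring
       (kspace Q I M ((\<lambda>x. vertex_idem Q I i \<odot>\<^bsub>M\<^esub> x) ` carrier M))
     else 0)"

definition top_soc_pair ::
  "('v, 'e) pre_digraph \<Rightarrow> (('v, 'e) path \<Rightarrow> 'k::field) set \<Rightarrow>
   (('v, 'e, 'k) bqa, 'm) module \<Rightarrow> ('v \<Rightarrow> nat) \<times> ('v \<Rightarrow> nat)" where
  "top_soc_pair Q I M =
     (dimvec Q I (top_mod (bq_algebra Q I) M), dimvec Q I (soc (bq_algebra Q I) M))"

text \<open>
  HOL cannot quantify over modules with arbitrary carrier types inside a formula. Where the class
  of all modules is needed, we use the modules whose carrier consists of vertex-indexed families of
  column vectors; every finite dimensional module is isomorphic to one of these.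
\<close>

type_synonym ('v, 'e, 'k) std_module = "(('v, 'e, 'k) bqa, 'v \<Rightarrow> 'k vec) module"

definition Top_Soc ::
  "('v, 'e) pre_digraph \<Rightarrow> (('v, 'e) path \<Rightarrow> 'k::field) set \<Rightarrow> ('v \<Rightarrow> nat) \<Rightarrow>
   (('v \<Rightarrow> nat) \<times> ('v \<Rightarrow> nat)) set" where
  "Top_Soc Q I d = {top_soc_pair Q I M | M :: ('v, 'e, 'k) std_module.
     fd_module Q I M \<and> dimvec Q I M = d}"

definition minimal_elements :: "'a::order set \<Rightarrow> 'a set" where
  "minimal_elements A = {a \<in> A. \<not> (\<exists>b\<in>A. b < a)}"


section \<open>The representation varieties\<close>

text \<open>The matrix of the composed map \<open>x\<^sub>p : K^(d u) \<longrightarrow> K^(d v)\<close> along a path \<open>p\<close> from \<open>u\<close> to \<open>v\<close>.\<close>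

primrec path_map ::
  "('v, 'e) pre_digraph \<Rightarrow> ('v \<Rightarrow> nat) \<Rightarrow> ('e \<Rightarrow> 'k::field mat) \<Rightarrow> 'v \<Rightarrow> 'e list \<Rightarrow> 'k mat" where
  "path_map Q d x u [] = 1\<^sub>m (d u)"
| "path_map Q d x u (a # p) = path_map Q d x (head Q a) p * x a"

text \<open>The linear combination of the \<open>x\<^sub>p\<close>, \<open>p\<close> from \<open>u\<close> to \<open>v\<close>, with the coefficients given by \<open>f\<close>.\<close>

definition elem_map ::
  "('v, 'e) pre_digraph \<Rightarrow> ('v \<Rightarrow> nat) \<Rightarrow> ('e \<Rightarrow> 'k::field mat) \<Rightarrow>
   (('v, 'e) path \<Rightarrow> 'k) \<Rightarrow> 'v \<Rightarrow> 'v \<Rightarrow> 'k mat" where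
  "elem_map Q d x f u v = mat (d v) (d u) (\<lambda>(i, j).
     \<Sum>p\<in>{p. pre_digraph.awalk Q u p v \<and> f (u, p) \<noteq> 0}. f (u, p) * path_map Q d x u p $$ (i, j))"

definition rep_ambient ::
  "('v, 'e) pre_digraph \<Rightarrow> ('v \<Rightarrow> nat) \<Rightarrow> ('e \<Rightarrow> 'k::field mat) set" where
  "rep_ambient Q d = (\<Pi>\<^sub>E a\<in>arcs Q. carrier_mat (d (head Q a)) (d (tail Q a)))"

definition Rep ::
  "('v, 'e) pre_digraph \<Rightarrow> (('v, 'e) path \<Rightarrow> 'k::field) set \<Rightarrow> ('v \<Rightarrow> nat) \<Rightarrow>
   ('e \<Rightarrow> 'k mat) set" where
  "Rep Q I d = {x \<in> rep_ambient Q d.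
     \<forall>f\<in>I. \<forall>u\<in>verts Q. \<forall>v\<in>verts Q. elem_map Q d x f u v = 0\<^sub>m (d v) (d u)}"

definition elem_act ::
  "('v, 'e) pre_digraph \<Rightarrow> ('v \<Rightarrow> nat) \<Rightarrow> ('e \<Rightarrow> 'k::field mat) \<Rightarrow>
   (('v, 'e) path \<Rightarrow> 'k) \<Rightarrow> ('v \<Rightarrow> 'k vec) \<Rightarrow> 'v \<Rightarrow> 'k vec" where
  "elem_act Q d x f m = (\<lambda>v\<in>verts Q. vec (d v) (\<lambda>k.
     \<Sum>u\<in>verts Q. (elem_map Q d x f u v *\<^sub>v m u) $ k))"

text \<open>
  The module on the direct sum of the spaces \<open>K^(d i)\<close> given by a point of \<open>Rep Q I d\<close>. An element
  of the algebra is a coset, all of whose representatives act in the same way.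
\<close>

definition rep_module ::
  "('v, 'e) pre_digraph \<Rightarrow> ('v \<Rightarrow> nat) \<Rightarrow> ('e \<Rightarrow> 'k::field mat) \<Rightarrow> ('v, 'e, 'k) std_module" where
  "rep_module Q d x = \<lparr>carrier = (\<Pi>\<^sub>E i\<in>verts Q. carrier_vec (d i)),
     mult = undefined, one = undefined,
     zero = (\<lambda>i\<in>verts Q. 0\<^sub>v (d i)),
     add = (\<lambda>m m'. \<lambda>i\<in>verts Q. m i + m' i),
     smult = (\<lambda>C m. the_elem ((\<lambda>f. elem_act Q d x f m) ` C))\<rparr>"

definition Rep_top ::
  "('v, 'e) pre_digraph \<Rightarrow> (('v, 'e) path \<Rightarrow> 'k::field) set \<Rightarrow> ('v \<Rightarrow> nat) \<Rightarrow>
   (('v, 'e, 'k) bqa, 't) module \<Rightarrow> ('e \<Rightarrow> 'k mat) set" where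
  "Rep_top Q I d T = {x \<in> Rep Q I d.
     mod_isomorphic (bq_algebra Q I) (top_mod (bq_algebra Q I) (rep_module Q d x)) T}"


section \<open>Zariski topology and irreducible components\<close>

inductive_set poly_funs :: "('x \<Rightarrow> 'k::field) set \<Rightarrow> ('x \<Rightarrow> 'k) set"
  for X :: "('x \<Rightarrow> 'k) set" where
  const: "(\<lambda>_. c) \<in> poly_funs X"
| coord: "f \<in> X \<Longrightarrow> f \<in> poly_funs X"
| add: "f \<in> poly_funs X \<Longrightarrow> g \<in> poly_funs X \<Longrightarrow> (\<lambda>x. f x + g x) \<in> poly_funs X"
| mult: "f \<in> poly_funs X \<Longrightarrow> g \<in> poly_funs X \<Longrightarrow> (\<lambda>x. f x * g x) \<in> poly_funs X"

definition zero_locus :: "'x set \<Rightarrow> ('x \<Rightarrow> 'k::field) set \<Rightarrow> 'x set" where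
  "zero_locus A P = {x \<in> A. \<forall>f\<in>P. f x = 0}"

text \<open>The Zariski topology on an affine space \<open>A\<close> with set of coordinate functions \<open>X\<close>.\<close>

definition zariski :: "'x set \<Rightarrow> ('x \<Rightarrow> 'k::field) set \<Rightarrow> 'x topology" where
  "zariski A X = topology (\<lambda>U. \<exists>P \<subseteq> poly_funs X. U = A - zero_locus A P)"

lemma istopology_zariski:
  fixes X :: "('x \<Rightarrow> 'k::field) set"
  shows "istopology (\<lambda>U. \<exists>P \<subseteq> poly_funs X. U = A - zero_locus A P)"
  unfolding istopology_def
proof safe
  fix P1 P2 :: "('x \<Rightarrow> 'k) set"
  assume P: "P1 \<subseteq> poly_funs X" "P2 \<subseteq> poly_funs X"
  let ?P = "(\<lambda>(f, g) x. f x * g x) ` (P1 \<times> P2)"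
  have "?P \<subseteq> poly_funs X"
    using P by (auto intro!: poly_funs.mult)
  moreover have "(A - zero_locus A P1) \<inter> (A - zero_locus A P2) = A - zero_locus A ?P"
    by (auto simp: zero_locus_def)
  ultimately show "\<exists>P\<subseteq>poly_funs X.
      (A - zero_locus A P1) \<inter> (A - zero_locus A P2) = A - zero_locus A P"
    by blast
next
  fix \<K> :: "'x set set"
  assume "\<forall>U\<in>\<K>. \<exists>P\<subseteq>poly_funs X. U = A - zero_locus A P"
  then obtain P where P: "\<And>U. U \<in> \<K> \<Longrightarrow> P U \<subseteq> poly_funs X \<and> U = A - zero_locus A (P U)"
    by metis
  have "\<Union>\<K> = (\<Union>U\<in>\<K>. A - zero_locus A (P U))"
    using P by (metis (no_types, lifting) SUP_cong UN_I Union_eq image_ident)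
  also have "\<dots> = A - zero_locus A (\<Union>U\<in>\<K>. P U)"
    by (auto simp: zero_locus_def)
  finally show "\<exists>P\<subseteq>poly_funs X. \<Union>\<K> = A - zero_locus A P"
    using P by (intro exI[of _ "\<Union>U\<in>\<K>. P U"]) auto
qed

lemma openin_zariski:
  "openin (zariski A X) U \<longleftrightarrow> (\<exists>P \<subseteq> poly_funs X. U = A - zero_locus A P)"
  unfolding zariski_def by (simp add: topology_inverse'[OF istopology_zariski])

lemma topspace_zariski: "topspace (zariski A X) = A"
proof
  show "topspace (zariski A X) \<subseteq> A"
    by (auto simp: topspace_def openin_zariski)
  have "openin (zariski A X) A"
    unfolding openin_zariski
    by (intro exI[of _ "{\<lambda>_. 1}"]) (auto simp: zero_locus_def intro: poly_funs.const)
  then show "A \<subseteq> topspace (zariski A X)"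
    by (rule openin_subset)
qed

lemma closedin_zariski:
  "closedin (zariski A X) C \<longleftrightarrow> (\<exists>P \<subseteq> poly_funs X. C = zero_locus A P)"
  unfolding closedin_def topspace_zariski openin_zariski
proof safe
  fix P assume "C \<subseteq> A" "P \<subseteq> poly_funs X" "A - C = A - zero_locus A P"
  moreover have "zero_locus A P \<subseteq> A" by (auto simp: zero_locus_def)
  ultimately have "C = zero_locus A P" by blast
  then show "\<exists>P\<subseteq>poly_funs X. C = zero_locus A P" using \<open>P \<subseteq> _\<close> by blast
qed (auto simp: zero_locus_def)

definition irreducible_in :: "'x topology \<Rightarrow> 'x set \<Rightarrow> bool" where
  "irreducible_in X S \<longleftrightarrow> S \<subseteq> topspace X \<and> S \<noteq> {} \<and>
     (\<forall>C D. closedin X C \<and> closedin X D \<and> S \<subseteq> C \<union> D \<longrightarrow> S \<subseteq> C \<or> S \<subseteq> D)"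

definition irreducible_components :: "'x topology \<Rightarrow> 'x set set" where
  "irreducible_components X =
     {S. irreducible_in X S \<and> (\<forall>S'. irreducible_in X S' \<and> S \<subseteq> S' \<longrightarrow> S' = S)}"

definition rep_coords ::
  "('v, 'e) pre_digraph \<Rightarrow> ('v \<Rightarrow> nat) \<Rightarrow> (('e \<Rightarrow> 'k::field mat) \<Rightarrow> 'k) set" where
  "rep_coords Q d = {\<lambda>x. x a $$ (i, j) | a i j.
     a \<in> arcs Q \<and> i < d (head Q a) \<and> j < d (tail Q a)}"

definition Rep_space ::
  "('v, 'e) pre_digraph \<Rightarrow> (('v, 'e) path \<Rightarrow> 'k::field) set \<Rightarrow> ('v \<Rightarrow> nat) \<Rightarrow>
   ('e \<Rightarrow> 'k mat) topology" where
  "Rep_space Q I d = subtopology (zariski (rep_ambient Q d) (rep_coords Q d)) (Rep Q I d)"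

definition closure_Rep_top ::
  "('v, 'e) pre_digraph \<Rightarrow> (('v, 'e) path \<Rightarrow> 'k::field) set \<Rightarrow> ('v \<Rightarrow> nat) \<Rightarrow>
   (('v, 'e, 'k) bqa, 't) module \<Rightarrow> ('e \<Rightarrow> 'k mat) set" where
  "closure_Rep_top Q I d T = Rep_space Q I d closure_of Rep_top Q I d T"

definition generic_top ::
  "('v, 'e) pre_digraph \<Rightarrow> (('v, 'e) path \<Rightarrow> 'k::field) set \<Rightarrow> ('v \<Rightarrow> nat) \<Rightarrow>
   (('v, 'e, 'k) bqa, 't) module \<Rightarrow> bool" where
  "generic_top Q I d T \<longleftrightarrow> fd_module Q I T \<and> semisimple (bq_algebra Q I) T \<and>
     closure_Rep_top Q I d T \<in> irreducible_components (Rep_space Q I d)"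

definition generic_socle ::
  "('v, 'e) pre_digraph \<Rightarrow> (('v, 'e) path \<Rightarrow> 'k::field) set \<Rightarrow> ('v \<Rightarrow> nat) \<Rightarrow>
   (('v, 'e, 'k) bqa, 's) module \<Rightarrow> bool" where
  "generic_socle Q I d S \<longleftrightarrow> fd_module Q I S \<and> semisimple (bq_algebra Q I) S \<and>
     (\<exists>T :: ('v, 'e, 'k) std_module. generic_top Q I d T \<and>
       (let Y = subtopology (Rep_space Q I d) (closure_Rep_top Q I d T) in
         \<exists>U. openin Y U \<and> Y closure_of U = topspace Y \<and>
           (\<forall>x\<in>U. mod_isomorphic (bq_algebra Q I) (soc (bq_algebra Q I) (rep_module Q d x)) S)))"

end

theory Submission
  imports Defs "Jordan_Normal_Form.Determinant"
begin

text \<open>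
  Since \<open>J\<^sup>2 = 0\<close>, the ideal \<open>I\<close> consists of all combinations of paths of length at least two, and a point
  \<open>x\<close> of \<open>Rep\<^sub>d\<close> is a family of matrices with \<open>x\<^sub>b x\<^sub>a = 0\<close> whenever \<open>b\<close> can follow \<open>a\<close>. Let \<open>r\<^sub>i(x)\<close> be
  the rank of all columns of the \<open>x\<^sub>a\<close> with \<open>a\<close> ending in \<open>i\<close>, and \<open>s\<^sub>i(x)\<close> the dimension of the common
  kernel of the \<open>x\<^sub>a\<close> with \<open>a\<close> starting in \<open>i\<close>. The module of \<open>x\<close> has a top of dimension vector
  \<open>d - r(x)\<close> and a socle of dimension vector \<open>s(x)\<close>, and \<open>r(x) \<le> s(x)\<close>. For each \<open>\<rho>\<close> the set
  \<open>Z\<^sub>\<rho> = {x. r(x) \<le> \<rho> \<le> s(x)}\<close> is closed; it is irreducible because base change brings its points into a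
  common block form, so that rational curves inside \<open>Z\<^sub>\<rho>\<close> join any two of them. The points with
  \<open>r(x) = \<rho>\<close> are open in \<open>Z\<^sub>\<rho>\<close>, so the closure of a non-empty \<open>Rep\<^sup>T\<close> is \<open>Z\<^sub>\<rho>\<close> with \<open>\<rho> = d - dim T\<close>, and \<open>s\<close>
  takes its least value \<open>\<sigma>(\<rho>)\<close> on a dense open part. As \<open>Rep\<^sub>d\<close> is the union of finitely many of these
  closures, its components are the maximal ones, and \<open>Z\<^sub>\<rho> \<subseteq> Z\<^sub>\<rho>\<^sub>'\<close> means \<open>\<rho> \<le> \<rho>' \<le> \<sigma>(\<rho>)\<close>, which turns
  maximality into minimality of the pair \<open>(d - \<rho>, \<sigma>(\<rho>))\<close>.
\<close>

section \<open>Linear algebra in coordinate spaces\<close>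

text \<open>Semicontinuity of rank makes exactly the inequalities \<open>r(x) \<le> \<rho>\<close>
  and \<open>\<rho> \<le> s(x)\<close> closed. Together they say that at each vertex a subspace of
  dimension \<rho> fits between the image of the incoming maps and the common kernel of the outgoing
  ones. This intermediate subspace yields a block form whose zero pattern depends on \<rho> alone,
  which is why the strata are cut out by both inequalities. A curve between two points moves base
  changes and blocks along line segments; the inverse base change is rational in the parameter and
  loses finitely many parameters, so the infinitude of the field carries the argument. A non-empty
  stratum may contain no point with \<open>r(x) = \<rho>\<close>; statements about closures
  therefore start from a point of that rank. Modules live in arbitrary types and their tops consist
  of cosets. Every module is therefore compared with the module of a point, and every semisimple
  module with one given by zero matrices, so that isomorphism of tops and socles becomes equality of
  dimension vectors.\<close>

definition lin_comb :: "nat \<Rightarrow> nat \<Rightarrow> (nat \<Rightarrow> 'k::field vec) \<Rightarrow> (nat \<Rightarrow> 'k) \<Rightarrow> 'k vec" where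
  "lin_comb n k b c = vec n (\<lambda>i. \<Sum>j<k. c j * b j $ i)"

text \<open>Families are functions on the naturals of which the values below \<open>k\<close> count.
  Adjoining a vector is the update \<open>b(k := w)\<close>, and a repeated vector makes a family
  dependent, which a set of vectors would not record.\<close>

definition indep :: "nat \<Rightarrow> nat \<Rightarrow> (nat \<Rightarrow> 'k::field vec) \<Rightarrow> bool" where
  "indep n k b \<longleftrightarrow> (\<forall>j<k. b j \<in> carrier_vec n) \<and>
     (\<forall>c. lin_comb n k b c = 0\<^sub>v n \<longrightarrow> (\<forall>j<k. c j = 0))"

definition in_span :: "nat \<Rightarrow> nat \<Rightarrow> (nat \<Rightarrow> 'k::field vec) \<Rightarrow> 'k vec \<Rightarrow> bool" where
  "in_span n k b w \<longleftrightarrow> (\<exists>c. w = lin_comb n k b c)"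

lemma lin_comb_closed [simp]: "lin_comb n k b c \<in> carrier_vec n"
  by (simp add: lin_comb_def)

lemma index_lin_comb [simp]: "i < n \<Longrightarrow> lin_comb n k b c $ i = (\<Sum>j<k. c j * b j $ i)"
  by (simp add: lin_comb_def)

lemma lin_comb_cong:
  "(\<And>j. j < k \<Longrightarrow> b j = b' j) \<Longrightarrow> (\<And>j. j < k \<Longrightarrow> c j = c' j) \<Longrightarrow> lin_comb n k b c = lin_comb n k b' c'"
  by (auto simp: lin_comb_def intro!: sum.cong)

lemma mult_mat_vec_columns:
  assumes "c \<in> carrier_vec k"
  shows "mat n k (\<lambda>(i, j). b j $ i) *\<^sub>v c = lin_comb n k b (($) c)"
  using assms
  by (intro eq_vecI) (auto simp: scalar_prod_def lin_comb_def mult.commute atLeast0LessThan)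

lemma indep_det_nonzero:
  assumes "indep n n b"
  shows "det (mat n n (\<lambda>(i, j). b j $ i)) \<noteq> 0"
proof
  assume "det (mat n n (\<lambda>(i, j). b j $ i)) = 0"
  then obtain v where v: "v \<in> carrier_vec n" "v \<noteq> 0\<^sub>v n"
    "mat n n (\<lambda>(i, j). b j $ i) *\<^sub>v v = 0\<^sub>v n"
    using det_0_iff_vec_prod_zero[of "mat n n (\<lambda>(i, j). b j $ i)" n] by auto
  have "v $ j = 0" if "j < n" for j
    using assms v that unfolding indep_def by (auto simp: mult_mat_vec_columns)
  then show False using v by (auto intro: eq_vecI)
qed

lemma det_nonzero_indep:
  assumes "det (mat n n (\<lambda>(i, j). b j $ i)) \<noteq> (0::'k::field)"
    and "\<And>j. j < n \<Longrightarrow> b j \<in> carrier_vec n"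
  shows "indep n n b"
  unfolding indep_def
proof (intro conjI allI impI)
  fix c j assume c: "lin_comb n n b c = 0\<^sub>v n" and j: "j < n"
  have "mat n n (\<lambda>(i, j). b j $ i) *\<^sub>v vec n c = 0\<^sub>v n"
    using c by (simp add: mult_mat_vec_columns cong: lin_comb_cong)
  then have "vec n c = 0\<^sub>v n"
    using assms(1) det_0_iff_vec_prod_zero[of "mat n n (\<lambda>(i, j). b j $ i)" n]
    by (metis mat_carrier vec_carrier)
  then show "c j = 0" using j by (metis index_vec index_zero_vec(1))
qed (use assms in auto)

text \<open>For \<open>k > n\<close>, zero rows pad the matrix of columns to a singular square
  matrix, and a non-zero element of its kernel is a non-trivial relation.\<close>

lemma indep_le_dim:
  assumes "indep n k b"
  shows "k \<le> n"
proof (rule ccontr)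
  assume "\<not> k \<le> n"
  then have nk: "n < k" by simp
  let ?A = "mat k k (\<lambda>(i, j). if i < n then b j $ i else 0)"
  \<comment> \<open>Row \<open>n\<close> of the padded matrix is zero, so the transpose kills the
    unit vector with index \<open>n\<close>.\<close>
  have "transpose_mat ?A *\<^sub>v unit_vec k n = 0\<^sub>v k"
    using nk by (intro eq_vecI) (auto simp: scalar_prod_def unit_vec_def if_distrib cong: if_cong)
  moreover have "unit_vec k n \<noteq> 0\<^sub>v k" using nk by (metis index_unit_vec(1) index_zero_vec(1) zero_neq_one)
  ultimately have "det (transpose_mat ?A) = 0"
    using det_0_iff_vec_prod_zero[of "transpose_mat ?A" k] by (meson mat_carrier transpose_carrier_mat unit_vec_carrier)
  then have "det ?A = 0" by (subst (asm) det_transpose[OF mat_carrier])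
  then obtain v where v: "v \<in> carrier_vec k" "v \<noteq> 0\<^sub>v k" "?A *\<^sub>v v = 0\<^sub>v k"
    using det_0_iff_vec_prod_zero[of ?A k] by auto
  have "lin_comb n k b (($) v) = 0\<^sub>v n"
  proof (rule eq_vecI)
    fix i assume i: "i < dim_vec (0\<^sub>v n)"
    then have "(?A *\<^sub>v v) $ i = (\<Sum>j<k. v $ j * b j $ i)"
      using v(1) nk by (auto simp: scalar_prod_def atLeast0LessThan mult.commute)
    then show "lin_comb n k b (($) v) $ i = 0\<^sub>v n $ i" using v(3) i nk by simp
  qed auto
  then have "v $ j = 0" if "j < k" for j using assms that unfolding indep_def by blast
  then show False using v by (auto intro: eq_vecI)
qed

lemma not_indep_coeffs:
  assumes "n < k" and "\<And>j. j < k \<Longrightarrow> b j \<in> carrier_vec n"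
  obtains c j where "lin_comb n k b c = 0\<^sub>v n" "j < k" "c j \<noteq> 0"
proof -
  have "\<not> indep n k b" using indep_le_dim[of n k b] assms(1) by auto
  then have "\<exists>c. lin_comb n k b c = 0\<^sub>v n \<and> (\<exists>j<k. c j \<noteq> 0)"
    using assms(2) unfolding indep_def by blast
  then show ?thesis using that by blast
qed

lemma indep_extend:
  assumes b: "indep n k b" and w: "w \<in> carrier_vec n" and "\<not> in_span n k b w"
  shows "indep n (Suc k) (b(k := w))"
  unfolding indep_def
proof (rule conjI)
  show "\<forall>j<Suc k. (b(k := w)) j \<in> carrier_vec n"
    using b w by (auto simp: indep_def less_Suc_eq)
  show "\<forall>c. lin_comb n (Suc k) (b(k := w)) c = 0\<^sub>v n \<longrightarrow> (\<forall>j<Suc k. c j = 0)"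
  proof (rule allI, rule impI)
    fix c assume c: "lin_comb n (Suc k) (b(k := w)) c = 0\<^sub>v n"
    have e: "(\<Sum>j<k. c j * b j $ i) + c k * w $ i = 0" if "i < n" for i
    proof -
      have "lin_comb n (Suc k) (b(k := w)) c $ i = 0" using c that by simp
      moreover have "(\<Sum>j<k. c j * (b(k := w)) j $ i) = (\<Sum>j<k. c j * b j $ i)"
        by (rule sum.cong) auto
      ultimately show ?thesis using that by simp
    qed
    have ck: "c k = 0"
    proof (rule ccontr)
      assume nz: "c k \<noteq> 0"
      have "w = lin_comb n k b (\<lambda>j. - c j / c k)"
      proof (rule eq_vecI)
        fix i assume "i < dim_vec (lin_comb n k b (\<lambda>j. - c j / c k))"
        then have i: "i < n" by (simp add: lin_comb_def)
        have "lin_comb n k b (\<lambda>j. - c j / c k) $ i = - (\<Sum>j<k. c j * b j $ i) / c k"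
          using i by (simp add: sum_divide_distrib sum_negf)
        also have "\<dots> = w $ i" using e[OF i] nz by (simp add: field_simps add_eq_0_iff)
        finally show "w $ i = lin_comb n k b (\<lambda>j. - c j / c k) $ i" by simp
      qed (use w in \<open>auto simp: lin_comb_def\<close>)
      then show False using assms(3) by (auto simp: in_span_def)
    qed
    have "lin_comb n k b c = 0\<^sub>v n" using e ck by (intro eq_vecI) (auto simp: lin_comb_def)
    then show "\<forall>j<Suc k. c j = 0" using b ck by (auto simp: indep_def less_Suc_eq)
  qed
qed

text \<open>Vectors of \<open>G\<close> outside the span are adjoined one by one;
  \<open>n - k\<close> drops each time because independent families have at most \<open>n\<close>
  members. The old vectors keep their positions and the new ones lie in \<open>G\<close>, so
  repeated extension produces bases adapted to a flag.\<close>

lemma indep_extend_to_spanning: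
  assumes "indep n k b" and "G \<subseteq> carrier_vec n"
  shows "\<exists>k' b'. k \<le> k' \<and> indep n k' b' \<and> (\<forall>j<k. b' j = b j) \<and> (\<forall>j\<ge>k. j < k' \<longrightarrow> b' j \<in> G) \<and>
    (\<forall>w\<in>G. in_span n k' b' w)"
  using assms(1)
proof (induction "n - k" arbitrary: k b rule: less_induct)
  case less
  show ?case
  proof (cases "\<forall>w\<in>G. in_span n k b w")
    case True
    then show ?thesis using less.prems by (intro exI[of _ k] exI[of _ b]) auto
  next
    case False
    then obtain w where w: "w \<in> G" "\<not> in_span n k b w" by blast
    have ind: "indep n (Suc k) (b(k := w))" using indep_extend[OF less.prems] w assms(2) by auto
    then have "n - Suc k < n - k" using indep_le_dim[of n "Suc k"] by fastforce
    from less.hyps[OF this ind] obtain k' b' where k': "Suc k \<le> k'" "indep n k' b'"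
      "\<forall>j<Suc k. b' j = (b(k := w)) j" "\<forall>j\<ge>Suc k. j < k' \<longrightarrow> b' j \<in> G" "\<forall>w\<in>G. in_span n k' b' w"
      by blast
    have "b' j \<in> G" if "j \<ge> k" "j < k'" for j
      using k' w that by (cases "j = k") auto
    moreover have "\<forall>j<k. b' j = b j" using k'(3) by auto
    ultimately show ?thesis using k' by (intro exI[of _ k'] exI[of _ b']) auto
  qed
qed

text \<open>Otherwise the coefficient vectors of the \<open>b j\<close> with respect to
  \<open>c\<close> are more than \<open>l\<close> vectors in \<open>l\<close>-space, and a relation
  between them is a relation between the \<open>b j\<close>.\<close>

lemma indep_le_spanning:
  assumes b: "indep n k b" and c: "\<And>j. j < k \<Longrightarrow> in_span n l c (b j)"
  shows "k \<le> l"
proof (rule ccontr)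
  assume "\<not> k \<le> l"
  obtain C where C: "\<And>j. j < k \<Longrightarrow> b j = lin_comb n l c (C j)"
    using c unfolding in_span_def by metis
  obtain a j where a: "lin_comb l k (\<lambda>j. vec l (C j)) a = 0\<^sub>v l" "j < k" "a j \<noteq> 0"
    using not_indep_coeffs[of l k "\<lambda>j. vec l (C j)"] \<open>\<not> k \<le> l\<close> by auto
  have z: "(\<Sum>j<k. a j * C j i) = 0" if "i < l" for i
  proof -
    have "lin_comb l k (\<lambda>j. vec l (C j)) a $ i = 0" using a(1) that by simp
    then show ?thesis using that by simp
  qed
  have "lin_comb n k b a = 0\<^sub>v n"
  proof (rule eq_vecI)
    fix p assume "p < dim_vec (0\<^sub>v n)"
    then have p: "p < n" by simp
    have "lin_comb n k b a $ p = (\<Sum>j<k. \<Sum>i<l. a j * C j i * c i $ p)"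
      using p by (auto simp: C sum_distrib_left mult.assoc intro!: sum.cong)
    also have "\<dots> = (\<Sum>i<l. (\<Sum>j<k. a j * C j i) * c i $ p)"
      by (subst sum.swap) (simp add: sum_distrib_right)
    also have "\<dots> = 0" using z by simp
    finally show "lin_comb n k b a $ p = 0\<^sub>v n $ p" using p by simp
  qed (auto simp: lin_comb_def)
  then show False using b a unfolding indep_def by blast
qed

section \<open>Ranks of sets of vectors\<close>

definition vrank :: "nat \<Rightarrow> 'k::field vec set \<Rightarrow> nat" where
  "vrank n G = (GREATEST k. \<exists>b. indep n k b \<and> (\<forall>j<k. b j \<in> G))"

lemma vrank_ge: "indep n k b \<Longrightarrow> (\<And>j. j < k \<Longrightarrow> b j \<in> G) \<Longrightarrow> k \<le> vrank n G"
  unfolding vrank_def by (rule Greatest_le_nat[where b = n]) (auto dest: indep_le_dim)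

text \<open>A family of greatest size spans, since a vector of \<open>G\<close> outside its span
  could be adjoined; a greatest size exists because independent families have at most
  \<open>n\<close> members. Thus \<open>vrank\<close> is the dimension of the span, also for
  infinite \<open>G\<close>.\<close>

lemma vrank_basis:
  assumes "G \<subseteq> carrier_vec n"
  obtains b where "indep n (vrank n G) b" "\<And>j. j < vrank n G \<Longrightarrow> b j \<in> G"
    "\<And>w. w \<in> G \<Longrightarrow> in_span n (vrank n G) b w"
proof -
  have "indep n 0 (\<lambda>_. 0\<^sub>v n)" by (simp add: indep_def)
  then have "\<exists>b. indep n (vrank n G) b \<and> (\<forall>j<vrank n G. b j \<in> G)"
    unfolding vrank_def
    by (intro GreatestI_nat[where b = n and P = "\<lambda>k. \<exists>b. indep n k b \<and> (\<forall>j<k. b j \<in> G)" and k = 0])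
       (auto dest: indep_le_dim)
  then obtain b where b: "indep n (vrank n G) b" "\<And>j. j < vrank n G \<Longrightarrow> b j \<in> G" by blast
  have "in_span n (vrank n G) b w" if "w \<in> G" for w
  proof (rule ccontr)
    assume "\<not> in_span n (vrank n G) b w"
    then have "indep n (Suc (vrank n G)) (b(vrank n G := w))"
      using b(1) assms that by (intro indep_extend) auto
    then have "Suc (vrank n G) \<le> vrank n G"
      by (rule vrank_ge) (use b(2) that in \<open>auto simp: less_Suc_eq\<close>)
    then show False by simp
  qed
  with b show ?thesis by (intro that) auto
qed

lemma vrank_le_spanning:
  assumes "G \<subseteq> carrier_vec n" and "\<And>w. w \<in> G \<Longrightarrow> in_span n l c w"
  shows "vrank n G \<le> l"
proof -
  obtain b where b: "indep n (vrank n G) b" "\<And>j. j < vrank n G \<Longrightarrow> b j \<in> G"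
    using vrank_basis[OF assms(1)] by blast
  show ?thesis by (rule indep_le_spanning[OF b(1)]) (use b(2) assms(2) in auto)
qed

lemma vrank_le_dim: "G \<subseteq> carrier_vec n \<Longrightarrow> vrank n G \<le> n"
  by (erule vrank_basis) (erule indep_le_dim)

lemma indep_inverse:
  fixes b :: "nat \<Rightarrow> 'a::field vec"
  assumes "indep n n b"
  obtains h where "h \<in> carrier_mat n n" "h * mat n n (\<lambda>(i, j). b j $ i) = 1\<^sub>m n"
    "mat n n (\<lambda>(i, j). b j $ i) * h = 1\<^sub>m n"
proof -
  let ?g = "mat n n (\<lambda>(i, j). b j $ i)"
  have "?g \<in> Units (ring_mat TYPE('a) n ())"
    by (rule det_non_zero_imp_unit[OF mat_carrier indep_det_nonzero[OF assms]])
  then obtain h where "h \<in> carrier (ring_mat TYPE('a) n ())"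
    "h \<otimes>\<^bsub>ring_mat TYPE('a) n ()\<^esub> ?g = \<one>\<^bsub>ring_mat TYPE('a) n ()\<^esub>"
    "?g \<otimes>\<^bsub>ring_mat TYPE('a) n ()\<^esub> h = \<one>\<^bsub>ring_mat TYPE('a) n ()\<^esub>"
    unfolding Units_def by blast
  then show ?thesis by (intro that) (simp_all add: ring_mat_simps)
qed

text \<open>\<open>h\<close> is inverse to the matrix of the basis, so \<open>h *\<^sub>v v\<close>
  lists the coordinates of \<open>v\<close>; the span of the first \<open>k\<close> basis vectors is
  where the coordinates from \<open>k\<close> on vanish.\<close>

lemma indep_in_span_subset:
  assumes b: "indep n n b" and h: "h \<in> carrier_mat n n" "h * mat n n (\<lambda>(i, j). b j $ i) = 1\<^sub>m n"
    "mat n n (\<lambda>(i, j). b j $ i) * h = 1\<^sub>m n" and k: "k \<le> n" and v: "v \<in> carrier_vec n"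
  shows "in_span n k b v \<longleftrightarrow> (\<forall>i<n. k \<le> i \<longrightarrow> (h *\<^sub>v v) $ i = 0)"
proof
  let ?g = "mat n n (\<lambda>(i, j). b j $ i)"
  assume "in_span n k b v"
  then obtain c where c: "v = lin_comb n k b c" by (auto simp: in_span_def)
  have "v = ?g *\<^sub>v vec n (\<lambda>j. if j < k then c j else 0)"
  proof (subst mult_mat_vec_columns, simp, rule eq_vecI)
    fix i assume "i < dim_vec (lin_comb n n b (($) (vec n (\<lambda>j. if j < k then c j else 0))))"
    then have i: "i < n" by (simp add: lin_comb_def)
    have "(\<Sum>j<n. vec n (\<lambda>j. if j < k then c j else 0) $ j * b j $ i) = (\<Sum>j<k. c j * b j $ i)"
      using k by (intro sum.mono_neutral_cong_right) auto
    then show "v $ i = lin_comb n n b (($) (vec n (\<lambda>j. if j < k then c j else 0))) $ i"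
      using i by (simp add: c)
  qed (use v in \<open>auto simp: lin_comb_def\<close>)
  then have "h *\<^sub>v v = (h * ?g) *\<^sub>v vec n (\<lambda>j. if j < k then c j else 0)"
    using h(1) by (simp add: assoc_mult_mat_vec[of _ n n _ n])
  then show "\<forall>i<n. k \<le> i \<longrightarrow> (h *\<^sub>v v) $ i = 0" by (simp add: h(2))
next
  let ?g = "mat n n (\<lambda>(i, j). b j $ i)"
  assume z: "\<forall>i<n. k \<le> i \<longrightarrow> (h *\<^sub>v v) $ i = 0"
  have "v = (?g * h) *\<^sub>v v" using v by (simp add: h(3))
  also have "\<dots> = ?g *\<^sub>v (h *\<^sub>v v)" using h(1) v by (simp add: assoc_mult_mat_vec[of _ n n _ n])
  also have "\<dots> = lin_comb n n b (($) (h *\<^sub>v v))" by (rule mult_mat_vec_columns) (use h v in auto)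
  also have "\<dots> = lin_comb n k b (($) (h *\<^sub>v v))"
    using k z unfolding lin_comb_def
    by (intro eq_vecI) (auto simp: not_less[symmetric] intro!: sum.mono_neutral_right)
  finally show "in_span n k b v" by (auto simp: in_span_def)
qed

lemma scalar_prod_lin_comb:
  assumes "w \<in> carrier_vec n" and "\<And>j. j < k \<Longrightarrow> b j \<in> carrier_vec n"
  shows "w \<bullet> lin_comb n k b c = (\<Sum>j<k. c j * (w \<bullet> b j))"
proof -
  have "w \<bullet> lin_comb n k b c = (\<Sum>i<n. \<Sum>j<k. c j * (w $ i * b j $ i))"
    by (auto simp: scalar_prod_def lin_comb_def sum_distrib_left atLeast0LessThan ac_simps intro!: sum.cong)
  also have "\<dots> = (\<Sum>j<k. c j * (w \<bullet> b j))"
    using assms(2)[THEN carrier_vecD]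
    by (subst sum.swap) (auto simp: scalar_prod_def sum_distrib_left atLeast0LessThan intro!: sum.cong)
  finally show ?thesis .
qed

text \<open>The rows of \<open>h\<close> are the basis dual to \<open>b\<close>, hence
  \<open>w\<close> is the sum of the rows \<open>j\<close> of \<open>h\<close> with coefficients
  \<open>w \<bullet> b j\<close>. For \<open>w\<close> in \<open>R\<close> the first
  \<open>k\<close> coefficients vanish, and \<open>R\<close> lies in the span of the remaining
  \<open>n - k\<close> rows.\<close>

lemma vrank_le_codim:
  assumes R: "R \<subseteq> carrier_vec n" and b: "\<And>j. j < n \<Longrightarrow> b j \<in> carrier_vec n"
    and h: "h \<in> carrier_mat n n" "mat n n (\<lambda>(i, j). b j $ i) * h = 1\<^sub>m n"
    and k: "k \<le> n" and z: "\<And>w j. w \<in> R \<Longrightarrow> j < k \<Longrightarrow> w \<bullet> b j = 0"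
  shows "vrank n R \<le> n - k"
proof (rule vrank_le_spanning[OF R])
  let ?g = "mat n n (\<lambda>(i, j). b j $ i)"
  fix w assume w: "w \<in> R"
  then have wc: "w \<in> carrier_vec n" using R by auto
  show "in_span n (n - k) (\<lambda>j. row h (j + k)) w"
    unfolding in_span_def
  proof (rule exI, rule eq_vecI)
    fix i assume "i < dim_vec (lin_comb n (n - k) (\<lambda>j. row h (j + k)) (\<lambda>j. w \<bullet> b (j + k)))"
    then have i: "i < n" by (simp add: lin_comb_def)
    have "w $ i = w \<bullet> col (1\<^sub>m n) i" using wc i by simp
    also have "\<dots> = w \<bullet> (?g *\<^sub>v col h i)"
      using h i by (metis (no_types, lifting) col_mult2 mat_carrier)
    also have "?g *\<^sub>v col h i = lin_comb n n b (($) (col h i))"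
      by (rule mult_mat_vec_columns) (use h i in auto)
    also have "w \<bullet> \<dots> = (\<Sum>j<n. h $$ (j, i) * (w \<bullet> b j))"
      using wc b i h by (subst scalar_prod_lin_comb) auto
    also have "\<dots> = (\<Sum>j\<in>{k..<n}. h $$ (j, i) * (w \<bullet> b j))"
      using k z w by (intro sum.mono_neutral_right) auto
    also have "\<dots> = (\<Sum>j<n - k. h $$ (j + k, i) * (w \<bullet> b (j + k)))"
      using k by (intro sum.reindex_bij_witness[of _ "\<lambda>j. j + k" "\<lambda>j. j - k"]) auto
    finally show "w $ i = lin_comb n (n - k) (\<lambda>j. row h (j + k)) (\<lambda>j. w \<bullet> b (j + k)) $ i"
      using i h by (simp add: mult.commute)
  qed (use wc in \<open>auto simp: lin_comb_def\<close>)
qed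

text \<open>
  A basis of \<open>K\<^sup>n\<close> adapted to the flag \<open>span G \<subseteq> R\<^sup>\<bottom> \<subseteq> K\<^sup>n\<close>; \<open>g\<close> is the base change matrix and
  \<open>h\<close> its inverse.
\<close>

lemma adapted_basis:
  fixes G R :: "'k::field vec set"
  assumes G: "G \<subseteq> carrier_vec n" and R: "R \<subseteq> carrier_vec n"
    and orth: "\<And>v w. v \<in> G \<Longrightarrow> w \<in> R \<Longrightarrow> w \<bullet> v = 0"
  obtains g h where "g \<in> carrier_mat n n" "h \<in> carrier_mat n n" "h * g = 1\<^sub>m n" "g * h = 1\<^sub>m n"
    "\<And>v i. v \<in> G \<Longrightarrow> i < n \<Longrightarrow> vrank n G \<le> i \<Longrightarrow> (h *\<^sub>v v) $ i = 0"
    "\<And>j. j < vrank n G \<Longrightarrow> col g j \<in> G"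
    "\<And>v. v \<in> carrier_vec n \<Longrightarrow>
      (\<forall>w\<in>R. w \<bullet> v = 0) \<longleftrightarrow> (\<forall>i<n. n - vrank n R \<le> i \<longrightarrow> (h *\<^sub>v v) $ i = 0)"
    "vrank n G \<le> n - vrank n R"
proof -
  let ?q = "vrank n G" and ?p = "vrank n R"
  define S where "S = {v \<in> carrier_vec n. \<forall>w\<in>R. w \<bullet> v = 0}"
  obtain b0 where b0: "indep n ?q b0" "\<And>j. j < ?q \<Longrightarrow> b0 j \<in> G"
    "\<And>w. w \<in> G \<Longrightarrow> in_span n ?q b0 w" using vrank_basis[OF G] by blast
  \<comment> \<open>\<open>S\<close> is the orthogonal complement of \<open>R\<close> and contains
    \<open>G\<close>. Extending a basis of the span of \<open>G\<close> inside \<open>S\<close>, and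
    the result to the whole space, keeps earlier vectors in front, so each member of the flag is
    spanned by an initial segment.\<close>
  obtain k b1 where k: "?q \<le> k" "indep n k b1" "\<forall>j<?q. b1 j = b0 j"
    "\<forall>j\<ge>?q. j < k \<longrightarrow> b1 j \<in> S" "\<forall>w\<in>S. in_span n k b1 w"
    using indep_extend_to_spanning[OF b0(1), of S] by (auto simp: S_def)
  obtain m b where m: "k \<le> m" "indep n m b" "\<forall>j<k. b j = b1 j" "\<forall>w\<in>carrier_vec n. in_span n m b w"
    using indep_extend_to_spanning[OF k(2), of "carrier_vec n"] by auto
  have "n \<le> m"
  proof (rule indep_le_spanning)
    show "indep n n (unit_vec n :: nat \<Rightarrow> 'k vec)"
      unfolding indep_def
    proof (intro conjI allI impI)
      fix c :: "nat \<Rightarrow> 'k" and j assume c: "lin_comb n n (unit_vec n) c = 0\<^sub>v n" and j: "j < n"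
      have "lin_comb n n (unit_vec n) c $ j = c j"
        using j by (simp add: unit_vec_def if_distrib cong: if_cong)
      then show "c j = 0" using c j by simp
    qed auto
    show "in_span n m b (unit_vec n j)" for j using m(4) by auto
  qed
  with indep_le_dim[OF m(2)] have mn: "m = n" by simp
  have bn: "indep n n b" using m mn by simp
  have bc: "\<And>j. j < n \<Longrightarrow> b j \<in> carrier_vec n" using bn by (simp add: indep_def)
  let ?g = "mat n n (\<lambda>(i, j). b j $ i)"
  obtain h where h: "h \<in> carrier_mat n n" "h * ?g = 1\<^sub>m n" "?g * h = 1\<^sub>m n"
    using indep_inverse[OF bn] .
  have kn: "k \<le> n" using m mn by simp
  have span_k: "in_span n k b v \<longleftrightarrow> in_span n k b1 v" for v
    unfolding in_span_def using m(3) lin_comb_cong[of k b b1] by metis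
  have span_q: "in_span n ?q b v \<longleftrightarrow> in_span n ?q b0 v" for v
  proof -
    have "\<And>j. j < ?q \<Longrightarrow> b j = b0 j" using m(3) k(1,3) by simp
    then show ?thesis unfolding in_span_def using lin_comb_cong[of ?q b b0] by metis
  qed
  have GS: "G \<subseteq> S" using G orth by (auto simp: S_def)
  have bS: "b j \<in> S" if "j < k" for j
    using that k m b0(2) GS by (cases "j < ?q") auto
  have S_span: "v \<in> S \<longleftrightarrow> in_span n k b v" if v: "v \<in> carrier_vec n" for v
  proof
    show "v \<in> S \<Longrightarrow> in_span n k b v" using k(5) span_k by simp
    assume "in_span n k b v"
    then obtain c where c: "v = lin_comb n k b c" by (auto simp: in_span_def)
    have "w \<bullet> v = 0" if "w \<in> R" for w
      unfolding c using that R bS kn bc by (subst scalar_prod_lin_comb) (auto simp: S_def)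
    then show "v \<in> S" using v by (simp add: S_def)
  qed
  have k_eq: "k = n - ?p"
  proof (rule antisym)
    have "?p \<le> n - k"
      using bS by (intro vrank_le_codim[OF R bc h(1,3) kn]) (auto simp: S_def)
    then show "k \<le> n - ?p" using kn vrank_le_dim[OF R] by simp
    obtain w where w: "indep n ?p w" "\<And>j. j < ?p \<Longrightarrow> w j \<in> R"
      "\<And>v. v \<in> R \<Longrightarrow> in_span n ?p w v" using vrank_basis[OF R] by blast
    have wc: "\<And>j. j < ?p \<Longrightarrow> w j \<in> carrier_vec n" using w R by auto
    \<comment> \<open>Pairing the last \<open>n - k\<close> basis vectors with a basis
      \<open>w\<close> of the span of \<open>R\<close> gives independent vectors in
      \<open>?p\<close>-space, hence \<open>n - k \<le> ?p\<close>. A relation would produce a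
      combination \<open>v\<close> of these basis vectors that is orthogonal to \<open>R\<close> and
      so lies in the span of the first \<open>k\<close>.\<close>
    have "indep ?p (n - k) (\<lambda>j. vec ?p (\<lambda>l. w l \<bullet> b (k + j)))"
      unfolding indep_def
    proof (rule conjI, simp, rule allI, rule impI)
      fix c assume c: "lin_comb ?p (n - k) (\<lambda>j. vec ?p (\<lambda>l. w l \<bullet> b (k + j))) c = 0\<^sub>v ?p"
      define v where "v = lin_comb n (n - k) (\<lambda>j. b (k + j)) c"
      have wv: "w l \<bullet> v = 0" if "l < ?p" for l
      proof -
        have "w l \<bullet> v = (\<Sum>j<n - k. c j * (w l \<bullet> b (k + j)))"
          unfolding v_def using wc that bc by (subst scalar_prod_lin_comb) auto
        also have "\<dots> = lin_comb ?p (n - k) (\<lambda>j. vec ?p (\<lambda>l. w l \<bullet> b (k + j))) c $ l"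
          using that by simp
        finally show ?thesis using c that by simp
      qed
      have vc: "v \<in> carrier_vec n" by (simp add: v_def)
      have "u \<bullet> v = 0" if "u \<in> R" for u
      proof -
        obtain a where a: "u = lin_comb n ?p w a" using w(3)[OF \<open>u \<in> R\<close>] by (auto simp: in_span_def)
        have "u \<bullet> v = v \<bullet> u" using that R vc by (intro comm_scalar_prod[of _ n]) auto
        also have "\<dots> = (\<Sum>j<?p. a j * (v \<bullet> w j))"
          unfolding a using vc wc by (subst scalar_prod_lin_comb) auto
        also have "\<dots> = (\<Sum>j<?p. a j * (w j \<bullet> v))"
          using vc wc comm_scalar_prod[of v n] by (intro sum.cong) auto
        also have "\<dots> = 0" using wv by simp
        finally show ?thesis .
      qed
      then have "in_span n k b v" using S_span[OF vc] vc by (simp add: S_def)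
      then obtain a where a: "v = lin_comb n k b a" by (auto simp: in_span_def)
      \<comment> \<open>\<open>v\<close> is a combination of the first \<open>k\<close> and also of
        the last \<open>n - k\<close> basis vectors; the difference is a relation of the whole
        basis, so all its coefficients vanish.\<close>
      have "lin_comb n n b (\<lambda>j. if j < k then a j else - c (j - k)) = 0\<^sub>v n"
      proof (rule eq_vecI)
        fix i assume "i < dim_vec (0\<^sub>v n)"
        then have i: "i < n" by simp
        have "(\<Sum>j<n. (if j < k then a j else - c (j - k)) * b j $ i) =
            (\<Sum>j<k. (if j < k then a j else - c (j - k)) * b j $ i) +
            (\<Sum>j\<in>{k..<n}. (if j < k then a j else - c (j - k)) * b j $ i)"
          using kn by (subst sum.union_disjoint[symmetric]) (auto intro!: sum.cong)
        also have "(\<Sum>j<k. (if j < k then a j else - c (j - k)) * b j $ i) = v $ i"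
          using i by (simp add: a)
        also have "(\<Sum>j\<in>{k..<n}. (if j < k then a j else - c (j - k)) * b j $ i) =
            (\<Sum>j<n - k. - c j * b (k + j) $ i)"
          using kn by (intro sum.reindex_bij_witness[of _ "\<lambda>j. k + j" "\<lambda>j. j - k"]) auto
        also have "v $ i + (\<Sum>j<n - k. - c j * b (k + j) $ i) = 0"
          using i by (simp add: v_def sum_negf)
        finally show "lin_comb n n b (\<lambda>j. if j < k then a j else - c (j - k)) $ i = 0\<^sub>v n $ i"
          using i by simp
      qed (simp add: lin_comb_def)
      then have z: "\<forall>j<n. (if j < k then a j else - c (j - k)) = 0"
        using bn unfolding indep_def by blast
      show "\<forall>j<n - k. c j = 0"
      proof (intro allI impI)
        fix j assume "j < n - k"
        then show "c j = 0" using z[rule_format, of "k + j"] by simp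
      qed
    qed
    then have "n - k \<le> ?p" by (rule indep_le_dim)
    then show "n - ?p \<le> k" by simp
  qed
  show ?thesis
  proof (rule that[of ?g h])
    show "(h *\<^sub>v v) $ i = 0" if "v \<in> G" "i < n" "?q \<le> i" for v i
      using indep_in_span_subset[OF bn h, of ?q v] b0(3)[OF that(1)] span_q that G k(1) kn by auto
    show "col ?g j \<in> G" if "j < ?q" for j
    proof -
      have jn: "j < n" using that k(1) kn by simp
      then have "col ?g j = b j" using bc[OF jn] by (intro eq_vecI) auto
      then show ?thesis using that k(1,3) m(3) b0(2) by simp
    qed
    show "(\<forall>w\<in>R. w \<bullet> v = 0) \<longleftrightarrow> (\<forall>i<n. n - ?p \<le> i \<longrightarrow> (h *\<^sub>v v) $ i = 0)"
      if v: "v \<in> carrier_vec n" for v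
      using S_span[OF v] indep_in_span_subset[OF bn h kn v] v k_eq by (simp add: S_def)
    show "?q \<le> n - ?p" using k(1) k_eq by simp
  qed (use h in auto)
qed

text \<open>\<open>h *\<^sub>v v\<close> gives the coordinates of \<open>v\<close> with respect to
  the columns of \<open>g\<close>, so \<open>G\<close> lies in the span of the first
  \<open>k\<close> columns.\<close>

lemma vrank_le_of_coords:
  assumes G: "G \<subseteq> carrier_vec n" and gh: "g \<in> carrier_mat n n" "h \<in> carrier_mat n n" "g * h = 1\<^sub>m n"
    and k: "k \<le> n" and z: "\<And>v i. v \<in> G \<Longrightarrow> i < n \<Longrightarrow> k \<le> i \<Longrightarrow> (h *\<^sub>v v) $ i = 0"
  shows "vrank n G \<le> k"
proof (rule vrank_le_spanning[OF G])
  fix v assume v: "v \<in> G"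
  then have vc: "v \<in> carrier_vec n" using G by auto
  have z': "\<forall>i<n. k \<le> i \<longrightarrow> (h *\<^sub>v v) $ i = 0" using z[OF v] by blast
  have g: "g = mat n n (\<lambda>(i, j). col g j $ i)" using gh(1) by (intro eq_matI) auto
  have "v = (g * h) *\<^sub>v v" using vc gh by simp
  also have "\<dots> = g *\<^sub>v (h *\<^sub>v v)" by (rule assoc_mult_mat_vec[OF gh(1,2) vc])
  also have "\<dots> = lin_comb n n (col g) (($) (h *\<^sub>v v))"
    by (subst g, rule mult_mat_vec_columns) (use gh vc in auto)
  also have "\<dots> = lin_comb n k (col g) (($) (h *\<^sub>v v))"
    using k z' unfolding lin_comb_def
    by (intro eq_vecI) (auto simp: not_less[symmetric] intro!: sum.mono_neutral_right)
  finally show "in_span n k (col g) v" by (auto simp: in_span_def)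
qed

text \<open>\<open>P\<close> maps to a space of dimension \<open>k + 1\<close>. Allowing an
  arbitrary \<open>P\<close> replaces the selection of a minor by rows of the inverse of a completed
  basis, and the determinant is still polynomial in the entries of the vectors.\<close>

lemma vrank_gt_iff:
  fixes G :: "'k::field vec set"
  assumes G: "G \<subseteq> carrier_vec n"
  shows "k < vrank n G \<longleftrightarrow> (\<exists>P b. (\<forall>j\<le>k. b j \<in> G) \<and>
     det (mat (Suc k) (Suc k) (\<lambda>(i, j). \<Sum>l<n. P i l * b j $ l)) \<noteq> 0)"
proof
  assume k: "k < vrank n G"
  obtain b where b: "indep n (vrank n G) b" "\<And>j. j < vrank n G \<Longrightarrow> b j \<in> G"
    "\<And>w. w \<in> G \<Longrightarrow> in_span n (vrank n G) b w"
    using vrank_basis[OF G] by blast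
  obtain m b' where m: "vrank n G \<le> m" "indep n m b'" "\<forall>j<vrank n G. b' j = b j"
    "\<forall>w\<in>carrier_vec n. in_span n m b' w"
    using indep_extend_to_spanning[OF b(1), of "carrier_vec n"] by auto
  have "n \<le> m"
  proof (rule indep_le_spanning)
    show "indep n n (unit_vec n :: nat \<Rightarrow> 'k vec)"
    proof (rule det_nonzero_indep)
      have "mat n n (\<lambda>(i, j). unit_vec n j $ i) = (1\<^sub>m n :: 'k mat)" by (intro eq_matI) auto
      then show "det (mat n n (\<lambda>(i, j). unit_vec n j $ i :: 'k)) \<noteq> 0" by simp
    qed auto
    show "in_span n m b' (unit_vec n j)" for j using m(4) by auto
  qed
  with indep_le_dim[OF m(2)] have mn: "m = n" by simp
  obtain h where h: "h \<in> carrier_mat n n" "h * mat n n (\<lambda>(i, j). b' j $ i) = 1\<^sub>m n"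
    using indep_inverse m(2) mn by metis
  \<comment> \<open>The rows of \<open>h\<close> are dual to the basis \<open>b'\<close>, which
    begins with the \<open>b j\<close>.\<close>
  have "mat (Suc k) (Suc k) (\<lambda>(i, j). \<Sum>l<n. h $$ (i, l) * b j $ l) = 1\<^sub>m (Suc k)"
  proof (rule eq_matI)
    fix i j assume "i < dim_row (1\<^sub>m (Suc k))" "j < dim_col (1\<^sub>m (Suc k))"
    then have ij: "i < Suc k" "j < Suc k" "i < n" "j < n" "j < vrank n G" using k m mn by auto
    have "(h * mat n n (\<lambda>(i, j). b' j $ i)) $$ (i, j) = (\<Sum>l<n. h $$ (i, l) * b j $ l)"
      using ij h(1) m(3) by (simp add: scalar_prod_def atLeast0LessThan)
    then show "mat (Suc k) (Suc k) (\<lambda>(i, j). \<Sum>l<n. h $$ (i, l) * b j $ l) $$ (i, j) = 1\<^sub>m (Suc k) $$ (i, j)"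
      using ij h(2) by simp
  qed auto
  then have "det (mat (Suc k) (Suc k) (\<lambda>(i, j). \<Sum>l<n. h $$ (i, l) * b j $ l)) \<noteq> 0" by (simp only: det_one) simp
  then show "\<exists>P b. (\<forall>j\<le>k. b j \<in> G) \<and>
     det (mat (Suc k) (Suc k) (\<lambda>(i, j). \<Sum>l<n. P i l * b j $ l)) \<noteq> 0"
    using b(2) k by (intro exI[of _ "\<lambda>i l. h $$ (i, l)"] exI[of _ b]) auto
next
  assume "\<exists>P b. (\<forall>j\<le>k. b j \<in> G) \<and>
     det (mat (Suc k) (Suc k) (\<lambda>(i, j). \<Sum>l<n. P i l * b j $ l)) \<noteq> 0"
  then obtain P b where b: "\<And>j. j \<le> k \<Longrightarrow> b j \<in> G"
    and det: "det (mat (Suc k) (Suc k) (\<lambda>(i, j). \<Sum>l<n. P i l * b j $ l)) \<noteq> 0" by blast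
  define u where "u j = vec (Suc k) (\<lambda>i. \<Sum>l<n. P i l * b j $ l)" for j
  have "mat (Suc k) (Suc k) (\<lambda>(i, j). u j $ i) = mat (Suc k) (Suc k) (\<lambda>(i, j). \<Sum>l<n. P i l * b j $ l)"
    by (intro eq_matI) (auto simp: u_def)
  then have ind: "indep (Suc k) (Suc k) u" using det by (intro det_nonzero_indep) (auto simp: u_def)
  have "indep n (Suc k) b"
    unfolding indep_def
  proof (intro conjI allI impI)
    fix c j assume c: "lin_comb n (Suc k) b c = 0\<^sub>v n" and j: "j < Suc k"
    have z: "(\<Sum>j<Suc k. c j * b j $ l) = 0" if "l < n" for l
    proof -
      have "lin_comb n (Suc k) b c $ l = 0" using c that by simp
      then show ?thesis using that by simp
    qed
    \<comment> \<open>\<open>P\<close> carries a relation between the \<open>b j\<close> to the same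
      relation between the \<open>u j\<close>.\<close>
    have "lin_comb (Suc k) (Suc k) u c = 0\<^sub>v (Suc k)"
    proof (rule eq_vecI)
      fix i assume "i < dim_vec (0\<^sub>v (Suc k))"
      then have i: "i < Suc k" by simp
      have "lin_comb (Suc k) (Suc k) u c $ i = (\<Sum>j<Suc k. \<Sum>l<n. P i l * (c j * b j $ l))"
        using i by (simp only: index_lin_comb) (auto simp: u_def sum_distrib_left ac_simps intro!: sum.cong)
      also have "\<dots> = (\<Sum>l<n. P i l * (\<Sum>j<Suc k. c j * b j $ l))"
        by (subst sum.swap) (simp only: sum_distrib_left)
      also have "\<dots> = 0" using z by simp
      finally show "lin_comb (Suc k) (Suc k) u c $ i = 0\<^sub>v (Suc k) $ i" using i by simp
    qed (simp add: lin_comb_def)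
    then show "c j = 0" using ind j by (simp add: indep_def)
  qed (use b G in auto)
  then have "Suc k \<le> vrank n G" by (rule vrank_ge) (use b in auto)
  then show "k < vrank n G" by simp
qed

section \<open>Zariski topology\<close>

lemma index_mult_mat_sum:
  assumes "A \<in> carrier_mat m n" "B \<in> carrier_mat n k" "i < m" "j < k"
  shows "(A * B) $$ (i, j) = (\<Sum>l<n. A $$ (i, l) * B $$ (l, j))"
  using assms by (simp add: scalar_prod_def atLeast0LessThan)

lemma poly_funs_sum: "(\<And>s. s \<in> S \<Longrightarrow> f s \<in> poly_funs X) \<Longrightarrow> (\<lambda>x. \<Sum>s\<in>S. f s x) \<in> poly_funs X"
  by (induction S rule: infinite_finite_induct) (auto intro: poly_funs.intros)

lemma poly_funs_prod: "(\<And>s. s \<in> S \<Longrightarrow> f s \<in> poly_funs X) \<Longrightarrow> (\<lambda>x. \<Prod>s\<in>S. f s x) \<in> poly_funs X"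
  by (induction S rule: infinite_finite_induct) (auto intro: poly_funs.intros)

lemma permutes_less_bound: "p permutes {0..<n} \<Longrightarrow> i < n \<Longrightarrow> p i < (n::nat)"
  using permutes_in_image[of p "{0..<n}" i] by auto

text \<open>By the Leibniz formula the determinant is a polynomial in the entries.\<close>

lemma poly_funs_det:
  assumes "\<And>i j. i < n \<Longrightarrow> j < n \<Longrightarrow> (\<lambda>x. f i j x) \<in> poly_funs X"
  shows "(\<lambda>x. det (mat n n (\<lambda>(i, j). f i j x))) \<in> poly_funs X"
proof -
  have "(\<lambda>x. det (mat n n (\<lambda>(i, j). f i j x))) =
      (\<lambda>x. \<Sum>p\<in>{p. p permutes {0..<n}}. signof p * (\<Prod>i = 0..<n. f i (p i) x))"
  proof
    fix x
    show "det (mat n n (\<lambda>(i, j). f i j x)) =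
      (\<Sum>p\<in>{p. p permutes {0..<n}}. signof p * (\<Prod>i = 0..<n. f i (p i) x))"
      by (subst det_def'[OF mat_carrier], rule sum.cong[OF refl], rule arg_cong2[where f = "(*)"], simp,
          rule prod.cong[OF refl]) (auto dest: permutes_less_bound)
  qed
  also have "\<dots> \<in> poly_funs X"
    by (intro poly_funs_sum poly_funs.mult poly_funs_prod poly_funs.const assms)
       (auto dest: permutes_less_bound)
  finally show ?thesis .
qed

text \<open>Rank at most \<open>k\<close> is the common vanishing of the determinants of
  \<open>vrank_gt_iff\<close>. The family of equations may be infinite, which
  \<open>zero_locus\<close> allows; it is indexed by elements of \<open>S\<close>, as the vectors
  themselves vary with \<open>x\<close>.\<close>

lemma closedin_vrank_le:
  fixes u :: "'s \<Rightarrow> nat \<Rightarrow> 'x \<Rightarrow> 'k::field"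
  assumes u: "\<And>s l. s \<in> S \<Longrightarrow> l < n \<Longrightarrow> (\<lambda>x. u s l x) \<in> poly_funs X"
  shows "closedin (zariski A X) {x \<in> A. vrank n {vec n (\<lambda>l. u s l x) | s. s \<in> S} \<le> k}"
proof -
  define D where "D P b x = det (mat (Suc k) (Suc k) (\<lambda>(i, j). \<Sum>l<n. P i l * u (b j) l x))"
    for P :: "nat \<Rightarrow> nat \<Rightarrow> 'k" and b x
  let ?F = "{D P b | P b. \<forall>j\<le>k. b j \<in> S}"
  have "?F \<subseteq> poly_funs X"
    unfolding D_def
    by (auto intro!: poly_funs_det poly_funs_sum poly_funs.mult poly_funs.const u)
  moreover have "{x \<in> A. vrank n {vec n (\<lambda>l. u s l x) | s. s \<in> S} \<le> k} = zero_locus A ?F"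
  proof -
    have key: "k < vrank n {vec n (\<lambda>l. u s l x) | s. s \<in> S} \<longleftrightarrow> (\<exists>f\<in>?F. f x \<noteq> 0)" for x
    proof -
      have "k < vrank n {vec n (\<lambda>l. u s l x) | s. s \<in> S} \<longleftrightarrow>
        (\<exists>P b. (\<forall>j\<le>k. b j \<in> {vec n (\<lambda>l. u s l x) | s. s \<in> S}) \<and>
           det (mat (Suc k) (Suc k) (\<lambda>(i, j). \<Sum>l<n. P i l * b j $ l)) \<noteq> 0)"
        by (rule vrank_gt_iff) auto
      also have "\<dots> \<longleftrightarrow> (\<exists>P b. (\<forall>j\<le>k. b j \<in> S) \<and> D P b x \<noteq> 0)"
      proof
        assume "\<exists>P b. (\<forall>j\<le>k. b j \<in> {vec n (\<lambda>l. u s l x) | s. s \<in> S}) \<and>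
           det (mat (Suc k) (Suc k) (\<lambda>(i, j). \<Sum>l<n. P i l * b j $ l)) \<noteq> 0"
        then obtain P b where b: "\<forall>j\<le>k. \<exists>s\<in>S. b j = vec n (\<lambda>l. u s l x)"
          and det: "det (mat (Suc k) (Suc k) (\<lambda>(i, j). \<Sum>l<n. P i l * b j $ l)) \<noteq> 0" by blast
        \<comment> \<open>Representing each vector by an index makes the determinant a function
          \<open>D P c\<close> of the point.\<close>
        obtain c where c: "\<forall>j\<le>k. c j \<in> S \<and> b j = vec n (\<lambda>l. u (c j) l x)" using b by metis
        have "mat (Suc k) (Suc k) (\<lambda>(i, j). \<Sum>l<n. P i l * b j $ l) =
          mat (Suc k) (Suc k) (\<lambda>(i, j). \<Sum>l<n. P i l * u (c j) l x)"
          using c by (intro eq_matI) (auto simp: less_Suc_eq_le)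
        then show "\<exists>P b. (\<forall>j\<le>k. b j \<in> S) \<and> D P b x \<noteq> 0"
          using det c by (intro exI[of _ P] exI[of _ c]) (simp add: D_def)
      next
        assume "\<exists>P b. (\<forall>j\<le>k. b j \<in> S) \<and> D P b x \<noteq> 0"
        then obtain P c where c: "\<forall>j\<le>k. c j \<in> S" "D P c x \<noteq> 0" by blast
        have "mat (Suc k) (Suc k) (\<lambda>(i, j). \<Sum>l<n. P i l * vec n (\<lambda>l. u (c j) l x) $ l) =
          mat (Suc k) (Suc k) (\<lambda>(i, j). \<Sum>l<n. P i l * u (c j) l x)"
          by (intro eq_matI) auto
        then show "\<exists>P b. (\<forall>j\<le>k. b j \<in> {vec n (\<lambda>l. u s l x) | s. s \<in> S}) \<and>
           det (mat (Suc k) (Suc k) (\<lambda>(i, j). \<Sum>l<n. P i l * b j $ l)) \<noteq> 0"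
          using c unfolding D_def
          by (intro exI[of _ P] exI[of _ "\<lambda>j. vec n (\<lambda>l. u (c j) l x)"]) auto
      qed
      finally show ?thesis by blast
    qed
    have "vrank n {vec n (\<lambda>l. u s l x) | s. s \<in> S} \<le> k \<longleftrightarrow> (\<forall>f\<in>?F. f x = 0)" for x
      unfolding not_less[symmetric] key by blast
    then show ?thesis unfolding zero_locus_def by blast
  qed
  ultimately show ?thesis unfolding closedin_zariski by blast
qed

text \<open>Over a finite field, the product of all \<open>X - a\<close> plus \<open>1\<close> has
  positive degree and takes the value \<open>1\<close> everywhere, so it has no root.\<close>

lemma infinite_alg_closed_field: "infinite (UNIV :: 'k::alg_closed_field set)"
proof
  assume fin: "finite (UNIV :: 'k set)"
  define p :: "'k poly" where "p = (\<Prod>a\<in>UNIV. [:- a, 1:])"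
  have "degree p = card (UNIV :: 'k set)"
    unfolding p_def by (subst degree_prod_eq_sum_degree) auto
  then have "degree p > 0" using fin by (simp add: finite_UNIV_card_ge_0)
  then have "degree (p + 1) > 0" by (metis degree_1 degree_add_eq_left)
  then obtain x where "poly (p + 1) x = 0" using alg_closed_imp_poly_has_root by blast
  moreover have "poly p x = 0" using fin by (simp add: p_def poly_prod prod_zero_iff)
  ultimately show False by simp
qed

section \<open>Rational curves as a test of irreducibility\<close>

definition ratfun :: "'k::field set \<Rightarrow> ('k \<Rightarrow> 'k) \<Rightarrow> bool" where
  "ratfun W F \<longleftrightarrow> (\<exists>p q. \<forall>t\<in>W. poly q t \<noteq> 0 \<and> F t = poly p t / poly q t)"

lemma ratfun_const: "ratfun W (\<lambda>_. c)"
  unfolding ratfun_def by (intro exI[of _ "[:c:]"] exI[of _ 1]) auto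

text \<open>The curves used later are built from line segments in matrix spaces. Inverting matrices
  introduces denominators, which \<open>ratfun\<close> requires to be non-zero on its domain
  \<open>W\<close>.\<close>

lemma ratfun_segment: "ratfun W (\<lambda>t. (1 - t) * a + t * b)"
  unfolding ratfun_def by (intro exI[of _ "[:a, b - a:]"] exI[of _ 1]) (auto simp: algebra_simps)

lemma ratfun_add:
  assumes "ratfun W F" "ratfun W G"
  shows "ratfun W (\<lambda>t. F t + G t)"
proof -
  obtain p q p' q' where "\<forall>t\<in>W. poly q t \<noteq> 0 \<and> F t = poly p t / poly q t"
    "\<forall>t\<in>W. poly q' t \<noteq> 0 \<and> G t = poly p' t / poly q' t"
    using assms unfolding ratfun_def by blast
  then show ?thesis
    unfolding ratfun_def
    by (intro exI[of _ "p * q' + p' * q"] exI[of _ "q * q'"]) (auto simp: field_simps)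
qed

lemma ratfun_mult:
  assumes "ratfun W F" "ratfun W G"
  shows "ratfun W (\<lambda>t. F t * G t)"
proof -
  obtain p q p' q' where "\<forall>t\<in>W. poly q t \<noteq> 0 \<and> F t = poly p t / poly q t"
    "\<forall>t\<in>W. poly q' t \<noteq> 0 \<and> G t = poly p' t / poly q' t"
    using assms unfolding ratfun_def by blast
  then show ?thesis
    unfolding ratfun_def by (intro exI[of _ "p * p'"] exI[of _ "q * q'"]) auto
qed

lemma ratfun_inverse:
  assumes "ratfun W F" "\<And>t. t \<in> W \<Longrightarrow> F t \<noteq> 0"
  shows "ratfun W (\<lambda>t. inverse (F t))"
proof -
  obtain p q where "\<forall>t\<in>W. poly q t \<noteq> 0 \<and> F t = poly p t / poly q t"
    using assms unfolding ratfun_def by blast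
  then show ?thesis
    using assms(2) unfolding ratfun_def by (intro exI[of _ q] exI[of _ p]) fastforce
qed

lemma ratfun_sum: "(\<And>s. s \<in> S \<Longrightarrow> ratfun W (F s)) \<Longrightarrow> ratfun W (\<lambda>t. \<Sum>s\<in>S. F s t)"
  by (induction S rule: infinite_finite_induct) (auto intro: ratfun_const ratfun_add)

lemma ratfun_prod: "(\<And>s. s \<in> S \<Longrightarrow> ratfun W (F s)) \<Longrightarrow> ratfun W (\<lambda>t. \<Prod>s\<in>S. F s t)"
  by (induction S rule: infinite_finite_induct) (auto intro: ratfun_const ratfun_mult)

lemma ratfun_poly_funs:
  assumes "f \<in> poly_funs X" and "\<And>g. g \<in> X \<Longrightarrow> ratfun W (\<lambda>t. g (\<gamma> t))"
  shows "ratfun W (\<lambda>t. f (\<gamma> t))"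
  using assms(1) by induction (auto intro: ratfun_const ratfun_add ratfun_mult assms(2))

lemma ratfun_det:
  assumes "\<And>t. A t \<in> carrier_mat n n"
    and "\<And>i j. i < n \<Longrightarrow> j < n \<Longrightarrow> ratfun W (\<lambda>t. A t $$ (i, j))"
  shows "ratfun W (\<lambda>t. det (A t))"
  by (subst det_def'[OF assms(1)], intro ratfun_sum ratfun_mult ratfun_const ratfun_prod assms(2))
     (auto dest: permutes_less_bound)

text \<open>Entries of the adjugate are signed minors. Divided by the determinant they give the
  inverse, so inverting a matrix of rational functions keeps its entries rational where the
  determinant does not vanish.\<close>

lemma ratfun_adj_mat:
  assumes A: "\<And>t. A t \<in> carrier_mat n n"
    and r: "\<And>i j. i < n \<Longrightarrow> j < n \<Longrightarrow> ratfun W (\<lambda>t. A t $$ (i, j))" and ij: "i < n" "j < n"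
  shows "ratfun W (\<lambda>t. adj_mat (A t) $$ (i, j))"
proof -
  have e: "adj_mat (A t) $$ (i, j) = (-1) ^ (j + i) * det (mat_delete (A t) j i)" for t
    using A[of t] ij by (auto simp: adj_mat_def cofactor_def)
  \<comment> \<open>Deleting row \<open>j\<close> and column \<open>i\<close> shifts the later
    indices by one.\<close>
  have del: "mat_delete (A t) j i $$ (k, l) =
    A t $$ (if k < j then k else Suc k, if l < i then l else Suc l)" if "k < n - 1" "l < n - 1" for k l t
    using A[of t] that by (auto simp: mat_delete_def)
  have "ratfun W (\<lambda>t. det (mat_delete (A t) j i))"
  proof (rule ratfun_det[where n = "n - 1"])
    show "mat_delete (A t) j i \<in> carrier_mat (n - 1) (n - 1)" for t
      using A[of t] by (rule mat_delete_carrier)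
    show "ratfun W (\<lambda>t. mat_delete (A t) j i $$ (k, l))" if "k < n - 1" "l < n - 1" for k l
      using that by (simp only: del) (intro r; auto)
  qed
  then show ?thesis unfolding e by (intro ratfun_mult ratfun_const)
qed

lemma ratfun_mat_mult:
  assumes "\<And>t. A t \<in> carrier_mat m n" "\<And>t. B t \<in> carrier_mat n k"
    and "\<And>i j. i < m \<Longrightarrow> j < n \<Longrightarrow> ratfun W (\<lambda>t. A t $$ (i, j))"
    and "\<And>i j. i < n \<Longrightarrow> j < k \<Longrightarrow> ratfun W (\<lambda>t. B t $$ (i, j))"
    and "i < m" "j < k"
  shows "ratfun W (\<lambda>t. (A t * B t) $$ (i, j))"
proof -
  have "(A t * B t) $$ (i, j) = (\<Sum>l<n. A t $$ (i, l) * B t $$ (l, j))" for t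
    by (rule index_mult_mat_sum[OF assms(1,2,5,6)])
  then show ?thesis using assms(3-) by (auto intro!: ratfun_sum ratfun_mult)
qed

text \<open>Suppose \<open>Z\<close> is covered by \<open>C\<close> and \<open>D\<close> with
  \<open>y\<close> outside \<open>C\<close> and \<open>z\<close> outside \<open>D\<close>, and take
  equations \<open>f\<close> of \<open>C\<close> and \<open>g\<close> of \<open>D\<close> that do
  not vanish there. Along the curve through \<open>y\<close> and \<open>z\<close> the product of
  \<open>f\<close> and \<open>g\<close> is zero at infinitely many parameters, so one numerator is
  the zero polynomial and \<open>f\<close> or \<open>g\<close> vanishes on the whole curve, against
  the choice at \<open>y\<close> and \<open>z\<close>.\<close>

lemma irreducible_in_zariskiI:
  assumes Z: "Z \<subseteq> A" "Z \<noteq> {}"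
    and curve: "\<And>y z. y \<in> Z \<Longrightarrow> z \<in> Z \<Longrightarrow> \<exists>W \<gamma>. infinite W \<and> \<gamma> ` W \<subseteq> Z \<and> y \<in> \<gamma> ` W \<and> z \<in> \<gamma> ` W \<and>
      (\<forall>g\<in>X. ratfun W (\<lambda>t. g (\<gamma> t)))"
  shows "irreducible_in (zariski A X) Z"
  unfolding irreducible_in_def
proof (intro conjI allI impI)
  fix C D
  assume "closedin (zariski A X) C \<and> closedin (zariski A X) D \<and> Z \<subseteq> C \<union> D"
  then obtain P P' where P: "P \<subseteq> poly_funs X" "P' \<subseteq> poly_funs X"
    "C = zero_locus A P" "D = zero_locus A P'" and cov: "Z \<subseteq> C \<union> D"
    unfolding closedin_zariski by blast
  show "Z \<subseteq> C \<or> Z \<subseteq> D"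
  proof (rule ccontr)
    assume "\<not> ?thesis"
    then obtain y z where yz: "y \<in> Z" "y \<notin> C" "z \<in> Z" "z \<notin> D" by blast
    then obtain f g where fg: "f \<in> P" "f y \<noteq> 0" "g \<in> P'" "g z \<noteq> 0"
      using P Z unfolding zero_locus_def by blast
    obtain W \<gamma> where W: "infinite W" "\<gamma> ` W \<subseteq> Z" "y \<in> \<gamma> ` W" "z \<in> \<gamma> ` W"
      "\<forall>g\<in>X. ratfun W (\<lambda>t. g (\<gamma> t))" using curve[OF yz(1,3)] by blast
    have "ratfun W (\<lambda>t. f (\<gamma> t))" "ratfun W (\<lambda>t. g (\<gamma> t))"
      using ratfun_poly_funs[of f X W \<gamma>] ratfun_poly_funs[of g X W \<gamma>] fg P W(5) by blast+
    then obtain p q p' q' where pq: "\<forall>t\<in>W. poly q t \<noteq> 0 \<and> f (\<gamma> t) = poly p t / poly q t"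
      "\<forall>t\<in>W. poly q' t \<noteq> 0 \<and> g (\<gamma> t) = poly p' t / poly q' t"
      unfolding ratfun_def by blast
    have "poly (p * p') t = 0" if "t \<in> W" for t
    proof -
      have "f (\<gamma> t) = 0 \<or> g (\<gamma> t) = 0"
        using cov W(2) that fg P unfolding zero_locus_def by blast
      then show ?thesis using pq that by auto
    qed
    then have "W \<subseteq> {t. poly (p * p') t = 0}" by blast
    then have "p * p' = 0" using W(1) poly_roots_finite finite_subset by blast
    then have "p = 0 \<or> p' = 0" by simp
    then have "(\<forall>t\<in>W. f (\<gamma> t) = 0) \<or> (\<forall>t\<in>W. g (\<gamma> t) = 0)" using pq by auto
    then show False using W(3,4) fg by auto
  qed
qed (use Z in \<open>auto simp: topspace_zariski\<close>)

lemma irreducible_in_subtopology: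
  assumes "irreducible_in X Z" "Z \<subseteq> B"
  shows "irreducible_in (subtopology X B) Z"
  unfolding irreducible_in_def
proof (intro conjI allI impI)
  fix C D
  assume "closedin (subtopology X B) C \<and> closedin (subtopology X B) D \<and> Z \<subseteq> C \<union> D"
  then obtain C' D' where CD: "closedin X C'" "closedin X D'" "C = C' \<inter> B" "D = D' \<inter> B" "Z \<subseteq> C \<union> D"
    unfolding closedin_subtopology by blast
  then have "Z \<subseteq> C' \<or> Z \<subseteq> D'" using assms(1) unfolding irreducible_in_def by blast
  then show "Z \<subseteq> C \<or> Z \<subseteq> D" using CD assms(2) by blast
qed (use assms in \<open>auto simp: irreducible_in_def\<close>)

section \<open>Rank strata of representations with radical square zero\<close>

text \<open>The points of \<open>Rep\<close> described without the ideal; \<open>Rep_eq\<close>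
  identifies the two when \<open>I\<close> is spanned by the paths of length at least two.\<close>

definition sq_zero_reps ::
  "('v, 'e) pre_digraph \<Rightarrow> ('v \<Rightarrow> nat) \<Rightarrow> ('e \<Rightarrow> 'k::field mat) set" where
  "sq_zero_reps Q d = {x \<in> rep_ambient Q d. \<forall>a\<in>arcs Q. \<forall>b\<in>arcs Q. head Q a = tail Q b \<longrightarrow>
     x b * x a = 0\<^sub>m (d (head Q b)) (d (tail Q a))}"

text \<open>The columns are written with \<open>vec (d i)\<close> over an index set of pairs that
  does not depend on \<open>x\<close>, the form that \<open>closedin_vrank_le\<close> expects. At
  points of the ambient space they are the columns proper.\<close>

definition in_columns ::
  "('v, 'e) pre_digraph \<Rightarrow> ('v \<Rightarrow> nat) \<Rightarrow> ('e \<Rightarrow> 'k::field mat) \<Rightarrow> 'v \<Rightarrow> 'k vec set" where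
  "in_columns Q d x i = {vec (d i) (\<lambda>l. x (fst s) $$ (l, snd s)) | s.
     s \<in> {(a, j). a \<in> arcs Q \<and> head Q a = i \<and> j < d (tail Q a)}}"

definition out_rows ::
  "('v, 'e) pre_digraph \<Rightarrow> ('v \<Rightarrow> nat) \<Rightarrow> ('e \<Rightarrow> 'k::field mat) \<Rightarrow> 'v \<Rightarrow> 'k vec set" where
  "out_rows Q d x i = {vec (d i) (\<lambda>l. x (fst s) $$ (snd s, l)) | s.
     s \<in> {(a, j). a \<in> arcs Q \<and> tail Q a = i \<and> j < d (head Q a)}}"

text \<open>The dimension vectors of the radical and of the socle of the module given by \<open>x\<close>.\<close>

definition rad_dim :: "('v, 'e) pre_digraph \<Rightarrow> ('v \<Rightarrow> nat) \<Rightarrow> ('e \<Rightarrow> 'k::field mat) \<Rightarrow> 'v \<Rightarrow> nat" where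
  "rad_dim Q d x i = vrank (d i) (in_columns Q d x i)"

definition soc_dim :: "('v, 'e) pre_digraph \<Rightarrow> ('v \<Rightarrow> nat) \<Rightarrow> ('e \<Rightarrow> 'k::field mat) \<Rightarrow> 'v \<Rightarrow> nat" where
  "soc_dim Q d x i = d i - vrank (d i) (out_rows Q d x i)"

lemma in_columns_carrier: "in_columns Q d x i \<subseteq> carrier_vec (d i)"
  by (auto simp: in_columns_def)

lemma out_rows_carrier: "out_rows Q d x i \<subseteq> carrier_vec (d i)"
  by (auto simp: out_rows_def)

lemma rad_dim_le: "rad_dim Q d x i \<le> d i"
  unfolding rad_dim_def by (rule vrank_le_dim[OF in_columns_carrier])

lemma soc_dim_le: "soc_dim Q d x i \<le> d i"
  by (simp add: soc_dim_def)

lemma rep_ambient_carrier: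
  "x \<in> rep_ambient Q d \<Longrightarrow> a \<in> arcs Q \<Longrightarrow> x a \<in> carrier_mat (d (head Q a)) (d (tail Q a))"
  by (auto simp: rep_ambient_def)

lemma in_columns_eq:
  assumes "x \<in> rep_ambient Q d"
  shows "in_columns Q d x i = {col (x a) j | a j. a \<in> arcs Q \<and> head Q a = i \<and> j < d (tail Q a)}"
proof -
  let ?S = "{(a, j). a \<in> arcs Q \<and> head Q a = i \<and> j < d (tail Q a)}"
  have "vec (d (head Q a)) (\<lambda>l. x a $$ (l, j)) = col (x a) j" if "a \<in> arcs Q" "j < d (tail Q a)" for a j
    using rep_ambient_carrier[OF assms that(1)] that by (intro eq_vecI) auto
  then have "(\<lambda>s. vec (d i) (\<lambda>l. x (fst s) $$ (l, snd s))) ` ?S = (\<lambda>s. col (x (fst s)) (snd s)) ` ?S"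
    by (intro image_cong) auto
  moreover have "\<dots> = {col (x a) j | a j. a \<in> arcs Q \<and> head Q a = i \<and> j < d (tail Q a)}" by force
  ultimately show ?thesis unfolding in_columns_def by (simp only: Setcompr_eq_image Collect_mem_eq)
qed

lemma out_rows_eq:
  assumes "x \<in> rep_ambient Q d"
  shows "out_rows Q d x i = {row (x a) j | a j. a \<in> arcs Q \<and> tail Q a = i \<and> j < d (head Q a)}"
proof -
  let ?S = "{(a, j). a \<in> arcs Q \<and> tail Q a = i \<and> j < d (head Q a)}"
  have "vec (d (tail Q a)) (\<lambda>l. x a $$ (j, l)) = row (x a) j" if "a \<in> arcs Q" "j < d (head Q a)" for a j
    using rep_ambient_carrier[OF assms that(1)] that by (intro eq_vecI) auto
  then have "(\<lambda>s. vec (d i) (\<lambda>l. x (fst s) $$ (snd s, l))) ` ?S = (\<lambda>s. row (x (fst s)) (snd s)) ` ?S"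
    by (intro image_cong) auto
  moreover have "\<dots> = {row (x a) j | a j. a \<in> arcs Q \<and> tail Q a = i \<and> j < d (head Q a)}" by force
  ultimately show ?thesis unfolding out_rows_def by (simp only: Setcompr_eq_image Collect_mem_eq)
qed

text \<open>The entries of \<open>x b * x a\<close> are these scalar products; the relations thus
  say that at each vertex the image of the incoming maps lies in the common kernel of the outgoing
  ones.\<close>

lemma out_rows_in_columns_orth:
  assumes x: "x \<in> sq_zero_reps Q d" and v: "v \<in> in_columns Q d x i" and w: "w \<in> out_rows Q d x i"
  shows "w \<bullet> v = 0"
proof -
  have xa: "x \<in> rep_ambient Q d" using x by (simp add: sq_zero_reps_def)
  obtain a j where a: "a \<in> arcs Q" "head Q a = i" "j < d (tail Q a)" "v = col (x a) j"
    using v unfolding in_columns_eq[OF xa] by blast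
  obtain b k where b: "b \<in> arcs Q" "tail Q b = i" "k < d (head Q b)" "w = row (x b) k"
    using w unfolding out_rows_eq[OF xa] by blast
  have "x b * x a = 0\<^sub>m (d (head Q b)) (d (tail Q a))" using x a b by (auto simp: sq_zero_reps_def)
  moreover have "(x b * x a) $$ (k, j) = w \<bullet> v"
    using rep_ambient_carrier[OF xa a(1)] rep_ambient_carrier[OF xa b(1)] a b by auto
  ultimately show ?thesis using a b by simp
qed

lemma rad_dim_le_soc_dim:
  assumes "x \<in> sq_zero_reps Q d"
  shows "rad_dim Q d x i \<le> soc_dim Q d x i"
  unfolding rad_dim_def soc_dim_def
  by (rule adapted_basis[OF in_columns_carrier[of Q d x i] out_rows_carrier[of Q d x i]
        out_rows_in_columns_orth[OF assms]])

lemma rep_coordsI: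
  "a \<in> arcs Q \<Longrightarrow> i < d (head Q a) \<Longrightarrow> j < d (tail Q a) \<Longrightarrow> (\<lambda>x. x a $$ (i, j)) \<in> rep_coords Q d"
  unfolding rep_coords_def by blast

lemma closedin_rad_dim_le:
  "closedin (zariski (rep_ambient Q d) (rep_coords Q d)) {x \<in> rep_ambient Q d. rad_dim Q d x i \<le> k}"
proof -
  let ?S = "{(a, j). a \<in> arcs Q \<and> head Q a = i \<and> j < d (tail Q a)}"
  have "(\<lambda>x. x (fst s) $$ (l, snd s)) \<in> poly_funs (rep_coords Q d)" if "s \<in> ?S" "l < d i" for s l
    using that by (auto intro!: poly_funs.coord rep_coordsI)
  from closedin_vrank_le[of ?S "d i" "\<lambda>s l x. x (fst s) $$ (l, snd s)", OF this]
  show ?thesis unfolding rad_dim_def in_columns_def .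
qed

text \<open>The bound on \<open>k\<close> lets the condition be rewritten with truncated subtraction
  as \<open>vrank \<le> d i - k\<close>. For larger \<open>k\<close> the set is empty, because
  \<open>soc_dim\<close> is at most \<open>d i\<close>.\<close>

lemma closedin_soc_dim_ge:
  assumes "k \<le> d i"
  shows "closedin (zariski (rep_ambient Q d) (rep_coords Q d)) {x \<in> rep_ambient Q d. k \<le> soc_dim Q d x i}"
proof -
  let ?S = "{(a, j). a \<in> arcs Q \<and> tail Q a = i \<and> j < d (head Q a)}"
  have "k \<le> soc_dim Q d x i \<longleftrightarrow> vrank (d i) (out_rows Q d x i) \<le> d i - k" for x :: "'b \<Rightarrow> 'c mat"
    using assms vrank_le_dim[OF out_rows_carrier[of Q d x i]] unfolding soc_dim_def by arith
  moreover have "(\<lambda>x. x (fst s) $$ (snd s, l)) \<in> poly_funs (rep_coords Q d)" if "s \<in> ?S" "l < d i" for s l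
    using that by (auto intro!: poly_funs.coord rep_coordsI)
  note closedin_vrank_le[of ?S "d i" "\<lambda>s l x. x (fst s) $$ (snd s, l)", OF this]
  ultimately show ?thesis unfolding out_rows_def by simp
qed

section \<open>Block forms and irreducibility of the strata\<close>

definition rank_stratum ::
  "('v, 'e) pre_digraph \<Rightarrow> ('v \<Rightarrow> nat) \<Rightarrow> ('v \<Rightarrow> nat) \<Rightarrow> ('e \<Rightarrow> 'k::field mat) set" where
  "rank_stratum Q d \<rho> = {x \<in> sq_zero_reps Q d. \<forall>i\<in>verts Q. rad_dim Q d x i \<le> \<rho> i \<and> \<rho> i \<le> soc_dim Q d x i}"

text \<open>The first \<rho> vectors of a basis adapted to image and common kernel span a space
  between the two, because \<rho> lies between their dimensions. In such bases images have no
  coordinates from \<rho> on, and the first \<rho> vectors are killed: a zero pattern that depends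
  on \<rho> only.\<close>

lemma rank_stratum_normal_form:
  fixes x :: "'e \<Rightarrow> 'k::field mat"
  assumes Q: "wf_digraph Q" and x: "x \<in> rank_stratum Q d \<rho>"
  obtains g h where
    "\<And>i. i \<in> verts Q \<Longrightarrow> g i \<in> carrier_mat (d i) (d i)"
    "\<And>i. i \<in> verts Q \<Longrightarrow> h i \<in> carrier_mat (d i) (d i)"
    "\<And>i. i \<in> verts Q \<Longrightarrow> h i * g i = 1\<^sub>m (d i)"
    "\<And>i. i \<in> verts Q \<Longrightarrow> g i * h i = 1\<^sub>m (d i)"
    "\<And>a i j. a \<in> arcs Q \<Longrightarrow> i < d (head Q a) \<Longrightarrow> j < d (tail Q a) \<Longrightarrow>
      \<rho> (head Q a) \<le> i \<or> j < \<rho> (tail Q a) \<Longrightarrow> (h (head Q a) * x a * g (tail Q a)) $$ (i, j) = 0"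
proof -
  interpret wf_digraph Q by (rule Q)
  have xs: "x \<in> sq_zero_reps Q d" and xa: "x \<in> rep_ambient Q d"
    using x by (auto simp: rank_stratum_def sq_zero_reps_def)
  \<comment> \<open>All properties of the pair are packed into one predicate so that a choice can be
    made at every vertex.\<close>
  define P where "P i g h \<longleftrightarrow> g \<in> carrier_mat (d i) (d i) \<and> h \<in> carrier_mat (d i) (d i) \<and> h * g = 1\<^sub>m (d i) \<and>
      g * h = 1\<^sub>m (d i) \<and>
      (\<forall>v k. v \<in> in_columns Q d x i \<longrightarrow> k < d i \<longrightarrow> rad_dim Q d x i \<le> k \<longrightarrow> (h *\<^sub>v v) $ k = 0) \<and>
      (\<forall>v. v \<in> carrier_vec (d i) \<longrightarrow>
        (\<forall>w\<in>out_rows Q d x i. w \<bullet> v = 0) = (\<forall>k<d i. soc_dim Q d x i \<le> k \<longrightarrow> (h *\<^sub>v v) $ k = 0))"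
    for i g h
  have "\<exists>g h. P i g h" for i
    unfolding P_def rad_dim_def soc_dim_def
    by (rule adapted_basis[OF in_columns_carrier[of Q d x i] out_rows_carrier[of Q d x i]
          out_rows_in_columns_orth[OF xs]]) (assumption, assumption, blast)
  then obtain g h where P: "\<And>i. P i (g i) (h i)" by metis
  have gh: "g i \<in> carrier_mat (d i) (d i)" "h i \<in> carrier_mat (d i) (d i)"
    "h i * g i = 1\<^sub>m (d i)" "g i * h i = 1\<^sub>m (d i)" for i
    using P[of i] unfolding P_def by blast+
  have inc: "(h i *\<^sub>v v) $ k = 0" if "v \<in> in_columns Q d x i" "k < d i" "rad_dim Q d x i \<le> k" for i v k
    using P[of i] that unfolding P_def by blast
  have out: "(\<forall>w\<in>out_rows Q d x i. w \<bullet> v = 0) = (\<forall>k<d i. soc_dim Q d x i \<le> k \<longrightarrow> (h i *\<^sub>v v) $ k = 0)"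
    if "v \<in> carrier_vec (d i)" for i v
    using P[of i] that unfolding P_def by blast
  show ?thesis
  proof (rule that[of g h])
    fix a i j assume a: "a \<in> arcs Q" and i: "i < d (head Q a)" and j: "j < d (tail Q a)"
      and ij: "\<rho> (head Q a) \<le> i \<or> j < \<rho> (tail Q a)"
    have c: "x a \<in> carrier_mat (d (head Q a)) (d (tail Q a))" by (rule rep_ambient_carrier[OF xa a])
    have "(h (head Q a) * x a) $$ (i, k) = 0" if "\<rho> (head Q a) \<le> i" "k < d (tail Q a)" for k
    proof -
      have "(h (head Q a) *\<^sub>v col (x a) k) $ i = 0"
      proof (rule inc[OF _ i])
        show "col (x a) k \<in> in_columns Q d x (head Q a)"
          unfolding in_columns_eq[OF xa] using a that by blast
        have "rad_dim Q d x (head Q a) \<le> \<rho> (head Q a)"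
          using x head_in_verts[OF a] by (simp add: rank_stratum_def)
        then show "rad_dim Q d x (head Q a) \<le> i" using that by simp
      qed
      then show ?thesis using c gh(2)[of "head Q a"] i that by simp
    qed
    moreover have "(x a * g (tail Q a)) $$ (k, j) = 0" if "j < \<rho> (tail Q a)" "k < d (head Q a)" for k
    proof -
      let ?t = "tail Q a"
      have jt: "j < soc_dim Q d x ?t"
      proof -
        have "\<rho> ?t \<le> soc_dim Q d x ?t" using x tail_in_verts[OF a] by (simp add: rank_stratum_def)
        then show ?thesis using that by simp
      qed
      have gc: "col (g ?t) j \<in> carrier_vec (d ?t)" using gh(1)[of ?t] unfolding carrier_vec_def by auto
      \<comment> \<open>The coordinates of the \<open>j\<close>-th basis vector form a unit vector,
        and \<open>j\<close> is below the dimension of the common kernel, so this vector lies in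
        that kernel.\<close>
      have "h ?t *\<^sub>v col (g ?t) j = col (1\<^sub>m (d ?t)) j"
        using col_mult2[OF gh(2)[of ?t] gh(1)[of ?t] j] gh(3)[of ?t] by simp
      then have "\<forall>k<d ?t. soc_dim Q d x ?t \<le> k \<longrightarrow> (h ?t *\<^sub>v col (g ?t) j) $ k = 0"
        using jt j by auto
      then have "\<forall>w\<in>out_rows Q d x ?t. w \<bullet> col (g ?t) j = 0" using out[OF gc] by blast
      moreover have "row (x a) k \<in> out_rows Q d x ?t" unfolding out_rows_eq[OF xa] using a that by blast
      ultimately have "row (x a) k \<bullet> col (g ?t) j = 0" by blast
      then show ?thesis using c gh(1)[of ?t] that j by simp
    qed
    ultimately show "(h (head Q a) * x a * g (tail Q a)) $$ (i, j) = 0"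
    proof (cases "\<rho> (head Q a) \<le> i")
      case True
      assume z: "\<And>k. \<rho> (head Q a) \<le> i \<Longrightarrow> k < d (tail Q a) \<Longrightarrow> (h (head Q a) * x a) $$ (i, k) = 0"
      have "(h (head Q a) * x a * g (tail Q a)) $$ (i, j) =
          (\<Sum>k<d (tail Q a). (h (head Q a) * x a) $$ (i, k) * g (tail Q a) $$ (k, j))"
        by (rule index_mult_mat_sum[OF mult_carrier_mat[OF gh(2) c] gh(1) i j])
      then show ?thesis using z[OF True] by simp
    next
      case False
      assume z: "\<And>k. j < \<rho> (tail Q a) \<Longrightarrow> k < d (head Q a) \<Longrightarrow> (x a * g (tail Q a)) $$ (k, j) = 0"
      have "h (head Q a) * x a * g (tail Q a) = h (head Q a) * (x a * g (tail Q a))"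
        by (rule assoc_mult_mat[OF gh(2) c gh(1)])
      also have "\<dots> $$ (i, j) =
          (\<Sum>k<d (head Q a). h (head Q a) $$ (i, k) * (x a * g (tail Q a)) $$ (k, j))"
        by (rule index_mult_mat_sum[OF gh(2) mult_carrier_mat[OF c gh(1)] i j])
      finally show ?thesis using z False ij by simp
    qed
  qed (use gh in auto)
qed

text \<open>Conversely every family with the zero pattern gives a point of the stratum in any frame.
  In a product \<open>y b * y a\<close> each intermediate index \<open>k\<close> is either at least
  \<rho>, where row \<open>k\<close> of \<open>y a\<close> vanishes, or below \<rho>, where column
  \<open>k\<close> of \<open>y b\<close> does. The same pattern yields both dimension
  bounds.\<close>

lemma rank_stratumI:
  fixes g h :: "'v \<Rightarrow> 'k::field mat"
  assumes Q: "wf_digraph Q" and \<rho>: "\<And>i. i \<in> verts Q \<Longrightarrow> \<rho> i \<le> d i"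
    and gh: "\<And>i. i \<in> verts Q \<Longrightarrow> g i \<in> carrier_mat (d i) (d i)"
    "\<And>i. i \<in> verts Q \<Longrightarrow> h i \<in> carrier_mat (d i) (d i)"
    "\<And>i. i \<in> verts Q \<Longrightarrow> h i * g i = 1\<^sub>m (d i)"
    "\<And>i. i \<in> verts Q \<Longrightarrow> g i * h i = 1\<^sub>m (d i)"
    and y: "\<And>a. a \<in> arcs Q \<Longrightarrow> y a \<in> carrier_mat (d (head Q a)) (d (tail Q a))"
    and z: "\<And>a i j. a \<in> arcs Q \<Longrightarrow> i < d (head Q a) \<Longrightarrow> j < d (tail Q a) \<Longrightarrow>
      \<rho> (head Q a) \<le> i \<or> j < \<rho> (tail Q a) \<Longrightarrow> y a $$ (i, j) = 0"
  shows "(\<lambda>a\<in>arcs Q. g (head Q a) * y a * h (tail Q a)) \<in> rank_stratum Q d \<rho>" (is "?x \<in> _")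
proof -
  interpret wf_digraph Q by (rule Q)
  have xa: "?x \<in> rep_ambient Q d"
    unfolding rep_ambient_def
    by (intro restrict_PiE_iff[THEN iffD2] ballI mult_carrier_mat[OF mult_carrier_mat]) (auto intro: gh y)
  have hx: "h (head Q a) * ?x a = y a * h (tail Q a)" if a: "a \<in> arcs Q" for a
  proof -
    have c: "g (head Q a) \<in> carrier_mat (d (head Q a)) (d (head Q a))"
      "h (head Q a) \<in> carrier_mat (d (head Q a)) (d (head Q a))"
      "h (tail Q a) \<in> carrier_mat (d (tail Q a)) (d (tail Q a))"
      "h (head Q a) * g (head Q a) = 1\<^sub>m (d (head Q a))"
      using gh a by auto
    have "h (head Q a) * ?x a = h (head Q a) * (g (head Q a) * (y a * h (tail Q a)))"
      using a assoc_mult_mat[OF c(1) y[OF a] c(3)] by simp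
    also have "\<dots> = h (head Q a) * g (head Q a) * (y a * h (tail Q a))"
      by (rule assoc_mult_mat[symmetric, OF c(2,1) mult_carrier_mat[OF y[OF a] c(3)]])
    also have "\<dots> = y a * h (tail Q a)"
      using left_mult_one_mat[OF mult_carrier_mat[OF y[OF a] c(3)]] c(4) by simp
    finally show ?thesis .
  qed
  have xg: "?x a * g (tail Q a) = g (head Q a) * y a" if a: "a \<in> arcs Q" for a
  proof -
    have c: "g (head Q a) \<in> carrier_mat (d (head Q a)) (d (head Q a))"
      "g (tail Q a) \<in> carrier_mat (d (tail Q a)) (d (tail Q a))"
      "h (tail Q a) \<in> carrier_mat (d (tail Q a)) (d (tail Q a))"
      "h (tail Q a) * g (tail Q a) = 1\<^sub>m (d (tail Q a))"
      using gh a by auto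
    have "?x a * g (tail Q a) = g (head Q a) * y a * (h (tail Q a) * g (tail Q a))"
      using a assoc_mult_mat[OF mult_carrier_mat[OF c(1) y[OF a]] c(3,2)] by simp
    also have "\<dots> = g (head Q a) * y a"
      using right_mult_one_mat[OF mult_carrier_mat[OF c(1) y[OF a]]] c(4) by simp
    finally show ?thesis .
  qed
  have "?x b * ?x a = 0\<^sub>m (d (head Q b)) (d (tail Q a))"
    if ab: "a \<in> arcs Q" "b \<in> arcs Q" "head Q a = tail Q b" for a b
  proof -
    have c: "g (head Q b) \<in> carrier_mat (d (head Q b)) (d (head Q b))"
      "g (head Q a) \<in> carrier_mat (d (head Q a)) (d (head Q a))"
      "h (tail Q a) \<in> carrier_mat (d (tail Q a)) (d (tail Q a))"
      "h (tail Q b) \<in> carrier_mat (d (tail Q b)) (d (tail Q b))"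
      using gh ab by auto
    have y': "y b \<in> carrier_mat (d (head Q b)) (d (head Q a))" using y[OF ab(2)] ab(3) by simp
    have yy: "y b * y a = 0\<^sub>m (d (head Q b)) (d (tail Q a))"
    proof (rule eq_matI)
      fix i j assume "i < dim_row (0\<^sub>m (d (head Q b)) (d (tail Q a)))"
        "j < dim_col (0\<^sub>m (d (head Q b)) (d (tail Q a)))"
      then have ij: "i < d (head Q b)" "j < d (tail Q a)" by auto
      have "(y b * y a) $$ (i, j) = (\<Sum>k<d (head Q a). y b $$ (i, k) * y a $$ (k, j))"
        using y' y[OF ab(1)] ij by (simp add: scalar_prod_def atLeast0LessThan)
      also have "\<dots> = 0"
      proof (rule sum.neutral, rule ballI)
        fix k assume "k \<in> {..<d (head Q a)}"
        then show "y b $$ (i, k) * y a $$ (k, j) = 0"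
          using z[OF ab(1), of k j] z[OF ab(2), of i k] ij ab(3)
          by (cases "\<rho> (head Q a) \<le> k") auto
      qed
      finally show "(y b * y a) $$ (i, j) = 0\<^sub>m (d (head Q b)) (d (tail Q a)) $$ (i, j)" using ij by simp
    qed (use y' y[OF ab(1)] in auto)
    have hc: "h (tail Q b) \<in> carrier_mat (d (head Q a)) (d (head Q a))" using c ab(3) by simp
    have xac: "?x a \<in> carrier_mat (d (head Q a)) (d (tail Q a))" by (rule rep_ambient_carrier[OF xa ab(1)])
    have "?x b * ?x a = g (head Q b) * y b * (h (head Q a) * ?x a)"
      using assoc_mult_mat[OF mult_carrier_mat[OF c(1) y'] hc xac] ab by simp
    also have "\<dots> = g (head Q b) * y b * (y a * h (tail Q a))" by (simp only: hx[OF ab(1)])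
    also have "\<dots> = g (head Q b) * (y b * (y a * h (tail Q a)))"
      by (rule assoc_mult_mat[OF c(1) y' mult_carrier_mat[OF y[OF ab(1)] c(3)]])
    also have "y b * (y a * h (tail Q a)) = y b * y a * h (tail Q a)"
      by (rule assoc_mult_mat[symmetric, OF y' y[OF ab(1)] c(3)])
    also have "\<dots> = 0\<^sub>m (d (head Q b)) (d (tail Q a))" unfolding yy using c by simp
    finally show ?thesis using c by simp
  qed
  then have "?x \<in> sq_zero_reps Q d" using xa by (simp add: sq_zero_reps_def)
  moreover have "rad_dim Q d ?x i \<le> \<rho> i \<and> \<rho> i \<le> soc_dim Q d ?x i" if i: "i \<in> verts Q" for i
  proof
    show "rad_dim Q d ?x i \<le> \<rho> i"
      unfolding rad_dim_def
    proof (rule vrank_le_of_coords[OF in_columns_carrier[of Q d ?x i] gh(1)[OF i] gh(2)[OF i] gh(4)[OF i] \<rho>[OF i]])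
      fix v k assume v: "v \<in> in_columns Q d ?x i" and k: "k < d i" "\<rho> i \<le> k"
      then obtain a j where a: "a \<in> arcs Q" "head Q a = i" "j < d (tail Q a)" "v = col (?x a) j"
        unfolding in_columns_eq[OF xa] by blast
      have hc: "h (tail Q a) \<in> carrier_mat (d (tail Q a)) (d (tail Q a))" using gh a by auto
      have "h i *\<^sub>v v = col (h i * ?x a) j"
        using col_mult2[OF gh(2)[OF i], of "?x a" "d (tail Q a)" j] rep_ambient_carrier[OF xa a(1)] a
        by simp
      also have "h i * ?x a = y a * h (tail Q a)" using hx[OF a(1)] a(2) by simp
      also have "col \<dots> j $ k = (\<Sum>l<d (tail Q a). y a $$ (k, l) * h (tail Q a) $$ (l, j))"
        using y[OF a(1)] hc a k by (simp add: scalar_prod_def atLeast0LessThan)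
      also have "\<dots> = 0" using z[OF a(1), of k] k a by simp
      finally show "(h i *\<^sub>v v) $ k = 0" .
    qed
    have gcol: "mat (d i) (d i) (\<lambda>(p, q). col (g i) q $ p) = g i"
      using gh(1)[OF i] by (intro eq_matI) auto
    have "vrank (d i) (out_rows Q d ?x i) \<le> d i - \<rho> i"
    proof (rule vrank_le_codim[OF out_rows_carrier])
      show "mat (d i) (d i) (\<lambda>(p, q). col (g i) q $ p) * h i = 1\<^sub>m (d i)"
        unfolding gcol by (rule gh(4)[OF i])
      fix w j assume w: "w \<in> out_rows Q d ?x i" and j: "j < \<rho> i"
      then obtain a k where a: "a \<in> arcs Q" "tail Q a = i" "k < d (head Q a)" "w = row (?x a) k"
        unfolding out_rows_eq[OF xa] by blast
      have gc: "g (head Q a) \<in> carrier_mat (d (head Q a)) (d (head Q a))" using gh a by auto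
      have ji: "j < d i" using j \<rho>[OF i] by simp
      have "w \<bullet> col (g i) j = (?x a * g (tail Q a)) $$ (k, j)"
        using a rep_ambient_carrier[OF xa a(1)] gh(1)[OF i] ji
        by (metis carrier_matD(1) carrier_matD(2) index_mult_mat(1))
      also have "\<dots> = (g (head Q a) * y a) $$ (k, j)" by (simp only: xg[OF a(1)])
      also have "\<dots> = (\<Sum>l<d (head Q a). g (head Q a) $$ (k, l) * y a $$ (l, j))"
        using y[OF a(1)] gc a ji by (simp add: scalar_prod_def atLeast0LessThan)
      also have "\<dots> = 0" using z[OF a(1), of _ j] j ji a by simp
      finally show "w \<bullet> col (g i) j = 0" .
    qed (use gh(1,2)[OF i] \<rho>[OF i] in auto)
    then show "\<rho> i \<le> soc_dim Q d ?x i" using \<rho>[OF i] by (simp add: soc_dim_def)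
  qed
  ultimately show ?thesis by (simp add: rank_stratum_def)
qed

text \<open>A point is given by a frame together with a block form. Between two points both are
  moved along line segments, \<open>G\<close> and \<open>Y\<close>; the frame stays invertible for
  all but finitely many parameters, and \<open>rank_stratumI\<close> keeps the curve in the
  stratum.\<close>

lemma irreducible_rank_stratum:
  fixes d \<rho> :: "'v \<Rightarrow> nat" and Q :: "('v, 'e) pre_digraph"
  assumes Q: "fin_digraph Q" and \<rho>: "\<And>i. i \<in> verts Q \<Longrightarrow> \<rho> i \<le> d i"
    and ne: "(rank_stratum Q d \<rho> :: ('e \<Rightarrow> 'k::alg_closed_field mat) set) \<noteq> {}"
  shows "irreducible_in (zariski (rep_ambient Q d) (rep_coords Q d))
    (rank_stratum Q d \<rho> :: ('e \<Rightarrow> 'k mat) set)"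
proof (rule irreducible_in_zariskiI[OF _ ne])
  interpret fin_digraph Q by (rule Q)
  show "(rank_stratum Q d \<rho> :: ('e \<Rightarrow> 'k mat) set) \<subseteq> rep_ambient Q d"
    by (auto simp: rank_stratum_def sq_zero_reps_def)
  fix x0 x1 :: "'e \<Rightarrow> 'k mat"
  assume x0: "x0 \<in> rank_stratum Q d \<rho>" and x1: "x1 \<in> rank_stratum Q d \<rho>"
  have amb: "x0 \<in> rep_ambient Q d" "x1 \<in> rep_ambient Q d"
    using x0 x1 by (auto simp: rank_stratum_def sq_zero_reps_def)
  obtain g0 h0 where gh0: "\<And>i. i \<in> verts Q \<Longrightarrow> g0 i \<in> carrier_mat (d i) (d i)"
    "\<And>i. i \<in> verts Q \<Longrightarrow> h0 i \<in> carrier_mat (d i) (d i)"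
    "\<And>i. i \<in> verts Q \<Longrightarrow> h0 i * g0 i = 1\<^sub>m (d i)"
    "\<And>i. i \<in> verts Q \<Longrightarrow> g0 i * h0 i = 1\<^sub>m (d i)"
    "\<And>a i j. a \<in> arcs Q \<Longrightarrow> i < d (head Q a) \<Longrightarrow> j < d (tail Q a) \<Longrightarrow>
      \<rho> (head Q a) \<le> i \<or> j < \<rho> (tail Q a) \<Longrightarrow> (h0 (head Q a) * x0 a * g0 (tail Q a)) $$ (i, j) = 0"
    using rank_stratum_normal_form[OF wf_digraph x0] by blast
  obtain g1 h1 where gh1: "\<And>i. i \<in> verts Q \<Longrightarrow> g1 i \<in> carrier_mat (d i) (d i)"
    "\<And>i. i \<in> verts Q \<Longrightarrow> h1 i \<in> carrier_mat (d i) (d i)"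
    "\<And>i. i \<in> verts Q \<Longrightarrow> h1 i * g1 i = 1\<^sub>m (d i)"
    "\<And>i. i \<in> verts Q \<Longrightarrow> g1 i * h1 i = 1\<^sub>m (d i)"
    "\<And>a i j. a \<in> arcs Q \<Longrightarrow> i < d (head Q a) \<Longrightarrow> j < d (tail Q a) \<Longrightarrow>
      \<rho> (head Q a) \<le> i \<or> j < \<rho> (tail Q a) \<Longrightarrow> (h1 (head Q a) * x1 a * g1 (tail Q a)) $$ (i, j) = 0"
    using rank_stratum_normal_form[OF wf_digraph x1] by blast
  define G where "G i t = mat (d i) (d i) (\<lambda>(p, q). (1 - t) * g0 i $$ (p, q) + t * g1 i $$ (p, q))" for i t
  \<comment> \<open>The adjugate makes \<open>H\<close> a total function of \<open>t\<close>; it is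
    the inverse of \<open>G\<close> wherever the determinant is non-zero.\<close>
  define H where "H i t = inverse (det (G i t)) \<cdot>\<^sub>m adj_mat (G i t)" for i t
  define y0 where "y0 a = h0 (head Q a) * x0 a * g0 (tail Q a)" for a
  define y1 where "y1 a = h1 (head Q a) * x1 a * g1 (tail Q a)" for a
  define Y where "Y a t = mat (d (head Q a)) (d (tail Q a))
    (\<lambda>(p, q). (1 - t) * y0 a $$ (p, q) + t * y1 a $$ (p, q))" for a t
  define W where "W = {t. \<forall>i\<in>verts Q. det (G i t) \<noteq> 0}"
  define \<gamma> where "\<gamma> t = (\<lambda>a\<in>arcs Q. G (head Q a) t * Y a t * H (tail Q a) t)" for t
  have Gc: "G i t \<in> carrier_mat (d i) (d i)" and Hc: "H i t \<in> carrier_mat (d i) (d i)"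
    and Yc: "Y a t \<in> carrier_mat (d (head Q a)) (d (tail Q a))" for i a t
    by (auto simp: G_def H_def Y_def adj_mat_def)
  have yc: "y0 a \<in> carrier_mat (d (head Q a)) (d (tail Q a))"
    "y1 a \<in> carrier_mat (d (head Q a)) (d (tail Q a))" if "a \<in> arcs Q" for a
    unfolding y0_def y1_def using that
    by (auto intro!: mult_carrier_mat[OF mult_carrier_mat] gh0(1,2) gh1(1,2) rep_ambient_carrier[OF amb(1)]
        rep_ambient_carrier[OF amb(2)])
  have GH: "H i t * G i t = 1\<^sub>m (d i)" "G i t * H i t = 1\<^sub>m (d i)" if "det (G i t) \<noteq> 0" for i t
  proof -
    have "H i t * G i t = inverse (det (G i t)) \<cdot>\<^sub>m (adj_mat (G i t) * G i t)"
      unfolding H_def by (rule mult_smult_assoc_mat[OF adj_mat(1)[OF Gc] Gc])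
    also have "\<dots> = inverse (det (G i t)) \<cdot>\<^sub>m (det (G i t) \<cdot>\<^sub>m 1\<^sub>m (d i))" by (simp only: adj_mat(3)[OF Gc])
    also have "\<dots> = 1\<^sub>m (d i)" using that by (intro eq_matI) auto
    finally show "H i t * G i t = 1\<^sub>m (d i)" .
    have "G i t * H i t = inverse (det (G i t)) \<cdot>\<^sub>m (G i t * adj_mat (G i t))"
      unfolding H_def by (rule mult_smult_distrib[OF Gc adj_mat(1)[OF Gc]])
    also have "\<dots> = inverse (det (G i t)) \<cdot>\<^sub>m (det (G i t) \<cdot>\<^sub>m 1\<^sub>m (d i))" by (simp only: adj_mat(2)[OF Gc])
    also have "\<dots> = 1\<^sub>m (d i)" using that by (intro eq_matI) auto
    finally show "G i t * H i t = 1\<^sub>m (d i)" .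
  qed
  have G01: "G i 0 = g0 i" "G i 1 = g1 i" if "i \<in> verts Q" for i
    using gh0(1)[OF that] gh1(1)[OF that] by (auto simp: G_def intro!: eq_matI)
  have Y01: "Y a 0 = y0 a" "Y a 1 = y1 a" if "a \<in> arcs Q" for a
    using yc[OF that] by (auto simp: Y_def intro!: eq_matI)
  have det_unit: "det g \<noteq> 0" if "h * g = 1\<^sub>m n" "g \<in> carrier_mat n n" "h \<in> carrier_mat n n" for g h :: "'k mat" and n
    using det_mult[OF that(3,2)] that(1) by auto
  have det01: "det (G i 0) \<noteq> 0" "det (G i 1) \<noteq> 0" if "i \<in> verts Q" for i
    using det_unit[OF gh0(3) gh0(1,2)] det_unit[OF gh1(3) gh1(1,2)] G01[OF that] that by auto
  \<comment> \<open>One computation for both ends of the curve: \<open>Y\<close> undoes the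
    conjugation, and the factors cancel by \<open>G * H = 1\<close> at the tail and
    \<open>g * h = 1\<close> at the head of the arrow.\<close>
  have \<gamma>_end: "\<gamma> t = x"
    if x: "x \<in> rep_ambient Q d" and g: "\<And>i. i \<in> verts Q \<Longrightarrow> G i t = g i"
      and det: "\<And>i. i \<in> verts Q \<Longrightarrow> det (G i t) \<noteq> 0"
      and h: "\<And>i. i \<in> verts Q \<Longrightarrow> h i \<in> carrier_mat (d i) (d i)" "\<And>i. i \<in> verts Q \<Longrightarrow> g i * h i = 1\<^sub>m (d i)"
      and y: "\<And>a. a \<in> arcs Q \<Longrightarrow> Y a t = h (head Q a) * x a * g (tail Q a)" for x g h t
  proof
    fix a
    show "\<gamma> t a = x a"
    proof (cases "a \<in> arcs Q")
      case False
      then show ?thesis using x by (auto simp: \<gamma>_def rep_ambient_def PiE_def extensional_def)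
    next
      case a: True
      let ?h = "head Q a" and ?t = "tail Q a"
      have v: "?h \<in> verts Q" "?t \<in> verts Q" using a by auto
      have xc: "x a \<in> carrier_mat (d ?h) (d ?t)" by (rule rep_ambient_carrier[OF x a])
      have "\<gamma> t a = G ?h t * (h ?h * x a * G ?t t) * H ?t t"
        using a y[OF a] g[OF v(2)] by (simp add: \<gamma>_def)
      also have "\<dots> = G ?h t * ((h ?h * x a * G ?t t) * H ?t t)"
        by (rule assoc_mult_mat[OF Gc mult_carrier_mat[OF mult_carrier_mat[OF h(1)[OF v(1)] xc] Gc] Hc])
      also have "(h ?h * x a * G ?t t) * H ?t t = h ?h * x a * (G ?t t * H ?t t)"
        by (rule assoc_mult_mat[OF mult_carrier_mat[OF h(1)[OF v(1)] xc] Gc Hc])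
      also have "\<dots> = h ?h * x a"
        using GH(2)[OF det[OF v(2)]] right_mult_one_mat[OF mult_carrier_mat[OF h(1)[OF v(1)] xc]] by simp
      also have "G ?h t * (h ?h * x a) = G ?h t * h ?h * x a"
        by (rule assoc_mult_mat[symmetric, OF Gc h(1)[OF v(1)] xc])
      also have "\<dots> = x a" using h(2)[OF v(1)] g[OF v(1)] xc by simp
      finally show ?thesis .
    qed
  qed
  have ratG: "ratfun V (\<lambda>t. G i t $$ (p, q))" if "p < d i" "q < d i" for V i p q
  proof -
    have "G i t $$ (p, q) = (1 - t) * g0 i $$ (p, q) + t * g1 i $$ (p, q)" for t
      using that by (simp add: G_def)
    then show ?thesis by (simp only: ratfun_segment)
  qed
  have ratY: "ratfun V (\<lambda>t. Y a t $$ (p, q))" if "p < d (head Q a)" "q < d (tail Q a)" for V a p q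
  proof -
    have "Y a t $$ (p, q) = (1 - t) * y0 a $$ (p, q) + t * y1 a $$ (p, q)" for t
      using that by (simp add: Y_def)
    then show ?thesis by (simp only: ratfun_segment)
  qed
  have ratdet: "ratfun V (\<lambda>t. det (G i t))" for V i
    by (rule ratfun_det[OF Gc ratG])
  have ratH: "ratfun W (\<lambda>t. H i t $$ (p, q))" if "p < d i" "q < d i" "i \<in> verts Q" for i p q
  proof -
    have "H i t $$ (p, q) = inverse (det (G i t)) * adj_mat (G i t) $$ (p, q)" for t
      using that adj_mat(1)[OF Gc[of i t]] by (simp add: H_def)
    moreover have "ratfun W (\<lambda>t. inverse (det (G i t)))"
      by (rule ratfun_inverse[OF ratdet]) (use that in \<open>simp add: W_def\<close>)
    ultimately show ?thesis
      using ratfun_adj_mat[OF Gc ratG that(1,2)] by (simp add: ratfun_mult)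
  qed
  have finG: "finite {t. det (G i t) = 0}" if i: "i \<in> verts Q" for i
  proof -
    \<comment> \<open>On the whole field the determinant is a rational function whose numerator is
      not the zero polynomial, since it takes a non-zero value at \<open>0\<close>; so it has
      finitely many zeros.\<close>
    obtain p q where pq: "\<forall>t\<in>UNIV. poly q t \<noteq> 0 \<and> det (G i t) = poly p t / poly q t"
      using ratdet[of UNIV i] unfolding ratfun_def by blast
    then have "p \<noteq> 0" using det01(1)[OF i] by auto
    moreover have "{t. det (G i t) = 0} = {t. poly p t = 0}" using pq by auto
    ultimately show ?thesis using poly_roots_finite by simp
  qed
  have "- W = (\<Union>i\<in>verts Q. {t. det (G i t) = 0})" by (auto simp: W_def)
  then have "finite (- W)" using finG by simp
  then have infW: "infinite W" using infinite_alg_closed_field[where 'k = 'k]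
    by (metis Compl_eq_Diff_UNIV finite_Diff2)
  have "\<gamma> t \<in> rank_stratum Q d \<rho>" if t: "t \<in> W" for t
    unfolding \<gamma>_def
  proof (rule rank_stratumI[OF wf_digraph \<rho> Gc Hc _ _ Yc])
    show "Y a t $$ (i, j) = 0" if "a \<in> arcs Q" "i < d (head Q a)" "j < d (tail Q a)"
      "\<rho> (head Q a) \<le> i \<or> j < \<rho> (tail Q a)" for a i j
      using gh0(5)[OF that] gh1(5)[OF that] that by (simp add: Y_def y0_def y1_def)
  qed (use t GH in \<open>auto simp: W_def\<close>)
  moreover have "\<gamma> 0 = x0"
    by (rule \<gamma>_end[OF amb(1) G01(1) det01(1) gh0(2,4)])
       (simp_all add: Y01 y0_def)
  moreover have "\<gamma> 1 = x1"
    by (rule \<gamma>_end[OF amb(2) G01(2) det01(2) gh1(2,4)])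
       (simp_all add: Y01 y1_def)
  moreover have "0 \<in> W" "1 \<in> W" using det01 by (auto simp: W_def)
  moreover have "ratfun W (\<lambda>t. f (\<gamma> t))" if f: "f \<in> rep_coords Q d" for f :: "('e \<Rightarrow> 'k mat) \<Rightarrow> 'k"
  proof -
    obtain a i j where a: "f = (\<lambda>x. x a $$ (i, j))" "a \<in> arcs Q" "i < d (head Q a)" "j < d (tail Q a)"
      using f unfolding rep_coords_def by blast
    have "ratfun W (\<lambda>t. (G (head Q a) t * Y a t * H (tail Q a) t) $$ (i, j))"
      using a by (intro ratfun_mat_mult[OF mult_carrier_mat[OF Gc Yc] Hc] ratfun_mat_mult[OF Gc Yc] ratG ratY ratH) auto
    then show ?thesis using a by (simp add: \<gamma>_def)
  qed
  ultimately show "\<exists>W \<gamma>. infinite W \<and> \<gamma> ` W \<subseteq> rank_stratum Q d \<rho> \<and> x0 \<in> \<gamma> ` W \<and> x1 \<in> \<gamma> ` W \<and>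
      (\<forall>g\<in>rep_coords Q d. ratfun W (\<lambda>t. g (\<gamma> t)))"
    using infW by (intro exI[of _ W] exI[of _ \<gamma>]) (auto intro: rev_image_eqI)
qed

section \<open>Left modules\<close>

context left_module
begin

lemma zero_smult: "x \<in> carrier M \<Longrightarrow> \<zero>\<^bsub>R\<^esub> \<odot>\<^bsub>M\<^esub> x = \<zero>\<^bsub>M\<^esub>"
  using smult_l_distr[of "\<zero>\<^bsub>R\<^esub>" "\<zero>\<^bsub>R\<^esub>" x] smult_closed[of "\<zero>\<^bsub>R\<^esub>" x] by simp

lemma smult_zero: "a \<in> carrier R \<Longrightarrow> a \<odot>\<^bsub>M\<^esub> \<zero>\<^bsub>M\<^esub> = \<zero>\<^bsub>M\<^esub>"
  using smult_r_distr[of a "\<zero>\<^bsub>M\<^esub>" "\<zero>\<^bsub>M\<^esub>"] smult_closed[of a "\<zero>\<^bsub>M\<^esub>"] by simp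

lemma minus_eq_smult: "x \<in> carrier M \<Longrightarrow> \<ominus>\<^bsub>M\<^esub> x = (\<ominus>\<^bsub>R\<^esub> \<one>\<^bsub>R\<^esub>) \<odot>\<^bsub>M\<^esub> x"
proof (rule M.minus_equality)
  assume x: "x \<in> carrier M"
  have "(\<ominus>\<^bsub>R\<^esub> \<one>\<^bsub>R\<^esub>) \<odot>\<^bsub>M\<^esub> x \<oplus>\<^bsub>M\<^esub> x = (\<ominus>\<^bsub>R\<^esub> \<one>\<^bsub>R\<^esub> \<oplus>\<^bsub>R\<^esub> \<one>\<^bsub>R\<^esub>) \<odot>\<^bsub>M\<^esub> x"
    using x by (simp add: smult_l_distr smult_one)
  then show "(\<ominus>\<^bsub>R\<^esub> \<one>\<^bsub>R\<^esub>) \<odot>\<^bsub>M\<^esub> x \<oplus>\<^bsub>M\<^esub> x = \<zero>\<^bsub>M\<^esub>" using x by (simp add: R.l_neg zero_smult)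
qed (auto simp: smult_closed)

text \<open>Closure under negation comes from the action of minus one.\<close>

lemma lsubmoduleI:
  assumes "N \<subseteq> carrier M" "\<zero>\<^bsub>M\<^esub> \<in> N" "\<And>x y. x \<in> N \<Longrightarrow> y \<in> N \<Longrightarrow> x \<oplus>\<^bsub>M\<^esub> y \<in> N"
    "\<And>a x. a \<in> carrier R \<Longrightarrow> x \<in> N \<Longrightarrow> a \<odot>\<^bsub>M\<^esub> x \<in> N"
  shows "Module.submodule N R M"
proof (intro Module.submodule.intro subgroup.intro Module.submodule_axioms.intro)
  fix x assume x: "x \<in> N"
  have "inv\<^bsub>add_monoid M\<^esub> x = \<ominus>\<^bsub>M\<^esub> x" by (simp add: a_inv_def)
  then show "inv\<^bsub>add_monoid M\<^esub> x \<in> N" using x assms by (auto simp: minus_eq_smult subset_iff)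
qed (use assms in auto)

lemma lsubmoduleD:
  assumes "Module.submodule N R M"
  shows "N \<subseteq> carrier M" "\<zero>\<^bsub>M\<^esub> \<in> N" "\<And>x y. x \<in> N \<Longrightarrow> y \<in> N \<Longrightarrow> x \<oplus>\<^bsub>M\<^esub> y \<in> N"
    "\<And>a x. a \<in> carrier R \<Longrightarrow> x \<in> N \<Longrightarrow> a \<odot>\<^bsub>M\<^esub> x \<in> N"
proof -
  interpret N: Module.submodule N R M by (rule assms)
  show "N \<subseteq> carrier M" "\<zero>\<^bsub>M\<^esub> \<in> N" "\<And>x y. x \<in> N \<Longrightarrow> y \<in> N \<Longrightarrow> x \<oplus>\<^bsub>M\<^esub> y \<in> N"
    "\<And>a x. a \<in> carrier R \<Longrightarrow> x \<in> N \<Longrightarrow> a \<odot>\<^bsub>M\<^esub> x \<in> N"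
    using N.subset N.one_closed N.m_closed N.smult_closed by auto
qed

lemma gen_submodule_subset: "A \<subseteq> gen_submodule R M A"
  by (auto simp: gen_submodule_def)

lemma gen_submodule_least: "Module.submodule N R M \<Longrightarrow> A \<subseteq> N \<Longrightarrow> gen_submodule R M A \<subseteq> N"
  by (auto simp: gen_submodule_def)

lemma carrier_submodule: "Module.submodule (carrier M) R M"
  by (rule lsubmoduleI) (auto simp: smult_closed)

text \<open>If \<open>A\<close> were not inside the carrier, no submodule would contain it and the
  intersection of the empty family would be the whole type.\<close>

lemma gen_submodule_submodule:
  assumes "A \<subseteq> carrier M"
  shows "Module.submodule (gen_submodule R M A) R M"
proof (rule lsubmoduleI)
  show "gen_submodule R M A \<subseteq> carrier M"
    by (rule gen_submodule_least[OF carrier_submodule assms])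
qed (use lsubmoduleD in \<open>auto simp: gen_submodule_def\<close>)

lemma submodule_left_module:
  assumes "Module.submodule N R M"
  shows "left_module R (M\<lparr>carrier := N\<rparr>)"
proof -
  note N = lsubmoduleD[OF assms]
  show ?thesis
  proof (intro left_module.intro left_module_axioms.intro)
    show "abelian_group (M\<lparr>carrier := N\<rparr>)"
    proof (rule abelian_groupI)
      fix x assume "x \<in> carrier (M\<lparr>carrier := N\<rparr>)"
      then have x: "x \<in> N" by simp
      then have "\<ominus>\<^bsub>M\<^esub> x \<in> N" using N by (auto simp: minus_eq_smult subset_iff)
      moreover have "\<ominus>\<^bsub>M\<^esub> x \<oplus>\<^bsub>M\<^esub> x = \<zero>\<^bsub>M\<^esub>" using x N(1) by (auto intro: M.l_neg)
      ultimately show "\<exists>y\<in>carrier (M\<lparr>carrier := N\<rparr>). y \<oplus>\<^bsub>M\<lparr>carrier := N\<rparr>\<^esub> x = \<zero>\<^bsub>M\<lparr>carrier := N\<rparr>\<^esub>"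
        by auto
    qed (use N in \<open>auto simp: subset_iff M.a_ac\<close>)
  qed (use N in \<open>auto simp: subset_iff smult_l_distr smult_r_distr smult_assoc smult_one R.ring_axioms\<close>)
qed

end

lemma regular_left_module: "ring R \<Longrightarrow> left_module R (regular_module R)"
proof -
  assume "ring R"
  then interpret ring R .
  show ?thesis
    by (intro left_module.intro left_module_axioms.intro ring_axioms abelian_groupI)
       (auto simp: regular_module_def l_distr r_distr m_assoc a_ac intro: l_neg)
qed

subsection \<open>Homomorphisms\<close>

lemma module_homD:
  assumes "\<phi> \<in> module_hom R M N"
  shows "x \<in> carrier M \<Longrightarrow> \<phi> x \<in> carrier N"
    "x \<in> carrier M \<Longrightarrow> y \<in> carrier M \<Longrightarrow> \<phi> (x \<oplus>\<^bsub>M\<^esub> y) = \<phi> x \<oplus>\<^bsub>N\<^esub> \<phi> y"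
    "a \<in> carrier R \<Longrightarrow> x \<in> carrier M \<Longrightarrow> \<phi> (a \<odot>\<^bsub>M\<^esub> x) = a \<odot>\<^bsub>N\<^esub> \<phi> x"
  using assms by (auto simp: module_hom_def)

lemma module_homI:
  assumes "\<And>x. x \<in> carrier M \<Longrightarrow> \<phi> x \<in> carrier N"
    "\<And>x y. x \<in> carrier M \<Longrightarrow> y \<in> carrier M \<Longrightarrow> \<phi> (x \<oplus>\<^bsub>M\<^esub> y) = \<phi> x \<oplus>\<^bsub>N\<^esub> \<phi> y"
    "\<And>a x. a \<in> carrier R \<Longrightarrow> x \<in> carrier M \<Longrightarrow> \<phi> (a \<odot>\<^bsub>M\<^esub> x) = a \<odot>\<^bsub>N\<^esub> \<phi> x"
  shows "\<phi> \<in> module_hom R M N"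
  using assms by (auto simp: module_hom_def)

lemma module_hom_zero:
  assumes "\<phi> \<in> module_hom R M N" "left_module R M" "left_module R N"
  shows "\<phi> \<zero>\<^bsub>M\<^esub> = \<zero>\<^bsub>N\<^esub>"
proof -
  interpret M: left_module R M by (rule assms)
  interpret N: left_module R N by (rule assms)
  have "\<phi> \<zero>\<^bsub>M\<^esub> \<oplus>\<^bsub>N\<^esub> \<phi> \<zero>\<^bsub>M\<^esub> = \<phi> \<zero>\<^bsub>M\<^esub>" using module_homD(2)[OF assms(1), of "\<zero>\<^bsub>M\<^esub>" "\<zero>\<^bsub>M\<^esub>"] by simp
  then show ?thesis using module_homD(1)[OF assms(1), of "\<zero>\<^bsub>M\<^esub>"] by simp
qed

lemma module_hom_comp:
  "\<phi> \<in> module_hom R M N \<Longrightarrow> \<psi> \<in> module_hom R N P \<Longrightarrow> (\<lambda>x. \<psi> (\<phi> x)) \<in> module_hom R M P"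
  by (auto simp: module_hom_def Pi_iff)

lemma module_hom_inverse:
  assumes \<phi>: "\<phi> \<in> module_hom R M N" and bij: "bij_betw \<phi> (carrier M) (carrier N)"
    and M: "left_module R M"
  shows "inv_into (carrier M) \<phi> \<in> module_hom R N M"
proof -
  interpret M: left_module R M by (rule M)
  let ?\<psi> = "inv_into (carrier M) \<phi>"
  have surj: "\<exists>x. x \<in> carrier M \<and> y = \<phi> x" if "y \<in> carrier N" for y
    using bij that by (auto simp: bij_betw_def)
  have inv: "?\<psi> (\<phi> x) = x" if "x \<in> carrier M" for x
    using bij that by (simp add: bij_betw_inv_into_left)
  show ?thesis
  proof (rule module_homI)
    fix y assume "y \<in> carrier N"
    then obtain x where "x \<in> carrier M" "y = \<phi> x" using surj by metis
    then show "?\<psi> y \<in> carrier M" by (simp add: inv)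
  next
    fix y y' assume "y \<in> carrier N" "y' \<in> carrier N"
    then obtain x x' where x: "x \<in> carrier M" "y = \<phi> x" "x' \<in> carrier M" "y' = \<phi> x'" using surj by metis
    have "y \<oplus>\<^bsub>N\<^esub> y' = \<phi> (x \<oplus>\<^bsub>M\<^esub> x')" using x by (simp add: module_homD(2)[OF \<phi>])
    then show "?\<psi> (y \<oplus>\<^bsub>N\<^esub> y') = ?\<psi> y \<oplus>\<^bsub>M\<^esub> ?\<psi> y'" using x by (simp add: inv)
  next
    fix a y assume "a \<in> carrier R" "y \<in> carrier N"
    then obtain x where x: "x \<in> carrier M" "y = \<phi> x" and a: "a \<in> carrier R" using surj by metis
    have "a \<odot>\<^bsub>N\<^esub> y = \<phi> (a \<odot>\<^bsub>M\<^esub> x)" using x a by (simp add: module_homD(3)[OF \<phi>])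
    then show "?\<psi> (a \<odot>\<^bsub>N\<^esub> y) = a \<odot>\<^bsub>M\<^esub> ?\<psi> y" using x a by (simp add: inv M.smult_closed)
  qed
qed

lemma mod_isomorphic_refl: "mod_isomorphic R M M"
  unfolding mod_isomorphic_def by (rule bexI[of _ id]) (auto simp: module_hom_def)

lemma mod_isomorphic_sym:
  "left_module R M \<Longrightarrow> mod_isomorphic R M N \<Longrightarrow> mod_isomorphic R N M"
  unfolding mod_isomorphic_def by (meson module_hom_inverse bij_betw_inv_into)

lemma mod_isomorphic_trans:
  assumes "mod_isomorphic R M N" "mod_isomorphic R N P"
  shows "mod_isomorphic R M P"
proof -
  obtain \<phi> \<psi> where "\<phi> \<in> module_hom R M N" "bij_betw \<phi> (carrier M) (carrier N)"
    "\<psi> \<in> module_hom R N P" "bij_betw \<psi> (carrier N) (carrier P)"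
    using assms unfolding mod_isomorphic_def by blast
  then have "(\<lambda>x. \<psi> (\<phi> x)) \<in> module_hom R M P" "bij_betw (\<lambda>x. \<psi> (\<phi> x)) (carrier M) (carrier P)"
    using module_hom_comp bij_betw_trans[of \<phi> _ _ \<psi>] by (auto simp: comp_def)
  then show ?thesis unfolding mod_isomorphic_def by blast
qed

text \<open>Transport of structure, used to see that a top is a module without verifying the laws on
  cosets. As nothing is known about \<open>X\<close> beforehand, the value at zero has to be
  assumed.\<close>

lemma mod_isomorphic_left_module:
  assumes N: "left_module R N" and \<phi>: "\<phi> \<in> module_hom R N X" "bij_betw \<phi> (carrier N) (carrier X)"
    and zero: "\<phi> \<zero>\<^bsub>N\<^esub> = \<zero>\<^bsub>X\<^esub>"
  shows "left_module R X"
proof -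
  interpret N: left_module R N by (rule N)
  note h = module_homD[OF \<phi>(1)]
  have surj: "\<And>y. y \<in> carrier X \<Longrightarrow> \<exists>x\<in>carrier N. y = \<phi> x"
    using \<phi>(2) by (auto simp: bij_betw_def)
  have h2: "\<phi> x \<oplus>\<^bsub>X\<^esub> \<phi> y = \<phi> (x \<oplus>\<^bsub>N\<^esub> y)" if "x \<in> carrier N" "y \<in> carrier N" for x y
    using h that by simp
  have h3: "a \<odot>\<^bsub>X\<^esub> \<phi> x = \<phi> (a \<odot>\<^bsub>N\<^esub> x)" if "a \<in> carrier R" "x \<in> carrier N" for a x
    using h that by simp
  note hs = h(1) h2 h3 zero[symmetric] N.smult_closed N.smult_l_distr N.smult_r_distr N.smult_assoc
    N.smult_one
  show ?thesis
  proof (intro left_module.intro left_module_axioms.intro abelian_groupI N.R.ring_axioms)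
    fix x y assume "x \<in> carrier X" "y \<in> carrier X"
    then obtain x' y' where x: "x' \<in> carrier N" "y' \<in> carrier N" "x = \<phi> x'" "y = \<phi> y'" using surj by metis
    show "x \<oplus>\<^bsub>X\<^esub> y \<in> carrier X" using x by (simp add: hs)
    show "x \<oplus>\<^bsub>X\<^esub> y = y \<oplus>\<^bsub>X\<^esub> x" using x by (simp add: hs N.a_comm)
    {
      fix a assume a: "a \<in> carrier R"
      show "a \<odot>\<^bsub>X\<^esub> (x \<oplus>\<^bsub>X\<^esub> y) = a \<odot>\<^bsub>X\<^esub> x \<oplus>\<^bsub>X\<^esub> a \<odot>\<^bsub>X\<^esub> y" using x a by (simp add: hs)
    }
    {
      fix z assume "z \<in> carrier X"
      then obtain z' where z: "z' \<in> carrier N" "z = \<phi> z'" using surj by metis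
      show "x \<oplus>\<^bsub>X\<^esub> y \<oplus>\<^bsub>X\<^esub> z = x \<oplus>\<^bsub>X\<^esub> (y \<oplus>\<^bsub>X\<^esub> z)" using x z by (simp add: hs N.a_assoc)
    }
  next
    fix x assume "x \<in> carrier X"
    then obtain x' where x: "x' \<in> carrier N" "x = \<phi> x'" using surj by metis
    show "\<zero>\<^bsub>X\<^esub> \<oplus>\<^bsub>X\<^esub> x = x" using x by (simp add: hs)
    show "\<one>\<^bsub>R\<^esub> \<odot>\<^bsub>X\<^esub> x = x" using x by (simp add: hs)
    have "\<phi> (\<ominus>\<^bsub>N\<^esub> x') \<oplus>\<^bsub>X\<^esub> x = \<zero>\<^bsub>X\<^esub>" using x by (simp add: hs N.l_neg)
    then show "\<exists>y\<in>carrier X. y \<oplus>\<^bsub>X\<^esub> x = \<zero>\<^bsub>X\<^esub>" using x h(1)[of "\<ominus>\<^bsub>N\<^esub> x'"] by auto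
    {
      fix a b assume a: "a \<in> carrier R" "b \<in> carrier R"
      show "(a \<oplus>\<^bsub>R\<^esub> b) \<odot>\<^bsub>X\<^esub> x = a \<odot>\<^bsub>X\<^esub> x \<oplus>\<^bsub>X\<^esub> b \<odot>\<^bsub>X\<^esub> x" using x a by (simp add: hs)
      show "(a \<otimes>\<^bsub>R\<^esub> b) \<odot>\<^bsub>X\<^esub> x = a \<odot>\<^bsub>X\<^esub> (b \<odot>\<^bsub>X\<^esub> x)" using x a by (simp add: hs)
    }
    {
      fix a assume a: "a \<in> carrier R"
      show "a \<odot>\<^bsub>X\<^esub> x \<in> carrier X" using x a by (simp add: hs)
    }
  next
    show "\<zero>\<^bsub>X\<^esub> \<in> carrier X" using h(1)[of "\<zero>\<^bsub>N\<^esub>"] by (simp add: zero)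
  qed
qed

lemma submodule_vimage:
  assumes \<phi>: "\<phi> \<in> module_hom R M N" and M: "left_module R M" and N: "left_module R N"
    and S: "Module.submodule S R N"
  shows "Module.submodule {x \<in> carrier M. \<phi> x \<in> S} R M"
proof -
  interpret M: left_module R M by (rule M)
  interpret N: left_module R N by (rule N)
  note S = N.lsubmoduleD[OF S]
  show ?thesis
    by (rule M.lsubmoduleI)
       (auto simp: module_homD[OF \<phi>] module_hom_zero[OF \<phi> M N] S M.smult_closed)
qed

text \<open>The preimage of the radical of \<open>N\<close> is a submodule containing the generators
  of the radical of \<open>M\<close>. Applied to an isomorphism and its inverse, this identifies the
  two radicals.\<close>

lemma module_hom_rad_submodule:
  assumes \<phi>: "\<phi> \<in> module_hom R M N" and M: "left_module R M" and N: "left_module R N"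
    and x: "x \<in> rad_submodule R M"
  shows "\<phi> x \<in> rad_submodule R N"
proof -
  interpret M: left_module R M by (rule M)
  interpret N: left_module R N by (rule N)
  have J: "jacobson_radical R \<subseteq> carrier R" by (simp add: jacobson_radical_def)
  let ?G = "{a \<odot>\<^bsub>N\<^esub> x | a x. a \<in> jacobson_radical R \<and> x \<in> carrier N}"
  have "Module.submodule (rad_submodule R N) R N"
    unfolding rad_submodule_def using J by (intro N.gen_submodule_submodule) (auto simp: N.smult_closed)
  note sub = submodule_vimage[OF \<phi> M N this]
  have "rad_submodule R M \<subseteq> {x \<in> carrier M. \<phi> x \<in> rad_submodule R N}"
  proof (subst rad_submodule_def, rule M.gen_submodule_least[OF sub], rule subsetI)
    fix z assume "z \<in> {a \<odot>\<^bsub>M\<^esub> x | a x. a \<in> jacobson_radical R \<and> x \<in> carrier M}"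
    then obtain a y where z: "z = a \<odot>\<^bsub>M\<^esub> y" "a \<in> jacobson_radical R" "y \<in> carrier M" by blast
    have "\<phi> z = a \<odot>\<^bsub>N\<^esub> \<phi> y" "\<phi> y \<in> carrier N" using z J module_homD[OF \<phi>] by auto
    then have "\<phi> z \<in> ?G" using z(2) by blast
    then have "\<phi> z \<in> rad_submodule R N" unfolding rad_submodule_def
      by (rule subsetD[OF N.gen_submodule_subset])
    then show "z \<in> {x \<in> carrier M. \<phi> x \<in> rad_submodule R N}" using z J by (auto simp: M.smult_closed)
  qed
  then show ?thesis using x by blast
qed

text \<open>A homomorphism onto \<open>N\<close> whose kernel is the radical identifies cosets with
  the fibres of \<open>f\<close>. The map \<open>fib\<close> from \<open>N\<close> to the top avoids
  choosing representatives, and it transports the module structure to the top.\<close>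

lemma top_mod_isomorphic:
  assumes M: "left_module R M" and N: "left_module R N" and f: "f \<in> module_hom R M N"
    and surj: "f ` carrier M = carrier N"
    and ker: "\<And>x. x \<in> carrier M \<Longrightarrow> f x = \<zero>\<^bsub>N\<^esub> \<longleftrightarrow> x \<in> rad_submodule R M"
  shows "mod_isomorphic R (top_mod R M) N" "left_module R (top_mod R M)"
proof -
  interpret M: left_module R M by (rule M)
  interpret N: left_module R N by (rule N)
  let ?T = "top_mod R M" and ?K = "rad_submodule R M"
  have J: "jacobson_radical R \<subseteq> carrier R" by (simp add: jacobson_radical_def)
  have Ks: "Module.submodule ?K R M"
    unfolding rad_submodule_def using J by (intro M.gen_submodule_submodule) (auto simp: M.smult_closed)
  note K = M.lsubmoduleD[OF Ks]
  note h = module_homD[OF f]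
  have coset: "?K +>\<^bsub>M\<^esub> x = {y \<in> carrier M. f y = f x}" if x: "x \<in> carrier M" for x
  proof (intro equalityI subsetI)
    fix y assume "y \<in> ?K +>\<^bsub>M\<^esub> x"
    then obtain k where k: "k \<in> ?K" "y = k \<oplus>\<^bsub>M\<^esub> x" by (auto simp: a_r_coset_def')
    then have "k \<in> carrier M" "f k = \<zero>\<^bsub>N\<^esub>" using K(1) ker by auto
    then show "y \<in> {y \<in> carrier M. f y = f x}" using k x h by auto
  next
    fix y assume "y \<in> {y \<in> carrier M. f y = f x}"
    then have y: "y \<in> carrier M" "f y = f x" by auto
    let ?k = "y \<oplus>\<^bsub>M\<^esub> (\<ominus>\<^bsub>R\<^esub> \<one>\<^bsub>R\<^esub>) \<odot>\<^bsub>M\<^esub> x"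
    have "f ?k = f x \<oplus>\<^bsub>N\<^esub> (\<ominus>\<^bsub>R\<^esub> \<one>\<^bsub>R\<^esub>) \<odot>\<^bsub>N\<^esub> f x" using x y h by (simp add: M.smult_closed)
    also have "\<dots> = \<zero>\<^bsub>N\<^esub>" using x h by (simp add: N.minus_eq_smult[symmetric] N.r_neg)
    finally have "?k \<in> ?K" using x y by (simp add: ker[symmetric] M.smult_closed)
    moreover have "?k \<oplus>\<^bsub>M\<^esub> x = y"
      using x y by (simp add: M.minus_eq_smult[symmetric] M.a_assoc M.l_neg)
    ultimately show "y \<in> ?K +>\<^bsub>M\<^esub> x" by (force simp: a_r_coset_def')
  qed
  define fib where "fib n = {y \<in> carrier M. f y = n}" for n
  have carT: "carrier ?T = fib ` carrier N"
  proof -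
    have "carrier ?T = (\<lambda>x. ?K +>\<^bsub>M\<^esub> x) ` carrier M"
      by (auto simp: top_mod_def quot_module_def A_RCOSETS_def')
    also have "\<dots> = (\<lambda>x. fib (f x)) ` carrier M" by (intro image_cong) (auto simp: coset fib_def)
    finally show ?thesis using surj[symmetric] by (simp add: image_image)
  qed
  have fne: "\<exists>x\<in>carrier M. f x = n" if "n \<in> carrier N" for n
    using surj that by (metis imageE)
  have hom: "fib \<in> module_hom R N ?T"
  proof (rule module_homI)
    show "fib n \<in> carrier ?T" if "n \<in> carrier N" for n using that carT by blast
    show "fib (n \<oplus>\<^bsub>N\<^esub> n') = fib n \<oplus>\<^bsub>?T\<^esub> fib n'" if n: "n \<in> carrier N" "n' \<in> carrier N" for n n'
    proof -
      have "fib n \<oplus>\<^bsub>?T\<^esub> fib n' = {x \<oplus>\<^bsub>M\<^esub> y | x y. x \<in> fib n \<and> y \<in> fib n'}"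
        by (auto simp: top_mod_def quot_module_def set_add_def set_mult_def)
      also have "\<dots> = fib (n \<oplus>\<^bsub>N\<^esub> n')"
      proof (intro equalityI subsetI)
        fix z assume "z \<in> fib (n \<oplus>\<^bsub>N\<^esub> n')"
        then have z: "z \<in> carrier M" "f z = n \<oplus>\<^bsub>N\<^esub> n'" by (auto simp: fib_def)
        obtain y where y: "y \<in> carrier M" "f y = n'" using fne n by blast
        \<comment> \<open>Subtracting from \<open>z\<close> some \<open>y\<close> over
          \<open>n'\<close> leaves an element over \<open>n\<close>, which writes \<open>z\<close>
          as a sum of elements of the two fibres.\<close>
        let ?x = "z \<oplus>\<^bsub>M\<^esub> (\<ominus>\<^bsub>R\<^esub> \<one>\<^bsub>R\<^esub>) \<odot>\<^bsub>M\<^esub> y"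
        have "f ?x = n \<oplus>\<^bsub>N\<^esub> n' \<oplus>\<^bsub>N\<^esub> (\<ominus>\<^bsub>R\<^esub> \<one>\<^bsub>R\<^esub>) \<odot>\<^bsub>N\<^esub> n'" using z y h by (simp add: M.smult_closed)
        also have "\<dots> = n" using n by (simp add: N.minus_eq_smult[symmetric] N.a_assoc N.r_neg)
        finally have "?x \<in> fib n" using z y by (simp add: fib_def M.smult_closed)
        moreover have "?x \<oplus>\<^bsub>M\<^esub> y = z" using z y by (simp add: M.minus_eq_smult[symmetric] M.a_assoc M.l_neg)
        moreover have "y \<in> fib n'" using y by (simp add: fib_def)
        ultimately show "z \<in> {x \<oplus>\<^bsub>M\<^esub> y | x y. x \<in> fib n \<and> y \<in> fib n'}" by (intro CollectI exI[of _ ?x] exI[of _ y]) simp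
      qed (auto simp: fib_def h)
      finally show ?thesis by simp
    qed
    show "fib (a \<odot>\<^bsub>N\<^esub> n) = a \<odot>\<^bsub>?T\<^esub> fib n" if a: "a \<in> carrier R" and n: "n \<in> carrier N" for a n
    proof -
      have "a \<odot>\<^bsub>?T\<^esub> fib n = (\<Union>x\<in>fib n. ?K +>\<^bsub>M\<^esub> (a \<odot>\<^bsub>M\<^esub> x))"
        by (simp add: top_mod_def quot_module_def)
      also have "\<dots> = (\<Union>x\<in>fib n. fib (a \<odot>\<^bsub>N\<^esub> n))"
        using a by (intro SUP_cong) (auto simp: fib_def coset M.smult_closed h)
      \<comment> \<open>All terms of the union are the same fibre, and the index set is non-empty
        because \<open>f\<close> is onto.\<close>
      also have "\<dots> = fib (a \<odot>\<^bsub>N\<^esub> n)" using fne[OF n] by (auto simp: fib_def)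
      finally show ?thesis by simp
    qed
  qed
  have bij: "bij_betw fib (carrier N) (carrier ?T)"
    unfolding bij_betw_def
  proof
    show "inj_on fib (carrier N)"
    proof (rule inj_onI)
      fix n n' assume n: "n \<in> carrier N" "n' \<in> carrier N" "fib n = fib n'"
      obtain x where "x \<in> carrier M" "f x = n" using fne n by blast
      then have "x \<in> fib n'" using n(3) by (auto simp: fib_def)
      then show "n = n'" using \<open>f x = n\<close> by (simp add: fib_def)
    qed
  qed (simp add: carT)
  have "fib \<zero>\<^bsub>N\<^esub> = ?K" using coset[of "\<zero>\<^bsub>M\<^esub>"] K ker by (auto simp: fib_def)
  then have z: "fib \<zero>\<^bsub>N\<^esub> = \<zero>\<^bsub>?T\<^esub>" by (simp add: top_mod_def quot_module_def)
  show "left_module R ?T" by (rule mod_isomorphic_left_module[OF N hom bij z])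
  have "mod_isomorphic R N ?T" using hom bij by (auto simp: mod_isomorphic_def)
  then show "mod_isomorphic R ?T N" by (rule mod_isomorphic_sym[OF N])
qed

section \<open>Path algebras modulo the paths of length two\<close>

definition single :: "'w \<Rightarrow> 'k \<Rightarrow> 'w \<Rightarrow> 'k::zero" where
  "single w c = (\<lambda>z. if z = w then c else 0)"

lemma single_apply: "single w c z = (if z = w then c else 0)"
  by (simp add: single_def)

text \<open>\<open>f\<close> is assembled by restricting it to growing finite subsets of its
  support. The partial sums \<open>g\<close> have their support inside that of \<open>f\<close>, so
  they are again elements of the path algebra when \<open>f\<close> is one.\<close>

lemma finite_support_induct:
  fixes f :: "'w \<Rightarrow> 'k::monoid_add"
  assumes "finite {w. f w \<noteq> 0}" and zero: "P (\<lambda>_. 0)"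
    and step: "\<And>g w. P g \<Longrightarrow> f w \<noteq> 0 \<Longrightarrow> finite {z. g z \<noteq> 0} \<Longrightarrow> {z. g z \<noteq> 0} \<subseteq> {z. f z \<noteq> 0} \<Longrightarrow>
      P (\<lambda>z. g z + single w (f w) z)"
  shows "P f"
proof -
  have "P (\<lambda>z. if z \<in> S then f z else 0)" if "finite S" "S \<subseteq> {w. f w \<noteq> 0}" for S
    using that
  proof (induction S)
    case empty
    then show ?case using zero by simp
  next
    case (insert w S)
    let ?g = "\<lambda>z. if z \<in> S then f z else 0"
    have "{z. ?g z \<noteq> 0} \<subseteq> S" by auto
    then have "finite {z. ?g z \<noteq> 0}" "{z. ?g z \<noteq> 0} \<subseteq> {z. f z \<noteq> 0}"
      using insert.hyps(1) finite_subset by auto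
    then have "P (\<lambda>z. ?g z + single w (f w) z)" using insert by (intro step) auto
    moreover have "(\<lambda>z. ?g z + single w (f w) z) = (\<lambda>z. if z \<in> insert w S then f z else 0)"
      using insert.hyps by (auto simp: single_def)
    ultimately show ?case by simp
  qed
  from this[OF assms(1)] have "P (\<lambda>z. if z \<in> {w. f w \<noteq> 0} then f z else 0)" by simp
  moreover have "(\<lambda>z. if z \<in> {w. f w \<noteq> 0} then f z else 0) = f" by auto
  ultimately show ?thesis by simp
qed

locale quiver_algebra = fin_digraph Q + PA: ideal I "path_algebra Q"
  for Q :: "('v, 'e) pre_digraph" and I :: "(('v, 'e) path \<Rightarrow> 'k::field) set"
begin

abbreviation "PA \<equiv> path_algebra Q :: (('v, 'e) path \<Rightarrow> 'k) ring"
abbreviation "\<Lambda> \<equiv> bq_algebra Q I"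
abbreviation "cl f \<equiv> I +>\<^bsub>path_algebra Q\<^esub> f"
abbreviation "arrow_cl a \<equiv> cl (single (tail Q a, [a]) 1)"

lemma Lambda_ring: "ring \<Lambda>"
  unfolding bq_algebra_def by (rule PA.quotient_is_ring)

sublocale Lam: ring \<Lambda> by (rule Lambda_ring)

lemma PA_simps:
  "zero PA = (\<lambda>_. 0)" "add PA f g = (\<lambda>w. f w + g w)"
  "\<one>\<^bsub>PA\<^esub> = (\<lambda>(u, p). if u \<in> verts Q \<and> p = [] then 1 else 0)"
  by (simp_all add: path_algebra_def)

lemma PA_carrier: "f \<in> carrier PA \<longleftrightarrow> finite {w. f w \<noteq> 0} \<and> {w. f w \<noteq> 0} \<subseteq> paths Q"
  by (simp add: path_algebra_def)

lemma PA_mult: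
  "mult PA f g (u, p) = (\<Sum>k\<le>length p. f (awlast u (take k p), drop k p) * g (u, take k p))"
  by (simp add: path_algebra_def)

lemma PA_mult_Nil: "mult PA f g (u, []) = f (u, []) * g (u, [])"
  by (simp add: PA_mult)

text \<open>An arrow splits in two ways, with the trivial path before it or after it. Together with
  the value at trivial paths this describes the product up to paths of length at least two.\<close>

lemma PA_mult_arc:
  "mult PA f g (tail Q a, [a]) = f (tail Q a, [a]) * g (tail Q a, []) + f (head Q a, []) * g (tail Q a, [a])"
  by (simp add: PA_mult)

lemma paths_Nil: "(u, []) \<in> paths Q \<longleftrightarrow> u \<in> verts Q"
  by (auto simp: paths_def awalk_def)

lemma paths_arc: "(u, [a]) \<in> paths Q \<longleftrightarrow> a \<in> arcs Q \<and> u = tail Q a"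
  by (auto simp: paths_def awalk_def)

lemma paths_Cons: "(u, a # p) \<in> paths Q \<longleftrightarrow> a \<in> arcs Q \<and> u = tail Q a \<and> (head Q a, p) \<in> paths Q"
  by (auto simp: paths_def awalk_Cons_iff)

lemma single_carrier: "w \<in> paths Q \<Longrightarrow> single w c \<in> carrier PA"
  by (auto simp: PA_carrier single_def intro: finite_subset[of _ "{w}"])

lemma PA_minus:
  assumes "g \<in> carrier PA"
  shows "(\<lambda>w. - g w) \<in> carrier PA" "\<ominus>\<^bsub>PA\<^esub> g = (\<lambda>w. - g w)"
proof -
  show c: "(\<lambda>w. - g w) \<in> carrier PA" using assms by (simp add: PA_carrier)
  show "\<ominus>\<^bsub>PA\<^esub> g = (\<lambda>w. - g w)"
    by (rule PA.minus_equality[OF _ assms c]) (simp add: PA_simps)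
qed

lemma cl_eq_iff:
  assumes "f \<in> carrier PA" "g \<in> carrier PA"
  shows "cl f = cl g \<longleftrightarrow> (\<lambda>w. f w - g w) \<in> I"
proof
  assume "cl f = cl g"
  then have "f \<in> cl g" using PA.a_rcos_self[OF assms(1)] by simp
  then obtain h where "h \<in> I" "f = h \<oplus>\<^bsub>PA\<^esub> g" by (auto simp: a_r_coset_def')
  then show "(\<lambda>w. f w - g w) \<in> I" by (simp add: PA_simps)
next
  assume h: "(\<lambda>w. f w - g w) \<in> I"
  have "f = (\<lambda>w. f w - g w) \<oplus>\<^bsub>PA\<^esub> g" by (simp add: PA_simps)
  then have "f \<in> cl g" using h unfolding a_r_coset_def' by blast
  then show "cl f = cl g" using PA.a_repr_independence[OF _ assms(2) PA.a_subgroup] by simp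
qed

lemma Lambda_carrier: "C \<in> carrier \<Lambda> \<longleftrightarrow> (\<exists>f\<in>carrier PA. C = cl f)"
  by (auto simp: bq_algebra_def FactRing_def A_RCOSETS_def')

lemma cl_closed: "f \<in> carrier PA \<Longrightarrow> cl f \<in> carrier \<Lambda>"
  by (auto simp: Lambda_carrier)

lemma cl_add: "f \<in> carrier PA \<Longrightarrow> g \<in> carrier PA \<Longrightarrow> cl f \<oplus>\<^bsub>\<Lambda>\<^esub> cl g = cl (\<lambda>w. f w + g w)"
  using PA.a_rcos_sum[of f g] by (simp add: bq_algebra_def FactRing_def PA_simps)

lemma cl_mult: "f \<in> carrier PA \<Longrightarrow> g \<in> carrier PA \<Longrightarrow> cl f \<otimes>\<^bsub>\<Lambda>\<^esub> cl g = cl (f \<otimes>\<^bsub>PA\<^esub> g)"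
  using PA.rcoset_mult_add[of f g] by (simp add: bq_algebra_def FactRing_def)

lemma Lambda_one: "\<one>\<^bsub>\<Lambda>\<^esub> = cl \<one>\<^bsub>PA\<^esub>"
  by (simp add: bq_algebra_def FactRing_def)

lemma cl_zero: "cl (\<lambda>_. 0) = \<zero>\<^bsub>\<Lambda>\<^esub>"
  using PA.a_rcos_const[of "\<zero>\<^bsub>PA\<^esub>"] additive_subgroup.zero_closed[OF PA.is_additive_subgroup]
  by (simp add: bq_algebra_def FactRing_def PA_simps)

lemma cl_eq_zero_iff: "f \<in> carrier PA \<Longrightarrow> cl f = \<zero>\<^bsub>\<Lambda>\<^esub> \<longleftrightarrow> f \<in> I"
  using cl_eq_iff[of f "\<lambda>_. 0"] PA.zero_closed by (simp add: cl_zero PA_simps)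

lemma vertex_idem_eq: "vertex_idem Q I v = cl (single (v, []) 1)"
  by (simp add: vertex_idem_def single_def)

lemma arrow_ideal_pow_subset: "arrow_ideal_pow Q k \<subseteq> carrier PA"
  by (auto simp: arrow_ideal_pow_def)

text \<open>\<open>g\<close> vanishes on trivial paths and so takes at least one arrow; of a path
  with at most \<open>j\<close> arrows fewer than \<open>j\<close> are left for
  \<open>f\<close>.\<close>

lemma arrow_ideal_pow_mult:
  assumes "f \<in> arrow_ideal_pow Q j" "g \<in> arrow_ideal_pow Q 1"
  shows "f \<otimes>\<^bsub>PA\<^esub> g \<in> arrow_ideal_pow Q (Suc j)"
proof -
  have fg: "f \<in> carrier PA" "g \<in> carrier PA" using assms by (auto simp: arrow_ideal_pow_def)
  have "(f \<otimes>\<^bsub>PA\<^esub> g) (u, p) = 0" if "length p < Suc j" for u p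
    unfolding PA_mult
  proof (rule sum.neutral, rule ballI)
    fix k assume "k \<in> {..length p}"
    show "f (awlast u (take k p), drop k p) * g (u, take k p) = 0"
    proof (cases "k = 0")
      case True
      then show ?thesis using assms(2) by (simp add: arrow_ideal_pow_def)
    next
      case False
      then have "length (drop k p) < j" using that \<open>k \<in> {..length p}\<close> by auto
      then have "f (awlast u (take k p), drop k p) = 0" using assms(1) unfolding arrow_ideal_pow_def by blast
      then show ?thesis by simp
    qed
  qed
  then show ?thesis using fg by (simp add: arrow_ideal_pow_def)
qed

lemma arrow_ideal_pow_left_ideal:
  assumes "f \<in> carrier PA" "g \<in> arrow_ideal_pow Q 1"
  shows "f \<otimes>\<^bsub>PA\<^esub> g \<in> arrow_ideal_pow Q 1"
proof -
  have "f \<in> arrow_ideal_pow Q 0" using assms(1) by (simp add: arrow_ideal_pow_def)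
  from arrow_ideal_pow_mult[OF this assms(2)] show ?thesis by simp
qed

subsection \<open>The Jacobson radical\<close>

lemma maximal_left_idealD:
  assumes "maximal_left_ideal \<Lambda> L"
  shows "Module.submodule L \<Lambda> (regular_module \<Lambda>)" "L \<noteq> carrier \<Lambda>"
    "\<And>N. Module.submodule N \<Lambda> (regular_module \<Lambda>) \<Longrightarrow> L \<subseteq> N \<Longrightarrow> N = L \<or> N = carrier \<Lambda>"
  using assms by (auto simp: maximal_left_ideal_def)

sublocale reg: left_module \<Lambda> "regular_module \<Lambda>"
  rewrites "carrier (regular_module \<Lambda>) = carrier \<Lambda>" and "add (regular_module \<Lambda>) = add \<Lambda>"
    and "zero (regular_module \<Lambda>) = zero \<Lambda>" and "smult (regular_module \<Lambda>) = mult \<Lambda>"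
  by (rule regular_left_module[OF Lambda_ring]) (simp_all add: regular_module_def)

text \<open>The coefficient at the trivial path of a vertex \<open>v\<close> is multiplicative and
  vanishes on \<open>I\<close>, and its kernel \<open>L\<close> is a maximal left ideal. An element
  of the radical lies in all these kernels and so has no trivial paths.\<close>

lemma jacobson_radical_subset:
  assumes I2: "I \<subseteq> arrow_ideal_pow Q 2"
  shows "jacobson_radical \<Lambda> \<subseteq> {cl f | f. f \<in> arrow_ideal_pow Q 1}"
proof
  fix C assume C: "C \<in> jacobson_radical \<Lambda>"
  then have "C \<in> carrier \<Lambda>" by (simp add: jacobson_radical_def)
  then obtain f where f: "f \<in> carrier PA" "C = cl f" by (auto simp: Lambda_carrier)
  have "f (v, []) = 0" if v: "v \<in> verts Q" for v
  proof -
    define L where "L = {cl g | g. g \<in> carrier PA \<and> g (v, []) = 0}"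
    have L_iff: "cl g \<in> L \<longleftrightarrow> g (v, []) = 0" if g: "g \<in> carrier PA" for g
    proof
      assume "cl g \<in> L"
      then obtain g' where g': "g' \<in> carrier PA" "g' (v, []) = 0" "cl g = cl g'" by (auto simp: L_def)
      then have "(\<lambda>w. g w - g' w) \<in> I" using cl_eq_iff g by blast
      then have "g (v, []) - g' (v, []) = 0" using I2 by (auto simp: arrow_ideal_pow_def)
      then show "g (v, []) = 0" using g' by simp
    qed (use g in \<open>auto simp: L_def\<close>)
    have Lc: "L \<subseteq> carrier \<Lambda>" by (auto simp: L_def cl_closed)
    have e: "single (v, []) c \<in> carrier PA" for c using v by (intro single_carrier) (simp add: paths_Nil)
    have "maximal_left_ideal \<Lambda> L"
      unfolding maximal_left_ideal_def
    proof (intro conjI allI impI)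
      show "Module.submodule L \<Lambda> (regular_module \<Lambda>)"
      proof (rule reg.lsubmoduleI[OF Lc])
        show "\<zero>\<^bsub>\<Lambda>\<^esub> \<in> L" using L_iff[of "\<lambda>_. 0"] PA.zero_closed by (simp add: cl_zero PA_simps)
        fix x y assume "x \<in> L" "y \<in> L"
        then obtain g g' where g: "g \<in> carrier PA" "g (v, []) = 0" "x = cl g"
          "g' \<in> carrier PA" "g' (v, []) = 0" "y = cl g'" by (auto simp: L_def)
        have "(\<lambda>w. g w + g' w) \<in> carrier PA" using PA.a_closed[OF g(1,4)] by (simp add: PA_simps)
        then show "x \<oplus>\<^bsub>\<Lambda>\<^esub> y \<in> L" using g by (simp add: cl_add L_iff)
      next
        fix a x assume "a \<in> carrier \<Lambda>" "x \<in> L"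
        then obtain g g' where g: "g \<in> carrier PA" "g (v, []) = 0" "x = cl g" "g' \<in> carrier PA" "a = cl g'"
          by (auto simp: L_def Lambda_carrier)
        then show "a \<otimes>\<^bsub>\<Lambda>\<^esub> x \<in> L" by (simp add: cl_mult L_iff PA_mult_Nil)
      qed
      show "L \<noteq> carrier \<Lambda>"
      proof
        assume "L = carrier \<Lambda>"
        then have "cl (single (v, []) 1) \<in> L" using e by (simp add: cl_closed)
        then show False using L_iff[OF e] by (simp add: single_def)
      qed
    next
      fix N assume N: "Module.submodule N \<Lambda> (regular_module \<Lambda>) \<and> L \<subseteq> N"
      note Ns = reg.lsubmoduleD[OF conjunct1[OF N]]
      show "N = L \<or> N = carrier \<Lambda>"
      proof (rule disjCI)
        assume "N \<noteq> carrier \<Lambda>"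
        have "N \<subseteq> L"
        proof (rule ccontr)
          assume "\<not> N \<subseteq> L"
          then obtain g where g: "cl g \<in> N" "g \<in> carrier PA" "g (v, []) \<noteq> 0"
            using Ns(1) L_iff by (auto simp: Lambda_carrier subset_iff)
          have "x \<in> N" if "x \<in> carrier \<Lambda>" for x
          proof -
            obtain h where h: "h \<in> carrier PA" "x = cl h" using \<open>x \<in> carrier \<Lambda>\<close> by (auto simp: Lambda_carrier)
            \<comment> \<open>The quotient of coefficients is chosen so that \<open>h - c g\<close>
              has coefficient zero at \<open>v\<close> and its class falls into \<open>L\<close>.
              Hence one \<open>g\<close> outside the kernel puts every \<open>h\<close> into
              \<open>N\<close>.\<close>
            define c :: "('v, 'e) path \<Rightarrow> 'k" where "c = single (v, []) (h (v, []) / g (v, []))"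
            define k where "k w = h w - (c \<otimes>\<^bsub>PA\<^esub> g) w" for w
            have c: "c \<in> carrier PA" using e by (simp add: c_def)
            have cg: "c \<otimes>\<^bsub>PA\<^esub> g \<in> carrier PA" using c g by simp
            have k: "k \<in> carrier PA" using PA.a_closed[OF h(1) PA_minus(1)[OF cg]] by (simp add: PA_simps k_def[abs_def])
            have "k (v, []) = 0" using g(3) by (simp add: k_def PA_mult_Nil c_def single_def)
            then have "cl k \<in> N" using L_iff[OF k] N by auto
            moreover have "cl c \<otimes>\<^bsub>\<Lambda>\<^esub> cl g \<in> N" using Ns(4) g c by (simp add: cl_closed)
            moreover have "x = cl c \<otimes>\<^bsub>\<Lambda>\<^esub> cl g \<oplus>\<^bsub>\<Lambda>\<^esub> cl k"
              using c g cg k by (simp add: cl_mult cl_add h(2)) (simp add: k_def)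
            ultimately show ?thesis using Ns(3) by simp
          qed
          then show False using \<open>N \<noteq> carrier \<Lambda>\<close> Ns(1) by blast
        qed
        then show "N = L" using N by blast
      qed
    qed
    then have "C \<in> L" using C by (simp add: jacobson_radical_def)
    then show ?thesis using L_iff f by simp
  qed
  moreover have "f (v, []) = 0" if "v \<notin> verts Q" for v
    using f(1) that paths_Nil by (auto simp: PA_carrier)
  ultimately have "f \<in> arrow_ideal_pow Q 1" using f(1) by (auto simp: arrow_ideal_pow_def)
  then show "C \<in> {cl f | f. f \<in> arrow_ideal_pow Q 1}" using f by blast
qed

text \<open>
  A descending Nakayama argument: if \<open>A\<close> is the image of the arrow ideal and \<open>A\<close> is not contained in a
  maximal left ideal \<open>L\<close>, then \<open>1 \<in> L + A\<close>, so \<open>A\<^sup>k\<^sup>+\<^sup>1 \<subseteq> L\<close> implies \<open>A\<^sup>k \<subseteq> L\<close>.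
\<close>

lemma jacobson_radical_superset:
  assumes nil: "arrow_ideal_pow Q n \<subseteq> I"
  shows "{cl f | f. f \<in> arrow_ideal_pow Q 1} \<subseteq> jacobson_radical \<Lambda>"
proof
  let ?A = "\<lambda>k. {cl f | f. f \<in> arrow_ideal_pow Q k}"
  fix C assume C: "C \<in> ?A 1"
  then have Cc: "C \<in> carrier \<Lambda>" using arrow_ideal_pow_subset cl_closed by blast
  have "C \<in> L" if L: "maximal_left_ideal \<Lambda> L" for L
  proof (rule ccontr)
    assume "C \<notin> L"
    note m = maximal_left_idealD[OF L]
    note Ls = reg.lsubmoduleD[OF m(1)]
    \<comment> \<open>The sum of \<open>L\<close> and the arrow ideal contains \<open>C\<close> and
      is strictly larger than \<open>L\<close>; maximality makes it the whole algebra.\<close>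
    let ?N = "{l \<oplus>\<^bsub>\<Lambda>\<^esub> a | l a. l \<in> L \<and> a \<in> ?A 1}"
    have A1: "?A 1 \<subseteq> carrier \<Lambda>" using arrow_ideal_pow_subset cl_closed by blast
    have A0: "\<zero>\<^bsub>\<Lambda>\<^esub> \<in> ?A 1"
      using PA.zero_closed by (auto simp: cl_zero[symmetric] arrow_ideal_pow_def PA_simps intro!: exI[of _ "\<lambda>_. 0"])
    have Aadd: "x \<oplus>\<^bsub>\<Lambda>\<^esub> y \<in> ?A 1" if "x \<in> ?A 1" "y \<in> ?A 1" for x y
    proof -
      obtain f g where fg: "x = cl f" "f \<in> arrow_ideal_pow Q 1" "y = cl g" "g \<in> arrow_ideal_pow Q 1"
        using \<open>x \<in> ?A 1\<close> \<open>y \<in> ?A 1\<close> by blast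
      then have "(\<lambda>w. f w + g w) \<in> arrow_ideal_pow Q 1"
        using PA.a_closed[of f g] by (auto simp: arrow_ideal_pow_def PA_simps)
      moreover have "x \<oplus>\<^bsub>\<Lambda>\<^esub> y = cl (\<lambda>w. f w + g w)"
        unfolding fg(1,3) by (rule cl_add) (use fg arrow_ideal_pow_subset in auto)
      ultimately show ?thesis by blast
    qed
    have Amult: "b \<otimes>\<^bsub>\<Lambda>\<^esub> x \<in> ?A 1" if "b \<in> carrier \<Lambda>" "x \<in> ?A 1" for b x
    proof -
      obtain f g where fg: "b = cl f" "f \<in> carrier PA" "x = cl g" "g \<in> arrow_ideal_pow Q 1"
        using \<open>b \<in> carrier \<Lambda>\<close> \<open>x \<in> ?A 1\<close> by (auto simp: Lambda_carrier)
      then have "b \<otimes>\<^bsub>\<Lambda>\<^esub> x = cl (f \<otimes>\<^bsub>PA\<^esub> g)" using arrow_ideal_pow_subset cl_mult by blast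
      then show ?thesis using arrow_ideal_pow_left_ideal[OF fg(2,4)] by blast
    qed
    have "Module.submodule ?N \<Lambda> (regular_module \<Lambda>)"
    proof (rule reg.lsubmoduleI)
      show "?N \<subseteq> carrier \<Lambda>" using Ls(1) A1 by auto
      show "\<zero>\<^bsub>\<Lambda>\<^esub> \<in> ?N" using Ls(2) A0 by (intro CollectI exI[of _ "\<zero>\<^bsub>\<Lambda>\<^esub>"]) simp
    next
      fix x y assume "x \<in> ?N" "y \<in> ?N"
      then obtain l a l' a' where la: "l \<in> L" "a \<in> ?A 1" "x = l \<oplus>\<^bsub>\<Lambda>\<^esub> a"
        "l' \<in> L" "a' \<in> ?A 1" "y = l' \<oplus>\<^bsub>\<Lambda>\<^esub> a'" by blast
      then have c: "l \<in> carrier \<Lambda>" "a \<in> carrier \<Lambda>" "l' \<in> carrier \<Lambda>" "a' \<in> carrier \<Lambda>"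
        using Ls(1) A1 by blast+
      have "x \<oplus>\<^bsub>\<Lambda>\<^esub> y = (l \<oplus>\<^bsub>\<Lambda>\<^esub> l') \<oplus>\<^bsub>\<Lambda>\<^esub> (a \<oplus>\<^bsub>\<Lambda>\<^esub> a')"
        using c unfolding la by (simp add: Lam.a_ac)
      then show "x \<oplus>\<^bsub>\<Lambda>\<^esub> y \<in> ?N" using Ls(3)[OF la(1,4)] Aadd[OF la(2,5)] by blast
    next
      fix b x assume b: "b \<in> carrier \<Lambda>" "x \<in> ?N"
      then obtain l a where la: "l \<in> L" "a \<in> ?A 1" "x = l \<oplus>\<^bsub>\<Lambda>\<^esub> a" by blast
      then have c: "l \<in> carrier \<Lambda>" "a \<in> carrier \<Lambda>" using Ls(1) A1 by blast+
      have "b \<otimes>\<^bsub>\<Lambda>\<^esub> x = b \<otimes>\<^bsub>\<Lambda>\<^esub> l \<oplus>\<^bsub>\<Lambda>\<^esub> b \<otimes>\<^bsub>\<Lambda>\<^esub> a"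
        using b(1) c unfolding la by (simp add: Lam.r_distr)
      then show "b \<otimes>\<^bsub>\<Lambda>\<^esub> x \<in> ?N" using Ls(4)[OF b(1) la(1)] Amult[OF b(1) la(2)] by blast
    qed
    moreover have "L \<subseteq> ?N"
    proof
      fix l assume "l \<in> L"
      moreover have "l = l \<oplus>\<^bsub>\<Lambda>\<^esub> \<zero>\<^bsub>\<Lambda>\<^esub>" using \<open>l \<in> L\<close> Ls(1) by auto
      ultimately show "l \<in> ?N" using A0 by blast
    qed
    moreover have "?N \<noteq> L"
    proof -
      have "C = \<zero>\<^bsub>\<Lambda>\<^esub> \<oplus>\<^bsub>\<Lambda>\<^esub> C" using Cc by simp
      then have "C \<in> ?N" using Ls(2) C by blast
      then show ?thesis using \<open>C \<notin> L\<close> by blast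
    qed
    ultimately have "?N = carrier \<Lambda>" using m(3) by blast
    then have "\<one>\<^bsub>\<Lambda>\<^esub> \<in> ?N" using Lam.one_closed by simp
    then obtain l a where la: "l \<in> L" "a \<in> ?A 1" "\<one>\<^bsub>\<Lambda>\<^esub> = l \<oplus>\<^bsub>\<Lambda>\<^esub> a" by blast
    have lac: "l \<in> carrier \<Lambda>" "a \<in> carrier \<Lambda>" using la Ls(1) A1 by blast+
    have down: "?A j \<subseteq> L" if "?A (Suc j) \<subseteq> L" for j
    proof
      fix b assume b: "b \<in> ?A j"
      then obtain f g where fg: "b = cl f" "f \<in> arrow_ideal_pow Q j" "a = cl g" "g \<in> arrow_ideal_pow Q 1"
        using la(2) by blast
      then have bc: "b \<in> carrier \<Lambda>" using arrow_ideal_pow_subset cl_closed by blast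
      have "b \<otimes>\<^bsub>\<Lambda>\<^esub> a = cl (f \<otimes>\<^bsub>PA\<^esub> g)" using fg arrow_ideal_pow_subset cl_mult by blast
      then have ba: "b \<otimes>\<^bsub>\<Lambda>\<^esub> a \<in> L" using that arrow_ideal_pow_mult[OF fg(2,4)] by blast
      have "b = b \<otimes>\<^bsub>\<Lambda>\<^esub> \<one>\<^bsub>\<Lambda>\<^esub>" using bc by simp
      also have "\<dots> = b \<otimes>\<^bsub>\<Lambda>\<^esub> l \<oplus>\<^bsub>\<Lambda>\<^esub> b \<otimes>\<^bsub>\<Lambda>\<^esub> a"
        unfolding la(3) using bc lac by (simp add: Lam.r_distr)
      finally show "b \<in> L" using Ls(3)[OF Ls(4)[OF bc la(1)] ba] by simp
    qed
    have "cl f \<in> L" if "f \<in> arrow_ideal_pow Q n" for f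
    proof -
      have "f \<in> I" "f \<in> carrier PA" using that nil arrow_ideal_pow_subset by auto
      then have "cl f = \<zero>\<^bsub>\<Lambda>\<^esub>" using cl_eq_zero_iff by blast
      then show ?thesis using Ls(2) by simp
    qed
    then have An: "?A n \<subseteq> L" by blast
    have "?A k \<subseteq> L \<Longrightarrow> ?A 0 \<subseteq> L" for k
      by (induction k) (use down in blast)+
    \<comment> \<open>Descending from exponent \<open>n\<close> to exponent \<open>0\<close> puts
      the whole algebra into the proper left ideal \<open>L\<close>.\<close>
    then have "?A 0 \<subseteq> L" using An by blast
    moreover have "?A 0 = carrier \<Lambda>" by (auto simp: Lambda_carrier arrow_ideal_pow_def)
    ultimately have "carrier \<Lambda> \<subseteq> L" by simp
    then show False using m(2) Ls(1) by simp
  qed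
  then show "C \<in> jacobson_radical \<Lambda>" using Cc by (simp add: jacobson_radical_def)
qed

text \<open>Products are traversed from right to left, so the initial arrow of the path is the right
  factor. In the sum over all splittings the one after a single arrow remains.\<close>

lemma single_Cons:
  assumes "(u, a # p) \<in> paths Q"
  shows "single (u, a # p) c = single (head Q a, p) c \<otimes>\<^bsub>PA\<^esub> single (u, [a]) 1"
proof (rule ext, clarify)
  fix u' p'
  have a: "a \<in> arcs Q" "u = tail Q a" "(head Q a, p) \<in> paths Q" using assms by (auto simp: paths_Cons)
  have eq: "single (head Q a, p) c (awlast u' (take k p'), drop k p') * single (u, [a]) 1 (u', take k p') =
    (if k = 1 \<and> u' = u \<and> p' = a # p then c else 0)" if "k \<le> length p'" for k
  proof (cases "u' = u \<and> take k p' = [a] \<and> drop k p' = p")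
    case True
    then have "p' = a # p" by (metis append_take_drop_id append_Cons append_Nil)
    moreover have "k = 1" using True that by (metis length_take min.absorb2 length_Cons list.size(3) One_nat_def)
    ultimately show ?thesis using True by (simp add: single_def)
  next
    case False
    then show ?thesis by (auto simp: single_def)
  qed
  have "(single (head Q a, p) c \<otimes>\<^bsub>PA\<^esub> single (u, [a]) 1) (u', p') =
    (\<Sum>k\<le>length p'. if k = 1 \<and> u' = u \<and> p' = a # p then c else 0)"
    unfolding PA_mult by (rule sum.cong[OF refl]) (use eq in auto)
  also have "\<dots> = (\<Sum>k\<le>length p'. if k = 1 then if u' = u \<and> p' = a # p then c else 0 else 0)"
    by (rule sum.cong) auto
  also have "\<dots> = (if u' = u \<and> p' = a # p then c else 0)"
    by (subst sum.delta) auto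
  finally show "single (u, a # p) c (u', p') = (single (head Q a, p) c \<otimes>\<^bsub>PA\<^esub> single (u, [a]) 1) (u', p')"
    by (simp add: single_def)
qed

text \<open>A path with at least two arrows is the product of the rest of the path and its initial
  arrow. Both factors lie in the radical, so the class of the path is zero. The hypothesis on
  \<open>n\<close> is what places the arrows in the radical.\<close>

lemma arrow_ideal_square_zero:
  assumes "I \<subseteq> arrow_ideal_pow Q 2" and "arrow_ideal_pow Q n \<subseteq> I"
    and J2: "ideal_prod \<Lambda> (jacobson_radical \<Lambda>) (jacobson_radical \<Lambda>) = {\<zero>\<^bsub>\<Lambda>\<^esub>}"
  shows "I = arrow_ideal_pow Q 2"
proof (rule antisym[OF assms(1)], rule subsetI)
  fix f :: "('v, 'e) path \<Rightarrow> 'k" assume f: "f \<in> arrow_ideal_pow Q 2"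
  then have fc: "f \<in> carrier PA" by (simp add: arrow_ideal_pow_def)
  have fin: "finite {w. f w \<noteq> 0}" using fc by (simp add: PA_carrier)
  show "f \<in> I"
  proof (rule finite_support_induct[of f "\<lambda>g. g \<in> I", OF fin])
    show "(\<lambda>_. 0) \<in> I"
      using additive_subgroup.zero_closed[OF PA.is_additive_subgroup] by (simp add: PA_simps)
  next
    fix g w assume 2: "g \<in> I" "f w \<noteq> 0"
    obtain u q where w: "w = (u, q)" by (cases w)
    have "2 \<le> length q" using f 2(2) w by (force simp: arrow_ideal_pow_def)
    then obtain a b p where q: "q = a # b # p" by (cases q; cases "tl q") auto
    have path: "(u, a # b # p) \<in> paths Q" using fc 2(2) w q by (auto simp: PA_carrier)
    have x: "single (head Q a, b # p) (f w) \<in> arrow_ideal_pow Q 1" "single (u, [a]) (1 :: 'k) \<in> arrow_ideal_pow Q 1"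
      using path single_carrier[of "(head Q a, b # p)" "f w"] single_carrier[of "(u, [a])" "1 :: 'k"]
      by (auto simp: arrow_ideal_pow_def single_def paths_Cons paths_Nil)
    have "cl (single (head Q a, b # p) (f w)) \<otimes>\<^bsub>\<Lambda>\<^esub> cl (single (u, [a]) 1) \<in>
      ideal_prod \<Lambda> (jacobson_radical \<Lambda>) (jacobson_radical \<Lambda>)"
      using x jacobson_radical_superset[OF assms(2)] by (intro ideal_prod.prod) auto
    then have "cl (single (head Q a, b # p) (f w)) \<otimes>\<^bsub>\<Lambda>\<^esub> cl (single (u, [a]) 1) = \<zero>\<^bsub>\<Lambda>\<^esub>"
      using J2 by simp
    then have "cl (single w (f w)) = \<zero>\<^bsub>\<Lambda>\<^esub>"
      using x arrow_ideal_pow_subset single_Cons[OF path] w q by (subst (asm) cl_mult) auto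
    then have "single w (f w) \<in> I"
      using cl_eq_zero_iff[OF single_carrier] path w q by simp
    then show "(\<lambda>z. g z + single w (f w) z) \<in> I"
      using additive_subgroup.a_closed[OF PA.is_additive_subgroup 2(1)] by (simp add: PA_simps)
  qed
qed

end

section \<open>Coordinates in finite dimensional vector spaces\<close>

text \<open>An enumerated basis turns coordinate vectors into linear combinations; this is the
  bridge from abstract dimension to vectors and matrices.\<close>

lemma coordinates_exist:
  fixes V :: "('k::field, 'm) module"
  assumes "vectorspace class_ring V" and fd: "vectorspace.fin_dim class_ring V"
    and n: "n = vectorspace.dim class_ring V"
  obtains \<phi> where "bij_betw \<phi> (carrier_vec n) (carrier V)"
    "\<And>u v. u \<in> carrier_vec n \<Longrightarrow> v \<in> carrier_vec n \<Longrightarrow> \<phi> (u + v) = \<phi> u \<oplus>\<^bsub>V\<^esub> \<phi> v"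
    "\<And>c u. u \<in> carrier_vec n \<Longrightarrow> \<phi> (c \<cdot>\<^sub>v u) = c \<odot>\<^bsub>V\<^esub> \<phi> u"
proof -
  interpret V: vectorspace class_ring V by (rule assms)
  obtain A where A: "finite A" "V.basis A" using V.finite_basis_exists[OF fd] by blast
  have Ac: "A \<subseteq> carrier V" using A(2) by (simp add: V.basis_def)
  have cA: "card A = n" using V.dim_basis[OF A] n by simp
  obtain h where h: "bij_betw h {0..<n} A" using ex_bij_betw_nat_finite[OF A(1)] cA by blast
  define idx where "idx = inv_into {0..<n} h"
  have idx: "idx x < n" "h (idx x) = x" if "x \<in> A" for x
    using bij_betw_inv_into[OF h] bij_betw_inv_into_right[OF h] that
    by (auto simp: idx_def bij_betw_def)
  have idx2: "idx (h j) = j" "h j \<in> A" if "j < n" for j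
    using bij_betw_inv_into_left[OF h] h that by (auto simp: idx_def bij_betw_def)
  define \<phi> where "\<phi> u = V.lincomb (\<lambda>x. u $ idx x) A" for u
  have crit: "\<exists>!a. a \<in> A \<rightarrow>\<^sub>E UNIV \<and> V.lincomb a A = v" if "v \<in> carrier V" for v
    using V.basis_criterion[OF A(1) Ac] A(2) that by simp
  have closed: "\<phi> u \<in> carrier V" for u unfolding \<phi>_def using Ac by (intro V.lincomb_closed) auto
  show ?thesis
  proof (rule that[of \<phi>])
    show "\<phi> (u + v) = \<phi> u \<oplus>\<^bsub>V\<^esub> \<phi> v" if "u \<in> carrier_vec n" "v \<in> carrier_vec n" for u v
    proof -
      have "\<phi> (u + v) = V.lincomb (\<lambda>x. u $ idx x \<oplus>\<^bsub>class_ring\<^esub> v $ idx x) A"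
        unfolding \<phi>_def using that Ac by (intro V.lincomb_cong) (auto simp: idx)
      then show ?thesis unfolding \<phi>_def using A(1) Ac by (subst (asm) V.lincomb_sum) auto
    qed
    show "\<phi> (c \<cdot>\<^sub>v u) = c \<odot>\<^bsub>V\<^esub> \<phi> u" if "u \<in> carrier_vec n" for c u
    proof -
      have "\<phi> (c \<cdot>\<^sub>v u) = V.lincomb (\<lambda>x. c \<otimes>\<^bsub>class_ring\<^esub> u $ idx x) A"
        unfolding \<phi>_def using that Ac by (intro V.lincomb_cong) (auto simp: idx)
      then show ?thesis unfolding \<phi>_def using Ac by (subst (asm) V.lincomb_smult) auto
    qed
    \<comment> \<open>Uniqueness of coordinates is available for functions extensional on
      \<open>A\<close>, so coefficient functions are restricted before they are compared.\<close>
    have restr: "V.lincomb (restrict a A) A = V.lincomb a A" for a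
      using Ac by (intro V.lincomb_cong) auto
    show "bij_betw \<phi> (carrier_vec n) (carrier V)"
      unfolding bij_betw_def
    proof
      show "inj_on \<phi> (carrier_vec n)"
      proof (rule inj_onI)
        fix u v :: "'k vec" assume uv: "u \<in> carrier_vec n" "v \<in> carrier_vec n" "\<phi> u = \<phi> v"
        have "restrict (\<lambda>x. u $ idx x) A = restrict (\<lambda>x. v $ idx x) A"
          using crit[OF closed[of u]] uv(3) restr unfolding \<phi>_def by (metis (no_types, lifting) UNIV_I restrict_PiE_iff)
        then have e: "u $ idx x = v $ idx x" if "x \<in> A" for x using that by (metis restrict_apply')
        show "u = v"
        proof (rule eq_vecI)
          fix j assume "j < dim_vec v"
          then have "j < n" using uv by auto
          then show "u $ j = v $ j" using e[of "h j"] idx2 by simp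
        qed (use uv in auto)
      qed
      show "\<phi> ` carrier_vec n = carrier V"
      proof (intro equalityI subsetI)
        fix v assume "v \<in> carrier V"
        then obtain a where a: "V.lincomb a A = v" using crit by blast
        have "\<phi> (vec n (\<lambda>j. a (h j))) = V.lincomb a A"
          unfolding \<phi>_def using Ac by (intro V.lincomb_cong) (auto simp: idx)
        then show "v \<in> \<phi> ` carrier_vec n" using a by (intro image_eqI[of _ _ "vec n (\<lambda>j. a (h j))"]) auto
      qed (use closed in auto)
    qed
  qed
qed

lemma vec_linear_map:
  fixes V :: "('k::field, 'm) module"
  assumes V: "vectorspace class_ring V" and closed: "\<And>u. u \<in> carrier_vec n \<Longrightarrow> \<phi> u \<in> carrier V"
    and add: "\<And>u v. u \<in> carrier_vec n \<Longrightarrow> v \<in> carrier_vec n \<Longrightarrow> \<phi> (u + v) = \<phi> u \<oplus>\<^bsub>V\<^esub> \<phi> v"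
    and smult: "\<And>c u. u \<in> carrier_vec n \<Longrightarrow> \<phi> (c \<cdot>\<^sub>v u) = c \<odot>\<^bsub>V\<^esub> \<phi> u"
  shows "linear_map class_ring (module_vec TYPE('k) n) V \<phi>"
proof -
  interpret V: vectorspace class_ring V by (rule V)
  show ?thesis
    by (intro linear_map.intro mod_hom.intro mod_hom_axioms.intro vec_vs vec_module V V.module_axioms)
       (auto simp: module_hom_def module_vec_simps closed add smult)
qed

lemma fin_dim_of_surj:
  fixes V :: "('k::field, 'm) module"
  assumes V: "vectorspace class_ring V" and surj: "\<phi> ` carrier_vec n = carrier V"
    and add: "\<And>u v. u \<in> carrier_vec n \<Longrightarrow> v \<in> carrier_vec n \<Longrightarrow> \<phi> (u + v) = \<phi> u \<oplus>\<^bsub>V\<^esub> \<phi> v"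
    and smult: "\<And>c u. u \<in> carrier_vec n \<Longrightarrow> \<phi> (c \<cdot>\<^sub>v u) = c \<odot>\<^bsub>V\<^esub> \<phi> u"
  shows "vectorspace.fin_dim class_ring V"
proof -
  interpret linear_map class_ring "module_vec TYPE('k) n" V \<phi>
    by (rule vec_linear_map[OF V]) (use surj add smult in auto)
  show ?thesis
    by (rule surj_fin_dim) (use surj vec_space.fin_dim in \<open>auto simp: module_vec_simps\<close>)
qed

lemma dim_of_coordinates:
  fixes V :: "('k::field, 'm) module"
  assumes V: "vectorspace class_ring V" and bij: "bij_betw \<phi> (carrier_vec n) (carrier V)"
    and add: "\<And>u v. u \<in> carrier_vec n \<Longrightarrow> v \<in> carrier_vec n \<Longrightarrow> \<phi> (u + v) = \<phi> u \<oplus>\<^bsub>V\<^esub> \<phi> v"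
    and smult: "\<And>c u. u \<in> carrier_vec n \<Longrightarrow> \<phi> (c \<cdot>\<^sub>v u) = c \<odot>\<^bsub>V\<^esub> \<phi> u"
  shows "vectorspace.dim class_ring V = n"
proof -
  interpret linear_map class_ring "module_vec TYPE('k) n" V \<phi>
    by (rule vec_linear_map[OF V]) (use bij add smult in \<open>auto simp: bij_betw_def\<close>)
  have "vectorspace.dim class_ring (module_vec TYPE('k) n) = vectorspace.dim class_ring V"
    by (rule dim_eq) (use bij vec_space.fin_dim in \<open>auto simp: module_vec_simps bij_betw_def\<close>)
  then show ?thesis by (simp add: vec_space.dim_is_n)
qed

text \<open>The truncations \<open>t k\<close> of \<open>u\<close> to its first \<open>k\<close>
  coordinates grow by one multiple of a unit vector at a time.\<close>

lemma linear_fun_eq_mult_mat_vec: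
  fixes F :: "'k::field vec \<Rightarrow> 'k vec"
  assumes closed: "\<And>u. u \<in> carrier_vec n \<Longrightarrow> F u \<in> carrier_vec m"
    and add: "\<And>u v. u \<in> carrier_vec n \<Longrightarrow> v \<in> carrier_vec n \<Longrightarrow> F (u + v) = F u + F v"
    and smult: "\<And>c u. u \<in> carrier_vec n \<Longrightarrow> F (c \<cdot>\<^sub>v u) = c \<cdot>\<^sub>v F u"
    and u: "u \<in> carrier_vec n"
  shows "F u = mat m n (\<lambda>(i, j). F (unit_vec n j) $ i) *\<^sub>v u"
proof -
  define t where "t k = vec n (\<lambda>j. if j < k then u $ j else 0)" for k
  have t: "F (t k) = vec m (\<lambda>i. \<Sum>j<k. F (unit_vec n j) $ i * u $ j)" if "k \<le> n" for k
    using that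
  proof (induction k)
    case 0
    have "t 0 = 0 \<cdot>\<^sub>v 0\<^sub>v n" by (auto simp: t_def)
    then have "F (t 0) = 0 \<cdot>\<^sub>v F (0\<^sub>v n)" using smult[of "0\<^sub>v n" 0] by simp
    then show ?case using closed[of "0\<^sub>v n"] by (auto intro!: eq_vecI)
  next
    case (Suc k)
    have "t (Suc k) = t k + u $ k \<cdot>\<^sub>v unit_vec n k"
      using Suc.prems by (intro eq_vecI) (auto simp: t_def unit_vec_def less_Suc_eq)
    then have "F (t (Suc k)) = F (t k) + u $ k \<cdot>\<^sub>v F (unit_vec n k)"
      by (simp add: add smult t_def)
    then show ?case using Suc closed[of "unit_vec n k"] by (auto intro!: eq_vecI simp: mult.commute)
  qed
  have "t n = u" using u by (intro eq_vecI) (auto simp: t_def)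
  then show ?thesis
    using t[of n] u by (auto intro!: eq_vecI simp: scalar_prod_def atLeast0LessThan)
qed

section \<open>Modules over algebras with radical square zero\<close>

lemma (in left_module) smult_finsum:
  assumes "a \<in> carrier R" "finite A" "f \<in> A \<rightarrow> carrier M"
  shows "a \<odot>\<^bsub>M\<^esub> (\<Oplus>\<^bsub>M\<^esub>i\<in>A. f i) = (\<Oplus>\<^bsub>M\<^esub>i\<in>A. a \<odot>\<^bsub>M\<^esub> f i)"
  using assms(2,3)
proof (induction A)
  case empty
  then show ?case using assms(1) by (simp add: smult_zero)
next
  case (insert i A)
  then have "f \<in> A \<rightarrow> carrier M" "(\<lambda>i. a \<odot>\<^bsub>M\<^esub> f i) \<in> A \<rightarrow> carrier M" "f i \<in> carrier M"
    using assms(1) smult_closed by auto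
  then show ?case using insert assms(1) by (simp add: smult_r_distr smult_closed)
qed

locale rsz_algebra = quiver_algebra Q I
  for Q :: "('v, 'e) pre_digraph" and I :: "(('v, 'e) path \<Rightarrow> 'k::field) set" +
  assumes I_eq: "I = arrow_ideal_pow Q 2"
begin

lemma jacobson_radical_eq: "jacobson_radical \<Lambda> = {cl f | f. f \<in> arrow_ideal_pow Q 1}"
proof (rule antisym)
  show "jacobson_radical \<Lambda> \<subseteq> {cl f | f. f \<in> arrow_ideal_pow Q 1}"
    by (rule jacobson_radical_subset) (simp add: I_eq)
  show "{cl f | f. f \<in> arrow_ideal_pow Q 1} \<subseteq> jacobson_radical \<Lambda>"
    by (rule jacobson_radical_superset[of 2]) (simp add: I_eq)
qed

section \<open>Generators and multiplication table of the algebra\<close>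

lemma jacobson_radical_carrier: "C \<in> jacobson_radical \<Lambda> \<Longrightarrow> C \<in> carrier \<Lambda>"
  by (simp add: jacobson_radical_def)

lemma PA_one_apply: "\<one>\<^bsub>PA\<^esub> (u, p) = (if u \<in> verts Q \<and> p = [] then 1 else 0)"
  by (simp add: PA_simps)

lemma zero_fun_carrier: "(\<lambda>_. 0) \<in> carrier PA"
  by (simp add: PA_carrier)

lemma PA_zero_outside: "f \<in> carrier PA \<Longrightarrow> w \<notin> paths Q \<Longrightarrow> f w = 0"
  by (auto simp: PA_carrier)

text \<open>The difference has its support on paths of length at least two and so lies in
  \<open>I\<close>; off \<open>paths Q\<close> both functions vanish.\<close>

lemma cl_eqI:
  assumes fg: "f \<in> carrier PA" "g \<in> carrier PA"
    and v: "\<And>v. v \<in> verts Q \<Longrightarrow> f (v, []) = g (v, [])"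
    and a: "\<And>a. a \<in> arcs Q \<Longrightarrow> f (tail Q a, [a]) = g (tail Q a, [a])"
  shows "cl f = cl g"
proof -
  have "f (u, p) - g (u, p) = 0" if "length p < 2" for u p
  proof (cases "(u, p) \<in> paths Q")
    case False
    then show ?thesis using PA_zero_outside[OF fg(1)] PA_zero_outside[OF fg(2)] by simp
  next
    case True
    show ?thesis
    proof (cases p)
      case Nil
      then show ?thesis using True v by (simp add: paths_Nil)
    next
      case (Cons b q)
      then have "p = [b]" using that by simp
      then show ?thesis using True a by (simp add: paths_arc)
    qed
  qed
  moreover have "(\<lambda>w. f w - g w) \<in> carrier PA"
    using PA.a_closed[OF fg(1) PA_minus(1)[OF fg(2)]] by (simp add: PA_simps)
  ultimately have "(\<lambda>w. f w - g w) \<in> I" unfolding I_eq by (simp add: arrow_ideal_pow_def)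
  then show ?thesis using cl_eq_iff fg by blast
qed

lemma cl_eqD:
  assumes "f \<in> carrier PA" "g \<in> carrier PA" "cl f = cl g"
  shows "f (u, []) = g (u, [])" "f (u, [a]) = g (u, [a])"
proof -
  have "(\<lambda>w. f w - g w) \<in> arrow_ideal_pow Q 2" using assms cl_eq_iff I_eq by blast
  then have z: "f (u, p) - g (u, p) = 0" if "length p < 2" for p using that by (simp add: arrow_ideal_pow_def)
  show "f (u, []) = g (u, [])" "f (u, [a]) = g (u, [a])" using z[of "[]"] z[of "[a]"] by simp_all
qed

lemma one_carrier: "(\<lambda>w. c * \<one>\<^bsub>PA\<^esub> w) \<in> carrier PA"
proof -
  have "{w. c * \<one>\<^bsub>PA\<^esub> w \<noteq> 0} \<subseteq> (\<lambda>v. (v, [])) ` verts Q" by (auto simp: PA_one_apply split: if_splits)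
  moreover have "(\<lambda>v. (v, [])) ` verts Q \<subseteq> paths Q" by (auto simp: paths_Nil)
  ultimately show ?thesis unfolding PA_carrier by (meson finite_imageI finite_subset finite_verts subset_trans)
qed

lemma single_vert_carrier: "v \<in> verts Q \<Longrightarrow> single (v, []) c \<in> carrier PA"
  by (rule single_carrier) (simp add: paths_Nil)

lemma single_arc_carrier: "a \<in> arcs Q \<Longrightarrow> single (tail Q a, [a]) c \<in> carrier PA"
  by (rule single_carrier) (simp add: paths_arc)

lemmas gen_carrier = one_carrier single_vert_carrier single_arc_carrier

lemma scalar_closed: "scalar Q I c \<in> carrier \<Lambda>"
  unfolding scalar_def by (rule cl_closed[OF one_carrier])

lemma vertex_closed: "v \<in> verts Q \<Longrightarrow> vertex_idem Q I v \<in> carrier \<Lambda>"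
  unfolding vertex_idem_eq by (rule cl_closed[OF single_vert_carrier])

lemma arrow_closed: "a \<in> arcs Q \<Longrightarrow> arrow_cl a \<in> carrier \<Lambda>"
  by (rule cl_closed[OF single_arc_carrier])

lemma arrow_radical: "a \<in> arcs Q \<Longrightarrow> arrow_cl a \<in> jacobson_radical \<Lambda>"
  unfolding jacobson_radical_eq using single_arc_carrier[of a 1]
  by (auto simp: arrow_ideal_pow_def single_apply)

text \<open>Modulo \<open>I\<close> a product is determined by its values at trivial paths and
  arrows, where \<open>PA_mult_Nil\<close> and \<open>PA_mult_arc\<close> compute it. The
  multiplication table of scalars, idempotents and arrows is read off from this.\<close>

lemma cl_mult_eqI:
  assumes "f \<in> carrier PA" "g \<in> carrier PA" "h \<in> carrier PA"
    and "\<And>v. v \<in> verts Q \<Longrightarrow> f (v, []) * g (v, []) = h (v, [])"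
    and "\<And>a. a \<in> arcs Q \<Longrightarrow>
      f (tail Q a, [a]) * g (tail Q a, []) + f (head Q a, []) * g (tail Q a, [a]) = h (tail Q a, [a])"
  shows "cl f \<otimes>\<^bsub>\<Lambda>\<^esub> cl g = cl h"
  using assms by (simp add: cl_mult) (intro cl_eqI, auto simp: PA_mult_Nil PA_mult_arc)

lemma scalar_add: "scalar Q I (c + c') = scalar Q I c \<oplus>\<^bsub>\<Lambda>\<^esub> scalar Q I c'"
  unfolding scalar_def by (simp add: cl_add[OF one_carrier one_carrier] distrib_right)

lemma scalar_mult: "scalar Q I (c * c') = scalar Q I c \<otimes>\<^bsub>\<Lambda>\<^esub> scalar Q I c'"
  unfolding scalar_def by (rule cl_mult_eqI[symmetric, OF one_carrier one_carrier one_carrier]) (auto simp: PA_one_apply)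

lemma scalar_one: "scalar Q I 1 = \<one>\<^bsub>\<Lambda>\<^esub>"
  by (simp add: scalar_def Lambda_one)

lemma scalar_zero: "scalar Q I 0 = \<zero>\<^bsub>\<Lambda>\<^esub>"
  by (simp add: scalar_def cl_zero)

lemma scalar_commute:
  assumes "C \<in> carrier \<Lambda>"
  shows "scalar Q I c \<otimes>\<^bsub>\<Lambda>\<^esub> C = C \<otimes>\<^bsub>\<Lambda>\<^esub> scalar Q I c"
proof -
  obtain f where f: "f \<in> carrier PA" "C = cl f" using assms by (auto simp: Lambda_carrier)
  have c: "(\<lambda>w. c * \<one>\<^bsub>PA\<^esub> w) \<otimes>\<^bsub>PA\<^esub> f \<in> carrier PA"
    "f \<otimes>\<^bsub>PA\<^esub> (\<lambda>w. c * \<one>\<^bsub>PA\<^esub> w) \<in> carrier PA" using one_carrier f by simp_all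
  have "cl ((\<lambda>w. c * \<one>\<^bsub>PA\<^esub> w) \<otimes>\<^bsub>PA\<^esub> f) = cl (f \<otimes>\<^bsub>PA\<^esub> (\<lambda>w. c * \<one>\<^bsub>PA\<^esub> w))"
    by (rule cl_eqI[OF c]) (auto simp: PA_mult_Nil PA_mult_arc PA_one_apply)
  then show ?thesis unfolding f(2) scalar_def by (simp add: cl_mult one_carrier f(1))
qed

lemma vertex_mult:
  "v \<in> verts Q \<Longrightarrow> w \<in> verts Q \<Longrightarrow>
    vertex_idem Q I v \<otimes>\<^bsub>\<Lambda>\<^esub> vertex_idem Q I w = (if v = w then vertex_idem Q I v else \<zero>\<^bsub>\<Lambda>\<^esub>)"
  unfolding vertex_idem_eq cl_zero[symmetric] if_distrib[of "\<lambda>f. cl f", symmetric]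
  by (rule cl_mult_eqI) (auto simp: gen_carrier single_apply PA_one_apply zero_fun_carrier)

lemma vertex_arrow_mult:
  assumes "v \<in> verts Q" "a \<in> arcs Q"
  shows "vertex_idem Q I v \<otimes>\<^bsub>\<Lambda>\<^esub> arrow_cl a = (if v = head Q a then arrow_cl a else \<zero>\<^bsub>\<Lambda>\<^esub>)"
  unfolding vertex_idem_eq cl_zero[symmetric] if_distrib[of "\<lambda>f. cl f", symmetric]
  by (rule cl_mult_eqI) (use assms in \<open>auto simp: gen_carrier single_apply PA_one_apply zero_fun_carrier\<close>)

lemma arrow_vertex_mult:
  assumes "v \<in> verts Q" "a \<in> arcs Q"
  shows "arrow_cl a \<otimes>\<^bsub>\<Lambda>\<^esub> vertex_idem Q I v = (if v = tail Q a then arrow_cl a else \<zero>\<^bsub>\<Lambda>\<^esub>)"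
  unfolding vertex_idem_eq cl_zero[symmetric] if_distrib[of "\<lambda>f. cl f", symmetric]
  by (rule cl_mult_eqI) (use assms in \<open>auto simp: gen_carrier single_apply PA_one_apply zero_fun_carrier\<close>)

lemma radical_mult_zero:
  assumes "C \<in> jacobson_radical \<Lambda>" "D \<in> jacobson_radical \<Lambda>"
  shows "C \<otimes>\<^bsub>\<Lambda>\<^esub> D = \<zero>\<^bsub>\<Lambda>\<^esub>"
proof -
  obtain f g where fg: "C = cl f" "f \<in> arrow_ideal_pow Q 1" "D = cl g" "g \<in> arrow_ideal_pow Q 1"
    using assms unfolding jacobson_radical_eq by blast
  then have c: "f \<in> carrier PA" "g \<in> carrier PA" by (auto simp: arrow_ideal_pow_def)
  have "f \<otimes>\<^bsub>PA\<^esub> g \<in> arrow_ideal_pow Q (Suc 1)" by (rule arrow_ideal_pow_mult[OF fg(2,4)])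
  then have "f \<otimes>\<^bsub>PA\<^esub> g \<in> I" by (simp add: I_eq numeral_2_eq_2)
  then show ?thesis unfolding fg using c by (simp add: cl_mult cl_eq_zero_iff)
qed

lemma radical_right_ideal:
  assumes "C \<in> jacobson_radical \<Lambda>" "D \<in> carrier \<Lambda>"
  shows "C \<otimes>\<^bsub>\<Lambda>\<^esub> D \<in> jacobson_radical \<Lambda>"
proof -
  obtain f g where fg: "C = cl f" "f \<in> arrow_ideal_pow Q 1" "D = cl g" "g \<in> carrier PA"
    using assms unfolding jacobson_radical_eq Lambda_carrier by blast
  then have c: "f \<in> carrier PA" by (auto simp: arrow_ideal_pow_def)
  have "f \<otimes>\<^bsub>PA\<^esub> g \<in> arrow_ideal_pow Q 1"
    using fg c PA.m_closed[OF c fg(4)] by (simp add: arrow_ideal_pow_def PA_mult_Nil)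
  then show ?thesis unfolding jacobson_radical_eq using fg c by (auto simp: cl_mult)
qed

text \<open>Scalars, vertex idempotents and arrows generate the algebra, so stability and linearity
  under all of it are checked on these.\<close>

lemma Lambda_induct:
  assumes C: "C \<in> carrier \<Lambda>" and scalar: "\<And>c. P (scalar Q I c)"
    and vertex: "\<And>v. v \<in> verts Q \<Longrightarrow> P (vertex_idem Q I v)"
    and arrow: "\<And>a. a \<in> arcs Q \<Longrightarrow> P (arrow_cl a)"
    and add: "\<And>C D. C \<in> carrier \<Lambda> \<Longrightarrow> D \<in> carrier \<Lambda> \<Longrightarrow> P C \<Longrightarrow> P D \<Longrightarrow> P (C \<oplus>\<^bsub>\<Lambda>\<^esub> D)"
    and mult: "\<And>C D. C \<in> carrier \<Lambda> \<Longrightarrow> D \<in> carrier \<Lambda> \<Longrightarrow> P C \<Longrightarrow> P D \<Longrightarrow> P (C \<otimes>\<^bsub>\<Lambda>\<^esub> D)"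
  shows "P C"
proof -
  obtain f where f: "f \<in> carrier PA" "C = cl f" using C by (auto simp: Lambda_carrier)
  have fin: "finite {w. f w \<noteq> 0}" using f by (simp add: PA_carrier)
  have "P (cl f)"
  proof (rule finite_support_induct[of f "\<lambda>g. P (cl g)", OF fin])
    show "P (cl (\<lambda>_. 0))" using scalar[of 0] by (simp add: scalar_zero cl_zero)
  next
    fix g w assume g: "P (cl g)" "f w \<noteq> 0" "finite {z. g z \<noteq> 0}" "{z. g z \<noteq> 0} \<subseteq> {z. f z \<noteq> 0}"
    have gc: "g \<in> carrier PA" using g f by (auto simp: PA_carrier)
    have wp: "w \<in> paths Q" using f g by (auto simp: PA_carrier)
    have sc: "single w (f w) \<in> carrier PA" by (rule single_carrier[OF wp])
    have "P (cl (single w (f w)))"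
    proof (cases w)
      case (Pair u p)
      consider "p = []" | a where "p = [a]" | a b q where "p = a # b # q"
        by (cases p; cases "tl p") auto
      then show ?thesis
      proof cases
        case 1
        then have u: "u \<in> verts Q" using wp Pair by (simp add: paths_Nil)
        have "scalar Q I (f w) \<otimes>\<^bsub>\<Lambda>\<^esub> vertex_idem Q I u = cl (single w (f w))"
          unfolding scalar_def vertex_idem_eq
          by (rule cl_mult_eqI) (use u 1 Pair in \<open>auto simp: gen_carrier single_apply PA_one_apply zero_fun_carrier\<close>)
        then show ?thesis using mult[OF scalar_closed vertex_closed[OF u] scalar vertex[OF u]] by metis
      next
        case (2 a)
        then have a: "a \<in> arcs Q" "u = tail Q a" using wp Pair by (simp_all add: paths_arc)
        have "scalar Q I (f w) \<otimes>\<^bsub>\<Lambda>\<^esub> arrow_cl a = cl (single w (f w))"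
          unfolding scalar_def
          by (rule cl_mult_eqI) (use a 2 Pair in \<open>auto simp: gen_carrier single_apply PA_one_apply zero_fun_carrier\<close>)
        then show ?thesis using mult[OF scalar_closed arrow_closed[OF a(1)] scalar arrow[OF a(1)]] by metis
      next
        case (3 a b q)
        \<comment> \<open>Paths of length at least two represent zero, which is the scalar
          \<open>0\<close>.\<close>
        have "cl (single w (f w)) = cl (\<lambda>_. 0)"
          by (rule cl_eqI[OF sc]) (use 3 Pair in \<open>auto simp: single_apply PA_one_apply zero_fun_carrier\<close>)
        then show ?thesis using scalar[of 0] by (simp add: scalar_zero cl_zero)
      qed
    qed
    then show "P (cl (\<lambda>z. g z + single w (f w) z))"
      using add[OF cl_closed[OF gc] cl_closed[OF sc] g(1)] by (simp add: cl_add[OF gc sc])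
  qed
  then show ?thesis using f by simp
qed

text \<open>Both actions are additive and multiplicative in the algebra element, so compatibility
  spreads from the generators to the whole algebra.\<close>

lemma module_hom_LambdaI:
  assumes M: "left_module \<Lambda> M" and N: "left_module \<Lambda> N"
    and closed: "\<And>x. x \<in> carrier M \<Longrightarrow> \<phi> x \<in> carrier N"
    and add: "\<And>x y. x \<in> carrier M \<Longrightarrow> y \<in> carrier M \<Longrightarrow> \<phi> (x \<oplus>\<^bsub>M\<^esub> y) = \<phi> x \<oplus>\<^bsub>N\<^esub> \<phi> y"
    and sc: "\<And>c x. x \<in> carrier M \<Longrightarrow> \<phi> (scalar Q I c \<odot>\<^bsub>M\<^esub> x) = scalar Q I c \<odot>\<^bsub>N\<^esub> \<phi> x"
    and ev: "\<And>v x. v \<in> verts Q \<Longrightarrow> x \<in> carrier M \<Longrightarrow> \<phi> (vertex_idem Q I v \<odot>\<^bsub>M\<^esub> x) = vertex_idem Q I v \<odot>\<^bsub>N\<^esub> \<phi> x"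
    and ar: "\<And>a x. a \<in> arcs Q \<Longrightarrow> x \<in> carrier M \<Longrightarrow> \<phi> (arrow_cl a \<odot>\<^bsub>M\<^esub> x) = arrow_cl a \<odot>\<^bsub>N\<^esub> \<phi> x"
  shows "\<phi> \<in> module_hom \<Lambda> M N"
proof -
  interpret M: left_module \<Lambda> M by (rule M)
  interpret N: left_module \<Lambda> N by (rule N)
  have "\<forall>x\<in>carrier M. \<phi> (C \<odot>\<^bsub>M\<^esub> x) = C \<odot>\<^bsub>N\<^esub> \<phi> x" if "C \<in> carrier \<Lambda>" for C
    using that
    by (rule Lambda_induct)
       (auto simp: sc ev ar M.smult_l_distr N.smult_l_distr M.smult_assoc N.smult_assoc M.smult_closed closed add)
  then show ?thesis using closed add by (intro module_homI) auto
qed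

text \<open>Modulo \<open>I\<close> the arrow ideal is the linear span of the arrows.\<close>

lemma radical_induct:
  assumes C: "C \<in> jacobson_radical \<Lambda>" and zero: "P \<zero>\<^bsub>\<Lambda>\<^esub>"
    and arrow: "\<And>a c. a \<in> arcs Q \<Longrightarrow> P (scalar Q I c \<otimes>\<^bsub>\<Lambda>\<^esub> arrow_cl a)"
    and add: "\<And>C D. C \<in> carrier \<Lambda> \<Longrightarrow> D \<in> carrier \<Lambda> \<Longrightarrow> P C \<Longrightarrow> P D \<Longrightarrow> P (C \<oplus>\<^bsub>\<Lambda>\<^esub> D)"
  shows "P C"
proof -
  obtain f where f: "C = cl f" "f \<in> arrow_ideal_pow Q 1" using C unfolding jacobson_radical_eq by blast
  then have fc: "f \<in> carrier PA" by (simp add: arrow_ideal_pow_def)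
  have fin: "finite {w. f w \<noteq> 0}" using fc by (simp add: PA_carrier)
  have "P (cl f)"
  proof (rule finite_support_induct[of f "\<lambda>g. P (cl g)", OF fin])
    show "P (cl (\<lambda>_. 0))" using zero by (simp add: cl_zero)
  next
    fix g w assume g: "P (cl g)" "f w \<noteq> 0" "finite {z. g z \<noteq> 0}" "{z. g z \<noteq> 0} \<subseteq> {z. f z \<noteq> 0}"
    have gc: "g \<in> carrier PA" using g fc by (auto simp: PA_carrier)
    have wp: "w \<in> paths Q" using fc g by (auto simp: PA_carrier)
    have sc: "single w (f w) \<in> carrier PA" by (rule single_carrier[OF wp])
    have "P (cl (single w (f w)))"
    proof (cases w)
      case (Pair u p)
      have "p \<noteq> []" using f(2) g(2) Pair by (auto simp: arrow_ideal_pow_def)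
      then consider a where "p = [a]" | a b q where "p = a # b # q" by (cases p; cases "tl p") auto
      then show ?thesis
      proof cases
        case (1 a)
        then have a: "a \<in> arcs Q" "u = tail Q a" using wp Pair by (simp_all add: paths_arc)
        have "scalar Q I (f w) \<otimes>\<^bsub>\<Lambda>\<^esub> arrow_cl a = cl (single w (f w))"
          unfolding scalar_def
          by (rule cl_mult_eqI) (use a 1 Pair in \<open>auto simp: gen_carrier single_apply PA_one_apply\<close>)
        then show ?thesis using arrow[OF a(1), of "f w"] by simp
      next
        case (2 a b q)
        have "cl (single w (f w)) = cl (\<lambda>_. 0)"
          by (rule cl_eqI[OF sc zero_fun_carrier]) (use 2 Pair in \<open>auto simp: single_apply\<close>)
        then show ?thesis using zero by (simp add: cl_zero)
      qed
    qed
    then show "P (cl (\<lambda>z. g z + single w (f w) z))"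
      using add[OF cl_closed[OF gc] cl_closed[OF sc] g(1)] by (simp add: cl_add[OF gc sc])
  qed
  then show ?thesis using f by simp
qed

end

section \<open>Modules as representations of the quiver\<close>

locale rsz_module = rsz_algebra Q I + M: left_module "bq_algebra Q I" M
  for Q :: "('v, 'e) pre_digraph" and I :: "(('v, 'e) path \<Rightarrow> 'k::field) set"
    and M :: "(('v, 'e, 'k) bqa, 'm) module"
begin

abbreviation "sc c x \<equiv> scalar Q I c \<odot>\<^bsub>M\<^esub> x"
abbreviation "ev v x \<equiv> vertex_idem Q I v \<odot>\<^bsub>M\<^esub> x"
abbreviation "ar a x \<equiv> arrow_cl a \<odot>\<^bsub>M\<^esub> x"

lemma op_closed:
  "x \<in> carrier M \<Longrightarrow> sc c x \<in> carrier M"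
  "v \<in> verts Q \<Longrightarrow> x \<in> carrier M \<Longrightarrow> ev v x \<in> carrier M"
  "a \<in> arcs Q \<Longrightarrow> x \<in> carrier M \<Longrightarrow> ar a x \<in> carrier M"
  by (auto intro: M.smult_closed scalar_closed vertex_closed arrow_closed)

lemma sc_props:
  assumes "x \<in> carrier M"
  shows "sc (c + c') x = sc c x \<oplus>\<^bsub>M\<^esub> sc c' x" "sc (c * c') x = sc c (sc c' x)"
    "sc 1 x = x" "sc 0 x = \<zero>\<^bsub>M\<^esub>"
  using assms
  by (simp_all add: scalar_add scalar_mult scalar_one scalar_zero M.smult_l_distr M.smult_assoc M.smult_one
      M.zero_smult scalar_closed)

lemma op_add:
  assumes "x \<in> carrier M" "y \<in> carrier M"
  shows "sc c (x \<oplus>\<^bsub>M\<^esub> y) = sc c x \<oplus>\<^bsub>M\<^esub> sc c y"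
    "v \<in> verts Q \<Longrightarrow> ev v (x \<oplus>\<^bsub>M\<^esub> y) = ev v x \<oplus>\<^bsub>M\<^esub> ev v y"
    "a \<in> arcs Q \<Longrightarrow> ar a (x \<oplus>\<^bsub>M\<^esub> y) = ar a x \<oplus>\<^bsub>M\<^esub> ar a y"
  using assms by (auto intro: M.smult_r_distr scalar_closed vertex_closed arrow_closed)

lemma op_zero:
  "sc c \<zero>\<^bsub>M\<^esub> = \<zero>\<^bsub>M\<^esub>" "v \<in> verts Q \<Longrightarrow> ev v \<zero>\<^bsub>M\<^esub> = \<zero>\<^bsub>M\<^esub>" "a \<in> arcs Q \<Longrightarrow> ar a \<zero>\<^bsub>M\<^esub> = \<zero>\<^bsub>M\<^esub>"
  by (auto intro: M.smult_zero scalar_closed vertex_closed arrow_closed)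

lemma op_sc:
  assumes "x \<in> carrier M"
  shows "v \<in> verts Q \<Longrightarrow> ev v (sc c x) = sc c (ev v x)" "a \<in> arcs Q \<Longrightarrow> ar a (sc c x) = sc c (ar a x)"
  using assms
  by (simp_all add: M.smult_assoc[symmetric] scalar_closed vertex_closed arrow_closed scalar_commute)

lemma op_comp:
  assumes "x \<in> carrier M"
  shows "v \<in> verts Q \<Longrightarrow> w \<in> verts Q \<Longrightarrow> ev v (ev w x) = (if v = w then ev v x else \<zero>\<^bsub>M\<^esub>)"
    "v \<in> verts Q \<Longrightarrow> a \<in> arcs Q \<Longrightarrow> ev v (ar a x) = (if v = head Q a then ar a x else \<zero>\<^bsub>M\<^esub>)"
    "v \<in> verts Q \<Longrightarrow> a \<in> arcs Q \<Longrightarrow> ar a (ev v x) = (if v = tail Q a then ar a x else \<zero>\<^bsub>M\<^esub>)"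
    "a \<in> arcs Q \<Longrightarrow> b \<in> arcs Q \<Longrightarrow> ar b (ar a x) = \<zero>\<^bsub>M\<^esub>"
  using assms
  by (simp_all add: M.smult_assoc[symmetric] vertex_closed arrow_closed vertex_mult vertex_arrow_mult
      arrow_vertex_mult radical_mult_zero arrow_radical M.zero_smult)

text \<open>The unit is the sum of the vertex idempotents. The functions \<open>?e F\<close>
  represent its partial sums, which allows an induction on finite sets of vertices.\<close>

lemma sum_ev:
  assumes x: "x \<in> carrier M"
  shows "(\<Oplus>\<^bsub>M\<^esub>v\<in>verts Q. ev v x) = x"
proof -
  let ?e = "\<lambda>F (u, p). if u \<in> F \<and> p = [] then 1 else (0::'k)"
  have c: "?e F \<in> carrier PA" if "F \<subseteq> verts Q" for F
  proof -
    have 1: "{w. ?e F w \<noteq> 0} \<subseteq> (\<lambda>v. (v, [])) ` F" by (auto split: if_splits)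
    have 2: "(\<lambda>v. (v, [])) ` F \<subseteq> paths Q" using that by (auto simp: paths_Nil)
    have 3: "finite ((\<lambda>v. (v, [] :: 'e list)) ` F)" using that finite_verts finite_subset by blast
    show ?thesis unfolding PA_carrier by (rule conjI[OF finite_subset[OF 1 3] subset_trans[OF 1 2]])
  qed
  have "cl (?e F) \<odot>\<^bsub>M\<^esub> x = (\<Oplus>\<^bsub>M\<^esub>v\<in>F. ev v x)" if "finite F" "F \<subseteq> verts Q" for F
    using that
  proof (induction F)
    case empty
    have "?e {} = (\<lambda>_. 0)" by auto
    then show ?case using x by (simp add: cl_zero M.zero_smult)
  next
    case (insert v F)
    have eq: "(\<lambda>w. single (v, []) 1 w + ?e F w) = ?e (insert v F)"
      using insert.hyps by (auto simp: single_apply)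
    have "cl (single (v, []) 1) \<oplus>\<^bsub>\<Lambda>\<^esub> cl (?e F) = cl (\<lambda>w. single (v, []) 1 w + ?e F w)"
      by (rule cl_add) (use insert.prems c[of F] in \<open>auto simp: single_vert_carrier\<close>)
    then have "cl (?e (insert v F)) = vertex_idem Q I v \<oplus>\<^bsub>\<Lambda>\<^esub> cl (?e F)"
      unfolding eq vertex_idem_eq by (rule sym)
    moreover have "(\<lambda>v. ev v x) \<in> F \<rightarrow> carrier M" using insert.prems x by (auto simp: op_closed)
    ultimately show ?case
      using insert x c[of F] by (simp add: M.smult_l_distr vertex_closed cl_closed op_closed)
  qed
  from this[of "verts Q"] have "cl (?e (verts Q)) \<odot>\<^bsub>M\<^esub> x = (\<Oplus>\<^bsub>M\<^esub>v\<in>verts Q. ev v x)" by simp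
  moreover have "cl (?e (verts Q)) = \<one>\<^bsub>\<Lambda>\<^esub>" by (simp add: Lambda_one PA_simps)
  ultimately show ?thesis using x by (simp add: M.smult_one)
qed

lemma ev_cong_imp_eq:
  assumes "x \<in> carrier M" "y \<in> carrier M" "\<And>v. v \<in> verts Q \<Longrightarrow> ev v x = ev v y"
  shows "x = y"
proof -
  have "(\<Oplus>\<^bsub>M\<^esub>v\<in>verts Q. ev v x) = (\<Oplus>\<^bsub>M\<^esub>v\<in>verts Q. ev v y)"
    by (rule M.finsum_cong') (use assms op_closed in auto)
  then show ?thesis using assms by (simp add: sum_ev)
qed

definition "part v = ev v ` carrier M"

lemma part_iff: "v \<in> verts Q \<Longrightarrow> x \<in> part v \<longleftrightarrow> x \<in> carrier M \<and> ev v x = x"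
  unfolding part_def
proof
  assume v: "v \<in> verts Q" and "x \<in> ev v ` carrier M"
  then obtain y where "y \<in> carrier M" "x = ev v y" by blast
  then show "x \<in> carrier M \<and> ev v x = x" using v by (simp add: op_comp op_closed)
qed force

lemma kspace_vectorspace:
  assumes H: "H \<subseteq> carrier M" "\<zero>\<^bsub>M\<^esub> \<in> H" "\<And>x y. x \<in> H \<Longrightarrow> y \<in> H \<Longrightarrow> x \<oplus>\<^bsub>M\<^esub> y \<in> H"
    "\<And>c x. x \<in> H \<Longrightarrow> sc c x \<in> H"
  shows "vectorspace class_ring (kspace Q I M H)"
proof (rule vs_criteria[OF class_field])
  show "\<forall>v\<in>carrier (kspace Q I M H). \<exists>w\<in>carrier (kspace Q I M H).
      v \<oplus>\<^bsub>kspace Q I M H\<^esub> w = \<zero>\<^bsub>kspace Q I M H\<^esub>"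
  proof
    fix v assume "v \<in> carrier (kspace Q I M H)"
    then have v: "v \<in> H" by (simp add: kspace_def)
    have "v \<oplus>\<^bsub>M\<^esub> sc (-1) v = sc (1 + -1) v" using v H(1) by (subst sc_props(1)) (auto simp: sc_props(3))
    then have "v \<oplus>\<^bsub>M\<^esub> sc (-1) v = \<zero>\<^bsub>M\<^esub>" using v H(1) by (auto simp: sc_props(4))
    then show "\<exists>w\<in>carrier (kspace Q I M H). v \<oplus>\<^bsub>kspace Q I M H\<^esub> w = \<zero>\<^bsub>kspace Q I M H\<^esub>"
      using H(4)[OF v] by (auto simp: kspace_def)
  qed
qed (use H in \<open>auto simp: kspace_def subset_iff sc_props op_add M.a_ac\<close>)

lemma kspace_simps:
  "carrier (kspace Q I M H) = H" "add (kspace Q I M H) = add M" "zero (kspace Q I M H) = zero M"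
  "smult (kspace Q I M H) = (\<lambda>c x. sc c x)"
  by (simp_all add: kspace_def)

lemma part_vectorspace:
  assumes "v \<in> verts Q"
  shows "vectorspace class_ring (kspace Q I M (part v))"
  by (rule kspace_vectorspace) (use assms in \<open>auto simp: part_iff op_closed op_add op_zero op_sc\<close>)

lemma carrier_vectorspace: "vectorspace class_ring (kspace Q I M (carrier M))"
  by (rule kspace_vectorspace) (auto simp: op_closed)

lemma fd_module_iff:
  "fd_module Q I M \<longleftrightarrow> vectorspace.fin_dim class_ring (kspace Q I M (carrier M))"
  by (simp add: fd_module_def M.left_module_axioms)

lemma dimvec_part: "v \<in> verts Q \<Longrightarrow> dimvec Q I M v = vectorspace.dim class_ring (kspace Q I M (part v))"
  by (simp add: dimvec_def part_def)

text \<open>\<open>ev v\<close> maps the finite dimensional space \<open>M\<close> linearly onto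
  \<open>part v\<close>, which is therefore finite dimensional too and admits coordinates.\<close>

lemma part_coordinates:
  assumes fd: "fd_module Q I M" and v: "v \<in> verts Q" and n: "n = dimvec Q I M v"
  obtains \<phi> where "bij_betw \<phi> (carrier_vec n) (part v)"
    "\<And>u w. u \<in> carrier_vec n \<Longrightarrow> w \<in> carrier_vec n \<Longrightarrow> \<phi> (u + w) = \<phi> u \<oplus>\<^bsub>M\<^esub> \<phi> w"
    "\<And>c u. u \<in> carrier_vec n \<Longrightarrow> \<phi> (c \<cdot>\<^sub>v u) = sc c (\<phi> u)"
proof -
  define N where "N = vectorspace.dim class_ring (kspace Q I M (carrier M))"
  obtain \<psi> where \<psi>: "bij_betw \<psi> (carrier_vec N) (carrier M)"
    "\<And>u w. u \<in> carrier_vec N \<Longrightarrow> w \<in> carrier_vec N \<Longrightarrow> \<psi> (u + w) = \<psi> u \<oplus>\<^bsub>M\<^esub> \<psi> w"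
    "\<And>c u. u \<in> carrier_vec N \<Longrightarrow> \<psi> (c \<cdot>\<^sub>v u) = sc c (\<psi> u)"
    by (rule coordinates_exist[OF carrier_vectorspace fd[unfolded fd_module_iff] N_def, unfolded kspace_simps]) blast
  have \<psi>c: "\<psi> u \<in> carrier M" if "u \<in> carrier_vec N" for u using \<psi>(1) that by (auto simp: bij_betw_def)
  have "vectorspace.fin_dim class_ring (kspace Q I M (part v))"
  proof (rule fin_dim_of_surj[OF part_vectorspace[OF v], of "\<lambda>u. ev v (\<psi> u)" N])
    have "\<psi> ` carrier_vec N = carrier M" using \<psi>(1) by (simp add: bij_betw_def)
    moreover have "(\<lambda>u. ev v (\<psi> u)) ` carrier_vec N = ev v ` \<psi> ` carrier_vec N" by (simp add: image_image)
    ultimately show "(\<lambda>u. ev v (\<psi> u)) ` carrier_vec N = carrier (kspace Q I M (part v))"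
      by (simp add: kspace_def part_def)
  qed (use v \<psi>c in \<open>auto simp: kspace_def \<psi> op_add op_sc\<close>)
  then obtain \<phi> where "bij_betw \<phi> (carrier_vec n) (part v)"
    "\<And>u w. u \<in> carrier_vec n \<Longrightarrow> w \<in> carrier_vec n \<Longrightarrow> \<phi> (u + w) = \<phi> u \<oplus>\<^bsub>M\<^esub> \<phi> w"
    "\<And>c u. u \<in> carrier_vec n \<Longrightarrow> \<phi> (c \<cdot>\<^sub>v u) = sc c (\<phi> u)"
    by (rule coordinates_exist[OF part_vectorspace[OF v] _ n[unfolded dimvec_part[OF v]], unfolded kspace_simps]) blast
  then show ?thesis by (rule that)
qed

subsection \<open>The socle\<close>

lemma radical_annihilates:
  assumes x: "x \<in> carrier M" "\<And>a. a \<in> arcs Q \<Longrightarrow> ar a x = \<zero>\<^bsub>M\<^esub>" and C: "C \<in> jacobson_radical \<Lambda>"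
  shows "C \<odot>\<^bsub>M\<^esub> x = \<zero>\<^bsub>M\<^esub>"
  using C
  by (rule radical_induct)
     (use x in \<open>auto simp: M.zero_smult M.smult_assoc M.smult_l_distr scalar_closed arrow_closed op_zero\<close>)

text \<open>The radical is a right ideal: an arrow times any algebra element lies in the radical
  again, and the radical kills every element killed by all arrows.\<close>

lemma ann_submodule: "Module.submodule {x \<in> carrier M. \<forall>a\<in>arcs Q. ar a x = \<zero>\<^bsub>M\<^esub>} \<Lambda> M"
proof (rule M.lsubmoduleI)
  fix C x assume C: "C \<in> carrier \<Lambda>" and x: "x \<in> {x \<in> carrier M. \<forall>a\<in>arcs Q. ar a x = \<zero>\<^bsub>M\<^esub>}"
  have "ar a (C \<odot>\<^bsub>M\<^esub> x) = \<zero>\<^bsub>M\<^esub>" if a: "a \<in> arcs Q" for a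
  proof -
    have "ar a (C \<odot>\<^bsub>M\<^esub> x) = (arrow_cl a \<otimes>\<^bsub>\<Lambda>\<^esub> C) \<odot>\<^bsub>M\<^esub> x"
      using C x a by (simp add: M.smult_assoc arrow_closed)
    also have "\<dots> = \<zero>\<^bsub>M\<^esub>"
      by (rule radical_annihilates) (use x radical_right_ideal[OF arrow_radical[OF a] C] in auto)
    finally show ?thesis .
  qed
  then show "C \<odot>\<^bsub>M\<^esub> x \<in> {x \<in> carrier M. \<forall>a\<in>arcs Q. ar a x = \<zero>\<^bsub>M\<^esub>}"
    using C x by (auto simp: M.smult_closed)
qed (auto simp: op_add op_zero)

text \<open>The elements of \<open>S\<close> killed by all arrows form a submodule of
  \<open>S\<close>, which is zero or everything. If it is zero, it still contains
  \<open>ar a s\<close>, since arrows compose to zero; so \<open>ar a s\<close> vanishes in both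
  cases.\<close>

lemma simple_submodule_annihilated:
  assumes S: "Module.submodule S \<Lambda> M" "simple_module \<Lambda> (M\<lparr>carrier := S\<rparr>)" and s: "s \<in> S"
    and a: "a \<in> arcs Q"
  shows "ar a s = \<zero>\<^bsub>M\<^esub>"
proof -
  note Ss = M.lsubmoduleD[OF S(1)]
  interpret S: left_module \<Lambda> "M\<lparr>carrier := S\<rparr>" using S(2) by (simp add: simple_module_def)
  let ?N = "{x \<in> S. \<forall>a\<in>arcs Q. ar a x = \<zero>\<^bsub>M\<^esub>}"
  have "Module.submodule ?N \<Lambda> (M\<lparr>carrier := S\<rparr>)"
    by (rule S.lsubmoduleI)
       (use Ss M.lsubmoduleD[OF ann_submodule] in \<open>auto simp: subset_iff op_zero\<close>)
  then have "?N = {\<zero>\<^bsub>M\<^esub>} \<or> ?N = S" using S(2) by (simp add: simple_module_def)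
  then show ?thesis
  proof
    assume z: "?N = {\<zero>\<^bsub>M\<^esub>}"
    have "ar a s \<in> ?N" using s a Ss by (auto simp: arrow_closed op_comp subset_iff)
    then show ?thesis using z by blast
  qed (use s a in blast)
qed

text \<open>Arrows kill \<open>x\<close>, and a vertex idempotent fixes or kills it, so the line
  through \<open>x\<close> is stable under the generators. It is simple because any non-zero
  multiple of \<open>x\<close> gives back \<open>x\<close>.\<close>

lemma line_simple:
  assumes v: "v \<in> verts Q" and x: "x \<in> part v" "x \<noteq> \<zero>\<^bsub>M\<^esub>" and ann: "\<And>a. a \<in> arcs Q \<Longrightarrow> ar a x = \<zero>\<^bsub>M\<^esub>"
  shows "Module.submodule {sc c x | c. True} \<Lambda> M" "simple_module \<Lambda> (M\<lparr>carrier := {sc c x | c. True}\<rparr>)"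
proof -
  let ?S = "{sc c x | c. True}"
  have xc: "x \<in> carrier M" and ex: "ev v x = x" using x(1) v by (auto simp: part_iff)
  have zS: "\<zero>\<^bsub>M\<^esub> \<in> ?S" using sc_props(4)[OF xc] by (metis (mono_tags, lifting) mem_Collect_eq)
  have addS: "y \<oplus>\<^bsub>M\<^esub> z \<in> ?S" if "y \<in> ?S" "z \<in> ?S" for y z
    using that sc_props(1)[OF xc] by (auto intro: exI[of _ "_ + _"])
  have ewx: "ev w x = (if w = v then x else \<zero>\<^bsub>M\<^esub>)" if "w \<in> verts Q" for w
    using op_comp(1)[OF xc that v] ex by (cases "w = v") auto
  have smultS: "\<forall>y\<in>?S. C \<odot>\<^bsub>M\<^esub> y \<in> ?S" if "C \<in> carrier \<Lambda>" for C
    using that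
  proof (rule Lambda_induct)
    show "\<forall>y\<in>?S. sc c y \<in> ?S" for c using sc_props(2)[OF xc, of c] by auto (metis)
    show "\<forall>y\<in>?S. ev w y \<in> ?S" if "w \<in> verts Q" for w
    proof
      fix y assume "y \<in> ?S"
      then obtain c where "y = sc c x" by blast
      then have "ev w y = sc c (if w = v then x else \<zero>\<^bsub>M\<^esub>)" using that xc by (simp add: op_sc ewx)
      then show "ev w y \<in> ?S" using zS by (cases "w = v") (auto simp: op_zero)
    qed
    show "\<forall>y\<in>?S. ar a y \<in> ?S" if "a \<in> arcs Q" for a
    proof
      fix y assume "y \<in> ?S"
      then have "ar a y = \<zero>\<^bsub>M\<^esub>" using that xc by (auto simp: op_sc ann op_zero)
      then show "ar a y \<in> ?S" using zS by simp
    qed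
    show "\<forall>y\<in>?S. (C \<oplus>\<^bsub>\<Lambda>\<^esub> D) \<odot>\<^bsub>M\<^esub> y \<in> ?S"
      if "C \<in> carrier \<Lambda>" "D \<in> carrier \<Lambda>" "\<forall>y\<in>?S. C \<odot>\<^bsub>M\<^esub> y \<in> ?S" "\<forall>y\<in>?S. D \<odot>\<^bsub>M\<^esub> y \<in> ?S" for C D
    proof
      fix y assume y: "y \<in> ?S"
      then have "y \<in> carrier M" using xc op_closed(1) by auto
      then show "(C \<oplus>\<^bsub>\<Lambda>\<^esub> D) \<odot>\<^bsub>M\<^esub> y \<in> ?S"
        using that y addS[of "C \<odot>\<^bsub>M\<^esub> y" "D \<odot>\<^bsub>M\<^esub> y"] by (simp only: M.smult_l_distr)
    qed
    show "\<forall>y\<in>?S. (C \<otimes>\<^bsub>\<Lambda>\<^esub> D) \<odot>\<^bsub>M\<^esub> y \<in> ?S"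
      if "C \<in> carrier \<Lambda>" "D \<in> carrier \<Lambda>" "\<forall>y\<in>?S. C \<odot>\<^bsub>M\<^esub> y \<in> ?S" "\<forall>y\<in>?S. D \<odot>\<^bsub>M\<^esub> y \<in> ?S" for C D
    proof
      fix y assume y: "y \<in> ?S"
      then have "y \<in> carrier M" using xc op_closed(1) by auto
      then show "(C \<otimes>\<^bsub>\<Lambda>\<^esub> D) \<odot>\<^bsub>M\<^esub> y \<in> ?S" using that y by (simp only: M.smult_assoc)
    qed
  qed
  show sub: "Module.submodule ?S \<Lambda> M"
    by (rule M.lsubmoduleI) (use xc op_closed(1) zS addS smultS in blast)+
  have xS: "x \<in> ?S" using sc_props(3)[OF xc] by (metis (mono_tags, lifting) mem_Collect_eq)
  have lm: "left_module \<Lambda> (M\<lparr>carrier := ?S\<rparr>)" by (rule M.submodule_left_module[OF sub])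
  interpret S: left_module \<Lambda> "M\<lparr>carrier := ?S\<rparr>" by (rule lm)
  show "simple_module \<Lambda> (M\<lparr>carrier := ?S\<rparr>)"
    unfolding simple_module_def
  proof (intro conjI allI impI lm)
    show "carrier (M\<lparr>carrier := ?S\<rparr>) \<noteq> {\<zero>\<^bsub>M\<lparr>carrier := ?S\<rparr>\<^esub>}"
    proof
      assume "carrier (M\<lparr>carrier := ?S\<rparr>) = {\<zero>\<^bsub>M\<lparr>carrier := ?S\<rparr>\<^esub>}"
      then have "?S = {\<zero>\<^bsub>M\<^esub>}" by simp
      then show False using xS x(2) by blast
    qed
    fix N assume "Module.submodule N \<Lambda> (M\<lparr>carrier := ?S\<rparr>)"
    note N0 = S.lsubmoduleD[OF this]
    have N: "N \<subseteq> ?S" "\<zero>\<^bsub>M\<^esub> \<in> N" "\<And>C y. C \<in> carrier \<Lambda> \<Longrightarrow> y \<in> N \<Longrightarrow> C \<odot>\<^bsub>M\<^esub> y \<in> N"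
      using N0 by auto
    have "N = {\<zero>\<^bsub>M\<^esub>} \<or> N = ?S"
    proof (rule disjCI)
      assume "N \<noteq> ?S"
      have "y = \<zero>\<^bsub>M\<^esub>" if y: "y \<in> N" for y
      proof (rule ccontr)
        assume nz: "y \<noteq> \<zero>\<^bsub>M\<^esub>"
        obtain c where c: "y = sc c x" using y N(1) by blast
        then have "c \<noteq> 0" using nz sc_props(4)[OF xc] by auto
        then have "x = sc (1 / c) y" using c sc_props(2)[OF xc, of "1 / c" c] sc_props(3)[OF xc] by simp
        then have "x \<in> N" using N(3)[OF scalar_closed y] by metis
        then have "?S \<subseteq> N" using N(3)[OF scalar_closed] by blast
        then show False using \<open>N \<noteq> ?S\<close> N(1) by blast
      qed
      then show "N = {\<zero>\<^bsub>M\<^esub>}" using N(2) by blast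
    qed
    then show "N = {\<zero>\<^bsub>M\<lparr>carrier := ?S\<rparr>\<^esub>} \<or> N = carrier (M\<lparr>carrier := ?S\<rparr>)" by simp
  qed
qed

text \<open>Simple submodules are killed by the arrows. Conversely the components
  \<open>ev v x\<close> of an element killed by the arrows are zero or span simple lines, and
  \<open>x\<close> is their sum.\<close>

lemma soc_carrier: "carrier (soc \<Lambda> M) = {x \<in> carrier M. \<forall>a\<in>arcs Q. ar a x = \<zero>\<^bsub>M\<^esub>}"
proof -
  let ?A = "{x \<in> carrier M. \<forall>a\<in>arcs Q. ar a x = \<zero>\<^bsub>M\<^esub>}"
  let ?U = "\<Union>{S. Module.submodule S \<Lambda> M \<and> simple_module \<Lambda> (M\<lparr>carrier := S\<rparr>)}"
  have UA: "?U \<subseteq> ?A" using simple_submodule_annihilated M.lsubmoduleD(1) by blast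
  have Uc: "?U \<subseteq> carrier M" using UA by blast
  have 1: "gen_submodule \<Lambda> M ?U \<subseteq> ?A" by (rule M.gen_submodule_least[OF ann_submodule UA])
  note G = M.lsubmoduleD[OF M.gen_submodule_submodule[OF Uc]]
  have "?A \<subseteq> gen_submodule \<Lambda> M ?U"
  proof
    fix x assume x: "x \<in> ?A"
    have e: "ev v x \<in> gen_submodule \<Lambda> M ?U" if v: "v \<in> verts Q" for v
    proof (cases "ev v x = \<zero>\<^bsub>M\<^esub>")
      case True
      then show ?thesis using G(2) by simp
    next
      case False
      have p: "ev v x \<in> part v" using x by (auto simp: part_def)
      have a: "ar a (ev v x) = \<zero>\<^bsub>M\<^esub>" if "a \<in> arcs Q" for a
        using x v that by (simp add: op_comp)
      have "ev v x \<in> {sc c (ev v x) | c. True}"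
        using sc_props(3)[of "ev v x"] p v by (metis (mono_tags, lifting) mem_Collect_eq part_iff)
      then have "ev v x \<in> ?U" using line_simple[OF v p False a] by blast
      then show ?thesis by (rule subsetD[OF M.gen_submodule_subset])
    qed
    have "finite F \<Longrightarrow> F \<subseteq> verts Q \<Longrightarrow> (\<Oplus>\<^bsub>M\<^esub>v\<in>F. ev v x) \<in> gen_submodule \<Lambda> M ?U" for F
    proof (induction F rule: finite_induct)
      case empty
      then show ?case using G(2) by simp
    next
      case (insert v F)
      have "(\<lambda>v. ev v x) \<in> F \<rightarrow> carrier M" "ev v x \<in> carrier M" using insert.prems x by (auto simp: op_closed)
      then show ?case using insert G(3) e by simp
    qed
    from this[of "verts Q"] show "x \<in> gen_submodule \<Lambda> M ?U" using x by (simp add: sum_ev)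
  qed
  then show ?thesis using 1 by (simp add: soc_def)
qed

lemma soc_left_module: "left_module \<Lambda> (soc \<Lambda> M)"
proof -
  have "soc \<Lambda> M = M\<lparr>carrier := carrier (soc \<Lambda> M)\<rparr>" by (simp add: soc_def)
  then show ?thesis unfolding soc_carrier using M.submodule_left_module[OF ann_submodule] by metis
qed

lemma soc_ops: "add (soc \<Lambda> M) = add M" "zero (soc \<Lambda> M) = zero M" "smult (soc \<Lambda> M) = smult M"
  by (simp_all add: soc_def)

lemma semisimple_iff: "semisimple \<Lambda> M \<longleftrightarrow> (\<forall>x\<in>carrier M. \<forall>a\<in>arcs Q. ar a x = \<zero>\<^bsub>M\<^esub>)"
  unfolding semisimple_def soc_carrier using M.left_module_axioms by auto

end

context rsz_algebra
begin

subsection \<open>The modules given by points of the representation variety\<close>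

text \<open>What \<open>elem_act\<close> reduces to when paths of length at least two act as zero:
  coordinate \<open>k\<close> of the result at the vertex \<open>v\<close>.\<close>

definition rep_act ::
  "('v \<Rightarrow> nat) \<Rightarrow> ('e \<Rightarrow> 'k mat) \<Rightarrow> (('v, 'e) path \<Rightarrow> 'k) \<Rightarrow> ('v \<Rightarrow> 'k vec) \<Rightarrow> 'v \<Rightarrow> nat \<Rightarrow> 'k" where
  "rep_act d x f m v k = f (v, []) * m v $ k +
     (\<Sum>a | a \<in> arcs Q \<and> head Q a = v. f (tail Q a, [a]) * (x a *\<^sub>v m (tail Q a)) $ k)"

text \<open>The last two arrows of the path already compose to zero.\<close>

lemma path_map_zero:
  assumes x: "x \<in> sq_zero_reps Q d"
  shows "awalk u p v \<Longrightarrow> 2 \<le> length p \<Longrightarrow> path_map Q d x u p = 0\<^sub>m (d v) (d u)"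
proof (induction p arbitrary: u)
  case Nil
  then show ?case by simp
next
  case (Cons a p)
  have xa: "x \<in> rep_ambient Q d" using x by (simp add: sq_zero_reps_def)
  have a: "a \<in> arcs Q" "tail Q a = u" "awalk (head Q a) p v" using Cons.prems by (auto simp: awalk_Cons_iff)
  have xac: "x a \<in> carrier_mat (d (head Q a)) (d u)" using rep_ambient_carrier[OF xa a(1)] a(2) by simp
  show ?case
  proof (cases "2 \<le> length p")
    case True
    then show ?thesis using Cons.IH[OF a(3)] xac by simp
  next
    case False
    then have "length p = 1" using Cons.prems by simp
    then obtain b where p: "p = [b]" by (cases p) auto
    have b: "b \<in> arcs Q" "tail Q b = head Q a" "head Q b = v" using a(3) p by (auto simp: awalk_Cons_iff awalk_Nil_iff)
    have "x b \<in> carrier_mat (d v) (d (head Q a))" using rep_ambient_carrier[OF xa b(1)] b by simp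
    then have "path_map Q d x u (a # p) = x b * x a" using b p by simp
    also have "\<dots> = 0\<^sub>m (d v) (d u)" using x a b by (auto simp: sq_zero_reps_def)
    finally show ?thesis .
  qed
qed

text \<open>The trivial path and the arrows from \<open>u\<close> to \<open>v\<close> survive in the
  sum; a loop counts as an arrow beside the trivial path.\<close>

lemma elem_map_entry:
  assumes x: "x \<in> sq_zero_reps Q d" and f: "f \<in> carrier PA" and u: "u \<in> verts Q" and v: "v \<in> verts Q"
    and ij: "i < d v" "j < d u"
  shows "elem_map Q d x f u v $$ (i, j) = (if u = v \<and> i = j then f (v, []) else 0) +
    (\<Sum>a | a \<in> arcs Q \<and> tail Q a = u \<and> head Q a = v. f (tail Q a, [a]) * x a $$ (i, j))"
proof -
  have xa: "x \<in> rep_ambient Q d" using x by (simp add: sq_zero_reps_def)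
  let ?S = "{p. awalk u p v \<and> f (u, p) \<noteq> 0}"
  let ?g = "\<lambda>p. f (u, p) * path_map Q d x u p $$ (i, j)"
  let ?A = "{a \<in> arcs Q. tail Q a = u \<and> head Q a = v}"
  \<comment> \<open>\<open>?T\<close> consists of the paths from \<open>u\<close> to
    \<open>v\<close> with fewer than two arrows. The sum passes from \<open>?S\<close> to
    \<open>?T\<close> through their intersection: longer paths act as zero, and \<open>f\<close>
    vanishes on the rest of \<open>?T\<close>.\<close>
  let ?T = "(if u = v then {[]} else {}) \<union> (\<lambda>a. [a]) ` ?A"
  have "(\<lambda>p. (u, p)) ` ?S \<subseteq> {w. f w \<noteq> 0}" by auto
  then have "finite ((\<lambda>p. (u, p)) ` ?S)" using f finite_subset by (auto simp: PA_carrier)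
  then have finS: "finite ?S" by (rule finite_imageD) (auto intro: inj_onI)
  have finA: "finite ?A" by simp
  have T: "awalk u p v \<and> length p < 2 \<longleftrightarrow> p \<in> ?T" for p
    using u v by (cases p; cases "tl p") (auto simp: awalk_Nil_iff awalk_Cons_iff)
  have "(\<Sum>p\<in>?S. ?g p) = (\<Sum>p\<in>?S \<inter> ?T. ?g p)"
  proof (rule sum.mono_neutral_right[OF finS])
    show "\<forall>p\<in>?S - ?S \<inter> ?T. ?g p = 0"
    proof
      fix p assume "p \<in> ?S - ?S \<inter> ?T"
      then have "awalk u p v" "2 \<le> length p" using T[of p] by auto
      from path_map_zero[OF x this] show "?g p = 0" using ij by simp
    qed
  qed auto
  also have "\<dots> = (\<Sum>p\<in>?T. ?g p)"
  proof (rule sum.mono_neutral_left)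
    show "\<forall>p\<in>?T - ?S \<inter> ?T. ?g p = 0"
    proof
      fix p assume "p \<in> ?T - ?S \<inter> ?T"
      then have p: "p \<in> ?T" "p \<notin> ?S" by blast+
      have "awalk u p v" using T[of p] p(1) by (simp only: simp_thms)
      then have "f (u, p) = 0" using p(2) by simp
      then show "?g p = 0" by simp
    qed
  qed (use finA in auto)
  also have "\<dots> = (\<Sum>p\<in>(if u = v then {[]} else {}). ?g p) + (\<Sum>p\<in>(\<lambda>a. [a]) ` ?A. ?g p)"
    by (rule sum.union_disjoint) (use finA in auto)
  also have "(\<Sum>p\<in>(if u = v then {[]} else {}). ?g p) = (if u = v \<and> i = j then f (v, []) else 0)"
    using ij by auto
  also have "(\<Sum>p\<in>(\<lambda>a. [a]) ` ?A. ?g p) = (\<Sum>a\<in>?A. ?g [a])"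
    by (subst sum.reindex) (auto intro: inj_onI)
  also have "\<dots> = (\<Sum>a\<in>?A. f (tail Q a, [a]) * x a $$ (i, j))"
    by (rule sum.cong) (auto simp: left_mult_one_mat[OF rep_ambient_carrier[OF xa]])
  finally show ?thesis using ij by (simp add: elem_map_def)
qed

lemma elem_act_eq:
  assumes x: "x \<in> sq_zero_reps Q d" and f: "f \<in> carrier PA"
    and m: "\<And>v. v \<in> verts Q \<Longrightarrow> m v \<in> carrier_vec (d v)"
  shows "elem_act Q d x f m = (\<lambda>v\<in>verts Q. vec (d v) (rep_act d x f m v))"
  unfolding elem_act_def
proof (rule restrict_ext)
  fix v assume v: "v \<in> verts Q"
  have xa: "x \<in> rep_ambient Q d" using x by (simp add: sq_zero_reps_def)
  show "vec (d v) (\<lambda>k. \<Sum>u\<in>verts Q. (elem_map Q d x f u v *\<^sub>v m u) $ k) = vec (d v) (rep_act d x f m v)"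
  proof (rule eq_vecI)
    fix k assume "k < dim_vec (vec (d v) (rep_act d x f m v))"
    then have k: "k < d v" by simp
    let ?A = "\<lambda>u. {a. a \<in> arcs Q \<and> tail Q a = u \<and> head Q a = v}"
    have row: "(elem_map Q d x f u v *\<^sub>v m u) $ k = (if u = v then f (v, []) * m v $ k else 0) +
      (\<Sum>a\<in>?A u. f (tail Q a, [a]) * (x a *\<^sub>v m (tail Q a)) $ k)" if u: "u \<in> verts Q" for u
    proof -
      have "(elem_map Q d x f u v *\<^sub>v m u) $ k = (\<Sum>j<d u. elem_map Q d x f u v $$ (k, j) * m u $ j)"
        using m[OF u] k by (simp add: elem_map_def scalar_prod_def atLeast0LessThan)
      also have "\<dots> = (\<Sum>j<d u. (if u = v \<and> k = j then f (v, []) else 0) * m u $ j +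
          (\<Sum>a\<in>?A u. f (tail Q a, [a]) * (x a $$ (k, j) * m u $ j)))"
        by (rule sum.cong)
           (use elem_map_entry[OF x f u v k] in \<open>auto simp: distrib_right sum_distrib_right mult.assoc\<close>)
      also have "\<dots> = (\<Sum>j<d u. (if u = v \<and> k = j then f (v, []) else 0) * m u $ j) +
          (\<Sum>a\<in>?A u. f (tail Q a, [a]) * (\<Sum>j<d u. x a $$ (k, j) * m u $ j))"
        by (simp add: sum.distrib sum_distrib_left sum.swap[of _ "?A u"])
      also have "(\<Sum>j<d u. (if u = v \<and> k = j then f (v, []) else 0) * m u $ j) =
          (if u = v then f (v, []) * m v $ k else 0)"
        using k by (cases "u = v") (auto simp: if_distrib[of "\<lambda>c. c * _"] cong: if_cong)
      also have "(\<Sum>a\<in>?A u. f (tail Q a, [a]) * (\<Sum>j<d u. x a $$ (k, j) * m u $ j)) =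
          (\<Sum>a\<in>?A u. f (tail Q a, [a]) * (x a *\<^sub>v m (tail Q a)) $ k)"
      proof (rule sum.cong[OF refl])
        fix a assume a: "a \<in> ?A u"
        then have "x a \<in> carrier_mat (d v) (d u)" using rep_ambient_carrier[OF xa, of a] by auto
        then show "f (tail Q a, [a]) * (\<Sum>j<d u. x a $$ (k, j) * m u $ j) =
            f (tail Q a, [a]) * (x a *\<^sub>v m (tail Q a)) $ k"
          using a k m[OF u] by (simp add: scalar_prod_def atLeast0LessThan)
      qed
      finally show ?thesis .
    qed
    have "(\<Sum>u\<in>verts Q. (elem_map Q d x f u v *\<^sub>v m u) $ k) =
      (\<Sum>u\<in>verts Q. (if u = v then f (v, []) * m v $ k else 0)) +
      (\<Sum>u\<in>verts Q. \<Sum>a\<in>?A u. f (tail Q a, [a]) * (x a *\<^sub>v m (tail Q a)) $ k)"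
      by (simp add: row sum.distrib)
    also have "(\<Sum>u\<in>verts Q. (if u = v then f (v, []) * m v $ k else 0)) = f (v, []) * m v $ k"
      using v by simp
    \<comment> \<open>Grouping arrows by their source runs exactly once through all arrows that end
      in \<open>v\<close>.\<close>
    also have "(\<Sum>u\<in>verts Q. \<Sum>a\<in>?A u. f (tail Q a, [a]) * (x a *\<^sub>v m (tail Q a)) $ k) =
        (\<Sum>a\<in>(\<Union>u\<in>verts Q. ?A u). f (tail Q a, [a]) * (x a *\<^sub>v m (tail Q a)) $ k)"
      by (rule sum.UNION_disjoint[symmetric]) auto
    also have "(\<Union>u\<in>verts Q. ?A u) = {a. a \<in> arcs Q \<and> head Q a = v}" by auto
    finally show "vec (d v) (\<lambda>k. \<Sum>u\<in>verts Q. (elem_map Q d x f u v *\<^sub>v m u) $ k) $ k =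
        vec (d v) (rep_act d x f m v) $ k"
      using k by (simp add: rep_act_def)
  qed simp
qed

text \<open>For one inclusion the relations are tested on the path \<open>[a, b]\<close>, which acts
  as \<open>x b * x a\<close>. For the other, elements of \<open>I\<close> have no coefficients at
  trivial paths and arrows, the places where \<open>elem_map_entry\<close> reads them.\<close>

lemma Rep_eq: "Rep Q I d = sq_zero_reps Q d"
proof (intro equalityI subsetI)
  fix x :: "'e \<Rightarrow> 'k mat" assume x: "x \<in> Rep Q I d"
  then have xa: "x \<in> rep_ambient Q d" by (simp add: Rep_def)
  have "x b * x a = 0\<^sub>m (d (head Q b)) (d (tail Q a))" if ab: "a \<in> arcs Q" "b \<in> arcs Q" "head Q a = tail Q b" for a b
  proof -
    let ?f = "single (tail Q a, [a, b]) (1 :: 'k)"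
    have path: "(tail Q a, [a, b]) \<in> paths Q" using ab by (simp add: paths_Cons paths_Nil)
    have "?f \<in> I" unfolding I_eq using single_carrier[OF path, of 1] by (auto simp: arrow_ideal_pow_def single_apply)
    then have "elem_map Q d x ?f (tail Q a) (head Q b) = 0\<^sub>m (d (head Q b)) (d (tail Q a))"
      using x ab by (auto simp: Rep_def)
    moreover have "elem_map Q d x ?f (tail Q a) (head Q b) = x b * x a"
    proof -
      have S: "{p. awalk (tail Q a) p (head Q b) \<and> ?f (tail Q a, p) \<noteq> 0} = {[a, b]}"
        using ab by (auto simp: single_apply awalk_Cons_iff awalk_Nil_iff)
      have p: "path_map Q d x (tail Q a) [a, b] = x b * x a"
        using rep_ambient_carrier[OF xa ab(2)] by simp
      have "elem_map Q d x ?f (tail Q a) (head Q b) =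
        mat (d (head Q b)) (d (tail Q a)) (\<lambda>(i, j). (x b * x a) $$ (i, j))"
        unfolding elem_map_def S by (simp only: p[symmetric]) (simp add: single_apply)
      also have "\<dots> = x b * x a"
        using rep_ambient_carrier[OF xa ab(2)] rep_ambient_carrier[OF xa ab(1)]
        by (intro eq_matI) (auto simp del: index_mult_mat(1))
      finally show ?thesis .
    qed
    ultimately show ?thesis by simp
  qed
  then show "x \<in> sq_zero_reps Q d" using xa by (simp add: sq_zero_reps_def)
next
  fix x :: "'e \<Rightarrow> 'k mat" assume x: "x \<in> sq_zero_reps Q d"
  have "elem_map Q d x f u v = 0\<^sub>m (d v) (d u)" if f: "f \<in> I" and uv: "u \<in> verts Q" "v \<in> verts Q" for f u v
  proof (rule eq_matI)
    have f2: "f \<in> arrow_ideal_pow Q 2" using f I_eq by simp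
    then have fc: "f \<in> carrier PA" by (simp add: arrow_ideal_pow_def)
    have z: "f (w, []) = 0" "f (w, [a]) = 0" for w a
      using f2 by (simp_all add: arrow_ideal_pow_def)
    fix i j assume "i < dim_row (0\<^sub>m (d v) (d u))" "j < dim_col (0\<^sub>m (d v) (d u))"
    then show "elem_map Q d x f u v $$ (i, j) = 0\<^sub>m (d v) (d u) $$ (i, j)"
      by (simp add: elem_map_entry[OF x fc uv] z)
  qed (simp_all add: elem_map_def)
  then show "x \<in> Rep Q I d" using x by (auto simp: Rep_def sq_zero_reps_def)
qed

section \<open>The module of a point\<close>

lemma rep_module_simps:
  "carrier (rep_module Q d x) = (\<Pi>\<^sub>E i\<in>verts Q. carrier_vec (d i))"
  "zero (rep_module Q d x) = (\<lambda>i\<in>verts Q. 0\<^sub>v (d i))"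
  "add (rep_module Q d x) m m' = (\<lambda>i\<in>verts Q. m i + m' i)"
  by (simp_all add: rep_module_def)

lemma rep_module_carrier_iff:
  "m \<in> carrier (rep_module Q d x) \<longleftrightarrow> (\<forall>v\<in>verts Q. m v \<in> carrier_vec (d v)) \<and> m \<in> extensional (verts Q)"
  by (auto simp: rep_module_simps PiE_def Pi_def)

lemma rep_module_eqI:
  assumes "m \<in> carrier (rep_module Q d x)" "m' \<in> carrier (rep_module Q d x)"
    "\<And>v k. v \<in> verts Q \<Longrightarrow> k < d v \<Longrightarrow> m v $ k = m' v $ k"
  shows "m = m'"
proof (rule extensionalityI[of _ "verts Q"])
  fix v assume v: "v \<in> verts Q"
  then have "m v \<in> carrier_vec (d v)" "m' v \<in> carrier_vec (d v)" using assms by (auto simp: rep_module_carrier_iff)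
  then show "m v = m' v" using assms(3)[OF v] by (intro eq_vecI) auto
qed (use assms in \<open>auto simp: rep_module_carrier_iff\<close>)

lemma rep_act_cong:
  assumes "\<And>u. f (u, []) = g (u, [])" "\<And>u a. f (u, [a]) = g (u, [a])"
  shows "rep_act d x f m v = rep_act d x g m v"
  unfolding rep_act_def using assms by simp

text \<open>Two representatives of a class agree on trivial paths and arrows. They act alike, so the
  image of the coset is a singleton and \<open>the_elem\<close> returns the common value.\<close>

lemma rep_module_smult:
  assumes x: "x \<in> sq_zero_reps Q d" and f: "f \<in> carrier PA" and m: "m \<in> carrier (rep_module Q d x)"
  shows "cl f \<odot>\<^bsub>rep_module Q d x\<^esub> m = (\<lambda>v\<in>verts Q. vec (d v) (rep_act d x f m v))"
proof -
  have "elem_act Q d x g m = (\<lambda>v\<in>verts Q. vec (d v) (rep_act d x f m v))" if g: "g \<in> cl f" for g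
  proof -
    have gc: "g \<in> carrier PA"
      using g f PA.a_r_coset_subset_G[OF PA.a_subset f] by blast
    have "cl g = cl f" using PA.a_repr_independence[OF g f PA.a_subgroup] by simp
    then have "rep_act d x g m v = rep_act d x f m v" for v
      using cl_eqD[OF gc f] by (intro rep_act_cong) auto
    moreover have "elem_act Q d x g m = (\<lambda>v\<in>verts Q. vec (d v) (rep_act d x g m v))"
      by (rule elem_act_eq[OF x gc]) (use m in \<open>auto simp: rep_module_carrier_iff\<close>)
    ultimately show ?thesis by simp
  qed
  moreover have "cl f \<noteq> {}" using PA.a_rcos_self[OF f] by blast
  ultimately have "(\<lambda>g. elem_act Q d x g m) ` cl f = {\<lambda>v\<in>verts Q. vec (d v) (rep_act d x f m v)}"
    by (auto simp: image_iff)
  then show ?thesis by (simp add: rep_module_def)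
qed

text \<open>All identities are compared coordinate by coordinate. The relations enter through
  associativity: an arrow applied after \<open>g\<close> sees the trivial-path part of
  \<open>g\<close> alone, because arrows compose to zero.\<close>

lemma rep_module_left_module:
  assumes x: "x \<in> sq_zero_reps Q d"
  shows "left_module \<Lambda> (rep_module Q d x)"
proof -
  let ?N = "rep_module Q d x"
  have xa: "x \<in> rep_ambient Q d" using x by (simp add: sq_zero_reps_def)
  have zero: "\<zero>\<^bsub>?N\<^esub> \<in> carrier ?N" by (auto simp: rep_module_simps)
  have add: "m \<oplus>\<^bsub>?N\<^esub> m' \<in> carrier ?N" if "m \<in> carrier ?N" "m' \<in> carrier ?N" for m m'
    using that by (auto simp: rep_module_carrier_iff rep_module_simps(2,3))
  have add_apply: "(m \<oplus>\<^bsub>?N\<^esub> m') v $ k = m v $ k + m' v $ k"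
    if "m \<in> carrier ?N" "m' \<in> carrier ?N" "v \<in> verts Q" "k < d v" for m m' v k
    using that by (auto simp: rep_module_carrier_iff rep_module_simps(2,3))
  have smult_closed: "C \<odot>\<^bsub>?N\<^esub> m \<in> carrier ?N" if "C \<in> carrier \<Lambda>" "m \<in> carrier ?N" for C m
  proof -
    obtain f where "f \<in> carrier PA" "C = cl f" using \<open>C \<in> carrier \<Lambda>\<close> by (auto simp: Lambda_carrier)
    then show ?thesis using rep_module_smult[OF x _ \<open>m \<in> carrier ?N\<close>, of f] by (auto simp: rep_module_simps)
  qed
  have smult_apply: "(cl f \<odot>\<^bsub>?N\<^esub> m) v $ k = rep_act d x f m v k"
    if "f \<in> carrier PA" "m \<in> carrier ?N" "v \<in> verts Q" "k < d v" for f m v k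
    using rep_module_smult[OF x that(1,2)] that by simp
  have xm: "(x a *\<^sub>v m (tail Q a)) $ k = (\<Sum>j<d (tail Q a). x a $$ (k, j) * m (tail Q a) $ j)"
    if "a \<in> arcs Q" "k < d (head Q a)" "m \<in> carrier ?N" for a k m
    using rep_ambient_carrier[OF xa that(1)] that
    by (auto simp: rep_module_carrier_iff scalar_prod_def atLeast0LessThan tail_in_verts
        intro!: sum.cong dest!: bspec[of _ _ "tail Q a"])
  have act_add: "rep_act d x f (m \<oplus>\<^bsub>?N\<^esub> m') v k = rep_act d x f m v k + rep_act d x f m' v k"
    if m: "m \<in> carrier ?N" "m' \<in> carrier ?N" and v: "v \<in> verts Q" "k < d v" for f m m' v k
  proof -
    have "(x a *\<^sub>v (m \<oplus>\<^bsub>?N\<^esub> m') (tail Q a)) $ k = (x a *\<^sub>v m (tail Q a)) $ k + (x a *\<^sub>v m' (tail Q a)) $ k"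
      if "a \<in> arcs Q" "head Q a = v" for a
      using that v m add[OF m]
      by (simp add: xm add_apply tail_in_verts distrib_left sum.distrib)
    then show ?thesis
      using m v unfolding rep_act_def by (simp add: add_apply distrib_left sum.distrib)
  qed
  have act_mult: "rep_act d x (f \<otimes>\<^bsub>PA\<^esub> g) m v k = rep_act d x f (cl g \<odot>\<^bsub>?N\<^esub> m) v k"
    if fg: "f \<in> carrier PA" "g \<in> carrier PA" and m: "m \<in> carrier ?N" and v: "v \<in> verts Q" "k < d v" for f g m v k
  proof -
    have gm: "cl g \<odot>\<^bsub>?N\<^esub> m \<in> carrier ?N" using smult_closed cl_closed fg(2) m by blast
    have xg: "(x a *\<^sub>v (cl g \<odot>\<^bsub>?N\<^esub> m) (tail Q a)) $ k = g (tail Q a, []) * (x a *\<^sub>v m (tail Q a)) $ k"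
      if a: "a \<in> arcs Q" "head Q a = v" for a
    proof -
      let ?t = "tail Q a"
      have t: "?t \<in> verts Q" using a by simp
      have kh: "k < d (head Q a)" using a v by simp
      have zero: "(\<Sum>j<d ?t. x a $$ (k, j) * (x b *\<^sub>v m (tail Q b)) $ j) = 0"
        if b: "b \<in> arcs Q" "head Q b = ?t" for b
      proof -
        have bc: "x b \<in> carrier_mat (d ?t) (d (tail Q b))" using rep_ambient_carrier[OF xa b(1)] b by simp
        have ac: "x a \<in> carrier_mat (d (head Q a)) (d ?t)" by (rule rep_ambient_carrier[OF xa a(1)])
        have mb: "m (tail Q b) \<in> carrier_vec (d (tail Q b))" using m b by (auto simp: rep_module_carrier_iff)
        have "(\<Sum>j<d ?t. x a $$ (k, j) * (x b *\<^sub>v m (tail Q b)) $ j) = (x a *\<^sub>v (x b *\<^sub>v m (tail Q b))) $ k"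
          using ac bc kh by (simp add: scalar_prod_def atLeast0LessThan)
        also have "x a *\<^sub>v (x b *\<^sub>v m (tail Q b)) = (x a * x b) *\<^sub>v m (tail Q b)"
          by (rule assoc_mult_mat_vec[symmetric, OF ac bc mb])
        also have "x a * x b = 0\<^sub>m (d (head Q a)) (d (tail Q b))" using x a b by (auto simp: sq_zero_reps_def)
        finally show ?thesis using kh mb by (simp add: scalar_prod_def)
      qed
      have "(x a *\<^sub>v (cl g \<odot>\<^bsub>?N\<^esub> m) ?t) $ k = (\<Sum>j<d ?t. x a $$ (k, j) * rep_act d x g m ?t j)"
        using a kh gm fg m t by (simp add: xm smult_apply)
      also have "\<dots> = (\<Sum>j<d ?t. g (?t, []) * (x a $$ (k, j) * m ?t $ j) +
          (\<Sum>b | b \<in> arcs Q \<and> head Q b = ?t. g (tail Q b, [b]) * (x a $$ (k, j) * (x b *\<^sub>v m (tail Q b)) $ j)))"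
        unfolding rep_act_def by (intro sum.cong) (auto simp: distrib_left sum_distrib_left ac_simps)
      also have "\<dots> = g (?t, []) * (\<Sum>j<d ?t. x a $$ (k, j) * m ?t $ j) +
          (\<Sum>b | b \<in> arcs Q \<and> head Q b = ?t. g (tail Q b, [b]) * (\<Sum>j<d ?t. x a $$ (k, j) * (x b *\<^sub>v m (tail Q b)) $ j))"
        by (simp add: sum.distrib sum_distrib_left sum.swap[of _ "{b. b \<in> arcs Q \<and> head Q b = ?t}"])
      also have "\<dots> = g (?t, []) * (x a *\<^sub>v m ?t) $ k"
        using zero a kh m by (simp add: xm)
      finally show ?thesis .
    qed
    have "rep_act d x f (cl g \<odot>\<^bsub>?N\<^esub> m) v k = f (v, []) * rep_act d x g m v k +
        (\<Sum>a | a \<in> arcs Q \<and> head Q a = v. f (tail Q a, [a]) * (g (tail Q a, []) * (x a *\<^sub>v m (tail Q a)) $ k))"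
      unfolding rep_act_def[of d x f "cl g \<odot>\<^bsub>?N\<^esub> m"] using fg m v by (simp add: smult_apply xg)
    also have "\<dots> = rep_act d x (f \<otimes>\<^bsub>PA\<^esub> g) m v k"
      unfolding rep_act_def
      by (simp add: PA_mult_Nil PA_mult_arc distrib_left distrib_right sum.distrib sum_distrib_left ac_simps)
    finally show ?thesis by simp
  qed
  show ?thesis
  proof (intro left_module.intro left_module_axioms.intro Lambda_ring abelian_groupI)
    show "m \<oplus>\<^bsub>?N\<^esub> m' \<oplus>\<^bsub>?N\<^esub> m'' = m \<oplus>\<^bsub>?N\<^esub> (m' \<oplus>\<^bsub>?N\<^esub> m'')"
      if "m \<in> carrier ?N" "m' \<in> carrier ?N" "m'' \<in> carrier ?N" for m m' m''
      by (rule rep_module_eqI) (use that in \<open>auto intro!: add simp: add_apply add\<close>)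
    show "m \<oplus>\<^bsub>?N\<^esub> m' = m' \<oplus>\<^bsub>?N\<^esub> m" if "m \<in> carrier ?N" "m' \<in> carrier ?N" for m m'
      by (rule rep_module_eqI) (use that in \<open>auto intro!: add simp: add_apply\<close>)
    show "\<zero>\<^bsub>?N\<^esub> \<oplus>\<^bsub>?N\<^esub> m = m" if "m \<in> carrier ?N" for m
      by (rule rep_module_eqI) (use that zero in \<open>auto intro!: add simp: add_apply rep_module_simps(2)\<close>)
    show "\<exists>m'\<in>carrier ?N. m' \<oplus>\<^bsub>?N\<^esub> m = \<zero>\<^bsub>?N\<^esub>" if m: "m \<in> carrier ?N" for m
    proof
      show c: "(\<lambda>v\<in>verts Q. - m v) \<in> carrier ?N" using m by (auto simp: rep_module_carrier_iff)
      show "(\<lambda>v\<in>verts Q. - m v) \<oplus>\<^bsub>?N\<^esub> m = \<zero>\<^bsub>?N\<^esub>"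
      proof (rule rep_module_eqI[OF add[OF c m] zero])
        fix v k assume v: "v \<in> verts Q" "k < d v"
        then have "dim_vec (m v) = d v" using m by (auto simp: rep_module_carrier_iff)
        then show "((\<lambda>v\<in>verts Q. - m v) \<oplus>\<^bsub>?N\<^esub> m) v $ k = \<zero>\<^bsub>?N\<^esub> v $ k"
          using v by (simp add: add_apply[OF c m] rep_module_simps(2))
      qed
    qed
    show "(C \<oplus>\<^bsub>\<Lambda>\<^esub> D) \<odot>\<^bsub>?N\<^esub> m = C \<odot>\<^bsub>?N\<^esub> m \<oplus>\<^bsub>?N\<^esub> D \<odot>\<^bsub>?N\<^esub> m"
      if CD: "C \<in> carrier \<Lambda>" "D \<in> carrier \<Lambda>" and m: "m \<in> carrier ?N" for C D m
    proof -
      obtain f g where fg: "f \<in> carrier PA" "C = cl f" "g \<in> carrier PA" "D = cl g"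
        using CD by (auto simp: Lambda_carrier)
      have fg': "(\<lambda>w. f w + g w) \<in> carrier PA" using PA.a_closed[OF fg(1,3)] by (simp add: PA_simps)
      show ?thesis
      proof (rule rep_module_eqI)
        fix v k assume v: "v \<in> verts Q" "k < d v"
        have "((C \<oplus>\<^bsub>\<Lambda>\<^esub> D) \<odot>\<^bsub>?N\<^esub> m) v $ k = rep_act d x (\<lambda>w. f w + g w) m v k"
          using fg fg' m v by (simp add: cl_add smult_apply)
        also have "\<dots> = rep_act d x f m v k + rep_act d x g m v k"
          unfolding rep_act_def by (simp add: distrib_right sum.distrib)
        also have "\<dots> = (C \<odot>\<^bsub>?N\<^esub> m \<oplus>\<^bsub>?N\<^esub> D \<odot>\<^bsub>?N\<^esub> m) v $ k"
          using fg m v CD by (simp add: add_apply smult_closed smult_apply)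
        finally show "((C \<oplus>\<^bsub>\<Lambda>\<^esub> D) \<odot>\<^bsub>?N\<^esub> m) v $ k = (C \<odot>\<^bsub>?N\<^esub> m \<oplus>\<^bsub>?N\<^esub> D \<odot>\<^bsub>?N\<^esub> m) v $ k" .
      qed (use CD m in \<open>auto intro!: smult_closed add\<close>)
    qed
    show "C \<odot>\<^bsub>?N\<^esub> (m \<oplus>\<^bsub>?N\<^esub> m') = C \<odot>\<^bsub>?N\<^esub> m \<oplus>\<^bsub>?N\<^esub> C \<odot>\<^bsub>?N\<^esub> m'"
      if C: "C \<in> carrier \<Lambda>" and m: "m \<in> carrier ?N" "m' \<in> carrier ?N" for C m m'
    proof -
      obtain f where f: "f \<in> carrier PA" "C = cl f" using C by (auto simp: Lambda_carrier)
      show ?thesis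
        by (rule rep_module_eqI)
           (use f C m in \<open>auto intro!: smult_closed add simp: smult_apply add_apply smult_closed add act_add\<close>)
    qed
    show "(C \<otimes>\<^bsub>\<Lambda>\<^esub> D) \<odot>\<^bsub>?N\<^esub> m = C \<odot>\<^bsub>?N\<^esub> (D \<odot>\<^bsub>?N\<^esub> m)"
      if CD: "C \<in> carrier \<Lambda>" "D \<in> carrier \<Lambda>" and m: "m \<in> carrier ?N" for C D m
    proof -
      obtain f g where fg: "f \<in> carrier PA" "C = cl f" "g \<in> carrier PA" "D = cl g"
        using CD by (auto simp: Lambda_carrier)
      show ?thesis
      proof (rule rep_module_eqI)
        fix v k assume v: "v \<in> verts Q" "k < d v"
        show "((C \<otimes>\<^bsub>\<Lambda>\<^esub> D) \<odot>\<^bsub>?N\<^esub> m) v $ k = (C \<odot>\<^bsub>?N\<^esub> (D \<odot>\<^bsub>?N\<^esub> m)) v $ k"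
          using fg m v CD smult_closed[OF CD(2) m] by (simp add: cl_mult smult_apply act_mult)
      qed (use CD m in \<open>auto intro!: smult_closed\<close>)
    qed
    show "\<one>\<^bsub>\<Lambda>\<^esub> \<odot>\<^bsub>?N\<^esub> m = m" if m: "m \<in> carrier ?N" for m
    proof (rule rep_module_eqI[OF _ m])
      fix v k assume v: "v \<in> verts Q" "k < d v"
      have "(\<one>\<^bsub>\<Lambda>\<^esub> \<odot>\<^bsub>?N\<^esub> m) v $ k = rep_act d x \<one>\<^bsub>PA\<^esub> m v k"
        unfolding Lambda_one using m v by (intro smult_apply) auto
      then show "(\<one>\<^bsub>\<Lambda>\<^esub> \<odot>\<^bsub>?N\<^esub> m) v $ k = m v $ k" using v by (simp add: rep_act_def PA_one_apply)
    qed (use m in \<open>auto intro!: smult_closed\<close>)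
  qed (use zero add smult_closed in auto)
qed

lemma rep_module_ops:
  assumes x: "x \<in> sq_zero_reps Q d" and m: "m \<in> carrier (rep_module Q d x)"
  shows "scalar Q I c \<odot>\<^bsub>rep_module Q d x\<^esub> m = (\<lambda>v\<in>verts Q. c \<cdot>\<^sub>v m v)"
    "w \<in> verts Q \<Longrightarrow> vertex_idem Q I w \<odot>\<^bsub>rep_module Q d x\<^esub> m = (\<lambda>v\<in>verts Q. if v = w then m v else 0\<^sub>v (d v))"
    "a \<in> arcs Q \<Longrightarrow> arrow_cl a \<odot>\<^bsub>rep_module Q d x\<^esub> m =
      (\<lambda>v\<in>verts Q. if v = head Q a then x a *\<^sub>v m (tail Q a) else 0\<^sub>v (d v))"
proof -
  have xa: "x \<in> rep_ambient Q d" using x by (simp add: sq_zero_reps_def)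
  have mv: "m v \<in> carrier_vec (d v)" if "v \<in> verts Q" for v using m that by (simp add: rep_module_carrier_iff)
  show "scalar Q I c \<odot>\<^bsub>rep_module Q d x\<^esub> m = (\<lambda>v\<in>verts Q. c \<cdot>\<^sub>v m v)"
    unfolding scalar_def rep_module_smult[OF x one_carrier m]
    by (rule restrict_ext, rule eq_vecI) (auto simp: rep_act_def PA_one_apply mv[THEN carrier_vecD])
  show "vertex_idem Q I w \<odot>\<^bsub>rep_module Q d x\<^esub> m = (\<lambda>v\<in>verts Q. if v = w then m v else 0\<^sub>v (d v))"
    if "w \<in> verts Q"
    unfolding vertex_idem_eq rep_module_smult[OF x single_vert_carrier[OF that] m]
    by (rule restrict_ext, rule eq_vecI) (auto simp: rep_act_def single_apply mv[THEN carrier_vecD])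
  show "arrow_cl a \<odot>\<^bsub>rep_module Q d x\<^esub> m =
      (\<lambda>v\<in>verts Q. if v = head Q a then x a *\<^sub>v m (tail Q a) else 0\<^sub>v (d v))" if a: "a \<in> arcs Q"
    unfolding rep_module_smult[OF x single_arc_carrier[OF a] m]
  proof (rule restrict_ext, rule eq_vecI)
    fix v k assume v: "v \<in> verts Q" "k < dim_vec (if v = head Q a then x a *\<^sub>v m (tail Q a) else 0\<^sub>v (d v))"
    then have k: "k < d v" using rep_ambient_carrier[OF xa a] by (auto split: if_splits)
    have "rep_act d x (single (tail Q a, [a]) 1) m v k =
      (\<Sum>b | b \<in> arcs Q \<and> head Q b = v. if b = a then (x b *\<^sub>v m (tail Q b)) $ k else 0)"
    proof -
      have z: "single (tail Q a, [a]) 1 (v, []) = (0 :: 'k)" by (simp add: single_apply)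
      show ?thesis
        unfolding rep_act_def z mult_zero_left add_0
        by (rule sum.cong[OF refl]) (simp add: single_apply)
    qed
    also have "\<dots> = (if v = head Q a then (x a *\<^sub>v m (tail Q a)) $ k else 0)"
      using a by (subst sum.delta) auto
    finally show "vec (d v) (rep_act d x (single (tail Q a, [a]) 1) m v) $ k =
      (if v = head Q a then x a *\<^sub>v m (tail Q a) else 0\<^sub>v (d v)) $ k" using k by simp
  qed (use rep_ambient_carrier[OF xa a] in auto)
qed

end

lemma mult_mat_unit_vec:
  fixes A :: "'k::field mat"
  assumes "A \<in> carrier_mat m n" "j < n"
  shows "A *\<^sub>v unit_vec n j = col A j"
  using assms by (intro eq_vecI) (auto simp: scalar_prod_right_unit)

context rsz_module
begin

lemma submodule_of_parts:
  assumes N: "Module.submodule N \<Lambda> M" and x: "x \<in> carrier M" "\<And>v. v \<in> verts Q \<Longrightarrow> ev v x \<in> N"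
  shows "x \<in> N"
proof -
  note G = M.lsubmoduleD[OF N]
  have "finite F \<Longrightarrow> F \<subseteq> verts Q \<Longrightarrow> (\<Oplus>\<^bsub>M\<^esub>v\<in>F. ev v x) \<in> N" for F
  proof (induction F rule: finite_induct)
    case empty
    then show ?case using G(2) by simp
  next
    case (insert v F)
    have "(\<lambda>v. ev v x) \<in> F \<rightarrow> carrier M" "ev v x \<in> carrier M" using insert.prems x by (auto simp: op_closed)
    then show ?case using insert G(3) x(2) by simp
  qed
  from this[of "verts Q"] show ?thesis using x by (simp add: sum_ev)
qed

end

section \<open>From modules to points of the variety\<close>

context rsz_algebra
begin

lemma rsz_moduleI: "left_module \<Lambda> M \<Longrightarrow> rsz_module Q I M"
  by (intro rsz_module.intro rsz_algebra_axioms)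

definition vertex_vec :: "('v \<Rightarrow> nat) \<Rightarrow> 'v \<Rightarrow> 'k vec \<Rightarrow> 'v \<Rightarrow> 'k vec" where
  "vertex_vec d v u = (\<lambda>w\<in>verts Q. if w = v then u else 0\<^sub>v (d w))"

lemma vertex_vec_closed: "u \<in> carrier_vec (d v) \<Longrightarrow> vertex_vec d v u \<in> carrier (rep_module Q d x)"
  by (auto simp: vertex_vec_def rep_module_carrier_iff)

lemma vertex_vec_add:
  "u \<in> carrier_vec (d v) \<Longrightarrow> u' \<in> carrier_vec (d v) \<Longrightarrow>
    vertex_vec d v (u + u') = vertex_vec d v u \<oplus>\<^bsub>rep_module Q d x\<^esub> vertex_vec d v u'"
  by (auto simp: vertex_vec_def rep_module_simps)

lemma vertex_vec_smult:
  assumes "x \<in> sq_zero_reps Q d" "u \<in> carrier_vec (d v)"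
  shows "vertex_vec d v (c \<cdot>\<^sub>v u) = scalar Q I c \<odot>\<^bsub>rep_module Q d x\<^esub> vertex_vec d v u"
  unfolding rep_module_ops(1)[OF assms(1) vertex_vec_closed[of u d v x, OF assms(2)]]
  by (rule restrict_ext[of "verts Q", THEN trans[OF vertex_vec_def]]) (auto simp: vertex_vec_def)

lemma vertex_act_eq:
  assumes "x \<in> sq_zero_reps Q d" "m \<in> carrier (rep_module Q d x)" "v \<in> verts Q"
  shows "vertex_idem Q I v \<odot>\<^bsub>rep_module Q d x\<^esub> m = vertex_vec d v (m v)"
  using assms by (auto simp: rep_module_ops vertex_vec_def)

text \<open>The coordinates of the vertex \<open>v\<close> occupy a block starting at
  \<open>idx v * D\<close>. All blocks have the same length \<open>D\<close>, the sum of the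
  \<open>d v\<close> and so at least each of them; surplus coordinates are ignored, which keeps
  \<open>\<sigma>\<close> onto though in general not injective.\<close>

lemma rep_module_fd_surj:
  fixes x :: "'e \<Rightarrow> 'k mat"
  obtains N \<sigma> where "\<sigma> ` carrier_vec N = carrier (rep_module Q d x)"
    "\<And>u u'. u \<in> carrier_vec N \<Longrightarrow> u' \<in> carrier_vec N \<Longrightarrow> \<sigma> (u + u') = \<sigma> u \<oplus>\<^bsub>rep_module Q d x\<^esub> \<sigma> u'"
    "\<And>c u. u \<in> carrier_vec N \<Longrightarrow> \<sigma> (c \<cdot>\<^sub>v u) = (\<lambda>v\<in>verts Q. c \<cdot>\<^sub>v \<sigma> u v)"
proof -
  define D where "D = (\<Sum>v\<in>verts Q. d v)"
  have dD: "d v \<le> D" if "v \<in> verts Q" for v unfolding D_def using that by (intro member_le_sum) auto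
  obtain e where e: "bij_betw e {0..<card (verts Q)} (verts Q)"
    using ex_bij_betw_nat_finite[OF finite_verts] by blast
  define idx where "idx = inv_into {0..<card (verts Q)} e"
  have idx: "idx v < card (verts Q)" "e (idx v) = v" if "v \<in> verts Q" for v
    using bij_betw_inv_into[OF e] bij_betw_inv_into_right[OF e] that by (auto simp: idx_def bij_betw_def)
  define N where "N = card (verts Q) * D"
  have bound: "idx v * D + j < N" if "v \<in> verts Q" "j < d v" for v j
  proof -
    have "idx v * D + j < Suc (idx v) * D" using dD[OF that(1)] that(2) by simp
    also have "\<dots> \<le> N" unfolding N_def using idx(1)[OF that(1)] by (intro mult_le_mono1) simp
    finally show ?thesis .
  qed
  define \<sigma> where "\<sigma> u = (\<lambda>v\<in>verts Q. vec (d v) (\<lambda>j. u $ (idx v * D + j)))" for u :: "'k vec"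
  show ?thesis
  proof (rule that[of \<sigma> N])
    show "\<sigma> ` carrier_vec N = carrier (rep_module Q d x)"
    proof (intro equalityI subsetI)
      fix m assume m: "m \<in> carrier (rep_module Q d x)"
      define u where "u = vec N (\<lambda>l. m (e (l div D)) $ (l mod D))"
      have "m = \<sigma> u"
      proof (rule rep_module_eqI[OF m])
        show "\<sigma> u \<in> carrier (rep_module Q d x)" by (auto simp: \<sigma>_def rep_module_carrier_iff)
        fix v k assume v: "v \<in> verts Q" "k < d v"
        then have "k < D" using dD by fastforce
        then have "(idx v * D + k) div D = idx v" "(idx v * D + k) mod D = k" by auto
        then show "m v $ k = \<sigma> u v $ k" using v bound idx by (simp add: \<sigma>_def u_def)
      qed
      then show "m \<in> \<sigma> ` carrier_vec N" by (auto simp: u_def)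
    qed (auto simp: \<sigma>_def rep_module_carrier_iff)
    show "\<sigma> (u + u') = \<sigma> u \<oplus>\<^bsub>rep_module Q d x\<^esub> \<sigma> u'"
      if "u \<in> carrier_vec N" "u' \<in> carrier_vec N" for u u'
      using that bound by (auto simp: \<sigma>_def rep_module_simps intro!: restrict_ext eq_vecI)
    show "\<sigma> (c \<cdot>\<^sub>v u) = (\<lambda>v\<in>verts Q. c \<cdot>\<^sub>v \<sigma> u v)" if "u \<in> carrier_vec N" for c u
      using that bound by (auto simp: \<sigma>_def intro!: restrict_ext eq_vecI)
  qed
qed

text \<open>\<open>vertex_vec\<close> followed by the isomorphism gives coordinates of
  \<open>part v\<close>. Outside the vertices \<open>dimvec\<close> is zero by convention, which
  \<open>d\<close> has to match.\<close>

lemma dimvec_of_isomorphic: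
  assumes M: "left_module \<Lambda> M" and x: "x \<in> sq_zero_reps Q d" and d: "\<And>v. v \<notin> verts Q \<Longrightarrow> d v = 0"
    and iso: "mod_isomorphic \<Lambda> M (rep_module Q d x)"
  shows "fd_module Q I M" "dimvec Q I M = d"
proof -
  interpret rsz_module Q I M by (rule rsz_moduleI[OF M])
  let ?N = "rep_module Q d x"
  have N: "left_module \<Lambda> ?N" by (rule rep_module_left_module[OF x])
  obtain \<psi> where \<psi>: "\<psi> \<in> module_hom \<Lambda> ?N M" "bij_betw \<psi> (carrier ?N) (carrier M)"
    using mod_isomorphic_sym[OF M iso] by (auto simp: mod_isomorphic_def)
  note h = module_homD[OF \<psi>(1)]
  obtain n \<sigma> where \<sigma>: "\<sigma> ` carrier_vec n = carrier ?N"
    "\<And>u u'. u \<in> carrier_vec n \<Longrightarrow> u' \<in> carrier_vec n \<Longrightarrow> \<sigma> (u + u') = \<sigma> u \<oplus>\<^bsub>?N\<^esub> \<sigma> u'"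
    "\<And>c u. u \<in> carrier_vec n \<Longrightarrow> \<sigma> (c \<cdot>\<^sub>v u) = (\<lambda>v\<in>verts Q. c \<cdot>\<^sub>v \<sigma> u v)"
    by (rule rep_module_fd_surj[of d x]) blast
  have \<sigma>c: "\<sigma> u \<in> carrier ?N" if "u \<in> carrier_vec n" for u using \<sigma>(1) that by blast
  show "fd_module Q I M"
    unfolding fd_module_iff
  proof (rule fin_dim_of_surj[OF carrier_vectorspace, of "\<lambda>u. \<psi> (\<sigma> u)" n])
    have "(\<lambda>u. \<psi> (\<sigma> u)) ` carrier_vec n = \<psi> ` \<sigma> ` carrier_vec n" by (simp add: image_image)
    then show "(\<lambda>u. \<psi> (\<sigma> u)) ` carrier_vec n = carrier (kspace Q I M (carrier M))"
      using \<sigma>(1) \<psi>(2) by (simp add: kspace_simps bij_betw_def)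
    fix u u' :: "'k vec" and c assume u: "u \<in> carrier_vec n" "u' \<in> carrier_vec n"
    then show "\<psi> (\<sigma> (u + u')) = \<psi> (\<sigma> u) \<oplus>\<^bsub>kspace Q I M (carrier M)\<^esub> \<psi> (\<sigma> u')"
      by (simp add: kspace_simps \<sigma> h \<sigma>c)
  next
    fix c and u :: "'k vec" assume u: "u \<in> carrier_vec n"
    have "\<sigma> (c \<cdot>\<^sub>v u) = scalar Q I c \<odot>\<^bsub>?N\<^esub> \<sigma> u" using u by (simp add: \<sigma>(3) rep_module_ops(1)[OF x \<sigma>c])
    then show "\<psi> (\<sigma> (c \<cdot>\<^sub>v u)) = c \<odot>\<^bsub>kspace Q I M (carrier M)\<^esub> \<psi> (\<sigma> u)"
      using u by (simp add: kspace_simps h scalar_closed \<sigma>c)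
  qed
  show "dimvec Q I M = d"
  proof
    fix v
    show "dimvec Q I M v = d v"
    proof (cases "v \<in> verts Q")
      case False
      then show ?thesis using d by (simp add: dimvec_def)
    next
      case v: True
      have c: "vertex_vec d v u \<in> carrier ?N" if "u \<in> carrier_vec (d v)" for u
        using that by (rule vertex_vec_closed)
      have ev: "ev v (\<psi> m) = \<psi> (vertex_vec d v (m v))" if "m \<in> carrier ?N" for m
        using that v by (simp add: h(3)[symmetric] vertex_closed vertex_act_eq[OF x])
      have "vectorspace.dim class_ring (kspace Q I M (part v)) = d v"
      proof (rule dim_of_coordinates[OF part_vectorspace[OF v], of "\<lambda>u. \<psi> (vertex_vec d v u)"])
        show "bij_betw (\<lambda>u. \<psi> (vertex_vec d v u)) (carrier_vec (d v)) (carrier (kspace Q I M (part v)))"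
          unfolding bij_betw_def kspace_simps
        proof
          show "inj_on (\<lambda>u. \<psi> (vertex_vec d v u)) (carrier_vec (d v))"
          proof (rule inj_onI)
            fix u u' assume u: "u \<in> carrier_vec (d v)" "u' \<in> carrier_vec (d v)"
              "\<psi> (vertex_vec d v u) = \<psi> (vertex_vec d v u')"
            then have "vertex_vec d v u = vertex_vec d v u'"
              using \<psi>(2) c by (auto simp: bij_betw_def inj_on_def)
            then have "vertex_vec d v u v = vertex_vec d v u' v" by simp
            then show "u = u'" using v by (simp add: vertex_vec_def)
          qed
          show "(\<lambda>u. \<psi> (vertex_vec d v u)) ` carrier_vec (d v) = part v"
          proof (intro equalityI subsetI)
            fix y assume "y \<in> (\<lambda>u. \<psi> (vertex_vec d v u)) ` carrier_vec (d v)"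
            then obtain u where u: "u \<in> carrier_vec (d v)" "y = \<psi> (vertex_vec d v u)" by blast
            have "vertex_vec d v u v = u" using v by (simp add: vertex_vec_def)
            then show "y \<in> part v" using u ev[OF c[OF u(1)]] h(1)[OF c[OF u(1)]] v by (simp add: part_iff)
          next
            fix y assume "y \<in> part v"
            then obtain z where z: "z \<in> carrier M" "y = ev v z" by (auto simp: part_def)
            then obtain m where m: "m \<in> carrier ?N" "z = \<psi> m" using \<psi>(2) by (auto simp: bij_betw_def)
            have "m v \<in> carrier_vec (d v)" using m v by (simp add: rep_module_carrier_iff)
            moreover have "y = \<psi> (vertex_vec d v (m v))" using z m ev by simp
            ultimately show "y \<in> (\<lambda>u. \<psi> (vertex_vec d v u)) ` carrier_vec (d v)" by blast
          qed
        qed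
      qed (use c in \<open>auto simp: kspace_simps vertex_vec_add[where x = x] vertex_vec_smult[OF x] h scalar_closed\<close>)
      then show ?thesis using v by (simp add: dimvec_part)
    qed
  qed
qed

text \<open>Choosing bases of the spaces \<open>e\<^sub>v M\<close> turns \<open>M\<close> into a point of the representation variety.\<close>

lemma exists_isomorphic_rep_module:
  assumes fd: "fd_module Q I M" and d: "dimvec Q I M = d"
  obtains x where "x \<in> sq_zero_reps Q d" "mod_isomorphic \<Lambda> M (rep_module Q d x)"
proof -
  have M: "left_module \<Lambda> M" using fd by (simp add: fd_module_def)
  interpret rsz_module Q I M by (rule rsz_moduleI[OF M])
  have "\<forall>v. \<exists>\<phi>. v \<in> verts Q \<longrightarrow> bij_betw \<phi> (carrier_vec (d v)) (part v) \<and>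
    (\<forall>u w. u \<in> carrier_vec (d v) \<longrightarrow> w \<in> carrier_vec (d v) \<longrightarrow> \<phi> (u + w) = \<phi> u \<oplus>\<^bsub>M\<^esub> \<phi> w) \<and>
    (\<forall>c u. u \<in> carrier_vec (d v) \<longrightarrow> \<phi> (c \<cdot>\<^sub>v u) = sc c (\<phi> u))"
  proof
    fix v
    show "\<exists>\<phi>. v \<in> verts Q \<longrightarrow> bij_betw \<phi> (carrier_vec (d v)) (part v) \<and>
      (\<forall>u w. u \<in> carrier_vec (d v) \<longrightarrow> w \<in> carrier_vec (d v) \<longrightarrow> \<phi> (u + w) = \<phi> u \<oplus>\<^bsub>M\<^esub> \<phi> w) \<and>
      (\<forall>c u. u \<in> carrier_vec (d v) \<longrightarrow> \<phi> (c \<cdot>\<^sub>v u) = sc c (\<phi> u))"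
    proof (cases "v \<in> verts Q")
      case True
      show ?thesis
        by (rule part_coordinates[OF fd True, of "d v"]) (use d in auto)
    qed simp
  qed
  from choice[OF this] obtain \<phi> where \<phi>0: "\<forall>v. v \<in> verts Q \<longrightarrow> bij_betw (\<phi> v) (carrier_vec (d v)) (part v) \<and>
    (\<forall>u w. u \<in> carrier_vec (d v) \<longrightarrow> w \<in> carrier_vec (d v) \<longrightarrow> \<phi> v (u + w) = \<phi> v u \<oplus>\<^bsub>M\<^esub> \<phi> v w) \<and>
    (\<forall>c u. u \<in> carrier_vec (d v) \<longrightarrow> \<phi> v (c \<cdot>\<^sub>v u) = sc c (\<phi> v u))" by blast
  have \<phi>b: "bij_betw (\<phi> v) (carrier_vec (d v)) (part v)" if "v \<in> verts Q" for v using \<phi>0 that by blast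
  have \<phi>add: "\<phi> v (u + w) = \<phi> v u \<oplus>\<^bsub>M\<^esub> \<phi> v w"
    if "v \<in> verts Q" "u \<in> carrier_vec (d v)" "w \<in> carrier_vec (d v)" for v u w using \<phi>0 that by blast
  have \<phi>sc: "\<phi> v (c \<cdot>\<^sub>v u) = sc c (\<phi> v u)" if "v \<in> verts Q" "u \<in> carrier_vec (d v)" for v c u
    using \<phi>0 that by blast
  define \<psi> where "\<psi> v = inv_into (carrier_vec (d v)) (\<phi> v)" for v
  have \<phi>p: "\<phi> v u \<in> part v" if "v \<in> verts Q" "u \<in> carrier_vec (d v)" for v u
    using \<phi>b[OF that(1)] that(2) by (auto simp: bij_betw_def)
  have \<psi>c: "\<psi> v y \<in> carrier_vec (d v)" and \<phi>\<psi>: "\<phi> v (\<psi> v y) = y" if "v \<in> verts Q" "y \<in> part v" for v y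
    using bij_betw_inv_into[OF \<phi>b[OF that(1)]] bij_betw_inv_into_right[OF \<phi>b[OF that(1)]] that(2)
    by (auto simp: \<psi>_def bij_betw_def)
  have \<psi>\<phi>: "\<psi> v (\<phi> v u) = u" if "v \<in> verts Q" "u \<in> carrier_vec (d v)" for v u
    using bij_betw_inv_into_left[OF \<phi>b[OF that(1)]] that(2) by (simp add: \<psi>_def)
  have \<psi>add: "\<psi> v (y \<oplus>\<^bsub>M\<^esub> z) = \<psi> v y + \<psi> v z" if "v \<in> verts Q" "y \<in> part v" "z \<in> part v" for v y z
    using \<psi>\<phi>[OF that(1), of "\<psi> v y + \<psi> v z"] that by (simp add: \<phi>add \<psi>c \<phi>\<psi>)
  have \<psi>sc: "\<psi> v (sc c y) = c \<cdot>\<^sub>v \<psi> v y" if "v \<in> verts Q" "y \<in> part v" for v c y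
    using \<psi>\<phi>[OF that(1), of "c \<cdot>\<^sub>v \<psi> v y"] that by (simp add: \<phi>sc \<psi>c \<phi>\<psi>)
  have z0: "\<psi> v \<zero>\<^bsub>M\<^esub> = 0\<^sub>v (d v)" if "v \<in> verts Q" for v
  proof -
    have p: "\<zero>\<^bsub>M\<^esub> \<in> part v" using that by (simp add: part_iff op_zero)
    have "\<psi> v (sc 0 \<zero>\<^bsub>M\<^esub>) = 0 \<cdot>\<^sub>v \<psi> v \<zero>\<^bsub>M\<^esub>" by (rule \<psi>sc[OF that p])
    then have "\<psi> v \<zero>\<^bsub>M\<^esub> = 0 \<cdot>\<^sub>v \<psi> v \<zero>\<^bsub>M\<^esub>" by (simp only: op_zero(1))
    also have "\<dots> = 0\<^sub>v (d v)" using \<psi>c[OF that p] by (intro eq_vecI) auto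
    finally show ?thesis .
  qed
  have pc: "y \<in> carrier M" if "v \<in> verts Q" "y \<in> part v" for v y using that by (simp add: part_iff)
  have arp: "ar a y \<in> part (head Q a)" if "a \<in> arcs Q" "y \<in> carrier M" for a y
    using that by (simp add: part_iff op_closed op_comp)
  have evp: "ev v y \<in> part v" if "y \<in> carrier M" for v y using that by (simp add: part_def)
  \<comment> \<open>\<open>F a\<close> is the action of the arrow in the chosen coordinates, and
    \<open>x a\<close> is its matrix.\<close>
  define F where "F a u = \<psi> (head Q a) (ar a (\<phi> (tail Q a) u))" for a u
  define x where "x = (\<lambda>a\<in>arcs Q. mat (d (head Q a)) (d (tail Q a))
    (\<lambda>(i, j). F a (unit_vec (d (tail Q a)) j) $ i))"
  have Fc: "F a u \<in> carrier_vec (d (head Q a))" if "a \<in> arcs Q" "u \<in> carrier_vec (d (tail Q a))" for a u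
    unfolding F_def using that by (auto intro!: \<psi>c arp pc[OF _ \<phi>p])
  have xF: "x a *\<^sub>v u = F a u" if a: "a \<in> arcs Q" and u: "u \<in> carrier_vec (d (tail Q a))" for a u
  proof -
    have t: "tail Q a \<in> verts Q" "head Q a \<in> verts Q" using a by auto
    have "F a u = mat (d (head Q a)) (d (tail Q a)) (\<lambda>(i, j). F a (unit_vec (d (tail Q a)) j) $ i) *\<^sub>v u"
    proof (rule linear_fun_eq_mult_mat_vec[OF Fc[OF a] _ _ u])
      fix w w' :: "'k vec" assume w: "w \<in> carrier_vec (d (tail Q a))" "w' \<in> carrier_vec (d (tail Q a))"
      note p = pc[OF t(1) \<phi>p[OF t(1) w(1)]] pc[OF t(1) \<phi>p[OF t(1) w(2)]]
      show "F a (w + w') = F a w + F a w'"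
        unfolding F_def using a w p by (simp add: \<phi>add op_add \<psi>add arp)
    next
      fix c and w :: "'k vec" assume w: "w \<in> carrier_vec (d (tail Q a))"
      note p = pc[OF t(1) \<phi>p[OF t(1) w]]
      show "F a (c \<cdot>\<^sub>v w) = c \<cdot>\<^sub>v F a w"
        unfolding F_def using a w p by (simp add: \<phi>sc op_sc \<psi>sc arp)
    qed auto
    then show ?thesis using a by (simp add: x_def)
  qed
  have xa: "x \<in> rep_ambient Q d" by (auto simp: x_def rep_ambient_def)
  have "x b * x a = 0\<^sub>m (d (head Q b)) (d (tail Q a))" if ab: "a \<in> arcs Q" "b \<in> arcs Q" "head Q a = tail Q b" for a b
  proof -
    have ca: "x a \<in> carrier_mat (d (head Q a)) (d (tail Q a))" by (rule rep_ambient_carrier[OF xa ab(1)])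
    have cb: "x b \<in> carrier_mat (d (head Q b)) (d (head Q a))"
      using rep_ambient_carrier[OF xa ab(2)] ab(3) by simp
    have t: "tail Q a \<in> verts Q" "head Q b \<in> verts Q" "head Q a \<in> verts Q" using ab by auto
    have col0: "col (x b * x a) j = 0\<^sub>v (d (head Q b))" if j: "j < d (tail Q a)" for j
    proof -
      let ?u = "unit_vec (d (tail Q a)) j :: 'k vec"
      have y: "\<phi> (tail Q a) ?u \<in> carrier M" using pc[OF t(1) \<phi>p[OF t(1)]] by simp
      have "col (x b * x a) j = x b *\<^sub>v (x a *\<^sub>v ?u)"
        using col_mult2[OF cb ca j] mult_mat_unit_vec[OF ca j] by simp
      also have "x a *\<^sub>v ?u = F a ?u" by (rule xF[OF ab(1)]) simp
      also have "x b *\<^sub>v F a ?u = F b (F a ?u)" using Fc[OF ab(1), of ?u] ab(3) by (intro xF[OF ab(2)]) simp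
      also have "\<dots> = \<psi> (head Q b) (ar b (ar a (\<phi> (tail Q a) ?u)))"
        unfolding F_def ab(3)[symmetric] using \<phi>\<psi>[OF t(3) arp[OF ab(1) y]] by simp
      also have "\<dots> = 0\<^sub>v (d (head Q b))" using y ab t z0 by (simp add: op_comp)
      finally show ?thesis .
    qed
    show ?thesis
    proof (rule eq_matI)
      fix i j assume "i < dim_row (0\<^sub>m (d (head Q b)) (d (tail Q a)))" "j < dim_col (0\<^sub>m (d (head Q b)) (d (tail Q a)))"
      then have ij: "i < d (head Q b)" "j < d (tail Q a)" by auto
      have "(x b * x a) $$ (i, j) = col (x b * x a) j $ i" using ca cb ij by (auto simp: col_def)
      then show "(x b * x a) $$ (i, j) = 0\<^sub>m (d (head Q b)) (d (tail Q a)) $$ (i, j)" using col0 ij by simp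
    qed (use ca cb in auto)
  qed
  then have xs: "x \<in> sq_zero_reps Q d" using xa by (simp add: sq_zero_reps_def)
  let ?N = "rep_module Q d x"
  have N: "left_module \<Lambda> ?N" by (rule rep_module_left_module[OF xs])
  \<comment> \<open>An element is sent to the coordinates of its components
    \<open>ev v z\<close>.\<close>
  define \<Psi> where "\<Psi> z = (\<lambda>v\<in>verts Q. \<psi> v (ev v z))" for z
  have \<Psi>c: "\<Psi> z \<in> carrier ?N" if "z \<in> carrier M" for z
    using that by (auto simp: \<Psi>_def rep_module_carrier_iff \<psi>c evp)
  have hom: "\<Psi> \<in> module_hom \<Lambda> M ?N"
  proof (rule module_hom_LambdaI[OF M N \<Psi>c])
    fix y z assume yz: "y \<in> carrier M" "z \<in> carrier M"
    then show "\<Psi> (y \<oplus>\<^bsub>M\<^esub> z) = \<Psi> y \<oplus>\<^bsub>?N\<^esub> \<Psi> z"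
      by (auto simp: \<Psi>_def rep_module_simps op_add \<psi>add evp intro!: restrict_ext)
  next
    fix c z assume z: "z \<in> carrier M"
    show "\<Psi> (sc c z) = scalar Q I c \<odot>\<^bsub>?N\<^esub> \<Psi> z"
      unfolding rep_module_ops(1)[OF xs \<Psi>c[OF z]]
      using z by (auto simp: \<Psi>_def op_sc \<psi>sc evp intro!: restrict_ext)
  next
    fix w z assume w: "w \<in> verts Q" and z: "z \<in> carrier M"
    show "\<Psi> (ev w z) = vertex_idem Q I w \<odot>\<^bsub>?N\<^esub> \<Psi> z"
      unfolding rep_module_ops(2)[OF xs \<Psi>c[OF z] w]
      using z w by (auto simp: \<Psi>_def op_comp z0 intro!: restrict_ext)
  next
    fix a z assume a: "a \<in> arcs Q" and z: "z \<in> carrier M"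
    have t: "tail Q a \<in> verts Q" "head Q a \<in> verts Q" using a by auto
    have "x a *\<^sub>v \<Psi> z (tail Q a) = F a (\<psi> (tail Q a) (ev (tail Q a) z))"
      using t \<psi>c[OF t(1) evp[OF z]] by (simp add: \<Psi>_def xF[OF a])
    also have "\<dots> = \<psi> (head Q a) (ar a z)"
      unfolding F_def using a t z by (simp add: \<phi>\<psi> evp op_comp)
    finally have xz: "x a *\<^sub>v \<Psi> z (tail Q a) = \<psi> (head Q a) (ar a z)" .
    show "\<Psi> (ar a z) = arrow_cl a \<odot>\<^bsub>?N\<^esub> \<Psi> z"
      unfolding rep_module_ops(3)[OF xs \<Psi>c[OF z] a] xz
      using z a by (auto simp: \<Psi>_def op_comp z0 intro!: restrict_ext)
  qed
  have bij: "bij_betw \<Psi> (carrier M) (carrier ?N)"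
    unfolding bij_betw_def
  proof
    show "inj_on \<Psi> (carrier M)"
    proof (rule inj_onI)
      fix y z assume yz: "y \<in> carrier M" "z \<in> carrier M" "\<Psi> y = \<Psi> z"
      show "y = z"
      proof (rule ev_cong_imp_eq[OF yz(1,2)])
        fix v assume v: "v \<in> verts Q"
        have "\<Psi> y v = \<Psi> z v" using yz(3) by simp
        then have "\<psi> v (ev v y) = \<psi> v (ev v z)" using v by (simp add: \<Psi>_def)
        then show "ev v y = ev v z" using \<phi>\<psi>[OF v evp[OF yz(1)]] \<phi>\<psi>[OF v evp[OF yz(2)]] by metis
      qed
    qed
    show "\<Psi> ` carrier M = carrier ?N"
    proof (intro equalityI subsetI)
      fix m assume m: "m \<in> carrier ?N"
      have mv: "m v \<in> carrier_vec (d v)" if "v \<in> verts Q" for v using m that by (simp add: rep_module_carrier_iff)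
      \<comment> \<open>The preimage of \<open>m\<close> is the sum of the elements with coordinates
        \<open>m v\<close> in the spaces \<open>part v\<close>.\<close>
      define z where "z = (\<Oplus>\<^bsub>M\<^esub>v\<in>verts Q. \<phi> v (m v))"
      have fc: "(\<lambda>v. \<phi> v (m v)) \<in> verts Q \<rightarrow> carrier M" using \<phi>p mv pc by blast
      have z: "z \<in> carrier M" unfolding z_def by (rule M.finsum_closed[OF fc])
      have "ev v z = \<phi> v (m v)" if v: "v \<in> verts Q" for v
      proof -
        have "ev v z = (\<Oplus>\<^bsub>M\<^esub>w\<in>verts Q. ev v (\<phi> w (m w)))"
          unfolding z_def by (rule M.smult_finsum[OF vertex_closed[OF v] finite_verts fc])
        also have "\<dots> = (\<Oplus>\<^bsub>M\<^esub>w\<in>verts Q. if v = w then \<phi> w (m w) else \<zero>\<^bsub>M\<^esub>)"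
        proof (rule M.finsum_cong'[OF refl])
          fix w assume w: "w \<in> verts Q"
          have "\<phi> w (m w) \<in> carrier M" "ev w (\<phi> w (m w)) = \<phi> w (m w)"
            using \<phi>p[OF w mv[OF w]] w by (auto simp: part_iff)
          then show "ev v (\<phi> w (m w)) = (if v = w then \<phi> w (m w) else \<zero>\<^bsub>M\<^esub>)"
            using op_comp(1)[of "\<phi> w (m w)" v w] v w by auto
        qed (use fc in auto)
        also have "\<dots> = \<phi> v (m v)" by (rule M.finsum_singleton[OF v finite_verts fc])
        finally show ?thesis .
      qed
      then have "\<Psi> z = m"
        using m mv by (intro rep_module_eqI[OF \<Psi>c[OF z] m]) (simp add: \<Psi>_def \<psi>\<phi>)
      then show "m \<in> \<Psi> ` carrier M" using z by blast
    qed (use \<Psi>c in blast)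
  qed
  show ?thesis using that[OF xs] hom bij by (auto simp: mod_isomorphic_def)
qed

end

section \<open>Tops and socles of representations\<close>

lemma lin_comb_Suc:
  assumes "b k \<in> carrier_vec n"
  shows "lin_comb n (Suc k) b c = lin_comb n k b c + c k \<cdot>\<^sub>v b k"
  using assms by (intro eq_vecI) auto

lemma mult_mat_vec_lin_comb:
  assumes g: "g \<in> carrier_mat n n" and c: "c \<in> carrier_vec n" and k: "k \<le> n"
    and z: "\<And>i. i < n \<Longrightarrow> k \<le> i \<Longrightarrow> c $ i = 0"
  shows "g *\<^sub>v c = lin_comb n k (col g) (($) c)"
proof -
  have "mat n n (\<lambda>(i, j). col g j $ i) = g" using g by (intro eq_matI) auto
  then have "g *\<^sub>v c = lin_comb n n (col g) (($) c)"
    using mult_mat_vec_columns[OF c, of n "col g"] by simp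
  also have "\<dots> = lin_comb n k (col g) (($) c)"
    using k z unfolding lin_comb_def by (intro eq_vecI) (auto intro!: sum.mono_neutral_right, metis not_less)
  finally show ?thesis .
qed

lemma mult_mat_vec_eq_zero_iff:
  "A *\<^sub>v u = 0\<^sub>v n \<longleftrightarrow> dim_row A = n \<and> (\<forall>j<dim_row A. row A j \<bullet> u = 0)"
  by (auto simp: vec_eq_iff)

text \<open>\<open>adapted_basis\<close> at each vertex, with columns and rows translated into the
  maps \<open>x a\<close>. In the coordinates given by \<open>h v\<close> the image of the incoming
  maps occupies the positions below \<open>rad_dim\<close> and the common kernel those below
  \<open>soc_dim\<close>.\<close>

lemma adapted_bases:
  fixes x :: "'e \<Rightarrow> 'k::field mat"
  assumes x: "x \<in> sq_zero_reps Q d"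
  obtains g h where "\<And>v. g v \<in> carrier_mat (d v) (d v)" "\<And>v. h v \<in> carrier_mat (d v) (d v)"
    "\<And>v c. c \<in> carrier_vec (d v) \<Longrightarrow> h v *\<^sub>v (g v *\<^sub>v c) = c"
    "\<And>v u. u \<in> carrier_vec (d v) \<Longrightarrow> g v *\<^sub>v (h v *\<^sub>v u) = u"
    "\<And>a u i. a \<in> arcs Q \<Longrightarrow> u \<in> carrier_vec (d (tail Q a)) \<Longrightarrow> rad_dim Q d x (head Q a) \<le> i \<Longrightarrow>
      i < d (head Q a) \<Longrightarrow> (h (head Q a) *\<^sub>v (x a *\<^sub>v u)) $ i = 0"
    "\<And>v j. j < rad_dim Q d x v \<Longrightarrow> \<exists>a k. a \<in> arcs Q \<and> head Q a = v \<and> k < d (tail Q a) \<and>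
      col (g v) j = x a *\<^sub>v unit_vec (d (tail Q a)) k"
    "\<And>v u. u \<in> carrier_vec (d v) \<Longrightarrow>
      (\<forall>a\<in>arcs Q. tail Q a = v \<longrightarrow> x a *\<^sub>v u = 0\<^sub>v (d (head Q a))) \<longleftrightarrow>
      (\<forall>i<d v. soc_dim Q d x v \<le> i \<longrightarrow> (h v *\<^sub>v u) $ i = 0)"
proof -
  have xa: "x \<in> rep_ambient Q d" using x by (simp add: sq_zero_reps_def)
  let ?P = "\<lambda>v (g, h). g \<in> carrier_mat (d v) (d v) \<and> h \<in> carrier_mat (d v) (d v) \<and>
    h * g = 1\<^sub>m (d v) \<and> g * h = 1\<^sub>m (d v) \<and>
    (\<forall>u\<in>in_columns Q d x v. \<forall>i<d v. rad_dim Q d x v \<le> i \<longrightarrow> (h *\<^sub>v u) $ i = 0) \<and>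
    (\<forall>j<rad_dim Q d x v. col g j \<in> in_columns Q d x v) \<and>
    (\<forall>u\<in>carrier_vec (d v). (\<forall>w\<in>out_rows Q d x v. w \<bullet> u = 0) \<longleftrightarrow>
      (\<forall>i<d v. soc_dim Q d x v \<le> i \<longrightarrow> (h *\<^sub>v u) $ i = 0))"
  have "\<forall>v. \<exists>gh. ?P v gh"
  proof
    fix v
    show "\<exists>gh. ?P v gh"
      apply (rule adapted_basis[OF in_columns_carrier[of Q d x v] out_rows_carrier[of Q d x v]
            out_rows_in_columns_orth[OF x, of _ v]])
        apply assumption
       apply assumption
      subgoal for g h unfolding rad_dim_def soc_dim_def by (rule exI[of _ "(g, h)"]) (simp add: carrier_matD)
      done
  qed
  from choice[OF this] obtain gh where gh: "\<And>v. ?P v (gh v)" by blast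
  define g h where "g v = fst (gh v)" and "h v = snd (gh v)" for v
  have P: "?P v (g v, h v)" for v using gh[of v] by (simp add: g_def h_def)
  have gc: "g v \<in> carrier_mat (d v) (d v)" and hc: "h v \<in> carrier_mat (d v) (d v)" for v using P[of v] by auto
  show ?thesis
  proof (rule that[of g h, OF gc hc])
    show "h v *\<^sub>v (g v *\<^sub>v c) = c" if "c \<in> carrier_vec (d v)" for v c
      using assoc_mult_mat_vec[OF hc gc that] P[of v] that by simp
    show "g v *\<^sub>v (h v *\<^sub>v c) = c" if "c \<in> carrier_vec (d v)" for v c
      using assoc_mult_mat_vec[OF gc hc that] P[of v] that by simp
    show "(h (head Q a) *\<^sub>v (x a *\<^sub>v u)) $ i = 0"
      if a: "a \<in> arcs Q" and u: "u \<in> carrier_vec (d (tail Q a))"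
        and i: "rad_dim Q d x (head Q a) \<le> i" "i < d (head Q a)" for a u i
    proof -
      have ac: "x a \<in> carrier_mat (d (head Q a)) (d (tail Q a))" by (rule rep_ambient_carrier[OF xa a])
      have "(h (head Q a) * x a) $$ (i, j) = 0" if "j < d (tail Q a)" for j
      proof -
        have "col (x a) j \<in> in_columns Q d x (head Q a)" unfolding in_columns_eq[OF xa] using a that by blast
        then have "(h (head Q a) *\<^sub>v col (x a) j) $ i = 0" using P[of "head Q a"] i by blast
        then show ?thesis using hc[of "head Q a"] ac i that by auto
      qed
      then have "row (h (head Q a) * x a) i = 0\<^sub>v (d (tail Q a))"
        using hc[of "head Q a"] ac i by (intro eq_vecI) auto
      then have "((h (head Q a) * x a) *\<^sub>v u) $ i = 0" using hc[of "head Q a"] i u by auto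
      then show ?thesis by (simp only: assoc_mult_mat_vec[OF hc ac u])
    qed
    show "\<exists>a k. a \<in> arcs Q \<and> head Q a = v \<and> k < d (tail Q a) \<and>
      col (g v) j = x a *\<^sub>v unit_vec (d (tail Q a)) k" if j: "j < rad_dim Q d x v" for v j
    proof -
      have "col (g v) j \<in> in_columns Q d x v" using P[of v] j by blast
      then obtain a k where a: "a \<in> arcs Q" "head Q a = v" "k < d (tail Q a)" "col (g v) j = col (x a) k"
        unfolding in_columns_eq[OF xa] by blast
      then show ?thesis using mult_mat_unit_vec[OF rep_ambient_carrier[OF xa a(1)] a(3)] by metis
    qed
    show "(\<forall>a\<in>arcs Q. tail Q a = v \<longrightarrow> x a *\<^sub>v u = 0\<^sub>v (d (head Q a))) \<longleftrightarrow>
      (\<forall>i<d v. soc_dim Q d x v \<le> i \<longrightarrow> (h v *\<^sub>v u) $ i = 0)" if u: "u \<in> carrier_vec (d v)" for v u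
    proof -
      have r: "x a *\<^sub>v u = 0\<^sub>v (d (head Q a)) \<longleftrightarrow> (\<forall>j<d (head Q a). row (x a) j \<bullet> u = 0)" if "a \<in> arcs Q" for a
        using rep_ambient_carrier[OF xa that] by (simp add: mult_mat_vec_eq_zero_iff carrier_matD)
      have "(\<forall>a\<in>arcs Q. tail Q a = v \<longrightarrow> x a *\<^sub>v u = 0\<^sub>v (d (head Q a))) \<longleftrightarrow> (\<forall>w\<in>out_rows Q d x v. w \<bullet> u = 0)"
        unfolding out_rows_eq[OF xa] using r by auto
      then show ?thesis using P[of v] u by simp
    qed
  qed
qed

text \<open>The module of this point is semisimple. For \<open>t\<close> supported on the vertices
  it has dimension vector \<open>t\<close> and serves as the normal form of the semisimple modules
  with that dimension vector.\<close>

definition zero_rep :: "('v, 'e) pre_digraph \<Rightarrow> ('v \<Rightarrow> nat) \<Rightarrow> 'e \<Rightarrow> 'k::field mat" where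
  "zero_rep Q t = (\<lambda>a\<in>arcs Q. 0\<^sub>m (t (head Q a)) (t (tail Q a)))"

lemma zero_rep_in_sq_zero_reps: "zero_rep Q t \<in> sq_zero_reps Q t"
  by (auto simp: zero_rep_def sq_zero_reps_def rep_ambient_def)

context rsz_algebra
begin

abbreviation semisimple_rep :: "('v \<Rightarrow> nat) \<Rightarrow> ('v, 'e, 'k) std_module" where
  "semisimple_rep t \<equiv> rep_module Q t (zero_rep Q t)"

lemma semisimple_rep_left_module: "left_module \<Lambda> (semisimple_rep t)"
  by (rule rep_module_left_module[OF zero_rep_in_sq_zero_reps])

lemma semisimple_rep_arrow:
  assumes "a \<in> arcs Q" "m \<in> carrier (semisimple_rep t)"
  shows "arrow_cl a \<odot>\<^bsub>semisimple_rep t\<^esub> m = \<zero>\<^bsub>semisimple_rep t\<^esub>"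
proof -
  have "zero_rep Q t a *\<^sub>v m (tail Q a) = 0\<^sub>v (t (head Q a))"
    using assms by (auto simp: zero_rep_def rep_module_carrier_iff)
  then show ?thesis
    unfolding rep_module_ops(3)[OF zero_rep_in_sq_zero_reps assms(2,1)] rep_module_simps(2)
    by (intro restrict_ext) auto
qed

text \<open>Arrows act as zero on the target, so a vertexwise linear map is a homomorphism as soon
  as it kills whatever arrows produce. It is applied with \<open>L\<close> the whole module for the
  top and with \<open>L\<close> the annihilator of the arrows for the socle.\<close>

lemma vertexwise_hom:
  assumes x: "x \<in> sq_zero_reps Q d" and L: "Module.submodule L \<Lambda> (rep_module Q d x)"
    and p: "\<And>v. v \<in> verts Q \<Longrightarrow> p v \<in> carrier_mat (t v) (d v)"
    and arrow: "\<And>a m. a \<in> arcs Q \<Longrightarrow> m \<in> L \<Longrightarrow>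
      p (head Q a) *\<^sub>v (x a *\<^sub>v m (tail Q a)) = 0\<^sub>v (t (head Q a))"
  shows "(\<lambda>m. \<lambda>v\<in>verts Q. p v *\<^sub>v m v) \<in> module_hom \<Lambda> (rep_module Q d x\<lparr>carrier := L\<rparr>) (semisimple_rep t)"
    (is "?f \<in> _")
proof -
  let ?N = "rep_module Q d x"
  interpret N: left_module \<Lambda> ?N by (rule rep_module_left_module[OF x])
  note z = zero_rep_in_sq_zero_reps[of Q t]
  have Lc: "m \<in> carrier ?N" if "m \<in> L" for m using N.lsubmoduleD(1)[OF L] that by blast
  have mv: "m v \<in> carrier_vec (d v)" if "m \<in> L" "v \<in> verts Q" for m v
    using Lc[OF that(1)] that(2) by (simp add: rep_module_carrier_iff)
  have fc: "?f m \<in> carrier (semisimple_rep t)" if "m \<in> L" for m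
    using mv[OF that] mult_mat_vec_carrier[OF p] by (auto simp: rep_module_carrier_iff)
  have p0: "p v *\<^sub>v 0\<^sub>v (d v) = 0\<^sub>v (t v)" if "v \<in> verts Q" for v using p[OF that] by auto
  show ?thesis
  proof (rule module_hom_LambdaI[OF N.submodule_left_module[OF L] semisimple_rep_left_module])
    fix m assume "m \<in> carrier (?N\<lparr>carrier := L\<rparr>)"
    then have m: "m \<in> L" by simp
    show "?f m \<in> carrier (semisimple_rep t)" by (rule fc[OF m])
    show "?f (scalar Q I c \<odot>\<^bsub>?N\<lparr>carrier := L\<rparr>\<^esub> m) = scalar Q I c \<odot>\<^bsub>semisimple_rep t\<^esub> ?f m" for c
      unfolding rep_module_ops(1)[OF z fc[OF m]]
      using m p mv by (auto simp: rep_module_ops(1)[OF x Lc] mult_mat_vec[OF p mv] intro!: restrict_ext)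
    show "?f (vertex_idem Q I w \<odot>\<^bsub>?N\<lparr>carrier := L\<rparr>\<^esub> m) = vertex_idem Q I w \<odot>\<^bsub>semisimple_rep t\<^esub> ?f m"
      if "w \<in> verts Q" for w
      unfolding rep_module_ops(2)[OF z fc[OF m] that]
      using m p mv p0 that by (auto simp: rep_module_ops(2)[OF x Lc] intro!: restrict_ext)
    show "?f (arrow_cl a \<odot>\<^bsub>?N\<lparr>carrier := L\<rparr>\<^esub> m) = arrow_cl a \<odot>\<^bsub>semisimple_rep t\<^esub> ?f m"
      if "a \<in> arcs Q" for a
      unfolding semisimple_rep_arrow[OF that fc[OF m]]
      using m p0 that arrow[OF that m]
      by (auto simp: rep_module_ops(3)[OF x Lc] rep_module_simps(2) intro!: restrict_ext)
  next
    fix m m' assume m: "m \<in> carrier (?N\<lparr>carrier := L\<rparr>)" "m' \<in> carrier (?N\<lparr>carrier := L\<rparr>)"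
    then show "?f (m \<oplus>\<^bsub>?N\<lparr>carrier := L\<rparr>\<^esub> m') = ?f m \<oplus>\<^bsub>semisimple_rep t\<^esub> ?f m'"
      using p mv by (auto simp: rep_module_simps(3) intro!: restrict_ext mult_add_distrib_mat_vec)
  qed
qed

lemma vertex_vec_arrow:
  assumes x: "x \<in> sq_zero_reps Q d" and a: "a \<in> arcs Q" and u: "u \<in> carrier_vec (d (tail Q a))"
  shows "arrow_cl a \<odot>\<^bsub>rep_module Q d x\<^esub> vertex_vec d (tail Q a) u = vertex_vec d (head Q a) (x a *\<^sub>v u)"
  unfolding rep_module_ops(3)[OF x vertex_vec_closed[of u d "tail Q a" x, OF u] a] using a
  by (auto simp: vertex_vec_def intro!: restrict_ext)

lemma vertex_vec_lin_comb:
  assumes x: "x \<in> sq_zero_reps Q d" and N: "Module.submodule N \<Lambda> (rep_module Q d x)"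
    and b: "\<And>j. j < k \<Longrightarrow> b j \<in> carrier_vec (d v)" "\<And>j. j < k \<Longrightarrow> vertex_vec d v (b j) \<in> N"
  shows "vertex_vec d v (lin_comb (d v) k b c) \<in> N"
  using b
proof (induction k)
  interpret N: left_module \<Lambda> "rep_module Q d x" by (rule rep_module_left_module[OF x])
  note G = N.lsubmoduleD[OF N]
  case 0
  have "vertex_vec d v (lin_comb (d v) 0 b c) = \<zero>\<^bsub>rep_module Q d x\<^esub>"
    by (auto simp: vertex_vec_def rep_module_simps(2) lin_comb_def intro!: restrict_ext eq_vecI)
  then show ?case using G(2) by simp
next
  interpret N: left_module \<Lambda> "rep_module Q d x" by (rule rep_module_left_module[OF x])
  note G = N.lsubmoduleD[OF N]
  case (Suc k)
  have bk: "b k \<in> carrier_vec (d v)" by (rule Suc.prems(1)) simp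
  have "vertex_vec d v (c k \<cdot>\<^sub>v b k) \<in> N"
    unfolding vertex_vec_smult[OF x bk] by (rule G(4)[OF scalar_closed Suc.prems(2)]) simp
  moreover have "vertex_vec d v (lin_comb (d v) k b c) \<in> N" by (rule Suc.IH) (use Suc.prems in auto)
  ultimately show ?case
    using G(3) bk by (simp add: lin_comb_Suc[of b k "d v", OF bk] vertex_vec_add[where x = x])
qed

text \<open>The radical annihilates the target, so the kernel of \<open>f\<close> is a submodule
  containing all generators of \<open>rad_submodule\<close>.\<close>

lemma rad_submodule_annihilated:
  assumes M: "left_module \<Lambda> M" and f: "f \<in> module_hom \<Lambda> M (semisimple_rep t)"
    and m: "m \<in> rad_submodule \<Lambda> M"
  shows "f m = \<zero>\<^bsub>semisimple_rep t\<^esub>"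
proof -
  let ?S = "semisimple_rep t"
  interpret M: left_module \<Lambda> M by (rule M)
  interpret S: rsz_module Q I ?S by (rule rsz_moduleI[OF semisimple_rep_left_module])
  note h = module_homD[OF f]
  have z: "Module.submodule {\<zero>\<^bsub>?S\<^esub>} \<Lambda> ?S"
    by (rule S.M.lsubmoduleI) (auto simp: S.M.smult_zero)
  have K: "Module.submodule {x \<in> carrier M. f x \<in> {\<zero>\<^bsub>?S\<^esub>}} \<Lambda> M"
    by (rule submodule_vimage[OF f M S.M.left_module_axioms z])
  have "rad_submodule \<Lambda> M \<subseteq> {x \<in> carrier M. f x \<in> {\<zero>\<^bsub>?S\<^esub>}}"
    unfolding rad_submodule_def
  proof (rule M.gen_submodule_least[OF K], clarify)
    fix C x assume C: "C \<in> jacobson_radical \<Lambda>" and x: "x \<in> carrier M"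
    note Cc = jacobson_radical_carrier[OF C]
    have "f (C \<odot>\<^bsub>M\<^esub> x) = C \<odot>\<^bsub>?S\<^esub> f x" by (rule h(3)[OF Cc x])
    also have "\<dots> = \<zero>\<^bsub>?S\<^esub>"
      by (rule S.radical_annihilates[OF h(1)[OF x] _ C]) (rule semisimple_rep_arrow[OF _ h(1)[OF x]])
    finally show "C \<odot>\<^bsub>M\<^esub> x \<in> carrier M \<and> f (C \<odot>\<^bsub>M\<^esub> x) \<in> {\<zero>\<^bsub>?S\<^esub>}"
      using M.smult_closed[OF Cc x] by simp
  qed
  then show ?thesis using m by blast
qed

text \<open>In adapted coordinates the radical consists of the elements whose coordinates from
  \<open>rad_dim\<close> on vanish, and the socle of those whose coordinates from
  \<open>soc_dim\<close> on vanish. The map onto the top is exported as a homomorphism together with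
  its kernel, a form that can be composed with an isomorphism from another module.\<close>

lemma top_soc_rep_module:
  fixes d
  assumes x: "x \<in> sq_zero_reps Q d"
  defines "N \<equiv> rep_module Q d x"
  obtains f where "f \<in> module_hom \<Lambda> N (semisimple_rep (\<lambda>v. d v - rad_dim Q d x v))"
    "f ` carrier N = carrier (semisimple_rep (\<lambda>v. d v - rad_dim Q d x v))"
    "\<And>m. m \<in> carrier N \<Longrightarrow>
      f m = \<zero>\<^bsub>semisimple_rep (\<lambda>v. d v - rad_dim Q d x v)\<^esub> \<longleftrightarrow> m \<in> rad_submodule \<Lambda> N"
    "mod_isomorphic \<Lambda> (soc \<Lambda> N) (semisimple_rep (soc_dim Q d x))"
proof -
  interpret N: rsz_module Q I N unfolding N_def by (rule rsz_moduleI[OF rep_module_left_module[OF x]])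
  show ?thesis
  proof (rule adapted_bases[OF x])
    fix g h
    assume gc: "\<And>v. g v \<in> carrier_mat (d v) (d v)" and hc: "\<And>v. h v \<in> carrier_mat (d v) (d v)"
      and hg: "\<And>v c. c \<in> carrier_vec (d v) \<Longrightarrow> h v *\<^sub>v (g v *\<^sub>v c) = c"
      and gh: "\<And>v u. u \<in> carrier_vec (d v) \<Longrightarrow> g v *\<^sub>v (h v *\<^sub>v u) = u"
      and hx: "\<And>a u i. a \<in> arcs Q \<Longrightarrow> u \<in> carrier_vec (d (tail Q a)) \<Longrightarrow> rad_dim Q d x (head Q a) \<le> i \<Longrightarrow>
        i < d (head Q a) \<Longrightarrow> (h (head Q a) *\<^sub>v (x a *\<^sub>v u)) $ i = 0"
      and gx: "\<And>v j. j < rad_dim Q d x v \<Longrightarrow> \<exists>a k. a \<in> arcs Q \<and> head Q a = v \<and> k < d (tail Q a) \<and>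
        col (g v) j = x a *\<^sub>v unit_vec (d (tail Q a)) k"
      and hs: "\<And>v u. u \<in> carrier_vec (d v) \<Longrightarrow>
        (\<forall>a\<in>arcs Q. tail Q a = v \<longrightarrow> x a *\<^sub>v u = 0\<^sub>v (d (head Q a))) \<longleftrightarrow>
        (\<forall>i<d v. soc_dim Q d x v \<le> i \<longrightarrow> (h v *\<^sub>v u) $ i = 0)"
    define r where "r = rad_dim Q d x"
    define s where "s = soc_dim Q d x"
    define t where "t v = d v - r v" for v
    have rd: "r v \<le> d v" and sd: "s v \<le> d v" for v by (simp_all add: r_def s_def rad_dim_le soc_dim_le)
    have mv: "m v \<in> carrier_vec (d v)" if "m \<in> carrier N" "v \<in> verts Q" for m v
      using that by (simp add: N_def rep_module_carrier_iff)
    have hu: "(h v *\<^sub>v u) $ i = row (h v) i \<bullet> u" if "i < d v" for v u i using hc[of v] that by simp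

    \<comment> \<open>The rows of \<open>h v\<close> from \<open>r v\<close> on read the coordinates
      modulo the radical.\<close>
    define p where "p v = mat (t v) (d v) (\<lambda>(i, j). h v $$ (i + r v, j))" for v
    have pc: "p v \<in> carrier_mat (t v) (d v)" for v by (simp add: p_def)
    have pu: "(p v *\<^sub>v u) $ k = (h v *\<^sub>v u) $ (k + r v)" if "k < t v" for v u k
    proof -
      have "row (p v) k = row (h v) (k + r v)"
        using hc[of v] that by (intro eq_vecI) (auto simp: p_def t_def)
      then show ?thesis using that hu[of "k + r v" v u] by (simp add: p_def t_def)
    qed
    define f where "f = (\<lambda>m. \<lambda>v\<in>verts Q. p v *\<^sub>v m v)"
    have "f \<in> module_hom \<Lambda> (rep_module Q d x\<lparr>carrier := carrier N\<rparr>) (semisimple_rep t)"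
      unfolding f_def
    proof (rule vertexwise_hom[OF x])
      show "Module.submodule (carrier N) \<Lambda> (rep_module Q d x)" using N.M.carrier_submodule by (simp add: N_def)
      show "p (head Q a) *\<^sub>v (x a *\<^sub>v m (tail Q a)) = 0\<^sub>v (t (head Q a))"
        if "a \<in> arcs Q" "m \<in> carrier N" for a m
      proof (rule eq_vecI)
        fix k assume "k < dim_vec (0\<^sub>v (t (head Q a)))"
        then have "k < t (head Q a)" by simp
        then show "(p (head Q a) *\<^sub>v (x a *\<^sub>v m (tail Q a))) $ k = 0\<^sub>v (t (head Q a)) $ k"
          using hx[OF that(1) mv[OF that(2)], of "k + r (head Q a)"] that
          by (simp only: pu) (simp add: r_def t_def)
      qed (simp add: p_def)
    qed (rule pc)
    then have f: "f \<in> module_hom \<Lambda> N (semisimple_rep t)" by (simp add: N_def)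
    have f_surj: "f ` carrier N = carrier (semisimple_rep t)"
    proof (intro equalityI subsetI)
      fix y assume y: "y \<in> carrier (semisimple_rep t)"
      \<comment> \<open>A preimage is prescribed by its adapted coordinates, zero in the radical
        part.\<close>
      define c where "c v = vec (d v) (\<lambda>i. if i < r v then 0 else y v $ (i - r v))" for v
      have cc: "c v \<in> carrier_vec (d v)" for v by (simp add: c_def)
      define m where "m = (\<lambda>v\<in>verts Q. g v *\<^sub>v c v)"
      have m: "m \<in> carrier N"
        using mult_mat_vec_carrier[OF gc cc] by (auto simp: m_def N_def rep_module_carrier_iff)
      have "f m = y"
      proof (rule rep_module_eqI[OF module_homD(1)[OF f m] y])
        fix v k assume v: "v \<in> verts Q" "k < t v"
        then show "f m v $ k = y v $ k"
          using pu[of k v "m v"] by (simp add: f_def m_def hg[OF cc]) (simp add: c_def t_def)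
      qed
      then show "y \<in> f ` carrier N" using m by blast
    qed (use module_homD(1)[OF f] in blast)
    have f_ker: "f m = \<zero>\<^bsub>semisimple_rep t\<^esub> \<longleftrightarrow> m \<in> rad_submodule \<Lambda> N" if m: "m \<in> carrier N" for m
    proof
      assume fm: "f m = \<zero>\<^bsub>semisimple_rep t\<^esub>"
      have Jc: "jacobson_radical \<Lambda> \<subseteq> carrier \<Lambda>" using jacobson_radical_carrier by blast
      have gen: "{C \<odot>\<^bsub>N\<^esub> y | C y. C \<in> jacobson_radical \<Lambda> \<and> y \<in> carrier N} \<subseteq> carrier N"
        using Jc N.M.smult_closed by blast
      have R: "Module.submodule (rad_submodule \<Lambda> N) \<Lambda> N"
        unfolding rad_submodule_def by (rule N.M.gen_submodule_submodule[OF gen])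
      have JR: "C \<odot>\<^bsub>N\<^esub> y \<in> rad_submodule \<Lambda> N" if "C \<in> jacobson_radical \<Lambda>" "y \<in> carrier N" for C y
        unfolding rad_submodule_def by (rule subsetD[OF N.M.gen_submodule_subset]) (use that in blast)
      show "m \<in> rad_submodule \<Lambda> N"
      proof (rule N.submodule_of_parts[OF R m])
        fix v assume v: "v \<in> verts Q"
        have c: "h v *\<^sub>v m v \<in> carrier_vec (d v)" by (rule mult_mat_vec_carrier[OF hc mv[OF m v]])
        have "(h v *\<^sub>v m v) $ i = 0" if i: "i < d v" "r v \<le> i" for i
        proof -
          have "f m v $ (i - r v) = 0" using fm v i by (simp add: rep_module_simps(2) t_def)
          then show ?thesis using pu[of "i - r v" v "m v"] v i by (simp add: f_def t_def)
        qed
        then have "g v *\<^sub>v (h v *\<^sub>v m v) = lin_comb (d v) (r v) (col (g v)) (($) (h v *\<^sub>v m v))"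
          by (intro mult_mat_vec_lin_comb[OF gc c rd])
        then have ml: "m v = lin_comb (d v) (r v) (col (g v)) (($) (h v *\<^sub>v m v))"
          by (simp only: gh[OF mv[OF m v]])
        have "vertex_vec d v (lin_comb (d v) (r v) (col (g v)) (($) (h v *\<^sub>v m v))) \<in> rad_submodule \<Lambda> N"
        proof (rule vertex_vec_lin_comb[OF x])
          show "Module.submodule (rad_submodule \<Lambda> N) \<Lambda> (rep_module Q d x)" using R by (simp add: N_def)
          fix j assume j: "j < r v"
          show "col (g v) j \<in> carrier_vec (d v)" using gc[of v] by (intro carrier_vecI) auto
          \<comment> \<open>A basis vector in the radical part is an arrow applied to a unit vector,
            so it lies in the radical of the module.\<close>
          obtain a k where a: "a \<in> arcs Q" "head Q a = v"
            "col (g v) j = x a *\<^sub>v unit_vec (d (tail Q a)) k"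
            using gx[OF j[unfolded r_def]] by (elim exE conjE) (rule that)
          let ?u = "unit_vec (d (tail Q a)) k :: 'k vec"
          have u: "vertex_vec d (tail Q a) ?u \<in> carrier N" by (simp add: N_def vertex_vec_closed)
          have "vertex_vec d v (col (g v) j) = arrow_cl a \<odot>\<^bsub>N\<^esub> vertex_vec d (tail Q a) ?u"
            unfolding N_def vertex_vec_arrow[OF x a(1) unit_vec_carrier] a(2,3) ..
          then show "vertex_vec d v (col (g v) j) \<in> rad_submodule \<Lambda> N"
            by (simp only: JR[OF arrow_radical[OF a(1)] u])
        qed
        then show "vertex_idem Q I v \<odot>\<^bsub>N\<^esub> m \<in> rad_submodule \<Lambda> N"
          using vertex_act_eq[OF x _ v, folded N_def, OF m] ml by simp
      qed
    qed (rule rad_submodule_annihilated[OF N.M.left_module_axioms f])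

    \<comment> \<open>On the socle the first \<open>s v\<close> adapted coordinates determine the
      element, since the others vanish.\<close>
    define q where "q v = mat (s v) (d v) (\<lambda>(i, j). h v $$ (i, j))" for v
    have qc: "q v \<in> carrier_mat (s v) (d v)" for v by (simp add: q_def)
    have qu: "(q v *\<^sub>v u) $ k = (h v *\<^sub>v u) $ k" if "k < s v" for v u k
    proof -
      have k: "k < d v" using sd[of v] that by simp
      have "row (q v) k = row (h v) k"
        using hc[of v] that k by (intro eq_vecI) (auto simp: q_def)
      then show ?thesis using that hu[OF k] by (simp add: q_def)
    qed
    let ?L = "carrier (soc \<Lambda> N)"
    have ar0: "arrow_cl a \<odot>\<^bsub>N\<^esub> m = \<zero>\<^bsub>N\<^esub> \<longleftrightarrow> x a *\<^sub>v m (tail Q a) = 0\<^sub>v (d (head Q a))"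
      if a: "a \<in> arcs Q" and m: "m \<in> carrier N" for a m
    proof
      assume "arrow_cl a \<odot>\<^bsub>N\<^esub> m = \<zero>\<^bsub>N\<^esub>"
      then have "(arrow_cl a \<odot>\<^bsub>N\<^esub> m) (head Q a) = \<zero>\<^bsub>N\<^esub> (head Q a)" by simp
      then show "x a *\<^sub>v m (tail Q a) = 0\<^sub>v (d (head Q a))"
        using rep_module_ops(3)[OF x m[unfolded N_def] a] a by (simp add: N_def rep_module_simps(2))
    next
      assume "x a *\<^sub>v m (tail Q a) = 0\<^sub>v (d (head Q a))"
      then show "arrow_cl a \<odot>\<^bsub>N\<^esub> m = \<zero>\<^bsub>N\<^esub>"
        unfolding N_def rep_module_ops(3)[OF x m[unfolded N_def] a] rep_module_simps(2)
        by (intro restrict_ext) auto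
    qed
    have L_iff: "m \<in> ?L \<longleftrightarrow> m \<in> carrier N \<and> (\<forall>v\<in>verts Q. \<forall>i<d v. s v \<le> i \<longrightarrow> (h v *\<^sub>v m v) $ i = 0)" for m
    proof (cases "m \<in> carrier N")
      case True
      have "m \<in> ?L \<longleftrightarrow> (\<forall>v\<in>verts Q. \<forall>a\<in>arcs Q. tail Q a = v \<longrightarrow> x a *\<^sub>v m v = 0\<^sub>v (d (head Q a)))"
        using True ar0[OF _ True] by (auto simp: N.soc_carrier)
      then show ?thesis using True hs[OF mv[OF True]] by (simp add: s_def)
    qed (simp add: N.soc_carrier)
    have Ls: "Module.submodule ?L \<Lambda> N" unfolding N.soc_carrier by (rule N.ann_submodule)
    have Lc: "m \<in> carrier N" if "m \<in> ?L" for m using that by (simp add: L_iff)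
    define e where "e = (\<lambda>m. \<lambda>v\<in>verts Q. q v *\<^sub>v m v)"
    have "e \<in> module_hom \<Lambda> (rep_module Q d x\<lparr>carrier := ?L\<rparr>) (semisimple_rep s)"
      unfolding e_def
    proof (rule vertexwise_hom[OF x])
      show "Module.submodule ?L \<Lambda> (rep_module Q d x)" using Ls unfolding N_def .
      show "q v \<in> carrier_mat (s v) (d v)" for v by (rule qc)
      fix a m assume a: "a \<in> arcs Q" and m: "m \<in> ?L"
      then have "x a *\<^sub>v m (tail Q a) = 0\<^sub>v (d (head Q a))" using ar0[OF a Lc[OF m]] by (simp add: N.soc_carrier)
      then show "q (head Q a) *\<^sub>v (x a *\<^sub>v m (tail Q a)) = 0\<^sub>v (s (head Q a))" using qc[of "head Q a"] by auto
    qed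
    then have e: "e \<in> module_hom \<Lambda> (soc \<Lambda> N) (semisimple_rep s)" by (simp add: N_def soc_def)
    have "bij_betw e ?L (carrier (semisimple_rep s))"
      unfolding bij_betw_def
    proof
      show "inj_on e ?L"
      proof (rule inj_onI)
        fix m m' assume m: "m \<in> ?L" "m' \<in> ?L" "e m = e m'"
        show "m = m'"
        proof (rule rep_module_eqI)
          show "m \<in> carrier (rep_module Q d x)" "m' \<in> carrier (rep_module Q d x)"
            using Lc[OF m(1)] Lc[OF m(2)] by (simp_all add: N_def)
          fix v k assume v: "v \<in> verts Q" "k < d v"
          have c: "m v \<in> carrier_vec (d v)" "m' v \<in> carrier_vec (d v)"
            using mv[OF Lc[OF m(1)] v(1)] mv[OF Lc[OF m(2)] v(1)] by auto
          have "h v *\<^sub>v m v = h v *\<^sub>v m' v"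
          proof (rule eq_vecI)
            fix i assume "i < dim_vec (h v *\<^sub>v m' v)"
            then have i: "i < d v" using hc[of v] by simp
            show "(h v *\<^sub>v m v) $ i = (h v *\<^sub>v m' v) $ i"
            proof (cases "i < s v")
              case True
              have "e m v $ i = e m' v $ i" using m(3) by simp
              then show ?thesis using qu[OF True] v by (simp only: e_def restrict_apply' )
            next
              case False
              then show ?thesis using m(1,2) v(1) i by (auto simp only: L_iff not_less)
            qed
          qed simp
          then have "m v = m' v" using gh[OF c(1)] gh[OF c(2)] by metis
          then show "m v $ k = m' v $ k" by simp
        qed
      qed
      show "e ` ?L = carrier (semisimple_rep s)"
      proof (intro equalityI subsetI)
        fix y assume y: "y \<in> carrier (semisimple_rep s)"
        define c where "c v = vec (d v) (\<lambda>i. if i < s v then y v $ i else 0)" for v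
        have cc: "c v \<in> carrier_vec (d v)" for v by (simp add: c_def)
        define m where "m = (\<lambda>v\<in>verts Q. g v *\<^sub>v c v)"
        have m: "m \<in> carrier N"
          using mult_mat_vec_carrier[OF gc cc] by (auto simp: m_def N_def rep_module_carrier_iff)
        have mL: "m \<in> ?L"
          unfolding L_iff using m by (auto simp: m_def hg[OF cc]) (simp add: c_def)
        have "e m = y"
        proof (rule rep_module_eqI[OF _ y])
          show "e m \<in> carrier (semisimple_rep s)" using module_homD(1)[OF e mL] .
          fix v k assume v: "v \<in> verts Q" "k < s v"
          then have "k < d v" using sd[of v] by simp
          then show "e m v $ k = y v $ k"
            using qu[of k v "m v"] v by (simp add: e_def m_def hg[OF cc]) (simp add: c_def)
        qed
        then show "y \<in> e ` ?L" using mL by blast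
      qed (use module_homD(1)[OF e] in blast)
    qed
    then have "mod_isomorphic \<Lambda> (soc \<Lambda> N) (semisimple_rep s)" using e unfolding mod_isomorphic_def by blast
    then show ?thesis
      using that[of f] f f_surj f_ker unfolding t_def r_def s_def by blast
  qed
qed

text \<open>The isomorphism and its inverse both respect the radical, so the kernel of the composed
  map onto the semisimple module is the radical of \<open>M\<close>. An element is killed by the
  arrows exactly if its image is, which matches the socles.\<close>

lemma top_soc_isomorphic:
  assumes M: "left_module \<Lambda> M" and x: "x \<in> sq_zero_reps Q d"
    and iso: "mod_isomorphic \<Lambda> M (rep_module Q d x)"
  shows "left_module \<Lambda> (top_mod \<Lambda> M)"
    "mod_isomorphic \<Lambda> (top_mod \<Lambda> M) (semisimple_rep (\<lambda>v. d v - rad_dim Q d x v))"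
    "mod_isomorphic \<Lambda> (soc \<Lambda> M) (semisimple_rep (soc_dim Q d x))"
proof -
  let ?N = "rep_module Q d x" and ?S = "semisimple_rep (\<lambda>v. d v - rad_dim Q d x v)"
  have N: "left_module \<Lambda> ?N" by (rule rep_module_left_module[OF x])
  interpret M: rsz_module Q I M by (rule rsz_moduleI[OF M])
  interpret N: rsz_module Q I ?N by (rule rsz_moduleI[OF N])
  obtain \<phi> where \<phi>: "\<phi> \<in> module_hom \<Lambda> M ?N" "bij_betw \<phi> (carrier M) (carrier ?N)"
    using iso by (auto simp: mod_isomorphic_def)
  let ?\<psi> = "inv_into (carrier M) \<phi>"
  have \<psi>: "?\<psi> \<in> module_hom \<Lambda> ?N M" by (rule module_hom_inverse[OF \<phi> M])
  have \<psi>\<phi>: "?\<psi> (\<phi> m) = m" if "m \<in> carrier M" for m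
    using bij_betw_inv_into_left[OF \<phi>(2) that] .
  have \<phi>im: "\<phi> ` carrier M = carrier ?N" using \<phi>(2) by (simp add: bij_betw_def)
  show "left_module \<Lambda> (top_mod \<Lambda> M)" "mod_isomorphic \<Lambda> (top_mod \<Lambda> M) ?S"
    "mod_isomorphic \<Lambda> (soc \<Lambda> M) (semisimple_rep (soc_dim Q d x))"
  proof -
    obtain f where f: "f \<in> module_hom \<Lambda> ?N ?S" "f ` carrier ?N = carrier ?S"
      and ker: "\<And>m. m \<in> carrier ?N \<Longrightarrow> f m = \<zero>\<^bsub>?S\<^esub> \<longleftrightarrow> m \<in> rad_submodule \<Lambda> ?N"
      and soc: "mod_isomorphic \<Lambda> (soc \<Lambda> ?N) (semisimple_rep (soc_dim Q d x))"
      by (rule top_soc_rep_module[OF x]) (rule that)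
    have im: "(\<lambda>m. f (\<phi> m)) ` carrier M = carrier ?S"
      using f(2) \<phi>im by (simp add: image_image[symmetric])
    have k: "f (\<phi> m) = \<zero>\<^bsub>?S\<^esub> \<longleftrightarrow> m \<in> rad_submodule \<Lambda> M" if m: "m \<in> carrier M" for m
    proof -
      have "\<phi> m \<in> rad_submodule \<Lambda> ?N \<longleftrightarrow> m \<in> rad_submodule \<Lambda> M"
        using module_hom_rad_submodule[OF \<phi>(1) M N, of m] module_hom_rad_submodule[OF \<psi> N M, of "\<phi> m"] \<psi>\<phi>[OF m]
        by auto
      then show ?thesis using ker[OF module_homD(1)[OF \<phi>(1) m]] by simp
    qed
    show "mod_isomorphic \<Lambda> (top_mod \<Lambda> M) ?S" "left_module \<Lambda> (top_mod \<Lambda> M)"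
      by (rule top_mod_isomorphic[OF M semisimple_rep_left_module module_hom_comp[OF \<phi>(1) f(1)] im k]; assumption)+
    have ann: "(\<forall>a\<in>arcs Q. N.ar a (\<phi> m) = \<zero>\<^bsub>?N\<^esub>) \<longleftrightarrow> (\<forall>a\<in>arcs Q. M.ar a m = \<zero>\<^bsub>M\<^esub>)" if m: "m \<in> carrier M" for m
    proof -
      have "N.ar a (\<phi> m) = \<zero>\<^bsub>?N\<^esub> \<longleftrightarrow> M.ar a m = \<zero>\<^bsub>M\<^esub>" if a: "a \<in> arcs Q" for a
      proof -
        have "N.ar a (\<phi> m) = \<phi> (M.ar a m)" by (rule module_homD(3)[OF \<phi>(1) arrow_closed[OF a] m, symmetric])
        moreover have "\<phi> \<zero>\<^bsub>M\<^esub> = \<zero>\<^bsub>?N\<^esub>" by (rule module_hom_zero[OF \<phi>(1) M N])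
        ultimately show ?thesis
          using \<phi>(2) M.op_closed(3)[OF a m] M.M.zero_closed unfolding bij_betw_def inj_on_def by metis
      qed
      then show ?thesis by blast
    qed
    have "mod_isomorphic \<Lambda> (soc \<Lambda> M) (soc \<Lambda> ?N)"
      unfolding mod_isomorphic_def
    proof (rule bexI)
      have c: "m \<in> carrier M" if "m \<in> carrier (soc \<Lambda> M)" for m using that by (simp add: M.soc_carrier)
      have cN: "\<phi> m \<in> carrier (soc \<Lambda> ?N)" if "m \<in> carrier (soc \<Lambda> M)" for m
        using that ann[OF c[OF that]] module_homD(1)[OF \<phi>(1) c[OF that]] unfolding M.soc_carrier N.soc_carrier by blast
      show "\<phi> \<in> module_hom \<Lambda> (soc \<Lambda> M) (soc \<Lambda> ?N)"
        by (rule module_homI) (auto simp: cN M.soc_ops N.soc_ops module_homD(2,3)[OF \<phi>(1)] c)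
      show "bij_betw \<phi> (carrier (soc \<Lambda> M)) (carrier (soc \<Lambda> ?N))"
        unfolding bij_betw_def
      proof
        show "inj_on \<phi> (carrier (soc \<Lambda> M))" using \<phi>(2) c unfolding bij_betw_def inj_on_def by blast
        show "\<phi> ` carrier (soc \<Lambda> M) = carrier (soc \<Lambda> ?N)"
        proof (intro equalityI subsetI)
          fix n assume n: "n \<in> carrier (soc \<Lambda> ?N)"
          then have "n \<in> carrier ?N" by (simp add: N.soc_carrier)
          then obtain m where m: "m \<in> carrier M" "n = \<phi> m" using \<phi>im by blast
          then have "m \<in> carrier (soc \<Lambda> M)" using n ann[OF m(1)] unfolding M.soc_carrier N.soc_carrier by blast
          then show "n \<in> \<phi> ` carrier (soc \<Lambda> M)" using m by blast
        qed (use cN in blast)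
      qed
    qed
    then show "mod_isomorphic \<Lambda> (soc \<Lambda> M) (semisimple_rep (soc_dim Q d x))" using soc mod_isomorphic_trans by blast
  qed
qed

lemma top_soc_pair_eq:
  assumes M: "left_module \<Lambda> M" and x: "x \<in> sq_zero_reps Q d" and d: "\<And>v. v \<notin> verts Q \<Longrightarrow> d v = 0"
    and iso: "mod_isomorphic \<Lambda> M (rep_module Q d x)"
  shows "top_soc_pair Q I M = (\<lambda>v. d v - rad_dim Q d x v, soc_dim Q d x)"
proof -
  interpret M: rsz_module Q I M by (rule rsz_moduleI[OF M])
  have "dimvec Q I (top_mod \<Lambda> M) = (\<lambda>v. d v - rad_dim Q d x v)"
    by (rule dimvec_of_isomorphic(2)[OF top_soc_isomorphic(1)[OF M x iso] zero_rep_in_sq_zero_reps _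
          top_soc_isomorphic(2)[OF M x iso]]) (simp add: d)
  moreover have s0: "soc_dim Q d x v = 0" if "v \<notin> verts Q" for v
    using soc_dim_le[of Q d x v] d[OF that] by simp
  have "dimvec Q I (soc \<Lambda> M) = soc_dim Q d x"
    by (rule dimvec_of_isomorphic(2)[OF M.soc_left_module zero_rep_in_sq_zero_reps _
          top_soc_isomorphic(3)[OF M x iso]]) (rule s0)
  ultimately show ?thesis by (simp add: top_soc_pair_def)
qed

text \<open>If \<open>A\<close> and \<open>B\<close> are isomorphic, the dimension vector of
  \<open>A\<close> can be computed in two ways and is both \<open>s\<close> and
  \<open>t\<close>.\<close>

lemma isomorphic_semisimple_rep_iff:
  assumes A: "left_module \<Lambda> A" "mod_isomorphic \<Lambda> A (semisimple_rep s)" "\<And>v. v \<notin> verts Q \<Longrightarrow> s v = 0"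
    and B: "left_module \<Lambda> B" "mod_isomorphic \<Lambda> B (semisimple_rep t)" "\<And>v. v \<notin> verts Q \<Longrightarrow> t v = 0"
  shows "mod_isomorphic \<Lambda> A B \<longleftrightarrow> s = t"
proof
  assume "mod_isomorphic \<Lambda> A B"
  then have "mod_isomorphic \<Lambda> A (semisimple_rep t)" using B(2) mod_isomorphic_trans by blast
  then show "s = t"
    using dimvec_of_isomorphic(2)[OF A(1) zero_rep_in_sq_zero_reps A(3) A(2)]
      dimvec_of_isomorphic(2)[OF A(1) zero_rep_in_sq_zero_reps B(3)] by simp
next
  assume "s = t"
  then show "mod_isomorphic \<Lambda> A B"
    using mod_isomorphic_trans[OF A(2)] mod_isomorphic_sym[OF B(1,2)] by simp
qed

lemma semisimple_rep_semisimple: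
  assumes "\<And>v. v \<notin> verts Q \<Longrightarrow> t v = 0"
  shows "fd_module Q I (semisimple_rep t)" "semisimple \<Lambda> (semisimple_rep t)"
proof -
  interpret rsz_module Q I "semisimple_rep t" by (rule rsz_moduleI[OF semisimple_rep_left_module])
  show "fd_module Q I (semisimple_rep t)"
    by (rule dimvec_of_isomorphic(1)[OF semisimple_rep_left_module zero_rep_in_sq_zero_reps _ mod_isomorphic_refl])
       (rule assms)
  show "semisimple \<Lambda> (semisimple_rep t)" unfolding semisimple_iff using semisimple_rep_arrow by blast
qed

text \<open>\<open>T\<close> is isomorphic to the module of a point \<open>x\<close>. Arrows kill
  that module, and an arrow applied to the unit vectors at its source reads off the columns of
  \<open>x a\<close>, so all matrices are zero.\<close>

lemma semisimple_isomorphic: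
  assumes fd: "fd_module Q I T" and ss: "semisimple \<Lambda> T"
  shows "mod_isomorphic \<Lambda> T (semisimple_rep (dimvec Q I T))"
proof -
  let ?d = "dimvec Q I T"
  have T: "left_module \<Lambda> T" using fd by (simp add: fd_module_def)
  interpret T: rsz_module Q I T by (rule rsz_moduleI[OF T])
  obtain x where x: "x \<in> sq_zero_reps Q ?d" and iso: "mod_isomorphic \<Lambda> T (rep_module Q ?d x)"
    by (rule exists_isomorphic_rep_module[OF fd refl])
  have xa: "x \<in> rep_ambient Q ?d" using x by (simp add: sq_zero_reps_def)
  let ?N = "rep_module Q ?d x"
  have N: "left_module \<Lambda> ?N" by (rule rep_module_left_module[OF x])
  obtain \<phi> where \<phi>: "\<phi> \<in> module_hom \<Lambda> T ?N" "bij_betw \<phi> (carrier T) (carrier ?N)"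
    using iso by (auto simp: mod_isomorphic_def)
  have ar0: "arrow_cl a \<odot>\<^bsub>?N\<^esub> m = \<zero>\<^bsub>?N\<^esub>" if a: "a \<in> arcs Q" and m: "m \<in> carrier ?N" for a m
  proof -
    obtain z where z: "z \<in> carrier T" "m = \<phi> z" using \<phi>(2) m by (auto simp: bij_betw_def)
    have "arrow_cl a \<odot>\<^bsub>?N\<^esub> m = \<phi> (T.ar a z)" using module_homD(3)[OF \<phi>(1) arrow_closed[OF a] z(1)] z by simp
    also have "T.ar a z = \<zero>\<^bsub>T\<^esub>" using ss z(1) a T.semisimple_iff by blast
    also have "\<phi> \<zero>\<^bsub>T\<^esub> = \<zero>\<^bsub>?N\<^esub>" by (rule module_hom_zero[OF \<phi>(1) T N])
    finally show ?thesis .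
  qed
  have "x a = 0\<^sub>m (?d (head Q a)) (?d (tail Q a))" if a: "a \<in> arcs Q" for a
  proof -
    note ac = rep_ambient_carrier[OF xa a]
    have "x a $$ (i, j) = 0" if ij: "i < ?d (head Q a)" "j < ?d (tail Q a)" for i j
    proof -
      let ?u = "unit_vec (?d (tail Q a)) j :: 'k vec"
      have "vertex_vec ?d (head Q a) (x a *\<^sub>v ?u) = \<zero>\<^bsub>?N\<^esub>"
        using vertex_vec_arrow[OF x a, of ?u] ar0[OF a vertex_vec_closed[of ?u ?d "tail Q a" x]] by simp
      then have "vertex_vec ?d (head Q a) (x a *\<^sub>v ?u) (head Q a) $ i = \<zero>\<^bsub>?N\<^esub> (head Q a) $ i" by simp
      then have "col (x a) j $ i = 0"
        using a ij mult_mat_unit_vec[OF ac ij(2)] by (simp add: vertex_vec_def rep_module_simps(2))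
      then show ?thesis using ac ij by simp
    qed
    then show ?thesis using ac by (intro eq_matI) auto
  qed
  then have "x = zero_rep Q ?d"
    using xa by (intro ext) (auto simp: zero_rep_def rep_ambient_def PiE_def extensional_def)
  then show ?thesis using iso by simp
qed

end

section \<open>Components of stratified spaces\<close>

text \<open>Irreducibility speaks of two closed sets; induction extends it to finitely many, the
  form in which density and genericity are derived from it.\<close>

lemma irreducible_in_finite_cover:
  assumes S: "irreducible_in X S" and F: "finite F" "\<And>C. C \<in> F \<Longrightarrow> closedin X C" "S \<subseteq> \<Union>F"
  shows "\<exists>C\<in>F. S \<subseteq> C"
  using F
proof (induction F)
  case empty
  then show ?case using S by (simp add: irreducible_in_def)
next
  case (insert C F)
  have "closedin X (\<Union>F)" using insert by (intro closedin_Union) auto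
  then have "S \<subseteq> C \<or> S \<subseteq> \<Union>F" using S insert.prems unfolding irreducible_in_def by auto
  then show ?case using insert by auto
qed

text \<open>The axioms gather what the description of components uses about ranks and strata;
  \<open>r\<close> stands for the dimension vector of the radical, \<open>s\<close> for that of the
  socle. A non-empty \<open>Z \<rho>\<close> need not contain a point with
  \<open>r x = \<rho>\<close>, so the results are stated for \<rho> of the form
  \<open>r x\<close>.\<close>

locale rank_stratification =
  fixes X :: "'x topology" and V :: "'v set" and d :: "'v \<Rightarrow> nat" and r s :: "'x \<Rightarrow> 'v \<Rightarrow> nat"
    and Z :: "('v \<Rightarrow> nat) \<Rightarrow> 'x set"
  assumes finite_V: "finite V" and d_outside: "v \<notin> V \<Longrightarrow> d v = 0"
    and r_le_s: "x \<in> topspace X \<Longrightarrow> r x v \<le> s x v" and s_le_d: "x \<in> topspace X \<Longrightarrow> s x v \<le> d v"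
    and closed_r: "v \<in> V \<Longrightarrow> closedin X {x \<in> topspace X. r x v \<le> k}"
    and closed_s: "v \<in> V \<Longrightarrow> closedin X {x \<in> topspace X. k \<le> s x v}"
    and Z_def: "Z \<rho> = {x \<in> topspace X. \<forall>v\<in>V. r x v \<le> \<rho> v \<and> \<rho> v \<le> s x v}"
    and irreducible_Z: "Z \<rho> \<noteq> {} \<Longrightarrow> irreducible_in X (Z \<rho>)"
begin

definition pair :: "'x \<Rightarrow> ('v \<Rightarrow> nat) \<times> ('v \<Rightarrow> nat)" where
  "pair x = (\<lambda>v. d v - r x v, s x)"

text \<open>\<open>s x\<close> is to be the least value on the stratum, at all vertices
  simultaneously and not merely minimal; \<open>generic_facts\<close> shows that it is
  attained.\<close>

definition generic :: "('v \<Rightarrow> nat) \<Rightarrow> 'x set" where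
  "generic \<rho> = {x \<in> Z \<rho>. r x = \<rho> \<and> (\<forall>y\<in>Z \<rho>. s x \<le> s y)}"

lemma r_outside: "x \<in> topspace X \<Longrightarrow> v \<notin> V \<Longrightarrow> r x v = 0"
  using r_le_s[of x v] s_le_d[of x v] d_outside[of v] by simp

lemma s_outside: "x \<in> topspace X \<Longrightarrow> v \<notin> V \<Longrightarrow> s x v = 0"
  using s_le_d[of x v] d_outside[of v] by simp

lemma mem_Z: "x \<in> topspace X \<Longrightarrow> x \<in> Z (r x)"
  by (simp add: Z_def r_le_s)

lemma closed_Z: "closedin X (Z \<rho>)"
proof -
  have "Z \<rho> = \<Inter>(insert (topspace X) ((\<lambda>v. {x \<in> topspace X. r x v \<le> \<rho> v} \<inter> {x \<in> topspace X. \<rho> v \<le> s x v}) ` V))"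
    unfolding Z_def by auto
  also have "closedin X \<dots>" by (rule closedin_Inter) (auto intro: closedin_Int closed_r closed_s)
  finally show ?thesis .
qed

text \<open>The generic points are the complement in \<open>Z \<rho>\<close> of finitely many closed
  sets, where at some vertex \<open>r\<close> drops below \<rho> or \<open>s\<close> exceeds its
  least value. None of these contains the stratum, and an irreducible set contained in a finite
  union of closed sets lies in one of them.\<close>

lemma generic_facts:
  assumes x: "x \<in> topspace X" "r x = \<rho>"
  shows "generic \<rho> \<noteq> {}" "openin (subtopology X (Z \<rho>)) (generic \<rho>)" "X closure_of generic \<rho> = Z \<rho>"
proof -
  have xZ: "x \<in> Z \<rho>" using mem_Z[OF x(1)] x(2) by simp
  have irr: "irreducible_in X (Z \<rho>)" using irreducible_Z xZ by blast
  have Zt: "y \<in> topspace X" if "y \<in> Z \<rho>" for y using that by (simp add: Z_def)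
  \<comment> \<open>The least values at different vertices may be attained at different points;
    irreducibility makes them occur together.\<close>
  define m where "m v = (LEAST k. \<exists>y\<in>Z \<rho>. s y v = k)" for v
  have m_ex: "\<exists>y\<in>Z \<rho>. s y v = m v" for v unfolding m_def by (rule LeastI_ex) (use xZ in blast)
  have m_le: "m v \<le> s y v" if "y \<in> Z \<rho>" for v y unfolding m_def by (rule Least_le) (use that in blast)
  define A where "A v = {y \<in> topspace X. r y v \<le> \<rho> v - 1}" for v
  define B where "B v = {y \<in> topspace X. Suc (m v) \<le> s y v}" for v
  \<comment> \<open>Vertices with \<open>\<rho> v = 0\<close> are left out: there
    \<open>\<rho> v - 1\<close> is truncated to \<open>0\<close> and \<open>A v\<close> would
    contain the whole stratum.\<close>
  define F where "F = A ` {v \<in> V. \<rho> v > 0} \<union> B ` V"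
  have F: "finite F" "\<And>C. C \<in> F \<Longrightarrow> closedin X C"
    using finite_V by (auto simp: F_def A_def B_def closed_r closed_s)
  have proper: "\<not> Z \<rho> \<subseteq> C" if C: "C \<in> F" for C
  proof -
    consider v where "\<rho> v > 0" "C = A v" | v where "C = B v" using C by (auto simp: F_def)
    then show ?thesis
    proof cases
      case 1
      then have "x \<notin> C" using x(2) by (auto simp: A_def)
      then show ?thesis using xZ by blast
    next
      case (2 v)
      obtain y where "y \<in> Z \<rho>" "s y v = m v" using m_ex by blast
      then show ?thesis using 2 by (auto simp: B_def)
    qed
  qed
  have gen: "generic \<rho> = Z \<rho> - \<Union>F"
  proof (intro equalityI subsetI)
    fix y assume "y \<in> generic \<rho>"
    then have y: "y \<in> Z \<rho>" "r y = \<rho>" and ys: "\<And>w. w \<in> Z \<rho> \<Longrightarrow> s y \<le> s w" by (auto simp: generic_def)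
    have "s y v \<le> m v" for v
    proof -
      obtain w where w: "w \<in> Z \<rho>" "s w v = m v" using m_ex by blast
      then show ?thesis using ys[OF w(1)] by (auto simp: le_fun_def dest: spec[of _ v])
    qed
    then show "y \<in> Z \<rho> - \<Union>F" using y by (auto simp: F_def A_def B_def not_less_eq_eq[symmetric])
  next
    fix y assume y: "y \<in> Z \<rho> - \<Union>F"
    then have yZ: "y \<in> Z \<rho>" by blast
    have "r y v = \<rho> v" for v
    proof (cases "v \<in> V")
      case True
      have le: "r y v \<le> \<rho> v" using yZ True by (simp add: Z_def)
      have "y \<notin> A v" if "\<rho> v > 0" using y True that by (auto simp: F_def)
      then show ?thesis using le Zt[OF yZ] by (cases "\<rho> v") (auto simp: A_def)
    next
      case False
      then show ?thesis using r_outside[OF Zt[OF yZ] False] r_outside[OF x(1) False] x(2) by simp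
    qed
    moreover have "s y v \<le> s w v" if w: "w \<in> Z \<rho>" for w v
    proof (cases "v \<in> V")
      case True
      then have "y \<notin> B v" using y by (auto simp: F_def)
      then show ?thesis using m_le[OF w, of v] Zt[OF yZ] by (simp add: B_def)
    qed (simp add: s_outside Zt[OF yZ])
    ultimately show "y \<in> generic \<rho>" using yZ by (auto simp: generic_def le_fun_def)
  qed
  have UF: "closedin X (\<Union>F)" using F by (intro closedin_Union) auto
  show "generic \<rho> \<noteq> {}"
    unfolding gen using irreducible_in_finite_cover[OF irr F] proper by blast
  show "openin (subtopology X (Z \<rho>)) (generic \<rho>)"
    unfolding openin_subtopology gen
    by (rule exI[of _ "topspace X - \<Union>F"]) (use UF Zt in auto)
  have "generic \<rho> \<subseteq> X closure_of generic \<rho>"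
    by (rule closure_of_subset) (use Zt in \<open>auto simp: generic_def\<close>)
  \<comment> \<open>The covering argument again: \<open>Z \<rho>\<close> lies in the closure of its
    generic points or in a member of \<open>F\<close>, and the latter is excluded.\<close>
  then have "Z \<rho> \<subseteq> \<Union>(insert (X closure_of generic \<rho>) F)" using gen by auto
  then have "\<exists>C\<in>insert (X closure_of generic \<rho>) F. Z \<rho> \<subseteq> C"
    using F by (intro irreducible_in_finite_cover[OF irr]) auto
  then have "Z \<rho> \<subseteq> X closure_of generic \<rho>" using proper by blast
  moreover have "X closure_of generic \<rho> \<subseteq> Z \<rho>"
    by (rule closure_of_minimal[OF _ closed_Z]) (auto simp: generic_def)
  ultimately show "X closure_of generic \<rho> = Z \<rho>" by blast
qed

text \<open>The set lies between the generic points, which are dense in the stratum, and the closed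
  stratum itself.\<close>

lemma closure_of_equal_r:
  assumes x: "x \<in> topspace X" "r x = \<rho>"
  shows "X closure_of {y \<in> topspace X. r y = \<rho>} = Z \<rho>"
proof
  show "X closure_of {y \<in> topspace X. r y = \<rho>} \<subseteq> Z \<rho>"
    by (rule closure_of_minimal[OF _ closed_Z]) (use mem_Z in blast)
  have "generic \<rho> \<subseteq> {y \<in> topspace X. r y = \<rho>}" by (auto simp: generic_def Z_def)
  then show "Z \<rho> \<subseteq> X closure_of {y \<in> topspace X. r y = \<rho>}"
    using closure_of_mono generic_facts(3)[OF x] by blast
qed

text \<open>Each point lies in the stratum of the other, which gives both inequalities.\<close>

lemma Z_inj:
  assumes x: "x \<in> topspace X" and y: "y \<in> topspace X" and eq: "Z (r x) = Z (r y)"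
  shows "r x = r y"
proof (rule ext)
  fix v
  have "x \<in> Z (r y)" "y \<in> Z (r x)" using mem_Z[OF x] mem_Z[OF y] eq by auto
  then show "r x v = r y v"
    using r_outside[OF x] r_outside[OF y] by (cases "v \<in> V") (auto simp: Z_def intro!: antisym)
qed

lemma irreducible_subset_Z:
  assumes "irreducible_in X S"
  shows "\<exists>x\<in>topspace X. S \<subseteq> Z (r x)"
proof -
  \<comment> \<open>\<open>r\<close> is bounded by \<open>d\<close> and vanishes off the vertices,
    so it takes finitely many values; \<open>insert 0\<close> keeps \<open>Max\<close> meaningful
    when there are no vertices.\<close>
  have "finite {f. \<forall>v. (v \<in> V \<longrightarrow> f v \<in> {..Max (insert 0 (d ` V))}) \<and> (v \<notin> V \<longrightarrow> f v = 0)}"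
    by (rule finite_set_of_finite_funs[OF finite_V]) simp
  moreover have "r ` topspace X \<subseteq> {f. \<forall>v. (v \<in> V \<longrightarrow> f v \<in> {..Max (insert 0 (d ` V))}) \<and> (v \<notin> V \<longrightarrow> f v = 0)}"
  proof clarify
    fix x v assume x: "x \<in> topspace X"
    have "r x v \<le> d v" using r_le_s[OF x, of v] s_le_d[OF x, of v] by simp
    moreover have "d v \<le> Max (insert 0 (d ` V))" if "v \<in> V" using finite_V that by (intro Max_ge) auto
    ultimately show "(v \<in> V \<longrightarrow> r x v \<in> {..Max (insert 0 (d ` V))}) \<and> (v \<notin> V \<longrightarrow> r x v = 0)"
      using r_outside[OF x] by auto
  qed
  ultimately have fin: "finite (r ` topspace X)" using finite_subset by blast
  have "S \<subseteq> \<Union>(Z ` r ` topspace X)" using assms mem_Z unfolding irreducible_in_def by blast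
  then have "\<exists>C\<in>Z ` r ` topspace X. S \<subseteq> C"
    by (intro irreducible_in_finite_cover[OF assms finite_imageI[OF fin]]) (auto simp: closed_Z)
  then show ?thesis by blast
qed

lemma irreducible_component_eq_Z:
  assumes "C \<in> irreducible_components X"
  obtains x where "x \<in> topspace X" "C = Z (r x)"
proof -
  have C: "irreducible_in X C" "\<And>C'. irreducible_in X C' \<Longrightarrow> C \<subseteq> C' \<Longrightarrow> C' = C"
    using assms by (auto simp: irreducible_components_def)
  obtain x where x: "x \<in> topspace X" "C \<subseteq> Z (r x)" using irreducible_subset_Z[OF C(1)] by blast
  have "irreducible_in X (Z (r x))" by (rule irreducible_Z) (use mem_Z[OF x(1)] in blast)
  then have "Z (r x) = C" using C(2) x(2) by blast
  then show ?thesis using that[OF x(1)] by simp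
qed

text \<open>A generic point of the stratum has the same \<open>r\<close> and a socle vector at most
  \<open>s x\<close>; minimality of the pair makes the two socle vectors equal.\<close>

lemma minimal_pair_generic:
  assumes x: "x \<in> topspace X" and min: "pair x \<in> minimal_elements (pair ` topspace X)"
  shows "x \<in> generic (r x)"
proof -
  obtain g where g: "g \<in> generic (r x)" using generic_facts(1)[OF x refl] by blast
  then have gt: "g \<in> topspace X" "r g = r x" and le: "\<And>y. y \<in> Z (r x) \<Longrightarrow> s g \<le> s y" by (auto simp: generic_def Z_def)
  have "s g \<le> s x" using le mem_Z[OF x] by blast
  then have "pair g \<le> pair x" using gt by (simp add: pair_def)
  moreover have "\<not> pair g < pair x" using min gt by (auto simp: minimal_elements_def)
  ultimately have "pair g = pair x" by (simp add: less_le)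
  then have "s g = s x" by (simp add: pair_def)
  then show ?thesis using le mem_Z[OF x] by (simp add: generic_def)
qed

text \<open>A pair below that of a generic point of \<open>Z (r x)\<close> belongs to a stratum
  containing \<open>Z (r x)\<close>. Conversely a stratum containing \<open>Z (r x)\<close> has a
  generic point whose pair is at most that of the given \<open>y\<close>.\<close>

lemma component_iff:
  assumes x: "x \<in> topspace X"
  shows "Z (r x) \<in> irreducible_components X \<longleftrightarrow>
    (\<exists>y\<in>topspace X. r y = r x \<and> pair y \<in> minimal_elements (pair ` topspace X))"
proof
  assume "Z (r x) \<in> irreducible_components X"
  then have maxi: "\<And>C. irreducible_in X C \<Longrightarrow> Z (r x) \<subseteq> C \<Longrightarrow> C = Z (r x)" by (auto simp: irreducible_components_def)
  obtain g where g: "g \<in> generic (r x)" using generic_facts(1)[OF x refl] by blast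
  then have gt: "g \<in> topspace X" "r g = r x" and le: "\<And>y. y \<in> Z (r x) \<Longrightarrow> s g \<le> s y" by (auto simp: generic_def Z_def)
  have "\<not> pair y < pair g" if y: "y \<in> topspace X" for y
  proof
    assume lt: "pair y < pair g"
    then have "pair y \<le> pair g" by simp
    then have ge: "d v - r y v \<le> d v - r x v" "s y v \<le> s g v" for v
      using gt(2) by (auto simp: pair_def le_fun_def)
    have rle: "r x v \<le> r y v" for v
      using ge(1)[of v] r_le_s[OF y, of v] s_le_d[OF y, of v] r_le_s[OF x, of v] s_le_d[OF x, of v] by simp
    \<comment> \<open>For \<open>z\<close> in \<open>Z (r x)\<close> the chain is
      \<open>r z \<le> r x \<le> r y \<le> s y \<le> s g \<le> s z\<close>.\<close>
    have "Z (r x) \<subseteq> Z (r y)"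
    proof
      fix z assume z: "z \<in> Z (r x)"
      have "r z v \<le> r y v \<and> r y v \<le> s z v" if "v \<in> V" for v
      proof -
        have "r z v \<le> r x v" using z that by (simp add: Z_def)
        moreover have "s g v \<le> s z v" using le[OF z] by (simp add: le_fun_def)
        ultimately show ?thesis using rle[of v] ge(2)[of v] r_le_s[OF y, of v] by simp
      qed
      then show "z \<in> Z (r y)" using z by (simp add: Z_def)
    qed
    moreover have "irreducible_in X (Z (r y))" by (rule irreducible_Z) (use mem_Z[OF y] in blast)
    ultimately have "Z (r y) = Z (r x)" using maxi by blast
    then have ry: "r y = r x" by (rule Z_inj[OF y x])
    then have "s g \<le> s y" using le mem_Z[OF y] by simp
    moreover have "s y \<le> s g" using ge(2) by (simp add: le_fun_def)
    ultimately have "pair y = pair g" using ry gt by (simp add: pair_def)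
    then show False using lt by simp
  qed
  then have "pair g \<in> minimal_elements (pair ` topspace X)" using gt by (auto simp: minimal_elements_def)
  then show "\<exists>y\<in>topspace X. r y = r x \<and> pair y \<in> minimal_elements (pair ` topspace X)" using gt by blast
next
  assume "\<exists>y\<in>topspace X. r y = r x \<and> pair y \<in> minimal_elements (pair ` topspace X)"
  then obtain y where y: "y \<in> topspace X" "r y = r x" and min: "pair y \<in> minimal_elements (pair ` topspace X)" by blast
  have gen: "y \<in> generic (r x)" using minimal_pair_generic[OF y(1) min] y(2) by simp
  show "Z (r x) \<in> irreducible_components X"
    unfolding irreducible_components_def
  proof (intro CollectI conjI allI impI)
    show "irreducible_in X (Z (r x))" by (rule irreducible_Z) (use mem_Z[OF x] in blast)
    fix C assume C: "irreducible_in X C \<and> Z (r x) \<subseteq> C"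
    then obtain z where z: "z \<in> topspace X" "C \<subseteq> Z (r z)" using irreducible_subset_Z by blast
    have yz: "y \<in> Z (r z)" using gen C z by (auto simp: generic_def)
    \<comment> \<open>\<open>y\<close> lies in the larger stratum, so the least \<open>s\<close>
      there is at most \<open>s y\<close>, while \<open>r\<close> can only have grown.\<close>
    obtain g where g: "g \<in> generic (r z)" using generic_facts(1)[OF z(1) refl] by blast
    then have gt: "g \<in> topspace X" "r g = r z" "s g \<le> s y" using yz by (auto simp: generic_def Z_def)
    have "d v - r z v \<le> d v - r y v" for v
    proof (cases "v \<in> V")
      case True
      then have "r y v \<le> r z v" using yz by (simp add: Z_def)
      then show ?thesis by simp
    qed (simp add: d_outside)
    then have "pair g \<le> pair y" using gt by (simp add: pair_def le_fun_def)
    moreover have "\<not> pair g < pair y" using min gt(1) by (auto simp: minimal_elements_def)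
    ultimately have "pair g = pair y" by (simp add: less_le)
    then have eq: "d v - r z v = d v - r x v" for v using gt(2) y(2) by (auto simp: pair_def dest: fun_cong[of _ _ v])
    \<comment> \<open>\<open>r\<close> is bounded by \<open>d\<close>, so the truncated differences
      determine it.\<close>
    have "r z = r x"
    proof
      fix v
      show "r z v = r x v"
        using eq[of v] r_le_s[OF x, of v] s_le_d[OF x, of v] r_le_s[OF z(1), of v] s_le_d[OF z(1), of v] by simp
    qed
    then show "C = Z (r x)" using C z by auto
  qed
qed

lemma generic_s_eq: "x \<in> generic \<rho> \<Longrightarrow> y \<in> generic \<rho> \<Longrightarrow> s x = s y"
  by (auto simp: generic_def intro!: antisym)

lemma generic_dense:
  assumes x: "x \<in> topspace X"
  shows "subtopology X (Z (r x)) closure_of generic (r x) = Z (r x)"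
proof -
  have "Z (r x) \<inter> generic (r x) = generic (r x)" by (auto simp: generic_def)
  then show ?thesis using generic_facts(3)[OF x refl] by (simp add: closure_of_subtopology)
qed

text \<open>The generic points form a non-empty open set, so every dense set meets them. Hence a
  socle that is constant on some dense open subset must be the one with the least
  \<open>s\<close>.\<close>

lemma generic_meets_dense:
  assumes x: "x \<in> topspace X" and U: "openin (subtopology X (Z (r x))) U"
    "subtopology X (Z (r x)) closure_of U = topspace (subtopology X (Z (r x)))"
  shows "\<exists>g\<in>U. g \<in> generic (r x)"
proof -
  obtain g where g: "g \<in> generic (r x)" using generic_facts(1)[OF x refl] by blast
  have "g \<in> topspace (subtopology X (Z (r x)))" using g by (auto simp: generic_def Z_def)
  then have "g \<in> subtopology X (Z (r x)) closure_of U" using U(2) by simp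
  then show ?thesis using g generic_facts(2)[OF x refl] unfolding in_closure_of by blast
qed

end

section \<open>Components of the representation variety\<close>

locale rsz_dimension = rsz_algebra Q I
  for Q :: "('v, 'e) pre_digraph" and I :: "(('v, 'e) path \<Rightarrow> 'k::alg_closed_field) set" +
  fixes d :: "'v \<Rightarrow> nat"
  assumes d_outside: "v \<notin> verts Q \<Longrightarrow> d v = 0"
begin

lemma topspace_Rep_space: "topspace (Rep_space Q I d) = sq_zero_reps Q d"
  by (auto simp: Rep_space_def topspace_zariski Rep_eq sq_zero_reps_def)

sublocale strat: rank_stratification "Rep_space Q I d" "verts Q" d "rad_dim Q d" "soc_dim Q d" "rank_stratum Q d"
proof
  show "finite (verts Q)" by (rule finite_verts)
  show "d v = 0" if "v \<notin> verts Q" for v by (rule d_outside[OF that])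
  show "rad_dim Q d x v \<le> soc_dim Q d x v" if "x \<in> topspace (Rep_space Q I d)" for x v
    using that by (intro rad_dim_le_soc_dim) (simp add: topspace_Rep_space)
  show "soc_dim Q d x v \<le> d v" for x v by (rule soc_dim_le)
  have closed: "closedin (Rep_space Q I d) {x \<in> topspace (Rep_space Q I d). P x}"
    if "closedin (zariski (rep_ambient Q d) (rep_coords Q d)) {x \<in> rep_ambient Q d. P x}" for P
    unfolding topspace_Rep_space Rep_space_def Rep_eq closedin_subtopology
    by (rule exI, rule conjI[OF that]) (auto simp: sq_zero_reps_def topspace_zariski)
  show "closedin (Rep_space Q I d) {x \<in> topspace (Rep_space Q I d). rad_dim Q d x v \<le> k}" for v k
    by (rule closed[OF closedin_rad_dim_le])
  show "closedin (Rep_space Q I d) {x \<in> topspace (Rep_space Q I d). k \<le> soc_dim Q d x v}" for v k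
  proof (cases "k \<le> d v")
    case True
    then show ?thesis by (intro closed closedin_soc_dim_ge)
  next
    case False
    have "\<not> k \<le> soc_dim Q d x v" for x :: "'e \<Rightarrow> 'k mat" using soc_dim_le[of Q d x v] False by simp
    then show ?thesis by simp
  qed
  show "rank_stratum Q d \<rho> = {x \<in> topspace (Rep_space Q I d).
      \<forall>v\<in>verts Q. rad_dim Q d x v \<le> \<rho> v \<and> \<rho> v \<le> soc_dim Q d x v}" for \<rho>
    by (simp add: rank_stratum_def topspace_Rep_space)
  show "irreducible_in (Rep_space Q I d) (rank_stratum Q d \<rho>)"
    if ne: "(rank_stratum Q d \<rho> :: ('e \<Rightarrow> 'k mat) set) \<noteq> {}" for \<rho>
    unfolding Rep_space_def Rep_eq
  proof (rule irreducible_in_subtopology[OF irreducible_rank_stratum[OF fin_digraph_axioms _ ne]])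
    fix v assume v: "v \<in> verts Q"
    \<comment> \<open>A point of the stratum bounds \<rho> by \<open>soc_dim\<close> and so by
      \<open>d\<close>, as the construction of the joining curves requires.\<close>
    obtain x :: "'e \<Rightarrow> 'k mat" where "x \<in> rank_stratum Q d \<rho>" using ne by blast
    then have "\<rho> v \<le> soc_dim Q d x v" using v by (simp add: rank_stratum_def)
    then show "\<rho> v \<le> d v" using soc_dim_le[of Q d x v] by simp
  qed (auto simp: rank_stratum_def)
qed

section \<open>Translation of the statements about modules to points\<close>

lemma rep_module_fd:
  assumes "x \<in> sq_zero_reps Q d"
  shows "fd_module Q I (rep_module Q d x)" "dimvec Q I (rep_module Q d x) = d"
  using dimvec_of_isomorphic[OF rep_module_left_module[OF assms] assms d_outside mod_isomorphic_refl] by auto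

lemma top_soc_pair_pair:
  assumes "left_module \<Lambda> M" "x \<in> sq_zero_reps Q d" "mod_isomorphic \<Lambda> M (rep_module Q d x)"
  shows "top_soc_pair Q I M = strat.pair x"
  using top_soc_pair_eq[OF assms(1,2) d_outside assms(3)] by (simp add: strat.pair_def)

text \<open>Each module counted in \<open>Top_Soc\<close> is isomorphic to the module of a point,
  and the module of a point is itself counted.\<close>

lemma Top_Soc_eq: "Top_Soc Q I d = strat.pair ` topspace (Rep_space Q I d)"
proof (intro equalityI subsetI)
  fix p assume "p \<in> Top_Soc Q I d"
  then obtain M :: "('v, 'e, 'k) std_module" where M: "fd_module Q I M" "dimvec Q I M = d" "p = top_soc_pair Q I M"
    by (auto simp: Top_Soc_def)
  obtain x where x: "x \<in> sq_zero_reps Q d" "mod_isomorphic \<Lambda> M (rep_module Q d x)"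
    by (rule exists_isomorphic_rep_module[OF M(1,2)])
  have "left_module \<Lambda> M" using M(1) by (simp add: fd_module_def)
  then have "p = strat.pair x" using top_soc_pair_pair x M(3) by simp
  then show "p \<in> strat.pair ` topspace (Rep_space Q I d)" using x(1) topspace_Rep_space by simp
next
  fix p assume "p \<in> strat.pair ` topspace (Rep_space Q I d)"
  then obtain x where x: "x \<in> sq_zero_reps Q d" "p = strat.pair x" by (auto simp: topspace_Rep_space)
  have "p = top_soc_pair Q I (rep_module Q d x)"
    using top_soc_pair_pair[OF rep_module_left_module[OF x(1)] x(1) mod_isomorphic_refl] x(2) by simp
  then show "p \<in> Top_Soc Q I d" unfolding Top_Soc_def using rep_module_fd[OF x(1)] by blast
qed

lemma top_isomorphic_iff:
  assumes x: "x \<in> sq_zero_reps Q d" and M: "left_module \<Lambda> M" "mod_isomorphic \<Lambda> M (rep_module Q d x)"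
    and T: "left_module \<Lambda> T" "mod_isomorphic \<Lambda> T (semisimple_rep t)" "\<And>v. v \<notin> verts Q \<Longrightarrow> t v = 0"
  shows "mod_isomorphic \<Lambda> (top_mod \<Lambda> M) T \<longleftrightarrow> (\<lambda>v. d v - rad_dim Q d x v) = t"
  by (rule isomorphic_semisimple_rep_iff[OF top_soc_isomorphic(1,2)[OF M(1) x M(2)] _ T]) (simp add: d_outside)

lemma soc_isomorphic_iff:
  assumes x: "x \<in> sq_zero_reps Q d" and M: "left_module \<Lambda> M" "mod_isomorphic \<Lambda> M (rep_module Q d x)"
    and S: "left_module \<Lambda> S" "mod_isomorphic \<Lambda> S (semisimple_rep s)" "\<And>v. v \<notin> verts Q \<Longrightarrow> s v = 0"
  shows "mod_isomorphic \<Lambda> (soc \<Lambda> M) S \<longleftrightarrow> soc_dim Q d x = s"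
proof -
  interpret M: rsz_module Q I M by (rule rsz_moduleI[OF M(1)])
  have z: "soc_dim Q d x v = 0" if "v \<notin> verts Q" for v
    using soc_dim_le[of Q d x v] d_outside[OF that] by simp
  show ?thesis
    by (rule isomorphic_semisimple_rep_iff[OF M.soc_left_module top_soc_isomorphic(3)[OF M(1) x M(2)] z S])
qed

lemma Rep_top_eq:
  assumes "left_module \<Lambda> T" "mod_isomorphic \<Lambda> T (semisimple_rep t)" "\<And>v. v \<notin> verts Q \<Longrightarrow> t v = 0"
  shows "Rep_top Q I d T = {x \<in> topspace (Rep_space Q I d). (\<lambda>v. d v - rad_dim Q d x v) = t}"
  unfolding Rep_top_def Rep_eq topspace_Rep_space
  using top_isomorphic_iff[OF _ rep_module_left_module mod_isomorphic_refl assms] by blast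

lemma diff_rad_dim_eq_iff:
  "(\<lambda>v. d v - rad_dim Q d x v) = (\<lambda>v. d v - rad_dim Q d y v) \<longleftrightarrow> rad_dim Q d x = rad_dim Q d y"
proof
  assume e: "(\<lambda>v. d v - rad_dim Q d x v) = (\<lambda>v. d v - rad_dim Q d y v)"
  show "rad_dim Q d x = rad_dim Q d y"
  proof
    fix v
    show "rad_dim Q d x v = rad_dim Q d y v"
      using fun_cong[OF e, of v] rad_dim_le[of Q d x v] rad_dim_le[of Q d y v] by simp
  qed
qed simp

lemma closure_Rep_top_eq:
  assumes x: "x \<in> topspace (Rep_space Q I d)" and T: "left_module \<Lambda> T"
    "mod_isomorphic \<Lambda> T (semisimple_rep (\<lambda>v. d v - rad_dim Q d x v))"
  shows "closure_Rep_top Q I d T = rank_stratum Q d (rad_dim Q d x)"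
proof -
  have "Rep_top Q I d T = {y \<in> topspace (Rep_space Q I d). rad_dim Q d y = rad_dim Q d x}"
    using Rep_top_eq[OF T] by (simp add: d_outside diff_rad_dim_eq_iff)
  then show ?thesis unfolding closure_Rep_top_def using strat.closure_of_equal_r[OF x refl] by simp
qed

text \<open>If no point has top \<open>T\<close>, the closure is empty and not a component, as
  irreducible sets are non-empty. Otherwise the closure is a stratum \<open>Z (r x)\<close>, to
  which \<open>component_iff\<close> applies.\<close>

lemma component_closure_iff:
  assumes T: "left_module \<Lambda> T" "mod_isomorphic \<Lambda> T (semisimple_rep t)" "\<And>v. v \<notin> verts Q \<Longrightarrow> t v = 0"
  shows "closure_Rep_top Q I d T \<in> irreducible_components (Rep_space Q I d) \<longleftrightarrow>
    (\<exists>x\<in>topspace (Rep_space Q I d). (\<lambda>v. d v - rad_dim Q d x v) = t \<and>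
      strat.pair x \<in> minimal_elements (Top_Soc Q I d))"
proof (cases "Rep_top Q I d T = {}")
  case True
  then have "closure_Rep_top Q I d T = {}" by (simp add: closure_Rep_top_def)
  then have "closure_Rep_top Q I d T \<notin> irreducible_components (Rep_space Q I d)"
    by (simp add: irreducible_components_def irreducible_in_def)
  moreover have "\<not> (\<exists>x\<in>topspace (Rep_space Q I d). (\<lambda>v. d v - rad_dim Q d x v) = t)"
    using True Rep_top_eq[OF T] by simp
  ultimately show ?thesis by meson
next
  case False
  then obtain x where x: "x \<in> topspace (Rep_space Q I d)" "(\<lambda>v. d v - rad_dim Q d x v) = t"
    using Rep_top_eq[OF T] by auto
  have clo: "closure_Rep_top Q I d T = rank_stratum Q d (rad_dim Q d x)"
    by (rule closure_Rep_top_eq[OF x(1) T(1)]) (simp add: x(2) T(2))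
  have eq: "(\<lambda>v. d v - rad_dim Q d y v) = t \<longleftrightarrow> rad_dim Q d y = rad_dim Q d x" for y
    unfolding x(2)[symmetric] by (rule diff_rad_dim_eq_iff)
  show ?thesis unfolding clo eq Top_Soc_eq by (rule strat.component_iff[OF x(1)])
qed

lemma semisimple_facts:
  assumes "fd_module Q I T" "semisimple \<Lambda> T"
  shows "left_module \<Lambda> T" "mod_isomorphic \<Lambda> T (semisimple_rep (dimvec Q I T))"
    "\<And>v. v \<notin> verts Q \<Longrightarrow> dimvec Q I T v = 0"
  using assms semisimple_isomorphic[OF assms] by (simp_all add: fd_module_def dimvec_def)

lemma closure_component_iff_minimal:
  fixes T :: "(('v, 'e, 'k) bqa, 't) module"
  assumes fd: "fd_module Q I T" and ss: "semisimple \<Lambda> T"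
  shows "closure_Rep_top Q I d T \<in> irreducible_components (Rep_space Q I d) \<longleftrightarrow>
    (\<exists>N :: ('v, 'e, 'k) std_module. fd_module Q I N \<and> dimvec Q I N = d \<and>
      mod_isomorphic \<Lambda> (top_mod \<Lambda> N) T \<and> top_soc_pair Q I N \<in> minimal_elements (Top_Soc Q I d))"
    (is "_ \<longleftrightarrow> ?R")
proof -
  note T = semisimple_facts[OF fd ss]
  have "?R \<longleftrightarrow> (\<exists>x\<in>topspace (Rep_space Q I d). (\<lambda>v. d v - rad_dim Q d x v) = dimvec Q I T \<and>
      strat.pair x \<in> minimal_elements (Top_Soc Q I d))"
  proof
    assume ?R
    then obtain N :: "('v, 'e, 'k) std_module" where N: "fd_module Q I N" "dimvec Q I N = d"
      "mod_isomorphic \<Lambda> (top_mod \<Lambda> N) T" "top_soc_pair Q I N \<in> minimal_elements (Top_Soc Q I d)" by (elim exE conjE)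
    have NL: "left_module \<Lambda> N" using N(1) by (simp add: fd_module_def)
    obtain x where x: "x \<in> sq_zero_reps Q d" "mod_isomorphic \<Lambda> N (rep_module Q d x)"
      by (rule exists_isomorphic_rep_module[OF N(1,2)])
    show "\<exists>x\<in>topspace (Rep_space Q I d). (\<lambda>v. d v - rad_dim Q d x v) = dimvec Q I T \<and>
      strat.pair x \<in> minimal_elements (Top_Soc Q I d)"
      using x(1) top_isomorphic_iff[OF x(1) NL x(2) T] N(3,4) top_soc_pair_pair[OF NL x]
      by (intro bexI[of _ x]) (simp_all add: topspace_Rep_space)
  next
    assume "\<exists>x\<in>topspace (Rep_space Q I d). (\<lambda>v. d v - rad_dim Q d x v) = dimvec Q I T \<and>
      strat.pair x \<in> minimal_elements (Top_Soc Q I d)"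
    then obtain x where x: "x \<in> sq_zero_reps Q d" "(\<lambda>v. d v - rad_dim Q d x v) = dimvec Q I T"
      "strat.pair x \<in> minimal_elements (Top_Soc Q I d)" by (auto simp: topspace_Rep_space)
    note NL = rep_module_left_module[OF x(1)]
    show ?R
      using rep_module_fd[OF x(1)] top_isomorphic_iff[OF x(1) NL mod_isomorphic_refl T] x(2,3)
        top_soc_pair_pair[OF NL x(1) mod_isomorphic_refl]
      by (intro exI[of _ "rep_module Q d x"]) simp
  qed
  then show ?thesis using component_closure_iff[OF T] by simp
qed

text \<open>Each \<open>M i\<close> is replaced by a point \<open>x i\<close> with an isomorphic
  module. Minimality makes \<open>x i\<close> generic in its stratum, so its socle vector is the
  generic one there; the statements on tops and socles turn into statements about \<open>r\<close>
  and \<open>s\<close> at these points.\<close>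

lemma components_of_minimal_modules:
  fixes M :: "nat \<Rightarrow> (('v, 'e, 'k) bqa, 'm) module"
  assumes M: "\<And>i. i \<in> {1..m} \<Longrightarrow> fd_module Q I (M i)" "\<And>i. i \<in> {1..m} \<Longrightarrow> dimvec Q I (M i) = d"
    and bij: "bij_betw (\<lambda>i. top_soc_pair Q I (M i)) {1..m} (minimal_elements (Top_Soc Q I d))"
  shows "card (irreducible_components (Rep_space Q I d)) = m"
    "irreducible_components (Rep_space Q I d) = (\<lambda>i. closure_Rep_top Q I d (top_mod \<Lambda> (M i))) ` {1..m}"
    "\<And>T :: (('v, 'e, 'k) bqa, 't) module. fd_module Q I T \<Longrightarrow> semisimple \<Lambda> T \<Longrightarrow>
      generic_top Q I d T \<longleftrightarrow> (\<exists>i\<in>{1..m}. mod_isomorphic \<Lambda> (top_mod \<Lambda> (M i)) T)"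
    "\<And>S :: (('v, 'e, 'k) bqa, 's) module. fd_module Q I S \<Longrightarrow> semisimple \<Lambda> S \<Longrightarrow>
      generic_socle Q I d S \<longleftrightarrow> (\<exists>i\<in>{1..m}. mod_isomorphic \<Lambda> (soc \<Lambda> (M i)) S)"
proof -
  let ?X = "Rep_space Q I d" and ?r = "rad_dim Q d" and ?min = "minimal_elements (Top_Soc Q I d)"
  have lm: "left_module \<Lambda> (M i)" if "i \<in> {1..m}" for i using M(1)[OF that] by (simp add: fd_module_def)
  have "\<exists>x. i \<in> {1..m} \<longrightarrow> x \<in> sq_zero_reps Q d \<and> mod_isomorphic \<Lambda> (M i) (rep_module Q d x)" for i
  proof (cases "i \<in> {1..m}")
    case True
    obtain x where "x \<in> sq_zero_reps Q d" "mod_isomorphic \<Lambda> (M i) (rep_module Q d x)"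
      by (rule exists_isomorphic_rep_module[OF M[OF True]])
    then show ?thesis by blast
  qed blast
  then have "\<forall>i. \<exists>x. i \<in> {1..m} \<longrightarrow> x \<in> sq_zero_reps Q d \<and> mod_isomorphic \<Lambda> (M i) (rep_module Q d x)" ..
  from choice[OF this] obtain x where x0: "\<And>i. i \<in> {1..m} \<longrightarrow> x i \<in> sq_zero_reps Q d \<and> mod_isomorphic \<Lambda> (M i) (rep_module Q d (x i))"
    by blast
  have x: "x i \<in> sq_zero_reps Q d" and iso: "mod_isomorphic \<Lambda> (M i) (rep_module Q d (x i))" if "i \<in> {1..m}" for i
    using x0[of i] that by simp_all
  have xt: "x i \<in> topspace ?X" if "i \<in> {1..m}" for i using x[OF that] by (simp add: topspace_Rep_space)
  have pr: "top_soc_pair Q I (M i) = strat.pair (x i)" if "i \<in> {1..m}" for i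
    by (rule top_soc_pair_pair[OF lm[OF that] x[OF that] iso[OF that]])
  have min: "strat.pair (x i) \<in> ?min" if i: "i \<in> {1..m}" for i
    using bspec[OF bij_betwE[OF bij] i] by (simp only: pr[OF i])
  have min_ex: "\<exists>i\<in>{1..m}. p = strat.pair (x i)" if p: "p \<in> ?min" for p
  proof -
    have "p \<in> (\<lambda>i. top_soc_pair Q I (M i)) ` {1..m}" by (simp only: p bij_betw_imp_surj_on[OF bij])
    then obtain i where i: "p = top_soc_pair Q I (M i)" "i \<in> {1..m}" by (rule imageE)
    have "p = strat.pair (x i)" using i(1) by (simp only: pr[OF i(2)])
    then show ?thesis using i(2) by (rule bexI)
  qed
  have gen: "x i \<in> strat.generic (?r (x i))" if i: "i \<in> {1..m}" for i
    by (rule strat.minimal_pair_generic[OF xt[OF i]]) (use min[OF i] Top_Soc_eq in simp)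
  have clo: "closure_Rep_top Q I d (top_mod \<Lambda> (M i)) = rank_stratum Q d (?r (x i))" if i: "i \<in> {1..m}" for i
    by (rule closure_Rep_top_eq[OF xt[OF i] top_soc_isomorphic(1,2)[OF lm[OF i] x[OF i] iso[OF i]]])
  have comp: "rank_stratum Q d (?r (x i)) \<in> irreducible_components ?X" if i: "i \<in> {1..m}" for i
    unfolding strat.component_iff[OF xt[OF i]] using xt[OF i] min[OF i] Top_Soc_eq by auto
  show comps: "irreducible_components ?X = (\<lambda>i. closure_Rep_top Q I d (top_mod \<Lambda> (M i))) ` {1..m}"
  proof (intro equalityI subsetI)
    fix C assume C: "C \<in> irreducible_components ?X"
    obtain y where y: "y \<in> topspace ?X" "C = rank_stratum Q d (?r y)"
      by (rule strat.irreducible_component_eq_Z[OF C])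
    obtain z where z: "z \<in> topspace ?X" "?r z = ?r y" "strat.pair z \<in> ?min"
      using C strat.component_iff[OF y(1)] y(2) Top_Soc_eq by auto
    obtain i where i: "i \<in> {1..m}" "strat.pair z = strat.pair (x i)" using min_ex[OF z(3)] by blast
    have "?r z = ?r (x i)" using i(2) by (simp add: strat.pair_def diff_rad_dim_eq_iff)
    then have "C = closure_Rep_top Q I d (top_mod \<Lambda> (M i))" using clo[OF i(1)] y(2) z(2) by simp
    then show "C \<in> (\<lambda>i. closure_Rep_top Q I d (top_mod \<Lambda> (M i))) ` {1..m}" using i(1) by blast
  next
    fix C assume "C \<in> (\<lambda>i. closure_Rep_top Q I d (top_mod \<Lambda> (M i))) ` {1..m}"
    then obtain i where "i \<in> {1..m}" "C = closure_Rep_top Q I d (top_mod \<Lambda> (M i))" by blast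
    then show "C \<in> irreducible_components ?X" using comp clo by simp
  qed
  \<comment> \<open>Equal closures have equal \<open>r\<close>. Both points are generic in that
    stratum, so their \<open>s\<close> agree as well, and hence their pairs.\<close>
  have "inj_on (\<lambda>i. closure_Rep_top Q I d (top_mod \<Lambda> (M i))) {1..m}"
  proof (rule inj_onI)
    fix i j assume ij: "i \<in> {1..m}" "j \<in> {1..m}"
      "closure_Rep_top Q I d (top_mod \<Lambda> (M i)) = closure_Rep_top Q I d (top_mod \<Lambda> (M j))"
    have r: "?r (x i) = ?r (x j)"
      by (rule strat.Z_inj[OF xt[OF ij(1)] xt[OF ij(2)]]) (use ij(3) clo[OF ij(1)] clo[OF ij(2)] in simp)
    have "soc_dim Q d (x i) = soc_dim Q d (x j)"
      by (rule strat.generic_s_eq[OF gen[OF ij(1)]]) (use gen[OF ij(2)] r in simp)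
    then have "strat.pair (x i) = strat.pair (x j)" using r by (simp add: strat.pair_def)
    then have "top_soc_pair Q I (M i) = top_soc_pair Q I (M j)" using pr ij by simp
    then show "i = j" by (rule inj_onD[OF bij_betw_imp_inj_on[OF bij] _ ij(1,2)])
  qed
  then show "card (irreducible_components ?X) = m" unfolding comps by (simp add: card_image)
  have min_top: "(\<exists>y\<in>topspace ?X. (\<lambda>v. d v - ?r y v) = t \<and> strat.pair y \<in> ?min) \<longleftrightarrow>
      (\<exists>i\<in>{1..m}. (\<lambda>v. d v - ?r (x i) v) = t)" for t
  proof
    assume "\<exists>y\<in>topspace ?X. (\<lambda>v. d v - ?r y v) = t \<and> strat.pair y \<in> ?min"
    then obtain y where y: "y \<in> topspace ?X" "(\<lambda>v. d v - ?r y v) = t" "strat.pair y \<in> ?min" by blast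
    obtain i where "i \<in> {1..m}" "strat.pair y = strat.pair (x i)" using min_ex[OF y(3)] by blast
    then show "\<exists>i\<in>{1..m}. (\<lambda>v. d v - ?r (x i) v) = t" using y(2) by (auto simp: strat.pair_def)
  next
    assume "\<exists>i\<in>{1..m}. (\<lambda>v. d v - ?r (x i) v) = t"
    then show "\<exists>y\<in>topspace ?X. (\<lambda>v. d v - ?r y v) = t \<and> strat.pair y \<in> ?min" using xt min by blast
  qed
  show "generic_top Q I d T \<longleftrightarrow> (\<exists>i\<in>{1..m}. mod_isomorphic \<Lambda> (top_mod \<Lambda> (M i)) T)"
    if fd: "fd_module Q I T" "semisimple \<Lambda> T" for T :: "(('v, 'e, 'k) bqa, 't) module"
  proof -
    note T = semisimple_facts[OF fd]
    have "(\<exists>i\<in>{1..m}. mod_isomorphic \<Lambda> (top_mod \<Lambda> (M i)) T) \<longleftrightarrow>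
        (\<exists>i\<in>{1..m}. (\<lambda>v. d v - ?r (x i) v) = dimvec Q I T)"
    proof (rule bex_cong[OF refl])
      fix i assume i: "i \<in> {1..m}"
      show "mod_isomorphic \<Lambda> (top_mod \<Lambda> (M i)) T \<longleftrightarrow> (\<lambda>v. d v - ?r (x i) v) = dimvec Q I T"
        by (rule top_isomorphic_iff[OF x[OF i] lm[OF i] iso[OF i] T])
    qed
    moreover have "generic_top Q I d T \<longleftrightarrow> closure_Rep_top Q I d T \<in> irreducible_components ?X"
      using fd by (simp add: generic_top_def)
    moreover have "closure_Rep_top Q I d T \<in> irreducible_components ?X \<longleftrightarrow>
        (\<exists>y\<in>topspace ?X. (\<lambda>v. d v - ?r y v) = dimvec Q I T \<and> strat.pair y \<in> ?min)"
      by (rule component_closure_iff[OF T])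
    ultimately show ?thesis by (simp only: min_top)
  qed
  show "generic_socle Q I d S \<longleftrightarrow> (\<exists>i\<in>{1..m}. mod_isomorphic \<Lambda> (soc \<Lambda> (M i)) S)"
    if fd: "fd_module Q I S" "semisimple \<Lambda> S" for S :: "(('v, 'e, 'k) bqa, 's) module"
  proof -
    note S = semisimple_facts[OF fd]
    have "(\<exists>i\<in>{1..m}. mod_isomorphic \<Lambda> (soc \<Lambda> (M i)) S) \<longleftrightarrow> (\<exists>i\<in>{1..m}. soc_dim Q d (x i) = dimvec Q I S)"
    proof (rule bex_cong[OF refl])
      fix i assume i: "i \<in> {1..m}"
      show "mod_isomorphic \<Lambda> (soc \<Lambda> (M i)) S \<longleftrightarrow> soc_dim Q d (x i) = dimvec Q I S"
        by (rule soc_isomorphic_iff[OF x[OF i] lm[OF i] iso[OF i] S])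
    qed
    moreover have "generic_socle Q I d S \<longleftrightarrow> (\<exists>i\<in>{1..m}. soc_dim Q d (x i) = dimvec Q I S)"
    proof
      assume "generic_socle Q I d S"
      then obtain T :: "('v, 'e, 'k) std_module" and U where T: "generic_top Q I d T"
        and U: "openin (subtopology ?X (closure_Rep_top Q I d T)) U"
          "subtopology ?X (closure_Rep_top Q I d T) closure_of U =
            topspace (subtopology ?X (closure_Rep_top Q I d T))"
          "\<forall>y\<in>U. mod_isomorphic \<Lambda> (soc \<Lambda> (rep_module Q d y)) S"
        unfolding generic_socle_def Let_def by (elim conjE exE) (rule that; assumption)
      have "closure_Rep_top Q I d T \<in> irreducible_components ?X" using T by (simp add: generic_top_def)
      then obtain i where i: "i \<in> {1..m}" "closure_Rep_top Q I d T = rank_stratum Q d (?r (x i))"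
        unfolding comps using clo by (elim imageE) simp
      \<comment> \<open>The dense open set \<open>U\<close> is arbitrary, but it contains a generic
        point, and this fixes the socle.\<close>
      obtain g where g: "g \<in> U" "g \<in> strat.generic (?r (x i))"
        by (rule bexE[OF strat.generic_meets_dense[OF xt[OF i(1)] U(1,2)[unfolded i(2)]]])
      have gs: "g \<in> sq_zero_reps Q d" using g(2) by (simp add: strat.generic_def rank_stratum_def)
      have "mod_isomorphic \<Lambda> (soc \<Lambda> (rep_module Q d g)) S" using U(3) g(1) by (rule bspec)
      then have "soc_dim Q d g = dimvec Q I S"
        using soc_isomorphic_iff[OF gs rep_module_left_module[OF gs] mod_isomorphic_refl S] by simp
      moreover have "soc_dim Q d g = soc_dim Q d (x i)" by (rule strat.generic_s_eq[OF g(2) gen[OF i(1)]])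
      ultimately show "\<exists>i\<in>{1..m}. soc_dim Q d (x i) = dimvec Q I S" using i(1) by (intro bexI[of _ i]) simp_all
    next
      assume "\<exists>i\<in>{1..m}. soc_dim Q d (x i) = dimvec Q I S"
      then obtain i where i: "i \<in> {1..m}" "soc_dim Q d (x i) = dimvec Q I S" by blast
      \<comment> \<open>The witnesses are the semisimple module with the dimension vector of the top
        of \<open>M i\<close> and the set of generic points of the stratum.\<close>
      let ?T = "semisimple_rep (\<lambda>v. d v - ?r (x i) v)" and ?Z = "rank_stratum Q d (?r (x i))"
      let ?U = "strat.generic (?r (x i))"
      have cT: "closure_Rep_top Q I d ?T = ?Z"
        by (rule closure_Rep_top_eq[OF xt[OF i(1)] semisimple_rep_left_module mod_isomorphic_refl])
      have "generic_top Q I d ?T"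
        unfolding generic_top_def cT using comp[OF i(1)] semisimple_rep_semisimple d_outside by simp
      moreover have "openin (subtopology ?X ?Z) ?U" by (rule strat.generic_facts(2)[OF xt[OF i(1)] refl])
      moreover have "subtopology ?X ?Z closure_of ?U = topspace (subtopology ?X ?Z)"
        using strat.generic_dense[OF xt[OF i(1)]] by (auto simp: rank_stratum_def topspace_Rep_space)
      moreover have "\<forall>y\<in>?U. mod_isomorphic \<Lambda> (soc \<Lambda> (rep_module Q d y)) S"
      proof
        fix y assume y: "y \<in> ?U"
        have ys: "y \<in> sq_zero_reps Q d" using y by (simp add: strat.generic_def rank_stratum_def)
        have "soc_dim Q d y = dimvec Q I S" using strat.generic_s_eq[OF y gen[OF i(1)]] i(2) by simp
        then show "mod_isomorphic \<Lambda> (soc \<Lambda> (rep_module Q d y)) S"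
          using soc_isomorphic_iff[OF ys rep_module_left_module[OF ys] mod_isomorphic_refl S] by simp
      qed
      ultimately show "generic_socle Q I d S"
        unfolding generic_socle_def Let_def using fd cT by (intro conjI exI[of _ ?T] exI[of _ ?U]) simp_all
    qed
    ultimately show ?thesis by simp
  qed
qed

end

theorem corollary3p7:
  fixes Q :: "('v, 'e) pre_digraph"
    and I :: "(('v, 'e) path \<Rightarrow> 'k::alg_closed_field) set"
    and d :: "'v \<Rightarrow> nat"
    and T :: "(('v, 'e, 'k) bqa, 't) module"
    and M :: "nat \<Rightarrow> (('v, 'e, 'k) bqa, 'm) module"
    and m :: nat
  defines "\<Lambda> \<equiv> bq_algebra Q I"
  assumes quiver: "fin_digraph Q"
    and adm: "admissible Q I"
    and rad_sq_zero: "ideal_prod \<Lambda> (jacobson_radical \<Lambda>) (jacobson_radical \<Lambda>) = {\<zero>\<^bsub>\<Lambda>\<^esub>}"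
    and d: "\<forall>i. i \<notin> verts Q \<longrightarrow> d i = 0"
  shows
    "(fd_module Q I T \<and> semisimple \<Lambda> T \<longrightarrow>
       (closure_Rep_top Q I d T \<in> irreducible_components (Rep_space Q I d) \<longleftrightarrow>
        (\<exists>N :: ('v, 'e, 'k) std_module. fd_module Q I N \<and> dimvec Q I N = d \<and>
           mod_isomorphic \<Lambda> (top_mod \<Lambda> N) T \<and>
           top_soc_pair Q I N \<in> minimal_elements (Top_Soc Q I d))))
     \<and>
     ((\<forall>i\<in>{1..m}. fd_module Q I (M i) \<and> dimvec Q I (M i) = d) \<and>
      bij_betw (\<lambda>i. top_soc_pair Q I (M i)) {1..m} (minimal_elements (Top_Soc Q I d)) \<longrightarrow>
        card (irreducible_components (Rep_space Q I d)) = m \<and>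
        irreducible_components (Rep_space Q I d) =
          (\<lambda>i. closure_Rep_top Q I d (top_mod \<Lambda> (M i))) ` {1..m} \<and>
        (\<forall>T' :: (('v, 'e, 'k) bqa, 't) module.
           fd_module Q I T' \<and> semisimple \<Lambda> T' \<longrightarrow>
             (generic_top Q I d T' \<longleftrightarrow> (\<exists>i\<in>{1..m}. mod_isomorphic \<Lambda> (top_mod \<Lambda> (M i)) T'))) \<and>
        (\<forall>S :: (('v, 'e, 'k) bqa, 't) module.
           fd_module Q I S \<and> semisimple \<Lambda> S \<longrightarrow>
             (generic_socle Q I d S \<longleftrightarrow> (\<exists>i\<in>{1..m}. mod_isomorphic \<Lambda> (soc \<Lambda> (M i)) S))))"
proof -
  have adm': "ideal I (path_algebra Q)" "I \<subseteq> arrow_ideal_pow Q 2" using adm by (auto simp: admissible_def)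
  obtain k where k: "arrow_ideal_pow Q k \<subseteq> I" using adm by (auto simp: admissible_def)
  interpret fin_digraph Q by (rule quiver)
  interpret quiver_algebra Q I by (intro quiver_algebra.intro quiver adm'(1))
  \<comment> \<open>The exponent \<open>k\<close> from admissibility makes the arrow ideal nilpotent
    modulo \<open>I\<close>, which puts the arrows into the radical; the vanishing square of the
    radical then determines \<open>I\<close>.\<close>
  have I: "I = arrow_ideal_pow Q 2"
    by (rule arrow_ideal_square_zero[OF adm'(2) k]) (use rad_sq_zero in \<open>simp add: \<Lambda>_def\<close>)
  interpret rsz_dimension Q I d
    by (rule rsz_dimension.intro[OF rsz_algebra.intro[OF quiver_algebra_axioms rsz_algebra_axioms.intro[OF I]]
          rsz_dimension_axioms.intro]) (use d in blast)
  show ?thesis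
    unfolding \<Lambda>_def
  proof (rule conjI; intro impI)
    assume "fd_module Q I T \<and> semisimple (bq_algebra Q I) T"
    then show "closure_Rep_top Q I d T \<in> irreducible_components (Rep_space Q I d) \<longleftrightarrow>
        (\<exists>N :: ('v, 'e, 'k) std_module. fd_module Q I N \<and> dimvec Q I N = d \<and>
           mod_isomorphic (bq_algebra Q I) (top_mod (bq_algebra Q I) N) T \<and>
           top_soc_pair Q I N \<in> minimal_elements (Top_Soc Q I d))"
      by (elim conjE) (rule closure_component_iff_minimal)
  next
    assume "(\<forall>i\<in>{1..m}. fd_module Q I (M i) \<and> dimvec Q I (M i) = d) \<and>
      bij_betw (\<lambda>i. top_soc_pair Q I (M i)) {1..m} (minimal_elements (Top_Soc Q I d))"
    then have M: "\<And>i. i \<in> {1..m} \<Longrightarrow> fd_module Q I (M i)" "\<And>i. i \<in> {1..m} \<Longrightarrow> dimvec Q I (M i) = d"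
      "bij_betw (\<lambda>i. top_soc_pair Q I (M i)) {1..m} (minimal_elements (Top_Soc Q I d))" by auto
    note comp = components_of_minimal_modules[OF M]
    show "card (irreducible_components (Rep_space Q I d)) = m \<and>
        irreducible_components (Rep_space Q I d) =
          (\<lambda>i. closure_Rep_top Q I d (top_mod (bq_algebra Q I) (M i))) ` {1..m} \<and>
        (\<forall>T' :: (('v, 'e, 'k) bqa, 't) module.
           fd_module Q I T' \<and> semisimple (bq_algebra Q I) T' \<longrightarrow>
             (generic_top Q I d T' \<longleftrightarrow>
               (\<exists>i\<in>{1..m}. mod_isomorphic (bq_algebra Q I) (top_mod (bq_algebra Q I) (M i)) T'))) \<and>
        (\<forall>S :: (('v, 'e, 'k) bqa, 't) module.
           fd_module Q I S \<and> semisimple (bq_algebra Q I) S \<longrightarrow>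
             (generic_socle Q I d S \<longleftrightarrow>
               (\<exists>i\<in>{1..m}. mod_isomorphic (bq_algebra Q I) (soc (bq_algebra Q I) (M i)) S)))"
    proof (intro conjI allI impI)
      show "card (irreducible_components (Rep_space Q I d)) = m" by (rule comp(1))
      show "irreducible_components (Rep_space Q I d) =
          (\<lambda>i. closure_Rep_top Q I d (top_mod (bq_algebra Q I) (M i))) ` {1..m}" by (rule comp(2))
    next
      fix T' :: "(('v, 'e, 'k) bqa, 't) module"
      assume "fd_module Q I T' \<and> semisimple (bq_algebra Q I) T'"
      then show "generic_top Q I d T' \<longleftrightarrow>
          (\<exists>i\<in>{1..m}. mod_isomorphic (bq_algebra Q I) (top_mod (bq_algebra Q I) (M i)) T')"
        by (elim conjE) (rule comp(3))
    next
      fix S :: "(('v, 'e, 'k) bqa, 't) module"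
      assume "fd_module Q I S \<and> semisimple (bq_algebra Q I) S"
      then show "generic_socle Q I d S \<longleftrightarrow>
          (\<exists>i\<in>{1..m}. mod_isomorphic (bq_algebra Q I) (soc (bq_algebra Q I) (M i)) S)"
        by (elim conjE) (rule comp(4))
    qed
  qed
qed

end
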